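(* Fix $\gamma>-1$, $s\ge0$, and let $u\in L^2_+(\mathcal G_H,\mu_H^{-2\gamma}d\beta\,da)$. Then $u=I_0^Hx^{2\gamma+2}f$ for some $f\in H_w^{s,\gamma}(\mathbb D_H)$ (resp. $f\in C^\infty_{\mathrm{ev}}(\mathbb D_H)$) if and only if: (i) $u$ satisfies the hyperbolic moment conditions, and (ii) letting $P_m$ be the homogeneous polynomial provided by the moment conditions for the choice $p_m=p_m^\gamma$, and writing $P_m(\cos\omega,\sin\omega)=\sum_{k=0}^m M_{m,k}e^{i(m-2k)\omega}$, we have $$\sum_{m\ge0}\sum_{k=0}^m\frac{(m+1+\gamma)^{2s}}{(\sigma^\gamma_{m,k})^2}|M_{m,k}|^2<\infty,$$ resp. for each $N$ there exists $C_N$ such that $\max_{0\le k\le m}|M_{m,k}|\le C_N(1+m)^{-N}$ for all $m\in\mathbb N_0$.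
   Context: $\mathbb D_H=\{|z|\le1\}$, interior with Poincaré metric $g_H=c^{-2}|dz|^2$, $c=(1-|z|^2)/2$, volume $dV_H$, $x=\frac{1-|z|^2}{1+|z|^2}$; $C^\infty_{\mathrm{ev}}(\mathbb D_H)$ = smooth functions whose Taylor expansion off $\partial\mathbb D_H$ in $x$ has only even powers. $\mathcal G_H=\mathbb S^1_\beta\times\mathbb R_a$, $\gamma_{\beta,a}(t)=e^{i\beta}\frac{(2+ia)\tanh(t/2)+ia}{ia\tanh(t/2)-2+ia}$, $I_0^Hf(\beta,a)=\int_{\mathbb R}f(\gamma_{\beta,a}(t))dt$, $\mu_H=(1+a^2)^{-1/2}$, $\mathcal S^H_A(\beta,a)=(\beta+\pi+2\tan^{-1}a,-a)$, $L^2_+(\mathcal G_H,\mu_H^{-2\gamma}d\beta da)$ = $\mathcal S^H_A$-invariant elements of $L^2(\mathcal G_H,\mu_H^{-2\gamma}d\beta da)$. For $u$ on $\mathcal G_H$ let $u^{\mathrm v}(\omega,s)=u\big(\omega+\frac{3\pi}{2}+2\tan^{-1}s,\ \frac{-2s}{1-s^2}\big)$, $(\omega,s)\in\mathbb S^1\times(-1,1)$. Hyperbolic moment conditions: for every $m\in\mathbb N_0$ and every polynomial $p_m$ of degree $m$ with the same parity as $m$, there exists a homogeneous polynomial $P_m$ of degree $m$ on $\mathbb R^2$ with $\int_{-1}^1p_m\big(\frac{-2s}{1+s^2}\big)u^{\mathrm v}(\omega,s)\frac{2ds}{1+s^2}=P_m(\cos\omega,\sin\omega)$. $p_m^\gamma$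 is the multiple of the Jacobi polynomial $P_m^{(\gamma+1/2,\gamma+1/2)}$ with $\int_{-1}^1(p_m^\gamma)^2(1-y^2)^{\gamma+1/2}dy=(2\pi)^{-1}$. $(\sigma^\gamma_{m,k})^2=\frac{2^{2\gamma+2}\pi}{m+1}\frac{B(m-k+1+\gamma,k+1+\gamma)}{B(m-k+1,k+1)}$ ($B$ Beta function). Zernike/Sobolev: on $\partial_+S\mathbb D_E=\mathbb S^1_\beta\times[-\pi/2,\pi/2]_\alpha$ (point $e^{i\beta}$, direction $e^{i(\beta+\pi+\alpha)}$), $\mu=\cos\alpha$, $(I_0^E)^\sharp h(z)=\int_0^{2\pi}h(\beta(z,\theta),\alpha(z,\theta))d\theta$ ($(\beta,\alpha)(z,\theta)$ the entry point/direction of the line through $z$ with direction $e^{i\theta}$), $\psi^\gamma_{n,k}=(\cos\alpha)^{2\gamma+1}e^{i(n-2k)(\beta+\alpha+\pi/2)}p_n^\gamma(\sin\alpha)$, $Z^\gamma_{n,k}=(I_0^E)^\sharp(\mu^{-2\gamma-1}\psi^\gamma_{n,k})$, $\Phi(z)=\frac{2z}{1+|z|^2}$; $H_w^{s,\gamma}(\mathbb D_H)$ is the completion of $C^\infty_{\mathrm{ev}}(\mathbb D_H)$ under $\|u\|^2=\sum_{n\ge0,0\le k\le n}(n+1+\gamma)^{2s}|u_{n,k}|^2$, $u=\sum u_{n,k}\widehat{\Phi^*Z^\gamma_{n,k}}$ (normalized in $L^2(\mathbb D_H,x^{2\gamma+3}dV_H)$). *)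

theory Defs
  imports "HOL-Analysis.Analysis"
begin

definition xH :: "complex \<Rightarrow> real" where
  "xH z = (1 - (cmod z)^2) / (1 + (cmod z)^2)"

text \<open>Density of dV_H (metric c^(-2)|dz|^2, c=(1-|z|^2)/2) w.r.t. Lebesgue measure.\<close>
definition volH_density :: "complex \<Rightarrow> real" where
  "volH_density z = 4 / (1 - (cmod z)^2)^2"

definition PhiK :: "complex \<Rightarrow> complex" where
  "PhiK z = complex_of_real (2 / (1 + (cmod z)^2)) * z"

definition L2D_inner :: "real \<Rightarrow> (complex \<Rightarrow> complex) \<Rightarrow> (complex \<Rightarrow> complex) \<Rightarrow> complex" where
  "L2D_inner \<gamma> f g = (LINT z:ball 0 1|lborel.
      complex_of_real (xH z powr (2*\<gamma>+3) * volH_density z) * f z * cnj (g z))"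

fun ipartial :: "complex list \<Rightarrow> (complex \<Rightarrow> complex) \<Rightarrow> complex \<Rightarrow> complex" where
  "ipartial [] g = g"
| "ipartial (v # vs) g = (\<lambda>z. vector_derivative (\<lambda>t. ipartial vs g (z + complex_of_real t * v)) (at 0))"

definition smooth_open :: "complex set \<Rightarrow> (complex \<Rightarrow> complex) \<Rightarrow> bool" where
  "smooth_open U g \<longleftrightarrow> open U \<and>
     (\<forall>vs. set vs \<subseteq> {1, \<i>} \<longrightarrow>
        continuous_on U (ipartial vs g) \<and>
        (\<forall>v\<in>{1, \<i>}. \<forall>z\<in>U. (\<lambda>t. ipartial vs g (z + complex_of_real t * v)) differentiable (at 0)))"

text \<open>Inverse of x along rays: |z| = r(x).\<close>
definition rx :: "real \<Rightarrow> real" where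
  "rx y = sqrt ((1 - y) / (1 + y))"

text \<open>C^infty_ev(D_H): smooth on the closed disk (restriction of a smooth function on an open
  neighbourhood), and in the coordinates (x, theta) near the boundary all odd x-derivatives
  vanish at x = 0, i.e. the Taylor expansion in x has only even powers.\<close>
definition Cinf_ev :: "(complex \<Rightarrow> complex) set" where
  "Cinf_ev = {f. \<exists>U g. cball 0 1 \<subseteq> U \<and> smooth_open U g \<and> (\<forall>z\<in>cball 0 1. g z = f z) \<and>
      (\<forall>\<theta> j. odd j \<longrightarrow>
         (deriv ^^ j) (\<lambda>y. Re (g (complex_of_real (rx y) * cis \<theta>))) 0 = 0 \<and>
         (deriv ^^ j) (\<lambda>y. Im (g (complex_of_real (rx y) * cis \<theta>))) 0 = 0)}"

definition jacobiP :: "nat \<Rightarrow> real \<Rightarrow> real \<Rightarrow> real \<Rightarrow> real" where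
  "jacobiP n a b y = (\<Sum>j\<le>n. ((real n + a) gchoose (n - j)) * ((real n + b) gchoose j)
                        * ((y - 1) / 2) ^ j * ((y + 1) / 2) ^ (n - j))"

text \<open>p_m^gamma: the (positive) multiple of P_m^(gamma+1/2,gamma+1/2) with
  int_{-1}^1 (p_m^gamma)^2 (1-y^2)^(gamma+1/2) dy = 1/(2 pi).\<close>
definition p_gamma :: "real \<Rightarrow> nat \<Rightarrow> real \<Rightarrow> real" where
  "p_gamma \<gamma> m y = jacobiP m (\<gamma> + 1/2) (\<gamma> + 1/2) y /
      sqrt (2 * pi * integral {-1..1} (\<lambda>t. (jacobiP m (\<gamma> + 1/2) (\<gamma> + 1/2) t)^2 * (1 - t^2) powr (\<gamma> + 1/2)))"

definition sigma2 :: "real \<Rightarrow> nat \<Rightarrow> nat \<Rightarrow> real" where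
  "sigma2 \<gamma> m k = 2 powr (2*\<gamma>+2) * pi / (real m + 1) *
      Beta (real m - real k + 1 + \<gamma>) (real k + 1 + \<gamma>) / Beta (real m - real k + 1) (real k + 1)"

text \<open>Entry point of the line through z with direction e^(i theta) (z in the closed unit disk).\<close>
definition entry_pt :: "complex \<Rightarrow> real \<Rightarrow> complex" where
  "entry_pt z \<theta> = (let b = Re (z * cnj (cis \<theta>)) in
       z - complex_of_real (b + sqrt (b^2 + 1 - (cmod z)^2)) * cis \<theta>)"

definition beta_of :: "complex \<Rightarrow> real \<Rightarrow> real" where
  "beta_of z \<theta> = Arg (entry_pt z \<theta>)"

text \<open>alpha in [-pi/2,pi/2] with direction e^(i(beta+pi+alpha)) = e^(i theta).\<close>
definition alpha_of :: "complex \<Rightarrow> real \<Rightarrow> real" where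
  "alpha_of z \<theta> = Arg (cis \<theta> / (- entry_pt z \<theta>))"

definition psiE :: "real \<Rightarrow> nat \<Rightarrow> nat \<Rightarrow> real \<Rightarrow> real \<Rightarrow> complex" where
  "psiE \<gamma> n k \<beta> \<alpha> = complex_of_real ((cos \<alpha>) powr (2*\<gamma>+1)) *
      cis ((real n - 2 * real k) * (\<beta> + \<alpha> + pi/2)) * complex_of_real (p_gamma \<gamma> n (sin \<alpha>))"

text \<open>Z_{n,k}^gamma = (I_0^E)^sharp (mu^(-2 gamma-1) psi_{n,k}^gamma), mu = cos alpha.\<close>
definition ZernE :: "real \<Rightarrow> nat \<Rightarrow> nat \<Rightarrow> complex \<Rightarrow> complex" where
  "ZernE \<gamma> n k z = integral {0..2*pi} (\<lambda>\<theta>.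
      complex_of_real ((cos (alpha_of z \<theta>)) powr (-2*\<gamma>-1)) *
      psiE \<gamma> n k (beta_of z \<theta>) (alpha_of z \<theta>))"

definition coefH :: "real \<Rightarrow> nat \<Rightarrow> nat \<Rightarrow> (complex \<Rightarrow> complex) \<Rightarrow> complex" where
  "coefH \<gamma> n k f = (let Z = (\<lambda>z. ZernE \<gamma> n k (PhiK z)) in
      L2D_inner \<gamma> f Z / complex_of_real (sqrt (Re (L2D_inner \<gamma> Z Z))))"

definition Hw_terms :: "real \<Rightarrow> real \<Rightarrow> (complex \<Rightarrow> complex) \<Rightarrow> nat \<Rightarrow> real" where
  "Hw_terms \<gamma> s f n = (\<Sum>k\<le>n. (real n + 1 + \<gamma>) powr (2 * s) * (cmod (coefH \<gamma> n k f))^2)"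

text \<open>Cauchy sequences in C^infty_ev for the H_w^{s,gamma} norm (representing elements of the completion).\<close>
definition Hw_Cauchy :: "real \<Rightarrow> real \<Rightarrow> (nat \<Rightarrow> complex \<Rightarrow> complex) \<Rightarrow> bool" where
  "Hw_Cauchy \<gamma> s F \<longleftrightarrow> (\<forall>j. F j \<in> Cinf_ev) \<and>
     (\<forall>e>0. \<exists>N. \<forall>j\<ge>N. \<forall>l\<ge>N.
        summable (Hw_terms \<gamma> s (\<lambda>z. F j z - F l z)) \<and> suminf (Hw_terms \<gamma> s (\<lambda>z. F j z - F l z)) < e)"

definition geoH :: "real \<Rightarrow> real \<Rightarrow> real \<Rightarrow> complex" where
  "geoH \<beta> a t = cis \<beta> * (((2 + \<i> * complex_of_real a) * complex_of_real (tanh (t/2)) + \<i> * complex_of_real a) /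
                         (\<i> * complex_of_real a * complex_of_real (tanh (t/2)) - 2 + \<i> * complex_of_real a))"

definition I0H :: "(complex \<Rightarrow> complex) \<Rightarrow> real \<times> real \<Rightarrow> complex" where
  "I0H f = (\<lambda>(\<beta>, a). LINT t|lborel. f (geoH \<beta> a t))"

definition IHw :: "real \<Rightarrow> (complex \<Rightarrow> complex) \<Rightarrow> real \<times> real \<Rightarrow> complex" where
  "IHw \<gamma> f = I0H (\<lambda>z. complex_of_real (xH z powr (2*\<gamma>+2)) * f z)"

section \<open>L^2 on G_H = S^1 x R (functions on R x R, 2pi-periodic in beta)\<close>

definition L2G_dist2 :: "real \<Rightarrow> (real \<times> real \<Rightarrow> complex) \<Rightarrow> (real \<times> real \<Rightarrow> complex) \<Rightarrow> ennreal" where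
  "L2G_dist2 \<gamma> v w = (\<integral>\<^sup>+ p. indicator ({0..2*pi} \<times> UNIV) p *
        ennreal ((cmod (v p - w p))^2 * (1 + (snd p)^2) powr \<gamma>) \<partial>lborel)"

definition SA_H :: "real \<times> real \<Rightarrow> real \<times> real" where
  "SA_H p = (fst p + pi + 2 * arctan (snd p), - snd p)"

definition L2plus :: "real \<Rightarrow> (real \<times> real \<Rightarrow> complex) set" where
  "L2plus \<gamma> = {u. u \<in> borel_measurable borel \<and>
      (\<forall>\<beta> a. u (\<beta> + 2*pi, a) = u (\<beta>, a)) \<and>
      L2G_dist2 \<gamma> u (\<lambda>_. 0) < \<infinity> \<and>
      (AE p in lborel. u (SA_H p) = u p)}"

definition u_v :: "(real \<times> real \<Rightarrow> complex) \<Rightarrow> real \<Rightarrow> real \<Rightarrow> complex" where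
  "u_v u \<omega> s = u (\<omega> + 3*pi/2 + 2 * arctan s, -2 * s / (1 - s^2))"

definition moment_int :: "(real \<times> real \<Rightarrow> complex) \<Rightarrow> (real \<Rightarrow> real) \<Rightarrow> real \<Rightarrow> complex" where
  "moment_int u q \<omega> = (LINT s:{-1<..<1}|lborel.
      complex_of_real (q (-2 * s / (1 + s^2)) * (2 / (1 + s^2))) * u_v u \<omega> s)"

definition hom_poly :: "nat \<Rightarrow> (nat \<Rightarrow> complex) \<Rightarrow> real \<Rightarrow> real \<Rightarrow> complex" where
  "hom_poly m c X Y = (\<Sum>j\<le>m. c j * complex_of_real (X ^ j * Y ^ (m - j)))"

definition hyp_moment_conds :: "(real \<times> real \<Rightarrow> complex) \<Rightarrow> bool" where
  "hyp_moment_conds u \<longleftrightarrow>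
     (\<forall>m (p :: real poly). degree p = m \<and> (\<forall>j. odd (j + m) \<longrightarrow> coeff p j = 0) \<longrightarrow>
        (\<exists>c. AE \<omega> in lborel. moment_int u (poly p) \<omega> = hom_poly m c (cos \<omega>) (sin \<omega>)))"

definition moment_data :: "real \<Rightarrow> (real \<times> real \<Rightarrow> complex) \<Rightarrow> (nat \<Rightarrow> nat \<Rightarrow> complex) \<Rightarrow> (nat \<Rightarrow> nat \<Rightarrow> complex) \<Rightarrow> bool" where
  "moment_data \<gamma> u c M \<longleftrightarrow>
     (\<forall>m. AE \<omega> in lborel. moment_int u (p_gamma \<gamma> m) \<omega> = hom_poly m (c m) (cos \<omega>) (sin \<omega>)) \<and>
     (\<forall>m \<omega>. hom_poly m (c m) (cos \<omega>) (sin \<omega>) =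
              (\<Sum>k\<le>m. M m k * cis ((real m - 2 * real k) * \<omega>)))"

definition cond_sobolev :: "real \<Rightarrow> real \<Rightarrow> (real \<times> real \<Rightarrow> complex) \<Rightarrow> bool" where
  "cond_sobolev \<gamma> s u \<longleftrightarrow> (\<forall>c M. moment_data \<gamma> u c M \<longrightarrow>
     summable (\<lambda>m. \<Sum>k\<le>m. (real m + 1 + \<gamma>) powr (2 * s) / sigma2 \<gamma> m k * (cmod (M m k))^2))"

definition cond_smooth :: "real \<Rightarrow> (real \<times> real \<Rightarrow> complex) \<Rightarrow> bool" where
  "cond_smooth \<gamma> u \<longleftrightarrow> (\<forall>c M. moment_data \<gamma> u c M \<longrightarrow>
     (\<forall>N::nat. \<exists>C. \<forall>m. \<forall>k\<le>m. cmod (M m k) \<le> C * (1 + real m) powr (- real N)))"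

end

theory Submission
  imports Defs
begin

text \<open>
  In chord coordinates \<open>z = zc om al T\<close> (direction \<open>om\<close>, angle \<open>al\<close>, arc length \<open>T\<close>) the weighted
  transform of \<open>f\<close>, divided by \<open>cos al powr (2*\<gamma>+2)\<close>, is the average of \<open>f (zc om al T)\<close> against
  \<open>(1 / cosh T) powr (2*\<gamma>+2)\<close>, and the moment conditions pair it with polynomials in \<open>sin al\<close> against
  \<open>cos al powr (2*\<gamma>+2)\<close>, for which the \<open>p_gamma \<gamma> m\<close> are orthogonal. The Zernike functions are superpositions
  \<open>Zk m k\<close> of the plane waves \<open>p_gamma \<gamma> m (yc om z)\<close> and are mapped to multiples of
  \<open>cis ((m - 2*k) * om) * p_gamma \<gamma> m (sin al)\<close>. Hence the numbers \<open>M m k\<close> are, up to the singular values, the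
  coefficients of the preimage, and the Sobolev statement follows from the completeness of the \<open>p_gamma \<gamma> m\<close>.

  For the smooth statement: \<open>1 / sigma2 \<gamma> m k\<close> and all derivatives of \<open>p_gamma \<gamma> m\<close> grow polynomially in \<open>m\<close>, so
  rapidly decaying \<open>M\<close> give a series of waves converging with all derivatives, and \<open>yc\<close> is an even function of the
  boundary defining function. Conversely, for smooth even \<open>f\<close> the sum \<open>f (zc om al T) + f (zc om al (- T))\<close> extends
  smoothly across \<open>al = \<plusminus> pi/2\<close> and is even there to infinite order. Its cosine coefficients therefore decay
  rapidly, and \<open>p_gamma \<gamma> m (sin al)\<close> is orthogonal to all cosines of degree below \<open>m\<close>.
\<close>

section \<open>Changes of variables\<close>

text \<open>The singular values come from \<open>Td_pg\<close>. Averaging a wave of direction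
  \<open>om'\<close> along a chord of direction \<open>om\<close> acts on polynomials in
  \<open>sin al\<close> and depends only on \<open>om - om'\<close>. This operator does not raise
  degrees, and it is symmetric because the integral of two waves over the disk can be computed in
  the chord coordinates of either one. So the orthogonal polynomials are eigenfunctions, with
  eigenvalues read off leading coefficients. Evaluated at the degenerate chord
  \<open>al = pi/2\<close>, the same relation makes \<open>pg m\<close> a positive combination of
  Chebyshev polynomials, which is the source of the growth bounds. In the smooth converse the
  estimates must be uniform in \<open>T\<close> over the whole line. The angle \<open>phi\<close>
  with \<open>sin phi = tanh T\<close> compactifies it. Reflecting \<open>al\<close> about an
  endpoint together with \<open>phi\<close> to \<open>- phi\<close> sends a point to the one with
  the opposite value of the boundary coordinate on the same ray. Even expansions at the boundary of
  the disk thus become vanishing odd derivatives at the ends of the angle interval.\<close>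

lemma distr_density_eq_density_indicator:
  fixes g :: "'a::euclidean_space \<Rightarrow> 'a" and J :: "'a \<Rightarrow> real"
  assumes [measurable]: "g \<in> borel_measurable borel" "J \<in> borel_measurable borel" "S \<in> sets borel"
    and img: "g ` S = R" and R [measurable]: "R \<in> sets borel"
    and eq: "\<And>A. A \<in> sets borel \<Longrightarrow> A \<subseteq> S \<Longrightarrow> bounded (g ` A) \<Longrightarrow> g ` A \<in> sets borel \<Longrightarrow>
       (\<integral>\<^sup>+x. ennreal (J x) * indicator A x \<partial>lborel) = emeasure lborel (g ` A)"
  shows "distr (density lborel (\<lambda>x. ennreal (J x) * indicator S x)) borel g
       = density lborel (indicator R)"
proof (rule measure_eqI)
  let ?M = "distr (density lborel (\<lambda>x. ennreal (J x) * indicator S x)) borel g"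
  let ?N = "density lborel (indicator R :: 'a \<Rightarrow> ennreal)"
  show "sets ?M = sets ?N" by simp
  fix B assume "B \<in> sets ?M"
  then have B [measurable]: "B \<in> sets borel" by simp
  \<comment> \<open>The hypothesis \<open>eq\<close> speaks only of bounded images, whose measure is
    finite, so \<open>B\<close> is exhausted by bounded pieces and the equality passes to the
    supremum.\<close>
  define C where "C n = B \<inter> cball 0 (real n)" for n :: nat
  have C [measurable]: "C n \<in> sets borel" for n unfolding C_def by measurable
  have UC: "(\<Union>n. C n) = B"
    unfolding C_def by (auto intro: real_arch_simple)
  have inc: "incseq C" unfolding C_def incseq_def by auto
  have "emeasure ?M (C n) = emeasure ?N (C n)" for n
  proof -
    let ?A = "S \<inter> g -` (C n)"
    have A: "?A \<in> sets borel"
      using measurable_sets_borel[OF assms(1) C] by (intro sets.Int) (auto simp: assms)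
    have gA: "g ` ?A = R \<inter> C n" using img by auto
    have "emeasure ?M (C n) = (\<integral>\<^sup>+x. ennreal (J x) * indicator S x * indicator (g -` C n) x \<partial>lborel)"
      using measurable_sets_borel[OF assms(1) C]
      by (simp add: emeasure_distr emeasure_density)
    also have "... = (\<integral>\<^sup>+x. ennreal (J x) * indicator ?A x \<partial>lborel)"
      by (intro nn_integral_cong) (auto simp: indicator_def)
    also have "... = emeasure lborel (R \<inter> C n)"
      unfolding gA[symmetric]
    proof (rule eq[OF A])
      show "bounded (g ` ?A)"
        by (rule bounded_subset[of "cball 0 (real n)"]) (auto simp: gA C_def)
      show "g ` ?A \<in> sets borel" unfolding gA by measurable
    qed auto
    also have "... = emeasure ?N (C n)"
      by (subst emeasure_density) (auto simp: indicator_inter_arith[symmetric] nn_integral_indicator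
          intro!: arg_cong[where f="emeasure lborel"])
    finally show ?thesis .
  qed
  then have "(SUP n. emeasure ?M (C n)) = (SUP n. emeasure ?N (C n))" by simp
  then show "emeasure ?M B = emeasure ?N B"
    using SUP_emeasure_incseq[of C ?M] SUP_emeasure_incseq[of C ?N] inc UC by (simp add: image_subset_iff)
qed

lemma emeasure_lborel_eq_measure_lebesgue:
  assumes "X \<in> sets borel" "X \<in> lmeasurable"
  shows "ennreal (measure lebesgue X) = emeasure lborel X"
proof -
  have "ennreal (measure lebesgue X) = emeasure lebesgue X"
    using emeasure_eq_measure2[OF assms(2)] by simp
  then show ?thesis using assms(1) by simp
qed

text \<open>Phrased as an equality of measures, so that integrability, \<open>nn_integral\<close>
  and Bochner versions all follow from one statement.\<close>

lemma substitution_real: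
  fixes g g' :: "real \<Rightarrow> real"
  assumes [measurable]: "g \<in> borel_measurable borel" "g' \<in> borel_measurable borel" "S \<in> sets borel"
    and img: "g ` S = R" and R [measurable]: "R \<in> sets borel" and inj: "inj_on g S"
    and der: "\<And>x. x \<in> S \<Longrightarrow> (g has_field_derivative g' x) (at x)"
  shows "distr (density lborel (\<lambda>x. ennreal \<bar>g' x\<bar> * indicator S x)) borel g
       = density lborel (indicator R)"
proof (rule distr_density_eq_density_indicator)
  fix A assume A: "A \<in> sets borel" "A \<subseteq> S" "bounded (g ` A)" "g ` A \<in> sets borel"
  have fin: "g ` A \<in> lmeasurable"
    using A by (intro bounded_set_imp_lmeasurable) auto
  have "(\<lambda>x. \<bar>g' x\<bar> * 1) absolutely_integrable_on A \<and>
           integral A (\<lambda>x. \<bar>g' x\<bar> * 1) = measure lebesgue (g ` A)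
     \<longleftrightarrow> (\<lambda>_. 1::real) absolutely_integrable_on (g ` A) \<and> integral (g ` A) (\<lambda>_. 1) = measure lebesgue (g ` A)"
    using A inj der
    by (intro has_absolute_integral_change_of_variables_1')
      (auto intro: has_field_derivative_at_within inj_on_subset)
  moreover have "(\<lambda>_. 1::real) absolutely_integrable_on (g ` A)"
    using fin by (simp add: lmeasurable_iff_integrable_on absolutely_integrable_on_iff_nonneg)
  moreover have "integral (g ` A) (\<lambda>_. 1::real) = measure lebesgue (g ` A)"
    using fin by (simp add: lmeasure_integral)
  ultimately have "(\<lambda>x. \<bar>g' x\<bar>) absolutely_integrable_on A"
      "integral A (\<lambda>x. \<bar>g' x\<bar>) = measure lebesgue (g ` A)" by simp_all
  then have "((\<lambda>x. \<bar>g' x\<bar>) has_integral measure lebesgue (g ` A)) A"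
    by (simp add: absolutely_integrable_on_def has_integral_iff)
  then have "(\<integral>\<^sup>+x. ennreal \<bar>g' x\<bar> * indicator A x \<partial>lborel) = ennreal (measure lebesgue (g ` A))"
    by (intro nn_integral_has_integral_lebesgue') auto
  also have "... = emeasure lborel (g ` A)"
    using A fin by (intro emeasure_lborel_eq_measure_lebesgue) auto
  finally show "(\<integral>\<^sup>+x. ennreal \<bar>g' x\<bar> * indicator A x \<partial>lborel) = emeasure lborel (g ` A)" .
qed (use assms in auto)

lemma substitution_vec:
  fixes g :: "real^'n::{finite,wellorder} \<Rightarrow> real^'n::{finite,wellorder}" and g' :: "real^'n::{finite,wellorder} \<Rightarrow> real^'n::{finite,wellorder} \<Rightarrow> real^'n::{finite,wellorder}"
  assumes [measurable]: "g \<in> borel_measurable borel" "J \<in> borel_measurable borel" "S \<in> sets borel"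
    and img: "g ` S = R" and R [measurable]: "R \<in> sets borel" and inj: "inj_on g S"
    and der: "\<And>x. x \<in> S \<Longrightarrow> (g has_derivative g' x) (at x)"
    and J: "\<And>x. x \<in> S \<Longrightarrow> \<bar>det (matrix (g' x))\<bar> = J x"
  shows "distr (density lborel (\<lambda>x. ennreal (J x) * indicator S x)) borel g
       = density lborel (indicator R)"
proof (rule distr_density_eq_density_indicator)
  fix A assume A: "A \<in> sets borel" "A \<subseteq> S" "bounded (g ` A)" "g ` A \<in> sets borel"
  have fin: "g ` A \<in> lmeasurable"
    using A by (intro bounded_set_imp_lmeasurable) auto
  have "((\<lambda>x. \<bar>det (matrix (g' x))\<bar>) has_integral measure lebesgue (g ` A)) A"
    using A inj der fin
    by (subst has_measure_differentiable_image[symmetric])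
      (auto intro: has_derivative_at_withinI inj_on_subset)
  then have "((\<lambda>x. J x) has_integral measure lebesgue (g ` A)) A"
    by (rule has_integral_eq[rotated]) (use A J in auto)
  moreover have "J x \<ge> 0" if "x \<in> A" for x using A J that by (metis abs_ge_zero subsetD)
  ultimately have "(\<integral>\<^sup>+x. ennreal (J x) * indicator A x \<partial>lborel) = ennreal (measure lebesgue (g ` A))"
    by (intro nn_integral_has_integral_lebesgue') auto
  also have "... = emeasure lborel (g ` A)"
    using A fin by (intro emeasure_lborel_eq_measure_lebesgue) auto
  finally show "(\<integral>\<^sup>+x. ennreal (J x) * indicator A x \<partial>lborel) = emeasure lborel (g ` A)" .
qed (use assms in auto)

lemma axis2_nth [simp]:
  "(axis 1 1 :: real^2) $ 1 = 1" "(axis 1 1 :: real^2) $ 2 = 0"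
  "(axis 2 1 :: real^2) $ 1 = 0" "(axis 2 1 :: real^2) $ 2 = 1"
  by (simp_all add: axis_def)

lemma Basis_vec2: "(Basis :: (real^2) set) = {axis 1 1, axis 2 1}" "axis 1 1 \<noteq> (axis 2 1 :: real^2)"
  by (auto simp: Basis_vec_def axis_eq_axis) (metis exhaust_2)

text \<open>Jacobian determinants are taken on \<open>real^2\<close>, whereas chord coordinates are
  pairs and disk points are complex numbers. This lemma and the next carry Lebesgue measure between
  the three.\<close>

lemma distr_lborel_vec2_prod:
  "distr (lborel :: (real^2) measure) borel (\<lambda>v. (v $ 1, v $ 2)) = (lborel :: (real \<times> real) measure)"
proof (rule lborel_eqI[symmetric])
  fix l u :: "real \<times> real"
  assume le: "\<And>b. b \<in> Basis \<Longrightarrow> l \<bullet> b \<le> u \<bullet> b"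
  have le': "fst l \<le> fst u" "snd l \<le> snd u"
    using le[of "(1,0)"] le[of "(0,1)"] by (cases l; cases u; auto simp: Basis_prod_def)+
  let ?L = "fst l *\<^sub>R axis 1 1 + snd l *\<^sub>R axis 2 1 :: real^2"
  let ?U = "fst u *\<^sub>R axis 1 1 + snd u *\<^sub>R axis 2 1 :: real^2"
  have "(\<lambda>v::real^2. (v $ 1, v $ 2)) -` box l u = box ?L ?U"
    by (cases l; cases u) (auto simp: mem_box_cart mem_box Basis_prod_def forall_2)
  then have "emeasure (distr (lborel :: (real^2) measure) borel (\<lambda>v. (v $ 1, v $ 2))) (box l u)
     = emeasure lborel (box ?L ?U)"
    by (simp add: emeasure_distr)
  also have "... = (\<Prod>b\<in>Basis. (?U - ?L) \<bullet> b)"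
    using le' by (intro emeasure_lborel_box) (auto simp: Basis_vec2 inner_axis)
  also have "(\<Prod>b\<in>Basis. (?U - ?L) \<bullet> b) = (\<Prod>b\<in>Basis. (u - l) \<bullet> b)"
    by (cases l; cases u) (auto simp: Basis_vec2 inner_axis Basis_prod_def prod.union_disjoint)
  finally show "emeasure (distr (lborel :: (real^2) measure) borel (\<lambda>v. (v $ 1, v $ 2))) (box l u)
     = ennreal (\<Prod>b\<in>Basis. (u - l) \<bullet> b)" .
qed simp

lemma distr_lborel_vec2_complex:
  "distr (lborel :: (real^2) measure) borel (\<lambda>v. Complex (v $ 1) (v $ 2)) = (lborel :: complex measure)"
proof (rule lborel_eqI[symmetric])
  fix l u :: complex
  assume le: "\<And>b. b \<in> Basis \<Longrightarrow> l \<bullet> b \<le> u \<bullet> b"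
  have le': "Re l \<le> Re u" "Im l \<le> Im u"
    using le[of 1] le[of \<i>] by (auto simp: Basis_complex_def)
  let ?L = "Re l *\<^sub>R axis 1 1 + Im l *\<^sub>R axis 2 1 :: real^2"
  let ?U = "Re u *\<^sub>R axis 1 1 + Im u *\<^sub>R axis 2 1 :: real^2"
  have m: "(\<lambda>v::real^2. Complex (v $ 1) (v $ 2)) \<in> borel_measurable borel"
    unfolding Complex_eq by measurable
  have "(\<lambda>v::real^2. Complex (v $ 1) (v $ 2)) -` box l u = box ?L ?U"
    by (auto simp: in_box_complex_iff mem_box_cart forall_2)
  then have "emeasure (distr (lborel :: (real^2) measure) borel (\<lambda>v. Complex (v $ 1) (v $ 2))) (box l u)
     = emeasure lborel (box ?L ?U)"
    using m by (simp add: emeasure_distr)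
  also have "... = (\<Prod>b\<in>Basis. (?U - ?L) \<bullet> b)"
    using le' by (intro emeasure_lborel_box) (auto simp: Basis_vec2 inner_axis)
  also have "(\<Prod>b\<in>Basis. (?U - ?L) \<bullet> b) = (\<Prod>b\<in>Basis. (u - l) \<bullet> b)"
    by (auto simp: Basis_vec2 inner_axis Basis_complex_def complex_eq_iff)
  finally show "emeasure (distr (lborel :: (real^2) measure) borel (\<lambda>v. Complex (v $ 1) (v $ 2))) (box l u)
     = ennreal (\<Prod>b\<in>Basis. (u - l) \<bullet> b)" .
qed simp

section \<open>Chord coordinates on the disk\<close>

abbreviation Iang :: "real set" where "Iang \<equiv> {- (pi/2) <..< pi/2}"

text \<open>The geodesic from \<open>cis \<beta>\<close> with parameter \<open>a = tan al\<close>, where \<open>\<beta> = om + 3*pi/2 - al\<close>, parametrised by an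
  arclength \<open>T\<close> centred at its point closest to the origin.\<close>

definition zc :: "real \<Rightarrow> real \<Rightarrow> real \<Rightarrow> complex" where
  "zc om al T = cis om * Complex (- sin al * cosh T / (cosh T + cos al)) (cos al * sinh T / (cosh T + cos al))"

text \<open>Coordinate across the chords of direction \<open>om\<close> in the Klein model;
  functions of \<open>yc om\<close> are the plane waves. The sign is chosen so that it equals
  \<open>sin al\<close> on a chord.\<close>

definition yc :: "real \<Rightarrow> complex \<Rightarrow> real" where
  "yc om z = - Re (PhiK z * cnj (cis om))"

lemma cos_Iang: "al \<in> Iang \<Longrightarrow> cos al > 0"
  by (intro cos_gt_zero_pi) auto

lemma cosh_plus_cos_pos: "cosh (T::real) + cos al > 0" if "cos al > 0"
  using that cosh_real_pos[of T] by linarith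

lemma cmod_zc: assumes "cos al > 0"
  shows "(cmod (zc om al T))^2 = (cosh T - cos al) / (cosh T + cos al)"
proof -
  have p: "cosh T + cos al > 0" using cosh_plus_cos_pos assms .
  have "(cmod (zc om al T))^2 = (- sin al * cosh T / (cosh T + cos al))^2 + (cos al * sinh T / (cosh T + cos al))^2"
    by (simp add: zc_def norm_mult cmod_power2)
  also have "... = ((sin al)^2 * (cosh T)^2 + (cos al)^2 * (sinh T)^2) / (cosh T + cos al)^2"
    by (simp add: power_divide power_mult_distrib add_divide_distrib)
  also have "(sin al)^2 * (cosh T)^2 + (cos al)^2 * (sinh T)^2 = (cosh T - cos al) * (cosh T + cos al)"
    unfolding sinh_square_eq sin_squared_eq by algebra
  finally show ?thesis using p by (simp add: power2_eq_square)
qed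

lemma zc_in_ball: assumes "cos al > 0" shows "zc om al T \<in> ball 0 1"
proof -
  have p: "cosh T + cos al > 0" using cosh_plus_cos_pos assms .
  have "(cmod (zc om al T))^2 < 1" using p assms by (simp add: cmod_zc divide_simps)
  then have "cmod (zc om al T) < 1" by (simp add: power2_less_1_iff abs_square_less_1)
  then show ?thesis by simp
qed

lemma xH_zc: assumes "cos al > 0" shows "xH (zc om al T) = cos al / cosh T"
proof -
  have p: "cosh T + cos al > 0" using cosh_plus_cos_pos assms .
  show ?thesis unfolding xH_def cmod_zc[OF assms] using p cosh_real_pos[of T]
    by (simp add: divide_simps)
qed

text \<open>\<open>PhiK\<close> passes from the Poincare to the Klein model, where geodesics are
  straight: the component along \<open>cis om\<close> stays constant and only the one along
  \<open>\<i> * cis om\<close> moves with \<open>T\<close>.\<close>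

lemma PhiK_zc: assumes "cos al > 0" shows "PhiK (zc om al T) = cis om * Complex (- sin al) (cos al * tanh T)"
proof -
  have p: "cosh T + cos al > 0" using cosh_plus_cos_pos assms .
  have q: "cosh T > 0" by (rule cosh_real_pos)
  have "2 / (1 + (cmod (zc om al T))^2) = (cosh T + cos al) / cosh T"
    unfolding cmod_zc[OF assms] using p q by (simp add: divide_simps)
  then have "PhiK (zc om al T) = cis om * (complex_of_real ((cosh T + cos al) / cosh T) *
      Complex (- sin al * cosh T / (cosh T + cos al)) (cos al * sinh T / (cosh T + cos al)))"
    unfolding PhiK_def zc_def by (simp add: mult_ac)
  also have "complex_of_real ((cosh T + cos al) / cosh T) *
      Complex (- sin al * cosh T / (cosh T + cos al)) (cos al * sinh T / (cosh T + cos al))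
    = Complex (- sin al) (cos al * tanh T)"
    using p q by (simp add: complex_eq_iff tanh_def)
  finally show ?thesis .
qed

text \<open>A wave of the chord's own direction is constant along it. For another direction a term
  in \<open>tanh T\<close> appears, and its average over \<open>T\<close> is the operator
  \<open>Td\<close> below.\<close>

lemma yc_zc: assumes "cos al > 0"
  shows "yc om' (zc om al T) = sin al * cos (om - om') + cos al * tanh T * sin (om - om')"
proof -
  have "PhiK (zc om al T) * cnj (cis om') = cis (om - om') * Complex (- sin al) (cos al * tanh T)"
    unfolding PhiK_zc[OF assms] cis_cnj by (simp add: mult_ac cis_mult flip: mult.assoc)
  then show ?thesis unfolding yc_def by simp
qed

lemma yc_zc_same: "cos al > 0 \<Longrightarrow> yc om (zc om al T) = sin al"
  by (simp add: yc_zc)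

text \<open>The given parametrization passes the point nearest to the origin at
  \<open>t = ln (cos al)\<close>; the shift moves it to \<open>T = 0\<close>. The identity is then
  one between rational expressions in \<open>exp t\<close>, \<open>sin al\<close> and
  \<open>cos al\<close>.\<close>

lemma geoH_zc: assumes "cos al > 0"
  shows "geoH (om + 3*pi/2 - al) (tan al) t = zc om al (t - ln (cos al))"
proof -
  let ?c = "cos al" and ?s = "sin al" and ?E = "exp t"
  let ?C = "cosh (t - ln ?c)" and ?S = "sinh (t - ln ?c)"
  have E: "?E > 0" by simp
  have eT: "exp (t - ln ?c) = ?E / ?c" "exp (- (t - ln ?c)) = ?c / ?E"
    using assms by (simp_all add: exp_diff exp_minus field_simps)
  have C: "?C = (?E^2 + ?c^2) / (2 * ?E * ?c)"
    unfolding cosh_def eT using assms by (simp add: field_simps power2_eq_square)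
  have S: "?S = (?E^2 - ?c^2) / (2 * ?E * ?c)"
    unfolding sinh_def eT using assms by (simp add: field_simps power2_eq_square)
  have th: "tanh (t/2) = (?E - 1) / (?E + 1)"
  proof -
    have "tanh (t/2) = (1 - exp (-t)) / (1 + exp (-t))" by (simp add: tanh_real_altdef)
    also have "... = (?E - 1) / (?E + 1)" by (simp add: exp_minus divide_simps)
    finally show ?thesis .
  qed
  have cb: "cis (om + 3*pi/2 - al) = cis om * (- \<i> * cis (-al))"
  proof -
    have "cis (om + 3*pi/2 - al) = cis om * cis (3*pi/2) * cis (-al)" by (simp add: cis_mult)
    also have "cis (3*pi/2) = - \<i>"
    proof -
      have "cis (3*pi/2) = cis (pi + pi/2)" by (simp add: field_simps)
      also have "... = cis pi * cis (pi/2)" by (rule cis_mult[symmetric])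
      finally show ?thesis by simp
    qed
    finally show ?thesis by (simp add: mult_ac)
  qed
  \<comment> \<open>Up to a factor shared with the numerator, the denominator of \<open>geoH\<close>
    is \<open>- D\<close>; its real part has a strict sign, so the quotient is defined.\<close>
  define D where "D = ?E * cis (-al) + complex_of_real ?c"
  have D0: "D \<noteq> 0"
  proof -
    have "Re D > 0" unfolding D_def using assms E by (simp add: add_pos_pos)
    then show ?thesis by auto
  qed
  have "((2 + \<i> * complex_of_real (tan al)) * complex_of_real (tanh (t/2)) + \<i> * complex_of_real (tan al))
     = 2 / (complex_of_real ((?E + 1) * ?c)) * (?E * cis al - ?c)" (is "?N = _")
    unfolding th tan_def using assms E
    by (simp add: complex_eq_iff field_simps add_pos_pos add_nonneg_eq_0_iff)
  moreover have "(\<i> * complex_of_real (tan al) * complex_of_real (tanh (t/2)) - 2 + \<i> * complex_of_real (tan al))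
     = 2 / (complex_of_real ((?E + 1) * ?c)) * (- D)" (is "?Den = _")
    unfolding th tan_def D_def using assms E
    by (simp add: complex_eq_iff field_simps add_pos_pos add_nonneg_eq_0_iff)
  moreover have "2 / (complex_of_real ((?E + 1) * ?c)) \<noteq> 0"
    using assms E by (simp add: add_nonneg_eq_0_iff complex_eq_iff)
  ultimately have "?N / ?Den = (?E * cis al - ?c) / (- D)"
    by (metis mult_divide_mult_cancel_left)
  then have "geoH (om + 3*pi/2 - al) (tan al) t = cis om * (- \<i> * cis (-al) * ((?E * cis al - ?c) / (- D)))"
    unfolding geoH_def cb by (simp add: mult_ac)
  also have "- \<i> * cis (-al) * ((?E * cis al - ?c) / (- D)) =
     Complex (- ?s * ?C / (?C + ?c)) (?c * ?S / (?C + ?c))"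
  proof -
    have pos: "?E^2 + ?c^2 + 2 * ?E * ?c^2 > 0" using assms E by (simp add: add_pos_pos)
    have Cc: "?C + ?c = (?E^2 + ?c^2 + 2 * ?E * ?c^2) / (2 * ?E * ?c)"
      unfolding C using assms E by (simp add: field_simps power2_eq_square)
    have 1: "- ?s * ?C / (?C + ?c) = - ?s * (?E^2 + ?c^2) / (?E^2 + ?c^2 + 2 * ?E * ?c^2)"
      by (subst Cc, subst C) (use assms E in simp)
    have 2: "?c * ?S / (?C + ?c) = ?c * (?E^2 - ?c^2) / (?E^2 + ?c^2 + 2 * ?E * ?c^2)"
      by (subst Cc, subst S) (use assms E in simp)
    have sc: "?s^2 = 1 - ?c^2" by (rule sin_squared_eq)
    have "\<i> * (?E - ?c * cis (-al)) * complex_of_real (?E^2 + ?c^2 + 2 * ?E * ?c^2)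
        = Complex (- ?s * (?E^2 + ?c^2)) (?c * (?E^2 - ?c^2)) * D"
      unfolding D_def complex_eq_iff using sc by (simp; algebra)
    then have "\<i> * (?E - ?c * cis (-al)) / D = Complex (- ?s * (?E^2 + ?c^2)) (?c * (?E^2 - ?c^2)) /
        complex_of_real (?E^2 + ?c^2 + 2 * ?E * ?c^2)"
      using D0 pos by (subst frac_eq_eq) (simp_all del: of_real_add)
    moreover have "- \<i> * cis (-al) * ((?E * cis al - ?c) / (- D)) = \<i> * (?E - ?c * cis (-al)) / D"
    proof -
      have "cis (-al) * (?E * cis al - ?c) = ?E - ?c * cis (-al)"
        by (simp add: right_diff_distrib cis_mult mult_ac flip: mult.assoc)
      then show ?thesis by (simp add: mult.assoc)
    qed
    ultimately show ?thesis unfolding 1 2 by (simp add: complex_eq_iff)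
  qed
  finally show ?thesis unfolding zc_def by simp
qed

lemma cmod_PhiK: "cmod (PhiK z) = 2 * cmod z / (1 + (cmod z)^2)"
proof -
  have "1 + (cmod z)^2 > 0" by (simp add: add_pos_nonneg)
  then show ?thesis unfolding PhiK_def norm_mult norm_of_real by simp
qed

lemma cmod_PhiK_less_1: assumes "cmod z < 1" shows "cmod (PhiK z) < 1"
proof -
  have p: "1 + (cmod z)^2 > 0" by (simp add: add_pos_nonneg)
  have "(1 - cmod z)^2 > 0" using assms by simp
  then have "2 * cmod z < 1 + (cmod z)^2" by (simp add: power2_eq_square algebra_simps)
  then show ?thesis using p unfolding cmod_PhiK by (simp add: divide_simps)
qed

lemma xH_PhiK: "(xH z)^2 = 1 - (cmod (PhiK z))^2"
proof -
  have p: "1 + (cmod z)^2 \<noteq> 0" by (smt (verit) zero_le_power2)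
  then show ?thesis unfolding xH_def cmod_PhiK by (simp add: divide_simps) algebra
qed

lemma xH_pos: "cmod z < 1 \<Longrightarrow> xH z > 0"
  unfolding xH_def by (simp add: add_pos_nonneg power_less_one_iff)

lemma PhiK_inverse: "z = PhiK z / complex_of_real (1 + xH z)"
proof -
  have p: "1 + (cmod z)^2 > 0" by (simp add: add_pos_nonneg)
  then have x: "1 + xH z = 2 / (1 + (cmod z)^2)" unfolding xH_def by (simp add: field_simps)
  then have "1 + xH z > 0" using p by simp
  then have "complex_of_real (1 + xH z) \<noteq> 0" by (simp del: of_real_add)
  then show ?thesis unfolding PhiK_def x[symmetric] by simp
qed

text \<open>Inside the ball \<open>xH\<close> is positive, hence determined by its square and so by
  \<open>PhiK z\<close>; \<open>PhiK_inverse\<close> then recovers \<open>z\<close>.\<close>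

lemma inj_on_PhiK: "inj_on PhiK (ball 0 1)"
proof (rule inj_onI)
  fix z w assume a: "z \<in> ball 0 1" "w \<in> ball 0 1" "PhiK z = PhiK w"
  then have "(xH z)^2 = (xH w)^2" by (simp add: xH_PhiK)
  then have "xH z = xH w" using a xH_pos[of z] xH_pos[of w] by (simp add: power2_eq_iff)
  then show "z = w" using PhiK_inverse[of z] PhiK_inverse[of w] a by simp
qed

lemma zc_inj: assumes "al \<in> Iang" "al' \<in> Iang" "zc om al T = zc om al' T'" shows "al = al' \<and> T = T'"
proof -
  have c: "cos al > 0" "cos al' > 0" using assms cos_Iang by auto
  have eq: "Complex (- sin al) (cos al * tanh T) = Complex (- sin al') (cos al' * tanh T')"
    using assms(3) PhiK_zc[OF c(1), of om T] PhiK_zc[OF c(2), of om T'] by simp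
  then have "sin al = sin al'" by simp
  moreover have "arcsin (sin al) = al" "arcsin (sin al') = al'"
    using assms(1,2) by (auto intro!: arcsin_sin)
  ultimately have "al = al'" by metis
  moreover from this have "tanh T = tanh T'" using eq c by simp
  ultimately show ?thesis by simp
qed

lemma tanh_artanh: assumes "\<bar>x\<bar> < 1" shows "tanh (artanh x) = (x::real)"
proof -
  have p: "1 + x > 0" "1 - x > 0" using assms by auto
  have "-2 * artanh x = ln ((1 - x) / (1 + x))"
    unfolding artanh_def using p by (simp add: ln_div)
  then have e: "exp (-2 * artanh x) = (1 - x) / (1 + x)" using p by simp
  show ?thesis unfolding tanh_real_altdef e using p by (simp add: divide_simps)
qed

text \<open>Solved in the Klein model: \<open>arcsin\<close> gives \<open>al\<close> from the
  component along \<open>cis om\<close>, and \<open>artanh\<close> gives \<open>T\<close> because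
  the other component is smaller than \<open>cos al\<close> inside the disk.\<close>

lemma zc_surj: assumes "z \<in> ball 0 1" shows "\<exists>al\<in>Iang. \<exists>T. zc om al T = z"
proof -
  define p where "p = PhiK z * cnj (cis om)"
  have cp: "cmod p < 1" unfolding p_def using assms cmod_PhiK_less_1[of z] by (simp add: norm_mult)
  have p2: "(Re p)^2 + (Im p)^2 < 1" using cp by (simp add: cmod_def )
  have "\<bar>Re p\<bar> < 1" using abs_Re_le_cmod[of p] cp by linarith
  then have r: "-1 < Re p" "Re p < 1" by auto
  define al where "al = - arcsin (Re p)"
  have a: "al \<in> Iang" unfolding al_def using arcsin_lt_bounded[OF r] by auto
  have sa: "sin al = - Re p" unfolding al_def using r by simp
  have ca: "cos al > 0" using cos_Iang[OF a] .
  have "(cos al)^2 = 1 - (Re p)^2" using sa by (simp add: cos_squared_eq)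
  then have "(Im p)^2 < (cos al)^2" using p2 by simp
  then have "\<not> \<bar>cos al\<bar> \<le> \<bar>Im p\<bar>" unfolding abs_le_square_iff by linarith
  then have "\<bar>Im p\<bar> < cos al" using ca by linarith
  then have i: "\<bar>Im p / cos al\<bar> < 1" using ca by (simp add: abs_divide)
  define T where "T = artanh (Im p / cos al)"
  have "tanh T = Im p / cos al" unfolding T_def by (rule tanh_artanh[OF i])
  then have "cos al * tanh T = Im p" using ca by simp
  then have "PhiK (zc om al T) = cis om * p"
    using PhiK_zc[OF ca, of om T] sa by simp
  also have "... = PhiK z" unfolding p_def by (simp add: cis_cnj cis_mult mult.left_commute[of "cis om"])
  finally have "zc om al T = z"
    using inj_on_PhiK zc_in_ball[OF ca] assms by (meson inj_onD)
  then show ?thesis using a by blast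
qed

lemma measurable_Complex [measurable (raw)]:
  assumes "f \<in> borel_measurable M" "g \<in> borel_measurable M"
  shows "(\<lambda>x. Complex (f x) (g x)) \<in> borel_measurable M"
  using assms unfolding Complex_eq by measurable

lemma borel_measurable_cosh [measurable]: "(cosh :: real \<Rightarrow> real) \<in> borel_measurable borel"
  and borel_measurable_sinh [measurable]: "(sinh :: real \<Rightarrow> real) \<in> borel_measurable borel"
  and borel_measurable_tanh [measurable]: "(tanh :: real \<Rightarrow> real) \<in> borel_measurable borel"
  and borel_measurable_tan [measurable]: "(tan :: real \<Rightarrow> real) \<in> borel_measurable borel"
proof -
  show c: "(cosh :: real \<Rightarrow> real) \<in> borel_measurable borel" and s: "(sinh :: real \<Rightarrow> real) \<in> borel_measurable borel"
    by (intro borel_measurable_continuous_onI continuous_intros)+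
  show "(tanh :: real \<Rightarrow> real) \<in> borel_measurable borel"
    using c s unfolding tanh_def[abs_def] by measurable
  show "(tan :: real \<Rightarrow> real) \<in> borel_measurable borel"
    unfolding tan_def[abs_def] by measurable
qed

lemma borel_measurable_cis [measurable]: "cis \<in> borel_measurable borel"
  by (intro borel_measurable_continuous_onI continuous_intros)

lemma borel_measurable_zc [measurable (raw)]:
  assumes [measurable]: "f \<in> borel_measurable M" "g \<in> borel_measurable M" "h \<in> borel_measurable M"
  shows "(\<lambda>x. zc (f x) (g x) (h x)) \<in> borel_measurable M"
  unfolding zc_def by measurable

lemma borel_measurable_fst_snd [measurable]:
  "(fst :: 'a::topological_space \<times> 'b::topological_space \<Rightarrow> 'a) \<in> borel_measurable borel"
  "(snd :: 'a::topological_space \<times> 'b::topological_space \<Rightarrow> 'b) \<in> borel_measurable borel"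
  by (intro borel_measurable_continuous_onI continuous_intros)+

text \<open>The rotation by \<open>om\<close> has determinant 1, so only the Jacobian of
  \<open>(P, Q)\<close> remains; it is negative, whence the absolute value.\<close>

lemma det_matrix_chord:
  fixes v :: "real^2" and om :: real
  defines "P \<equiv> \<lambda>v::real^2. - sin (v$1) * cosh (v$2) / (cosh (v$2) + cos (v$1))"
  defines "Q \<equiv> \<lambda>v::real^2. cos (v$1) * sinh (v$2) / (cosh (v$2) + cos (v$1))"
  assumes c: "cos (v$1) > 0"
  shows "\<exists>g'. ((\<lambda>v. (cos om * P v - sin om * Q v) *\<^sub>R axis 1 1 + (sin om * P v + cos om * Q v) *\<^sub>R axis 2 1) has_derivative g') (at v)
     \<and> \<bar>det (matrix g' :: real^2^2)\<bar> = cos (v$1) * cosh (v$2) / (cosh (v$2) + cos (v$1))^2"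
proof -
  let ?c = "cos (v$1)" and ?s = "sin (v$1)" and ?C = "cosh (v$2)" and ?S = "sinh (v$2)"
  have p: "?C + ?c > 0" using cosh_plus_cos_pos c .
  then have p0: "?C + ?c \<noteq> 0" by linarith
  note d = bounded_linear.has_derivative[OF bounded_linear_vec_nth has_derivative_ident]
  have ds: "((\<lambda>v. sin (v$1)) has_derivative (\<lambda>h. h$1 * ?c)) (at v)"
    by (rule DERIV_compose_FDERIV[OF _ d]) (rule DERIV_sin)
  have dc: "((\<lambda>v. cos (v$1)) has_derivative (\<lambda>h. h$1 * (- ?s))) (at v)"
    by (rule DERIV_compose_FDERIV[OF _ d]) (rule DERIV_cos)
  have dC: "((\<lambda>v. cosh (v$2)) has_derivative (\<lambda>h. h$2 * ?S)) (at v)"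
    by (rule DERIV_compose_FDERIV[OF _ d]) (auto intro!: derivative_eq_intros)
  have dS: "((\<lambda>v. sinh (v$2)) has_derivative (\<lambda>h. h$2 * ?C)) (at v)"
    by (rule DERIV_compose_FDERIV[OF _ d]) (auto intro!: derivative_eq_intros)
  define Pa Pt Qa Qt where "Pa = - ?C * (1 + ?C * ?c) / (?C + ?c)^2" and "Pt = - ?s * ?S * ?c / (?C + ?c)^2"
    and "Qa = - ?s * ?S * ?C / (?C + ?c)^2" and "Qt = ?c * (1 + ?C * ?c) / (?C + ?c)^2"
  have sc: "?s^2 = 1 - ?c^2" by (rule sin_squared_eq)
  have SC: "?S^2 = ?C^2 - 1" by (rule sinh_square_eq)
  have dP: "(P has_derivative (\<lambda>h. Pa * h$1 + Pt * h$2)) (at v)"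
    unfolding P_def
    using has_derivative_divide'[OF has_derivative_mult[OF has_derivative_minus[OF ds] dC] has_derivative_add[OF dC dc] p0]
    by (rule has_derivative_eq_rhs) (use p sc SC in \<open>simp_all add: fun_eq_iff Pa_def Pt_def add_divide_distrib[symmetric] power2_eq_square; algebra\<close>)
  have dQ: "(Q has_derivative (\<lambda>h. Qa * h$1 + Qt * h$2)) (at v)"
    unfolding Q_def
    using has_derivative_divide'[OF has_derivative_mult[OF dc dS] has_derivative_add[OF dC dc] p0]
    by (rule has_derivative_eq_rhs) (use p sc SC in \<open>simp_all add: fun_eq_iff Qa_def Qt_def add_divide_distrib[symmetric] power2_eq_square; algebra\<close>)
  define g' :: "real^2 \<Rightarrow> real^2" where "g' = (\<lambda>h. (cos om * (Pa * h$1 + Pt * h$2) - sin om * (Qa * h$1 + Qt * h$2)) *\<^sub>R axis 1 1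
      + (sin om * (Pa * h$1 + Pt * h$2) + cos om * (Qa * h$1 + Qt * h$2)) *\<^sub>R axis 2 1)"
  have "((\<lambda>v. (cos om * P v - sin om * Q v) *\<^sub>R axis 1 1 + (sin om * P v + cos om * Q v) *\<^sub>R axis 2 1) has_derivative g') (at v)"
    unfolding g'_def
    by (intro has_derivative_add has_derivative_scaleR_left has_derivative_diff has_derivative_mult_right dP dQ)
  moreover have "det (matrix g') = (cos om * Pa - sin om * Qa) * (sin om * Pt + cos om * Qt)
      - (cos om * Pt - sin om * Qt) * (sin om * Pa + cos om * Qa)"
    by (simp add: det_2 matrix_def g'_def)
  moreover have "... = (Pa * Qt - Pt * Qa)"
    using sin_cos_squared_add[of om] by algebra
  moreover have "... = - (?c * ?C / (?C + ?c)^2)"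
  proof -
    have "(- ?C * (1 + ?C * ?c)) * (?c * (1 + ?C * ?c)) - (- ?s * ?S * ?c) * (- ?s * ?S * ?C) = - ?c * ?C * (?C + ?c)^2"
      using sc SC by algebra
    then show ?thesis unfolding Pa_def Pt_def Qa_def Qt_def using p
      by (simp add: divide_simps)
  qed
  ultimately show ?thesis using c p cosh_real_pos[of "v$2"] by (intro exI[of _ g']) auto
qed

text \<open>Change of variables on \<open>real^2\<close>, placed between the transports of Lebesgue
  measure to pairs and to complex numbers.\<close>

lemma chord_measure:
  "distr (density (lborel :: (real \<times> real) measure)
      (\<lambda>p. ennreal (cos (fst p) * cosh (snd p) / (cosh (snd p) + cos (fst p))^2) * indicator Iang (fst p)))
      borel (\<lambda>p. zc om (fst p) (snd p))
   = density lborel (indicator (ball 0 1))"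
proof -
  let ?J = "\<lambda>p::real\<times>real. cos (fst p) * cosh (snd p) / (cosh (snd p) + cos (fst p))^2"
  let ?e = "\<lambda>v::real^2. (v $ 1, v $ 2)"
  let ?k = "\<lambda>v::real^2. Complex (v $ 1) (v $ 2)"
  define P Q where "P = (\<lambda>v::real^2. - sin (v$1) * cosh (v$2) / (cosh (v$2) + cos (v$1)))"
    and "Q = (\<lambda>v::real^2. cos (v$1) * sinh (v$2) / (cosh (v$2) + cos (v$1)))"
  define g :: "real^2 \<Rightarrow> real^2"
    where "g = (\<lambda>v. (cos om * P v - sin om * Q v) *\<^sub>R axis 1 1 + (sin om * P v + cos om * Q v) *\<^sub>R axis 2 1)"
  have kg: "?k (g v) = zc om (v$1) (v$2)" for v
    unfolding g_def zc_def P_def Q_def by (simp add: complex_eq_iff)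
  let ?S = "{v::real^2. v $ 1 \<in> Iang}" and ?R = "?k -` ball 0 1"
  have km [measurable]: "?k \<in> borel_measurable borel" by measurable
  have em [measurable]: "?e \<in> borel_measurable borel" by measurable
  have [measurable]: "P \<in> borel_measurable borel" "Q \<in> borel_measurable borel" unfolding P_def Q_def by measurable
  have gm [measurable]: "g \<in> borel_measurable borel" unfolding g_def by measurable
  have S [measurable]: "?S \<in> sets borel" by measurable
  have R: "?R \<in> sets borel" using measurable_sets_borel[OF km] by auto
  have "\<exists>g'. (g has_derivative g') (at v) \<and> \<bar>det (matrix g' :: real^2^2)\<bar> = ?J (?e v)" if "v \<in> ?S" for v
    using det_matrix_chord[of v om] cos_Iang[of "v$1"] that unfolding g_def P_def Q_def by simp
  then obtain g' where g': "\<And>v. v \<in> ?S \<Longrightarrow> (g has_derivative g' v) (at v)"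
     "\<And>v. v \<in> ?S \<Longrightarrow> \<bar>det (matrix (g' v) :: real^2^2)\<bar> = ?J (?e v)"
    by metis
  have inj: "inj_on g ?S"
  proof (rule inj_onI)
    fix v w assume a: "v \<in> ?S" "w \<in> ?S" "g v = g w"
    then have "zc om (v$1) (v$2) = zc om (w$1) (w$2)" using kg by metis
    then show "v = w" using zc_inj[of "v$1" "w$1" om "v$2" "w$2"] a by (auto simp: vec_eq_iff forall_2)
  qed
  have img: "g ` ?S = ?R"
  proof (intro equalityI subsetI)
    fix w assume "w \<in> g ` ?S" then show "w \<in> ?R" using kg zc_in_ball cos_Iang by auto
  next
    fix w assume "w \<in> ?R"
    then obtain al T where "al \<in> Iang" "zc om al T = ?k w" using zc_surj[of "?k w" om] by auto
    then have "?k (g (al *\<^sub>R axis 1 1 + T *\<^sub>R axis 2 1)) = ?k w" by (simp add: kg)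
    then have "g (al *\<^sub>R axis 1 1 + T *\<^sub>R axis 2 1) = w" by (simp add: vec_eq_iff forall_2)
    then show "w \<in> g ` ?S" using \<open>al \<in> Iang\<close> by (intro image_eqI[of _ _ "al *\<^sub>R axis 1 1 + T *\<^sub>R axis 2 1"]) auto
  qed
  have main: "distr (density lborel (\<lambda>v. ennreal (?J (?e v)) * indicator ?S v)) borel g = density lborel (indicator ?R)"
    by (rule substitution_vec[OF _ _ _ img R inj g']) auto
  have "density (lborel::complex measure) (indicator (ball 0 1)) = distr (density lborel (\<lambda>v. indicator (ball 0 1) (?k v))) borel ?k"
    by (subst distr_lborel_vec2_complex[symmetric], subst density_distr) (auto intro!: borel_measurable_indicator)
  also have "(\<lambda>v. indicator (ball 0 1) (?k v) :: ennreal) = indicator ?R"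
    by (auto simp: indicator_def)
  also have "distr (density lborel (indicator ?R)) borel ?k = distr (density lborel (\<lambda>v. ennreal (?J (?e v)) * indicator ?S v)) borel (?k \<circ> g)"
    unfolding main[symmetric] by (subst distr_distr) auto
  also have "?k \<circ> g = (\<lambda>p. zc om (fst p) (snd p)) \<circ> ?e" using kg by auto
  also have "(\<lambda>v. ennreal (?J (?e v)) * indicator ?S v) = (\<lambda>v. ennreal (?J (?e v)) * indicator Iang (fst (?e v)))"
    by (auto simp: indicator_def)
  also have "distr (density lborel ...) borel ((\<lambda>p. zc om (fst p) (snd p)) \<circ> ?e)
     = distr (distr (density lborel (\<lambda>v. ennreal (?J (?e v)) * indicator Iang (fst (?e v)))) borel ?e) borel (\<lambda>p. zc om (fst p) (snd p))"
    by (subst distr_distr) auto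
  also have "distr (density lborel (\<lambda>v. ennreal (?J (?e v)) * indicator Iang (fst (?e v)))) borel ?e
     = density (distr lborel borel ?e) (\<lambda>p. ennreal (?J p) * indicator Iang (fst p))"
    by (subst density_distr) auto
  finally show ?thesis unfolding distr_lborel_vec2_prod by simp
qed

lemma subst_nn_integral:
  fixes g g' :: "real \<Rightarrow> real" and f :: "real \<Rightarrow> ennreal"
  assumes [measurable]: "g \<in> borel_measurable borel" "g' \<in> borel_measurable borel" "S \<in> sets borel"
    and img: "g ` S = R" and R [measurable]: "R \<in> sets borel" and inj: "inj_on g S"
    and der: "\<And>x. x \<in> S \<Longrightarrow> (g has_field_derivative g' x) (at x)"
    and f [measurable]: "f \<in> borel_measurable borel"
  shows "(\<integral>\<^sup>+y. f y * indicator R y \<partial>lborel) = (\<integral>\<^sup>+x. f (g x) * ennreal \<bar>g' x\<bar> * indicator S x \<partial>lborel)"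
proof -
  have "(\<integral>\<^sup>+y. f y * indicator R y \<partial>lborel) = (\<integral>\<^sup>+y. f y \<partial>density lborel (indicator R))"
    by (subst nn_integral_density) (auto simp: mult_ac)
  also have "... = (\<integral>\<^sup>+x. f (g x) * ennreal \<bar>g' x\<bar> * indicator S x \<partial>lborel)"
    by (subst substitution_real[OF assms(1-7), symmetric])
      (auto simp: nn_integral_distr nn_integral_density mult_ac)
  finally show ?thesis .
qed

lemma subst_integral:
  fixes g g' :: "real \<Rightarrow> real" and f :: "real \<Rightarrow> 'b::{banach, second_countable_topology}"
  assumes [measurable]: "g \<in> borel_measurable borel" "g' \<in> borel_measurable borel" "S \<in> sets borel"
    and img: "g ` S = R" and R [measurable]: "R \<in> sets borel" and inj: "inj_on g S"
    and der: "\<And>x. x \<in> S \<Longrightarrow> (g has_field_derivative g' x) (at x)"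
    and f [measurable]: "f \<in> borel_measurable borel"
  shows "(LINT y:R|lborel. f y) = (LINT x:S|lborel. \<bar>g' x\<bar> *\<^sub>R f (g x))"
    and "set_integrable lborel R f \<longleftrightarrow> set_integrable lborel S (\<lambda>x. \<bar>g' x\<bar> *\<^sub>R f (g x))"
proof -
  have iR: "(indicator R :: real \<Rightarrow> ennreal) = (\<lambda>x. ennreal (indicator R x))" by (auto simp: indicator_def)
  have iS: "(\<lambda>x. ennreal \<bar>g' x\<bar> * indicator S x) = (\<lambda>x. ennreal (indicator S x * \<bar>g' x\<bar>))"
    by (auto simp: indicator_def)
  have eq: "density lborel (\<lambda>x. ennreal (indicator R x)) = distr (density lborel (\<lambda>x. ennreal (indicator S x * \<bar>g' x\<bar>))) borel g"
    using substitution_real[OF assms(1-7)] unfolding iR iS by simp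
  show "(LINT y:R|lborel. f y) = (LINT x:S|lborel. \<bar>g' x\<bar> *\<^sub>R f (g x))"
    unfolding set_lebesgue_integral_def using integral_density[of f lborel "indicator R"]
    by (simp add: eq integral_distr integral_density)
  show "set_integrable lborel R f \<longleftrightarrow> set_integrable lborel S (\<lambda>x. \<bar>g' x\<bar> *\<^sub>R f (g x))"
    unfolding set_integrable_def using integrable_density[of f lborel "indicator R"]
    by (simp add: eq integrable_distr_eq integrable_density)
qed

section \<open>The measures of the three coordinate systems\<close>

text \<open>The weight of \<open>L2D_inner\<close> factorises in chord coordinates as
  \<open>mA\<close> times \<open>mT\<close>, for every direction \<open>om\<close> (see
  \<open>mW_eq_distr\<close>); \<open>mO\<close> is one period of directions.\<close>

definition mA :: "real \<Rightarrow> real measure" where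
  "mA \<gamma> = density lborel (\<lambda>al. ennreal (cos al powr (2*\<gamma>+2) * indicator Iang al))"

definition mT :: "real \<Rightarrow> real measure" where
  "mT \<gamma> = density lborel (\<lambda>T. ennreal ((1 / cosh T) powr (2*\<gamma>+2)))"

definition mW :: "real \<Rightarrow> complex measure" where
  "mW \<gamma> = density lborel (\<lambda>z. ennreal (xH z powr (2*\<gamma>+3) * volH_density z * indicator (ball 0 1) z))"

definition mO :: "real measure" where
  "mO = density lborel (\<lambda>om. ennreal (indicator {0..2*pi} om))"

lemma sets_m [measurable_cong, simp]: "sets (mA \<gamma>) = sets borel" "sets (mT \<gamma>) = sets borel"
   "sets (mW \<gamma>) = sets borel" "sets mO = sets borel"
  by (simp_all add: mA_def mT_def mW_def mO_def)

lemma space_m [simp]: "space (mA \<gamma>) = UNIV" "space (mT \<gamma>) = UNIV" "space (mW \<gamma>) = UNIV" "space mO = UNIV"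
  by (simp_all add: mA_def mT_def mW_def mO_def)

lemma borel_measurable_xH [measurable]: "xH \<in> borel_measurable borel"
  and borel_measurable_volH [measurable]: "volH_density \<in> borel_measurable borel"
  and borel_measurable_PhiK [measurable]: "PhiK \<in> borel_measurable borel"
  unfolding xH_def[abs_def] volH_density_def[abs_def] PhiK_def[abs_def] by measurable

lemma continuous_on_PhiK: "continuous_on UNIV PhiK"
proof -
  have "1 + (cmod z)^2 \<noteq> 0" for z by (smt (verit) zero_le_power2)
  then show ?thesis unfolding PhiK_def[abs_def] by (intro continuous_intros) auto
qed

lemma borel_measurable_cnj [measurable (raw)]:
  "f \<in> borel_measurable M \<Longrightarrow> (\<lambda>x. cnj (f x)) \<in> borel_measurable M"
  by (rule borel_measurable_continuous_on[of cnj]) (intro continuous_intros)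

lemma borel_measurable_yc [measurable (raw)]:
  assumes [measurable]: "f \<in> borel_measurable M" "g \<in> borel_measurable M"
  shows "(\<lambda>x. yc (f x) (g x)) \<in> borel_measurable M"
  unfolding yc_def by measurable

lemma abs_yc_le_1: "\<bar>yc om z\<bar> \<le> 1"
proof -
  have p: "1 + (cmod z)^2 > 0" by (simp add: add_pos_nonneg)
  have "0 \<le> (1 - cmod z)^2" by simp
  then have "2 * cmod z \<le> 1 + (cmod z)^2" by (simp add: power2_eq_square algebra_simps)
  then have "cmod (PhiK z) \<le> 1" using p unfolding cmod_PhiK by (simp add: divide_simps)
  then have "cmod (PhiK z * cnj (cis om)) \<le> 1" by (simp add: norm_mult)
  then show ?thesis unfolding yc_def using abs_Re_le_cmod[of "PhiK z * cnj (cis om)"] by simp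
qed

text \<open>The logistic function: a bijection of the line onto the open unit interval that turns
  the weight of \<open>mT\<close> into a Beta weight.\<close>

definition lgst :: "real \<Rightarrow> real" where "lgst T = 1 / (1 + exp (-2 * T))"

lemma lgst_bounds: "0 < lgst T" "lgst T < 1"
  by (simp_all add: lgst_def add_pos_pos)

lemma lgst_cosh: "(1 / cosh T)^2 = 4 * lgst T * (1 - lgst T)"
proof -
  have e: "exp (-T) = 1 / exp T" "exp (- 2*T) = 1 / (exp T)^2"
    by (simp_all add: exp_minus inverse_eq_divide exp_double)
  have p: "exp T > 0" "1 + (exp T)^2 > 0" by (auto simp: add_pos_nonneg)
  have "cosh T = (1 + (exp T)^2) / (2 * exp T)"
    unfolding cosh_def e using p by (simp add: field_simps power2_eq_square)
  moreover have "lgst T = (exp T)^2 / (1 + (exp T)^2)"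
    unfolding lgst_def e using p by (simp add: divide_simps)
  ultimately show ?thesis using p by (simp add: divide_simps power2_eq_square) algebra
qed

lemma lgst_tanh: "tanh T = 2 * lgst T - 1"
  unfolding tanh_real_altdef lgst_def by (simp add: field_simps add_pos_pos add_nonneg_eq_0_iff)

lemma borel_measurable_lgst [measurable]: "lgst \<in> borel_measurable borel"
  unfolding lgst_def[abs_def] by measurable

text \<open>With \<open>t = lgst T\<close> one has \<open>(1 / cosh T)^2 = 4*t*(1 - t)\<close> and
  \<open>dt = 2*t*(1 - t) dT\<close>, which leaves a Beta integral, convergent for
  \<open>\<gamma> > -1\<close>. The constant is \<open>4 powr (\<gamma>+1)\<close> divided by
  2.\<close>

lemma sech_moment:
  fixes a b :: nat
  assumes "\<gamma> > -1"
  shows "(\<integral>\<^sup>+T. ennreal (lgst T ^ a * (1 - lgst T) ^ b) \<partial>mT \<gamma>) = ennreal (2 powr (2*\<gamma>+1) * Beta (real a + 1 + \<gamma>) (real b + 1 + \<gamma>))"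
proof -
  let ?g' = "\<lambda>T. 2 * lgst T * (1 - lgst T)"
  have der: "(lgst has_field_derivative ?g' T) (at T)" for T
  proof -
    have "1 + exp (-2*T) > 0" by (simp add: add_pos_pos)
    then show ?thesis unfolding lgst_def[abs_def]
      by (auto intro!: derivative_eq_intros simp: divide_simps power2_eq_square)
  qed
  have img: "lgst ` UNIV = {0<..<1}"
  proof (intro equalityI subsetI)
    fix t :: real assume t: "t \<in> {0<..<1}"
    have "lgst (- ln ((1 - t) / t) / 2) = t" using t by (simp add: lgst_def field_simps)
    then show "t \<in> lgst ` UNIV" by (metis rangeI)
  qed (use lgst_bounds in auto)
  have inj: "inj_on lgst UNIV"
  proof (rule inj_onI)
    fix x y assume "lgst x = lgst y"
    then have "1 + exp (-2*x) = 1 + exp (-2*y)" unfolding lgst_def by simp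
    then show "x = y" by simp
  qed
  have "(\<integral>\<^sup>+T. ennreal (lgst T ^ a * (1 - lgst T) ^ b) \<partial>mT \<gamma>)
      = (\<integral>\<^sup>+T. ennreal ((1 / cosh T) powr (2*\<gamma>+2)) * ennreal (lgst T ^ a * (1 - lgst T) ^ b) \<partial>lborel)"
    unfolding mT_def by (subst nn_integral_density) auto
  also have "... = (\<integral>\<^sup>+T. ennreal (2 powr (2*\<gamma>+1) * (lgst T powr (real a + \<gamma>) * (1 - lgst T) powr (real b + \<gamma>))) * ennreal \<bar>?g' T\<bar> * indicator UNIV T \<partial>lborel)"
  proof (intro nn_integral_cong)
    fix T :: real
    note l = lgst_bounds[of T]
    have cp: "1 / cosh T > 0" using cosh_real_pos by simp
    have "(1 / cosh T) powr (2*\<gamma>+2) = ((1 / cosh T) powr 2) powr (\<gamma>+1)"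
      by (subst powr_powr) (simp add: algebra_simps)
    also have "(1 / cosh T) powr 2 = 4 * lgst T * (1 - lgst T)"
      using lgst_cosh[of T] cp by (simp add: powr_numeral del: of_nat_numeral)
    also have "(4 * lgst T * (1 - lgst T)) powr (\<gamma>+1) = 4 powr (\<gamma>+1) * (lgst T powr (\<gamma>+1) * (1 - lgst T) powr (\<gamma>+1))"
      using l by (simp add: powr_mult)
    also have "4 powr (\<gamma>+1) = 2 powr (2*\<gamma>+1) * 2"
    proof -
      have "(4::real) powr (\<gamma>+1) = (2 powr 2) powr (\<gamma>+1)" by simp
      also have "... = 2 powr ((2*\<gamma>+1) + 1)" by (subst powr_powr) (simp add: algebra_simps)
      also have "... = 2 powr (2*\<gamma>+1) * 2" by (subst powr_add) simp
      finally show ?thesis .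
    qed
    finally have 1: "(1 / cosh T) powr (2*\<gamma>+2) = 2 powr (2*\<gamma>+1) * 2 * (lgst T powr (\<gamma>+1) * (1 - lgst T) powr (\<gamma>+1))" .
    have 2: "lgst T powr (\<gamma>+1) * lgst T ^ a = lgst T powr (real a + \<gamma>) * lgst T"
    proof -
      have "lgst T powr (\<gamma>+1) * lgst T ^ a = lgst T powr (\<gamma>+1) * lgst T powr (real a)" using l by (simp add: powr_realpow)
      also have "... = lgst T powr ((real a + \<gamma>) + 1)" by (simp add: powr_add[symmetric] algebra_simps)
      also have "... = lgst T powr (real a + \<gamma>) * lgst T" using l by (subst powr_add) simp
      finally show ?thesis .
    qed
    have 3: "(1 - lgst T) powr (\<gamma>+1) * (1 - lgst T) ^ b = (1 - lgst T) powr (real b + \<gamma>) * (1 - lgst T)"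
    proof -
      have "(1 - lgst T) powr (\<gamma>+1) * (1 - lgst T) ^ b = (1 - lgst T) powr (\<gamma>+1) * (1 - lgst T) powr (real b)" using l by (simp add: powr_realpow)
      also have "... = (1 - lgst T) powr ((real b + \<gamma>) + 1)" by (simp add: powr_add[symmetric] algebra_simps)
      also have "... = (1 - lgst T) powr (real b + \<gamma>) * (1 - lgst T)" using l by (subst powr_add) simp
      finally show ?thesis .
    qed
    have "(1 / cosh T) powr (2*\<gamma>+2) * (lgst T ^ a * (1 - lgst T) ^ b)
       = 2 powr (2*\<gamma>+1) * 2 * ((lgst T powr (\<gamma>+1) * lgst T ^ a) * ((1 - lgst T) powr (\<gamma>+1) * (1 - lgst T) ^ b))"
      unfolding 1 by (simp add: mult_ac)
    also have "... = 2 powr (2*\<gamma>+1) * (lgst T powr (real a + \<gamma>) * (1 - lgst T) powr (real b + \<gamma>)) * \<bar>?g' T\<bar>"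
      unfolding 2 3 using l by (simp add: mult_ac abs_mult)
    finally show "ennreal ((1 / cosh T) powr (2*\<gamma>+2)) * ennreal (lgst T ^ a * (1 - lgst T) ^ b)
      = ennreal (2 powr (2*\<gamma>+1) * (lgst T powr (real a + \<gamma>) * (1 - lgst T) powr (real b + \<gamma>))) * ennreal \<bar>?g' T\<bar> * indicator UNIV T"
      using l by (simp add: ennreal_mult[symmetric])
  qed
  also have "... = (\<integral>\<^sup>+t. ennreal (2 powr (2*\<gamma>+1) * (t powr (real a + \<gamma>) * (1 - t) powr (real b + \<gamma>))) * indicator {0<..<1} t \<partial>lborel)"
    by (rule subst_nn_integral[symmetric, OF _ _ _ img _ inj der]) auto
  also have "... = ennreal (2 powr (2*\<gamma>+1) * Beta (real a + 1 + \<gamma>) (real b + 1 + \<gamma>))"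
  proof (rule nn_integral_has_integral_lebesgue')
    have "((\<lambda>t. t powr (real a + \<gamma>) * (1 - t) powr (real b + \<gamma>)) has_integral Beta (real a + 1 + \<gamma>) (real b + 1 + \<gamma>)) {0<..<1}"
      using has_integral_Beta_real[of "real a + 1 + \<gamma>" "real b + 1 + \<gamma>"] assms
      by (simp add: has_integral_Icc_iff_Ioo add.commute add.left_commute)
    then show "((\<lambda>t. 2 powr (2*\<gamma>+1) * (t powr (real a + \<gamma>) * (1 - t) powr (real b + \<gamma>))) has_integral 2 powr (2*\<gamma>+1) * Beta (real a + 1 + \<gamma>) (real b + 1 + \<gamma>)) {0<..<1}"
      by (rule has_integral_mult_right)
  qed auto
  finally show ?thesis .
qed

lemma finite_measure_mT: "\<gamma> > -1 \<Longrightarrow> finite_measure (mT \<gamma>)"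
  using sech_moment[of \<gamma> 0 0] by (intro finite_measureI) simp

lemma finite_measure_mA: assumes "\<gamma> > -1" shows "finite_measure (mA \<gamma>)"
proof (rule finite_measureI)
  have "emeasure (mA \<gamma>) UNIV = (\<integral>\<^sup>+al. ennreal (cos al powr (2*\<gamma>+2) * indicator Iang al) \<partial>lborel)"
    unfolding mA_def by (subst emeasure_density) auto
  also have "... \<le> (\<integral>\<^sup>+al. indicator Iang al \<partial>lborel)"
    using assms cos_Iang by (intro nn_integral_mono) (auto simp: indicator_def powr_le1)
  also have "... < \<infinity>" by simp
  finally show "emeasure (mA \<gamma>) (space (mA \<gamma>)) \<noteq> \<infinity>" by auto
qed

lemma finite_measure_mO: "finite_measure mO"
proof (rule finite_measureI)
  have "emeasure mO UNIV = emeasure lborel {0..2*pi}"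
    unfolding mO_def by (subst emeasure_density) (auto simp: ennreal_indicator)
  then show "emeasure mO (space mO) \<noteq> \<infinity>" by simp
qed

text \<open>One power of \<open>xH\<close> cancels against the chord Jacobian times the hyperbolic
  volume density. The remaining power \<open>2*\<gamma>+2\<close> splits into a product because
  \<open>xH\<close> is a function of \<open>al\<close> divided by a function of
  \<open>T\<close>.\<close>

lemma mW_eq_distr: assumes "\<gamma> > -1"
  shows "mW \<gamma> = distr (mA \<gamma> \<Otimes>\<^sub>M mT \<gamma>) borel (\<lambda>p. zc om (fst p) (snd p))"
proof -
  let ?W = "\<lambda>z. ennreal (xH z powr (2*\<gamma>+3) * volH_density z)"
  let ?J = "\<lambda>p::real\<times>real. cos (fst p) * cosh (snd p) / (cosh (snd p) + cos (fst p))^2"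
  let ?Z = "\<lambda>p::real\<times>real. zc om (fst p) (snd p)"
  have "mW \<gamma> = density (density lborel (indicator (ball 0 1))) ?W"
    unfolding mW_def by (subst density_density_eq) (auto intro!: density_cong borel_measurable_indicator simp: indicator_def)
  also have "... = distr (density (density lborel (\<lambda>p. ennreal (?J p) * indicator Iang (fst p))) (\<lambda>p. ?W (?Z p))) borel ?Z"
    unfolding chord_measure[of om, symmetric] by (subst density_distr) auto
  also have "density (density lborel (\<lambda>p. ennreal (?J p) * indicator Iang (fst p))) (\<lambda>p. ?W (?Z p))
     = density lborel (\<lambda>p. ennreal (cos (fst p) powr (2*\<gamma>+2) * indicator Iang (fst p)) * ennreal ((1 / cosh (snd p)) powr (2*\<gamma>+2)))"
  proof (subst density_density_eq, simp, simp, rule density_cong, simp, simp, rule AE_I2)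
    fix p :: "real \<times> real"
    obtain al T where p: "p = (al, T)" by (cases p)
    show "ennreal (?J p) * indicator Iang (fst p) * ?W (?Z p) =
       ennreal (cos (fst p) powr (2*\<gamma>+2) * indicator Iang (fst p)) * ennreal ((1 / cosh (snd p)) powr (2*\<gamma>+2))"
    proof (cases "al \<in> Iang")
      case True
      then have c: "cos al > 0" by (rule cos_Iang)
      have C: "cosh T > 0" by (rule cosh_real_pos)
      let ?x = "cos al / cosh T"
      have x: "?x > 0" using c C by simp
      have s: "cosh T + cos al > 0" using add_pos_pos[OF C c] .
      have "1 - (cmod (zc om al T))^2 = 2 * cos al / (cosh T + cos al)"
        unfolding cmod_zc[OF c] using s by (simp add: field_simps)
      then have v: "volH_density (zc om al T) = (cosh T + cos al)^2 / (cos al)^2"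
        unfolding volH_density_def using s c by (simp add: power_divide power_mult_distrib)
      have "?x powr (2*\<gamma>+3) = ?x powr (2*\<gamma>+2) * ?x"
        using x c powr_add[of ?x "2*\<gamma>+2" 1] by (simp add: algebra_simps)
      then have "?J p * (xH (zc om al T) powr (2*\<gamma>+3) * volH_density (zc om al T)) = ?x powr (2*\<gamma>+2) * (?x * ?J p * ((cosh T + cos al)^2 / (cos al)^2))"
        unfolding v xH_zc[OF c] by (simp add: mult_ac)
      also have "?x * ?J p * ((cosh T + cos al)^2 / (cos al)^2) = 1"
      proof -
        have "a / b * (a * b / (b + a)^2) * ((b + a)^2 / a^2) = 1" if "a > 0" "b > 0" for a b :: real
        proof -
          have "b + a \<noteq> 0" using that by linarith
          then show ?thesis using that by (simp add: power2_eq_square)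
        qed
        from this[OF c C] show ?thesis unfolding p by (simp only: fst_conv snd_conv)
      qed
      also have "?x powr (2*\<gamma>+2) = cos al powr (2*\<gamma>+2) * (1 / cosh T) powr (2*\<gamma>+2)"
        using c C powr_mult[of "cos al" "1 / cosh T" "2*\<gamma>+2"] by simp
      finally have *: "?J p * (xH (zc om al T) powr (2*\<gamma>+3) * volH_density (zc om al T)) = cos al powr (2*\<gamma>+2) * (1 / cosh T) powr (2*\<gamma>+2)" by simp
      have "?J p \<ge> 0" unfolding p using c C by simp
      moreover have "volH_density (zc om al T) \<ge> 0" by (simp add: v)
      ultimately have "ennreal (?J p) * ?W (zc om al T) = ennreal (cos al powr (2*\<gamma>+2)) * ennreal ((1 / cosh T) powr (2*\<gamma>+2))"
        using * by (simp add: ennreal_mult[symmetric])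
      then show ?thesis using True unfolding p by (simp add: mult_ac)
    qed (simp add: p)
  qed
  also have "... = mA \<gamma> \<Otimes>\<^sub>M mT \<gamma>"
    unfolding mA_def mT_def
    using finite_measure.axioms(1)[OF finite_measure_mT[OF assms]] finite_measure.axioms(1)[OF finite_measure_mA[OF assms]]
    by (subst pair_measure_density) (auto simp: lborel_prod case_prod_beta' mA_def mT_def lborel.sigma_finite_measure_axioms)
  finally show ?thesis .
qed

lemma AE_mA_Iang: "AE al in mA \<gamma>. al \<in> Iang"
  unfolding mA_def by (subst AE_density) (auto intro!: AE_I2 split: split_indicator_asm simp: indicator_def)

lemma integral_mA_cong:
  assumes "\<And>al. al \<in> Iang \<Longrightarrow> f al = g al" "f \<in> borel_measurable borel" "g \<in> borel_measurable borel"
  shows "(LINT al|mA \<gamma>. f al) = (LINT al|mA \<gamma>. g al)"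
proof (rule integral_cong_AE)
  show "AE al in mA \<gamma>. f al = g al"
    by (rule eventually_mono[OF AE_mA_Iang]) (rule assms(1))
qed (use assms in auto)

lemma integral_mA:
  fixes f :: "real \<Rightarrow> 'b::{banach, second_countable_topology}"
  assumes "f \<in> borel_measurable borel"
  shows "(LINT al|mA \<gamma>. f al) = (LINT al:Iang|lborel. cos al powr (2*\<gamma>+2) *\<^sub>R f al)"
  unfolding mA_def set_lebesgue_integral_def using assms
  by (subst integral_density) (auto intro!: Bochner_Integration.integral_cong)

section \<open>The transform and the moment integrals in chord coordinates\<close>

definition UU :: "real \<Rightarrow> (real \<times> real \<Rightarrow> complex) \<Rightarrow> real \<Rightarrow> real \<Rightarrow> complex" where
  "UU \<gamma> u om al = u (om + 3*pi/2 - al, tan al) / complex_of_real (cos al powr (2*\<gamma>+2))"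

lemma borel_measurable_comp_Pair:
  fixes u :: "'a::second_countable_topology \<times> 'b::second_countable_topology \<Rightarrow> 'c::topological_space"
  assumes "u \<in> borel_measurable borel" "f \<in> borel_measurable M" "g \<in> borel_measurable M"
  shows "(\<lambda>x. u (f x, g x)) \<in> borel_measurable M"
  by (rule measurable_compose[OF borel_measurable_Pair[OF assms(2,3)] assms(1)])

lemma borel_measurable_UU [measurable (raw)]:
  assumes [measurable]: "u \<in> borel_measurable borel" "f \<in> borel_measurable M" "g \<in> borel_measurable M"
  shows "(\<lambda>x. UU \<gamma> u (f x) (g x)) \<in> borel_measurable M"
  unfolding UU_def by (intro borel_measurable_divide borel_measurable_comp_Pair) measurable

text \<open>The half-angle substitution \<open>s = - tan (al/2)\<close> turns
  \<open>-2*s/(1+s^2)\<close> into \<open>sin al\<close>, \<open>-2*s/(1-s^2)\<close> into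
  \<open>tan al\<close>, and \<open>2 ds/(1+s^2)\<close> into \<open>d al\<close>. The weight of
  \<open>mA\<close> undoes the division in \<open>UU\<close>.\<close>

lemma moment_int_eq:
  assumes [measurable]: "u \<in> borel_measurable borel" "q \<in> borel_measurable borel"
  shows "moment_int u q om = (LINT al|mA \<gamma>. complex_of_real (q (sin al)) * UU \<gamma> u om al)"
proof -
  let ?g = "\<lambda>al. - tan (al/2)" and ?g' = "\<lambda>al. - ((1 + (tan (al/2))^2) / 2)"
  have half: "al/2 \<in> Iang \<and> cos (al/2) > 0 \<and> \<bar>tan (al/2)\<bar> < 1" if "al \<in> Iang" for al
  proof -
    have a: "al/2 \<in> Iang" using that by auto
    have "tan (al/2) < tan (pi/4)" using that by (intro tan_monotone) auto
    moreover have "tan (- (pi/4)) < tan (al/2)" using that by (intro tan_monotone) auto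
    ultimately have "\<bar>tan (al/2)\<bar> < 1" using tan_45 by simp
    then show ?thesis using a cos_Iang by blast
  qed
  have atn: "arctan (tan (al/2)) = al/2" if "al \<in> Iang" for al
    using that by (intro arctan_tan) auto
  have img: "?g ` Iang = {-1<..<1}"
  proof (intro equalityI subsetI)
    fix s :: real assume s: "s \<in> {-1<..<1}"
    then have "- (pi/4) < arctan s" "arctan s < pi/4"
      using arctan_less_iff[of s 1] arctan_less_iff[of "-1" s] by (auto simp: arctan_one arctan_minus)
    then have "-2 * arctan s \<in> Iang" by auto
    moreover have "s = ?g (-2 * arctan s)" by (simp add: tan_arctan)
    ultimately show "s \<in> ?g ` Iang" by blast
  qed (use half in \<open>fastforce simp: abs_less_iff\<close>)
  have inj: "inj_on ?g Iang"
    by (rule inj_onI) (metis atn neg_equal_iff_equal divide_cancel_right zero_neq_numeral)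
  have der: "(?g has_field_derivative ?g' al) (at al)" if "al \<in> Iang" for al
  proof -
    have c: "cos (al/2) \<noteq> 0" using half[OF that] by auto
    show ?thesis
      using c tan_sec[OF c] by (auto intro!: derivative_eq_intros simp: power_inverse)
  qed
  let ?f = "\<lambda>s. complex_of_real (q (-2 * s / (1 + s^2)) * (2 / (1 + s^2))) * u_v u om s"
  have fm: "?f \<in> borel_measurable borel"
    unfolding u_v_def
    by (intro borel_measurable_times borel_measurable_comp_Pair) measurable
  have "moment_int u q om = (LINT al:Iang|lborel. \<bar>?g' al\<bar> *\<^sub>R ?f (?g al))"
    unfolding moment_int_def by (rule subst_integral(1)[OF _ _ _ img _ inj der fm]) auto
  also have "... = (LINT al:Iang|lborel. cos al powr (2*\<gamma>+2) *\<^sub>R (complex_of_real (q (sin al)) * UU \<gamma> u om al))"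
  proof (rule set_lebesgue_integral_cong, simp, intro allI impI)
    fix al assume a: "al \<in> Iang"
    note h = half[OF a]
    let ?t = "tan (al/2)"
    have p: "1 + ?t^2 > 0" by (simp add: add_pos_nonneg)
    have t2: "?t^2 < 1" using h by (simp add: abs_square_less_1)
    have c: "cos al > 0" using cos_Iang[OF a] .
    have tn: "tan al = 2 * ?t / (1 - ?t^2)"
      using tan_double[of "al/2"] c h by (simp add: less_imp_neq[symmetric])
    have sn: "sin al = 2 * ?t / (1 + ?t^2)"
    proof -
      have "1 + ?t^2 = 1 / (cos (al/2))^2" using h by (simp add: tan_sec inverse_eq_divide power_divide less_imp_neq[symmetric])
      moreover have "sin al = 2 * sin (al/2) * cos (al/2)" using sin_double[of "al/2"] by simp
      ultimately show ?thesis using h by (simp add: tan_def power2_eq_square)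
    qed
    have uv: "u_v u om (?g al) = u (om + 3*pi/2 - al, tan al)"
      unfolding u_v_def tn by (simp add: arctan_minus atn[OF a])
    have "\<bar>?g' al\<bar> *\<^sub>R ?f (?g al) = complex_of_real (q (sin al)) * u (om + 3*pi/2 - al, tan al)"
      unfolding uv using p by (simp add: sn scaleR_conv_of_real)
        (simp add: complex_eq_iff)
    also have "... = cos al powr (2*\<gamma>+2) *\<^sub>R (complex_of_real (q (sin al)) * UU \<gamma> u om al)"
      unfolding UU_def using c by (simp add: scaleR_conv_of_real)
    finally show "\<bar>?g' al\<bar> *\<^sub>R ?f (?g al) = cos al powr (2*\<gamma>+2) *\<^sub>R (complex_of_real (q (sin al)) * UU \<gamma> u om al)" .
  qed
  also have "... = (LINT al|mA \<gamma>. complex_of_real (q (sin al)) * UU \<gamma> u om al)"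
    by (rule integral_mA[symmetric]) measurable
  finally show ?thesis .
qed

lemma IHw_chord:
  assumes c: "cos al > 0" and [measurable]: "f \<in> borel_measurable borel"
  shows "IHw \<gamma> f (om + 3*pi/2 - al, tan al) = complex_of_real (cos al powr (2*\<gamma>+2)) * (LINT T|mT \<gamma>. f (zc om al T))"
proof -
  let ?F = "\<lambda>T. complex_of_real (xH (zc om al T) powr (2*\<gamma>+2)) * f (zc om al T)"
  have "IHw \<gamma> f (om + 3*pi/2 - al, tan al) = (LINT t|lborel. ?F (- ln (cos al) + 1 * t))"
    unfolding IHw_def I0H_def by (simp add: geoH_zc[OF c])
  also have "... = (LINT T|lborel. ?F T)"
    using lborel_integral_real_affine[of 1 ?F "- ln (cos al)"] by simp
  also have "... = (LINT T|lborel. complex_of_real (cos al powr (2*\<gamma>+2)) * ((1 / cosh T) powr (2*\<gamma>+2) *\<^sub>R f (zc om al T)))"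
  proof (rule Bochner_Integration.integral_cong[OF refl])
    fix T :: real
    have "(cos al / cosh T) powr (2*\<gamma>+2) = cos al powr (2*\<gamma>+2) * (1 / cosh T) powr (2*\<gamma>+2)"
      using c cosh_real_pos[of T] powr_mult[of "cos al" "1 / cosh T" "2*\<gamma>+2"] by simp
    then show "?F T = complex_of_real (cos al powr (2*\<gamma>+2)) * ((1 / cosh T) powr (2*\<gamma>+2) *\<^sub>R f (zc om al T))"
      unfolding xH_zc[OF c] by (simp add: scaleR_conv_of_real)
  qed
  also have "... = complex_of_real (cos al powr (2*\<gamma>+2)) * (LINT T|lborel. (1 / cosh T) powr (2*\<gamma>+2) *\<^sub>R f (zc om al T))"
    by (rule integral_mult_right_zero)
  also have "(LINT T|lborel. (1 / cosh T) powr (2*\<gamma>+2) *\<^sub>R f (zc om al T)) = (LINT T|mT \<gamma>. f (zc om al T))"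
    unfolding mT_def by (subst integral_density) auto
  finally show ?thesis .
qed

lemma UU_IHw:
  assumes "al \<in> Iang" "f \<in> borel_measurable borel"
  shows "UU \<gamma> (IHw \<gamma> f) om al = (LINT T|mT \<gamma>. f (zc om al T))"
  unfolding UU_def using IHw_chord[OF cos_Iang[OF assms(1)] assms(2), of \<gamma> om] cos_Iang[OF assms(1)] by simp

lemma borel_measurable_IHw [measurable]:
  assumes [measurable]: "f \<in> borel_measurable borel"
  shows "IHw \<gamma> f \<in> borel_measurable borel"
proof -
  have [measurable]: "(\<lambda>x. geoH (fst (fst x)) (snd (fst x)) (snd x)) \<in> borel_measurable ((borel \<Otimes>\<^sub>M borel) \<Otimes>\<^sub>M lborel)"
    unfolding geoH_def by measurable
  have "(\<lambda>p. LINT t|lborel. complex_of_real (xH (geoH (fst p) (snd p) t) powr (2*\<gamma>+2)) * f (geoH (fst p) (snd p) t)) \<in> borel_measurable (borel \<Otimes>\<^sub>M borel)"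
    by (rule sigma_finite_measure.borel_measurable_lebesgue_integral) (auto simp: case_prod_beta' lborel.sigma_finite_measure_axioms)
  then show ?thesis unfolding IHw_def I0H_def by (simp add: borel_prod case_prod_beta')
qed

lemma geoH_in_ball: "geoH \<beta> a t \<in> ball 0 1"
proof -
  have c: "cos (arctan a) > 0" by (simp add: cos_arctan add_pos_nonneg)
  have "geoH \<beta> a t = geoH ((\<beta> - 3*pi/2 + arctan a) + 3*pi/2 - arctan a) (tan (arctan a)) t" by (simp add: tan_arctan)
  then show ?thesis using geoH_zc[OF c] zc_in_ball[OF c] by metis
qed

lemma IHw_cong: "(\<And>z. z \<in> ball 0 1 \<Longrightarrow> f z = g z) \<Longrightarrow> IHw \<gamma> f = IHw \<gamma> g"
  unfolding IHw_def I0H_def using geoH_in_ball by (auto simp: fun_eq_iff)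

lemma IHw_periodic: "IHw \<gamma> f (\<beta> + 2*pi, a) = IHw \<gamma> f (\<beta>, a)"
  unfolding IHw_def I0H_def geoH_def by (simp add: cis_mult[symmetric])

lemma volH_density_nonneg: "volH_density z \<ge> 0"
  by (simp add: volH_density_def)

lemma L2D_inner_eq:
  assumes [measurable]: "f \<in> borel_measurable borel" "g \<in> borel_measurable borel"
  shows "L2D_inner \<gamma> f g = (LINT z|mW \<gamma>. f z * cnj (g z))"
proof -
  have "(LINT z|mW \<gamma>. f z * cnj (g z)) = (LINT z|lborel. (xH z powr (2*\<gamma>+3) * volH_density z * indicator (ball 0 1) z) *\<^sub>R (f z * cnj (g z)))"
    unfolding mW_def by (rule integral_density) (auto simp: volH_density_nonneg intro!: borel_measurable_times borel_measurable_indicator)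
  also have "... = L2D_inner \<gamma> f g"
    unfolding L2D_inner_def set_lebesgue_integral_def
    by (intro Bochner_Integration.integral_cong) (auto simp: scaleR_conv_of_real indicator_def)
  finally show ?thesis by simp
qed

lemma finite_measure_mW: "\<gamma> > -1 \<Longrightarrow> finite_measure (mW \<gamma>)"
  by (subst mW_eq_distr[of \<gamma> 0], simp)
     (intro finite_measure.finite_measure_distr finite_measure_pair_measure finite_measure_mA finite_measure_mT; simp)+

lemma integral_mW:
  fixes f :: "complex \<Rightarrow> 'b::{banach, second_countable_topology}"
  assumes g: "\<gamma> > -1" and [measurable]: "f \<in> borel_measurable borel" and B: "\<And>z. norm (f z) \<le> B"
  shows "(LINT z|mW \<gamma>. f z) = (LINT al|mA \<gamma>. LINT T|mT \<gamma>. f (zc om al T))"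
proof -
  interpret A: finite_measure "mA \<gamma>" by (rule finite_measure_mA[OF g])
  interpret T: finite_measure "mT \<gamma>" by (rule finite_measure_mT[OF g])
  interpret P: pair_sigma_finite "mA \<gamma>" "mT \<gamma>" ..
  interpret F: finite_measure "mA \<gamma> \<Otimes>\<^sub>M mT \<gamma>"
    by (rule finite_measure_pair_measure) unfold_locales
  have m: "(\<lambda>p. f (zc om (fst p) (snd p))) \<in> borel_measurable (mA \<gamma> \<Otimes>\<^sub>M mT \<gamma>)" by measurable
  have i: "integrable (mA \<gamma> \<Otimes>\<^sub>M mT \<gamma>) (case_prod (\<lambda>al T. f (zc om al T)))"
    by (rule F.integrable_const_bound[where B=B]) (use B m in \<open>auto simp: case_prod_beta'\<close>)
  have "(LINT z|mW \<gamma>. f z) = (LINT p|(mA \<gamma> \<Otimes>\<^sub>M mT \<gamma>). f (zc om (fst p) (snd p)))"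
    unfolding mW_eq_distr[OF g, of om] by (rule integral_distr) auto
  also have "... = (LINT al|mA \<gamma>. LINT T|mT \<gamma>. f (zc om al T))"
    using P.integral_fst[OF i] by (simp add: case_prod_beta')
  finally show ?thesis .
qed

text \<open>In the chord coordinates of the same direction \<open>om\<close>, the factor
  \<open>q (yc om z)\<close> is constant along each chord and leaves the inner integral, which is
  then the transform. Moments of \<open>IHw \<gamma> f\<close> are therefore pairings of
  \<open>f\<close> with plane waves.\<close>

lemma moment_int_IHw:
  assumes g: "\<gamma> > -1" and [measurable]: "f \<in> borel_measurable borel" and B: "\<And>z. cmod (f z) \<le> B"
    and [measurable]: "q \<in> borel_measurable borel" and Q: "\<And>y. \<bar>y\<bar> \<le> 1 \<Longrightarrow> \<bar>q y\<bar> \<le> Q"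
  shows "moment_int (IHw \<gamma> f) q om = (LINT z|mW \<gamma>. complex_of_real (q (yc om z)) * f z)"
proof -
  interpret T: finite_measure "mT \<gamma>" by (rule finite_measure_mT[OF g])
  have "(LINT z|mW \<gamma>. complex_of_real (q (yc om z)) * f z)
     = (LINT al|mA \<gamma>. LINT T|mT \<gamma>. complex_of_real (q (yc om (zc om al T))) * f (zc om al T))"
  proof (rule integral_mW[OF g, where B="Q * B"])
    fix z show "cmod (complex_of_real (q (yc om z)) * f z) \<le> Q * B"
      unfolding norm_mult norm_of_real
      by (rule mult_mono[OF Q[OF abs_yc_le_1] B order_trans[OF abs_ge_zero Q[OF abs_yc_le_1]]]) simp
  qed measurable
  also have "... = (LINT al|mA \<gamma>. complex_of_real (q (sin al)) * UU \<gamma> (IHw \<gamma> f) om al)"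
  proof (rule integral_mA_cong)
    fix al assume a: "al \<in> Iang"
    show "(LINT T|mT \<gamma>. complex_of_real (q (yc om (zc om al T))) * f (zc om al T)) = complex_of_real (q (sin al)) * UU \<gamma> (IHw \<gamma> f) om al"
      by (subst UU_IHw[OF a]) (simp_all add: yc_zc_same[OF cos_Iang[OF a]])
  qed measurable
  also have "... = moment_int (IHw \<gamma> f) q om"
    by (rule moment_int_eq[symmetric]) measurable
  finally show ?thesis by simp
qed

lemma nn_integral_periodic_shift:
  fixes F :: "real \<Rightarrow> ennreal"
  assumes [measurable]: "F \<in> borel_measurable borel" and per: "\<And>x. F (x + 2*pi) = F x" and c: "0 \<le> c" "c \<le> 2*pi"
  shows "(\<integral>\<^sup>+x. F (x + c) \<partial>mO) = (\<integral>\<^sup>+x. F x \<partial>mO)"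
proof -
  \<comment> \<open>Dropping the null endpoint 0 makes the period half-open, so that the translated
    pieces below tile without overlap.\<close>
  have mO: "(\<integral>\<^sup>+x. G x \<partial>mO) = (\<integral>\<^sup>+x. G x * indicator {0<..2*pi} x \<partial>lborel)" if [measurable]: "G \<in> borel_measurable borel" for G
  proof -
    have "AE x in lborel. x \<noteq> (0::real)" by (rule AE_lborel_singleton)
    then have "AE x in lborel. ennreal (indicator {0..2*pi} x) * G x = G x * indicator {0<..2*pi} x"
      by eventually_elim (auto simp: indicator_def)
    then show ?thesis
      unfolding mO_def by (subst nn_integral_density) (auto intro!: nn_integral_cong_AE)
  qed
  have sh: "(\<integral>\<^sup>+x. G x \<partial>lborel) = (\<integral>\<^sup>+x. G (t + x) \<partial>lborel)" if "G \<in> borel_measurable borel" for G and t :: real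
    using nn_integral_real_affine[OF that, of 1 t] by simp
  have "(\<integral>\<^sup>+x. F (x + c) \<partial>mO) = (\<integral>\<^sup>+x. F (x + c) * indicator {0<..2*pi} x \<partial>lborel)"
    by (rule mO) measurable
  also have "... = (\<integral>\<^sup>+x. F x * indicator {0<..2*pi} (x - c) \<partial>lborel)"
    by (subst (2) sh[where t=c]) (auto simp: add.commute)
  also have "... = (\<integral>\<^sup>+x. F x * indicator {c<..2*pi} x + F x * indicator {2*pi<..2*pi+c} x \<partial>lborel)"
    using c by (intro nn_integral_cong) (auto simp: indicator_def)
  also have "... = (\<integral>\<^sup>+x. F x * indicator {c<..2*pi} x \<partial>lborel) + (\<integral>\<^sup>+x. F x * indicator {2*pi<..2*pi+c} x \<partial>lborel)"
    by (rule nn_integral_add) auto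
  also have "(\<integral>\<^sup>+x. F x * indicator {2*pi<..2*pi+c} x \<partial>lborel) = (\<integral>\<^sup>+x. F x * indicator {0<..c} x \<partial>lborel)"
    by (subst sh[where t="2*pi"]) (auto simp: add.commute per indicator_def intro!: nn_integral_cong)
  also have "(\<integral>\<^sup>+x. F x * indicator {c<..2*pi} x \<partial>lborel) + (\<integral>\<^sup>+x. F x * indicator {0<..c} x \<partial>lborel)
     = (\<integral>\<^sup>+x. F x * indicator {c<..2*pi} x + F x * indicator {0<..c} x \<partial>lborel)"
    by (rule nn_integral_add[symmetric]) auto
  also have "... = (\<integral>\<^sup>+x. F x * indicator {0<..2*pi} x \<partial>lborel)"
    using c by (intro nn_integral_cong) (auto simp: indicator_def)
  also have "... = (\<integral>\<^sup>+x. F x \<partial>mO)" by (rule mO[symmetric]) measurable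
  finally show ?thesis .
qed

lemma nn_integral_mA:
  assumes "f \<in> borel_measurable borel"
  shows "(\<integral>\<^sup>+al. f al \<partial>mA \<gamma>) = (\<integral>\<^sup>+al. ennreal (cos al powr (2*\<gamma>+2)) * f al * indicator Iang al \<partial>lborel)"
  unfolding mA_def using assms
  by (subst nn_integral_density) (auto intro!: nn_integral_cong simp: indicator_def)

text \<open>Substituting \<open>a = tan al\<close> contributes \<open>1 + a^2\<close>, and the
  weight becomes \<open>cos al powr (- (2*\<gamma>+2))\<close>. Since \<open>UU\<close> divides by
  \<open>cos al powr (2*\<gamma>+2)\<close>, squaring it leaves exactly the weight of
  \<open>mA\<close>. The shift of \<open>\<beta>\<close> is absorbed by periodicity.\<close>

lemma L2G_dist2_eq:
  assumes g: "\<gamma> > -1" and [measurable]: "v \<in> borel_measurable borel" "w \<in> borel_measurable borel"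
    and pv: "\<And>\<beta> a. v (\<beta> + 2*pi, a) = v (\<beta>, a)" and pw: "\<And>\<beta> a. w (\<beta> + 2*pi, a) = w (\<beta>, a)"
  shows "L2G_dist2 \<gamma> v w = (\<integral>\<^sup>+om. \<integral>\<^sup>+al. ennreal ((cmod (UU \<gamma> v om al - UU \<gamma> w om al))^2) \<partial>mA \<gamma> \<partial>mO)"
proof -
  interpret A: finite_measure "mA \<gamma>" by (rule finite_measure_mA[OF g])
  interpret O: finite_measure mO by (rule finite_measure_mO)
  interpret P: pair_sigma_finite mO "mA \<gamma>" ..
  interpret PO: pair_sigma_finite mO "lborel :: real measure" ..
  define H where "H = (\<lambda>\<beta> a. ennreal ((cmod (v (\<beta>, a) - w (\<beta>, a)))^2 * (1 + a^2) powr \<gamma>))"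
  have vm [measurable (raw)]: "(\<lambda>x. v (f x, h x)) \<in> borel_measurable M" "(\<lambda>x. w (f x, h x)) \<in> borel_measurable M"
    if "f \<in> borel_measurable M" "h \<in> borel_measurable M" for f h and M :: "'z measure"
    using that by (auto intro: borel_measurable_comp_Pair)
  have Hm [measurable (raw)]: "(\<lambda>x. H (f x) (h x)) \<in> borel_measurable M"
    if [measurable]: "f \<in> borel_measurable M" "h \<in> borel_measurable M" for f h and M :: "(real \<times> real) measure"
    unfolding H_def by measurable
  have Hm1 [measurable (raw)]: "(\<lambda>x. H (f x) (h x)) \<in> borel_measurable M"
    if [measurable]: "f \<in> borel_measurable M" "h \<in> borel_measurable M" for f h and M :: "real measure"
    unfolding H_def by measurable
  have "L2G_dist2 \<gamma> v w = (\<integral>\<^sup>+p. indicator {0..2*pi} (fst p) * H (fst p) (snd p) \<partial>(lborel \<Otimes>\<^sub>M lborel))"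
    unfolding L2G_dist2_def lborel_prod H_def by (intro nn_integral_cong) (auto simp: indicator_def)
  also have "... = (\<integral>\<^sup>+a. \<integral>\<^sup>+\<beta>. indicator {0..2*pi} \<beta> * H \<beta> a \<partial>lborel \<partial>lborel)"
    by (subst lborel_pair.nn_integral_snd[symmetric]) (auto simp: )
  also have "... = (\<integral>\<^sup>+a. (\<integral>\<^sup>+\<beta>. H \<beta> a \<partial>mO) * indicator UNIV a \<partial>lborel)"
    unfolding mO_def by (subst nn_integral_density) (auto simp: ennreal_indicator)
  also have "... = (\<integral>\<^sup>+al. (\<integral>\<^sup>+\<beta>. H \<beta> (tan al) \<partial>mO) * ennreal \<bar>1 + (tan al)^2\<bar> * indicator Iang al \<partial>lborel)"
  proof (rule subst_nn_integral)
    show "tan ` Iang = UNIV"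
    proof (intro equalityI subsetI)
      fix a :: real
      have "tan (arctan a) = a" "arctan a \<in> Iang" using arctan_bounded[of a] by (auto simp: tan_arctan)
      then show "a \<in> tan ` Iang" by (metis imageI)
    qed auto
    show "inj_on tan Iang"
      by (rule inj_onI) (metis arctan_tan greaterThanLessThan_iff)
    show "(tan has_real_derivative 1 + (tan x)^2) (at x)" if "x \<in> Iang" for x
    proof -
      have c: "cos x \<noteq> 0" using cos_Iang[OF that] by simp
      show ?thesis using DERIV_tan[OF c] tan_sec[OF c] by (simp add: power_inverse)
    qed
  qed auto
  also have "... = (\<integral>\<^sup>+al. ennreal (cos al powr (2*\<gamma>+2)) * (\<integral>\<^sup>+om. ennreal ((cmod (UU \<gamma> v om al - UU \<gamma> w om al))^2) \<partial>mO) * indicator Iang al \<partial>lborel)"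
  proof (intro nn_integral_cong)
    fix al :: real
    show "(\<integral>\<^sup>+\<beta>. H \<beta> (tan al) \<partial>mO) * ennreal \<bar>1 + (tan al)^2\<bar> * indicator Iang al =
      ennreal (cos al powr (2*\<gamma>+2)) * (\<integral>\<^sup>+om. ennreal ((cmod (UU \<gamma> v om al - UU \<gamma> w om al))^2) \<partial>mO) * indicator Iang al"
    proof (cases "al \<in> Iang")
      case True
      note c = cos_Iang[OF True]
      \<comment> \<open>For \<open>al\<close> in \<open>Iang\<close> this lies between
        \<open>pi\<close> and \<open>2*pi\<close>, within the range allowed by
        \<open>nn_integral_periodic_shift\<close>.\<close>
      let ?k = "3*pi/2 - al"
      have sec: "1 + (tan al)^2 = cos al powr (-2)"
        using c tan_sec[of al] by (simp add: powr_minus powr_numeral power_inverse)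
      have per: "H (x + 2*pi) (tan al) = H x (tan al)" for x unfolding H_def by (simp add: pv pw)
      have "(\<integral>\<^sup>+\<beta>. H \<beta> (tan al) \<partial>mO) = (\<integral>\<^sup>+om. H (om + ?k) (tan al) \<partial>mO)"
        by (rule nn_integral_periodic_shift[symmetric]) (use per True in auto)
      also have "... * ennreal \<bar>1 + (tan al)^2\<bar> = (\<integral>\<^sup>+om. H (om + ?k) (tan al) * ennreal \<bar>1 + (tan al)^2\<bar> \<partial>mO)"
        by (rule nn_integral_multc[symmetric]) measurable
      also have "... = (\<integral>\<^sup>+om. ennreal (cos al powr (2*\<gamma>+2)) * ennreal ((cmod (UU \<gamma> v om al - UU \<gamma> w om al))^2) \<partial>mO)"
      proof (intro nn_integral_cong)
        fix om
        let ?d = "cmod (v (om + 3*pi/2 - al, tan al) - w (om + 3*pi/2 - al, tan al))"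
        have U: "cmod (UU \<gamma> v om al - UU \<gamma> w om al) = ?d / cos al powr (2*\<gamma>+2)"
          unfolding UU_def diff_divide_distrib[symmetric] norm_divide by simp
        have "cos al powr (2*\<gamma>+2) * (?d / cos al powr (2*\<gamma>+2))^2 = ?d^2 * cos al powr (- (2*\<gamma>+2))"
          unfolding powr_minus_divide using c by (simp add: power2_eq_square)
        also have "cos al powr (- (2*\<gamma>+2)) = (1 + (tan al)^2) powr \<gamma> * (1 + (tan al)^2)"
          unfolding sec powr_powr by (simp add: powr_add[symmetric])
        finally have "cos al powr (2*\<gamma>+2) * (cmod (UU \<gamma> v om al - UU \<gamma> w om al))^2 = ?d^2 * (1 + (tan al)^2) powr \<gamma> * (1 + (tan al)^2)"
          unfolding U by simp
        then show "H (om + ?k) (tan al) * ennreal \<bar>1 + (tan al)^2\<bar> = ennreal (cos al powr (2*\<gamma>+2)) * ennreal ((cmod (UU \<gamma> v om al - UU \<gamma> w om al))^2)"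
        proof -
          assume *: "cos al powr (2*\<gamma>+2) * (cmod (UU \<gamma> v om al - UU \<gamma> w om al))^2 = ?d^2 * (1 + (tan al)^2) powr \<gamma> * (1 + (tan al)^2)"
          have "\<bar>1 + (tan al)^2\<bar> = 1 + (tan al)^2" by simp
          then have "H (om + ?k) (tan al) * ennreal \<bar>1 + (tan al)^2\<bar> = ennreal (?d^2 * (1 + (tan al)^2) powr \<gamma> * (1 + (tan al)^2))"
            unfolding H_def by (subst ennreal_mult[symmetric]) (simp_all add: add_diff_eq)
          then show ?thesis unfolding *[symmetric] by (simp add: ennreal_mult)
        qed
      qed
      also have "... = ennreal (cos al powr (2*\<gamma>+2)) * (\<integral>\<^sup>+om. ennreal ((cmod (UU \<gamma> v om al - UU \<gamma> w om al))^2) \<partial>mO)"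
        by (rule nn_integral_cmult) measurable
      finally show ?thesis using True by simp
    qed simp
  qed
  also have "... = (\<integral>\<^sup>+al. \<integral>\<^sup>+om. ennreal ((cmod (UU \<gamma> v om al - UU \<gamma> w om al))^2) \<partial>mO \<partial>mA \<gamma>)"
    by (rule nn_integral_mA[symmetric]) measurable
  also have "... = (\<integral>\<^sup>+om. \<integral>\<^sup>+al. ennreal ((cmod (UU \<gamma> v om al - UU \<gamma> w om al))^2) \<partial>mA \<gamma> \<partial>mO)"
    by (rule P.Fubini') measurable
  finally show ?thesis .
qed

section \<open>The orthogonal polynomials\<close>

lemma pochhammer_diff: "pochhammer x (Suc i) - pochhammer (x - 1) (Suc i) = (of_nat (Suc i)) * pochhammer x i"
  for x :: "'a::comm_ring_1"
proof -
  have 1: "pochhammer x (Suc i) = pochhammer x i * (x + of_nat i)" by (rule pochhammer_Suc)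
  have 2: "pochhammer (x - 1) (Suc i) = (x - 1) * pochhammer x i" by (subst pochhammer_rec) simp
  show ?thesis unfolding 1 2 by (simp add: algebra_simps)
qed

lemma alternating_sum_Suc:
  fixes f :: "nat \<Rightarrow> real"
  shows "(\<Sum>j\<le>Suc m. (-1)^j * of_nat (Suc m choose j) * f j) = (\<Sum>j\<le>m. (-1)^j * of_nat (m choose j) * (f j - f (Suc j)))"
proof -
  have "(\<Sum>j\<le>Suc m. (-1)^j * of_nat (Suc m choose j) * f j) = f 0 + (\<Sum>j\<le>m. (-1)^(Suc j) * of_nat (Suc m choose Suc j) * f (Suc j))"
    by (subst sum.atMost_Suc_shift) simp
  also have "(\<Sum>j\<le>m. (-1)^(Suc j) * of_nat (Suc m choose Suc j) * f (Suc j)) =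
     (\<Sum>j\<le>m. (-1)^(Suc j) * of_nat (m choose Suc j) * f (Suc j)) - (\<Sum>j\<le>m. (-1)^j * of_nat (m choose j) * f (Suc j))"
    unfolding sum_subtractf[symmetric] by (intro sum.cong refl) (simp add: algebra_simps)
  also have "f 0 + ... = (\<Sum>j\<le>Suc m. (-1)^j * of_nat (m choose j) * f j) - (\<Sum>j\<le>m. (-1)^j * of_nat (m choose j) * f (Suc j))"
    by (subst sum.atMost_Suc_shift) simp
  also have "... = (\<Sum>j\<le>m. (-1)^j * of_nat (m choose j) * (f j - f (Suc j)))"
    by (simp add: sum_subtractf right_diff_distrib binomial_eq_0)
  finally show ?thesis .
qed

text \<open>An \<open>m\<close>-th finite difference of a polynomial in \<open>j\<close> of degree
  \<open>i < m\<close>. Each induction step takes one difference, which by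
  \<open>pochhammer_diff\<close> lowers the degree by one.\<close>

lemma alternating_pochhammer_sum:
  "i < m \<Longrightarrow> (\<Sum>j\<le>m. (-1)^j * of_nat (m choose j) * pochhammer (c - real j) i) = 0"
proof (induction m arbitrary: i)
  case (Suc m)
  have "(\<Sum>j\<le>Suc m. (-1)^j * of_nat (Suc m choose j) * pochhammer (c - real j) i)
     = (\<Sum>j\<le>m. (-1)^j * of_nat (m choose j) * (pochhammer (c - real j) i - pochhammer (c - real j - 1) i))"
    by (subst alternating_sum_Suc) (simp add: algebra_simps)
  also have "... = 0"
  proof (cases i)
    case (Suc i')
    have "(\<Sum>j\<le>m. (-1)^j * of_nat (m choose j) * (pochhammer (c - real j) i - pochhammer (c - real j - 1) i))
      = real i * (\<Sum>j\<le>m. (-1)^j * of_nat (m choose j) * pochhammer (c - real j) i')"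
      unfolding Suc pochhammer_diff sum_distrib_left by (intro sum.cong) (auto simp: algebra_simps)
    then show ?thesis using Suc.IH[of i'] Suc.prems Suc by simp
  qed simp
  finally show ?case .
qed simp

text \<open>This basis is chosen because \<open>(1 + y) / 2\<close> becomes \<open>lgst T\<close>
  under \<open>y = tanh T\<close>, so products with Jacobi terms are Beta moments.\<close>

lemma poly_eq_sum_shifted:
  fixes q :: "real poly"
  shows "\<exists>c. \<forall>y. poly q y = (\<Sum>i\<le>degree q. c i * ((1 + y) / 2) ^ i)"
proof -
  define q' where "q' = pcompose q [:-1, 2:]"
  have d: "degree q' = degree q" unfolding q'_def by (simp add: degree_pcompose)
  have "poly q y = poly q' ((1+y)/2)" for y unfolding q'_def by (simp add: poly_pcompose field_simps)
  then show ?thesis unfolding poly_altdef[of q'] d by (intro exI[of _ "coeff q'"]) auto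
qed

definition jacobi_coeff :: "nat \<Rightarrow> real \<Rightarrow> nat \<Rightarrow> real" where
  "jacobi_coeff n a j = ((real n + a) gchoose (n - j)) * ((real n + a) gchoose j)"

definition Jp :: "nat \<Rightarrow> real \<Rightarrow> real poly" where
  "Jp n a = (\<Sum>j\<le>n. smult (jacobi_coeff n a j) ([:-1/2, 1/2:] ^ j * [:1/2, 1/2:] ^ (n - j)))"

lemma poly_Jp: "poly (Jp n a) y = jacobiP n a a y"
  unfolding Jp_def jacobiP_def poly_sum jacobi_coeff_def
  by (intro sum.cong refl) (simp add: diff_divide_distrib add_divide_distrib add.commute)

lemma gbinomial_pos: assumes "x > real k - 1" shows "x gchoose k > (0::real)"
  unfolding gbinomial_prod_rev using assms by (intro divide_pos_pos prod_pos) auto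

lemma jacobi_coeff_pos: "a > -1 \<Longrightarrow> j \<le> n \<Longrightarrow> jacobi_coeff n a j > 0"
  unfolding jacobi_coeff_def by (intro mult_pos_pos gbinomial_pos) auto

lemma coeff_jacobi_term: assumes "j \<le> n"
  shows "degree ([:-1/2, 1/2::real:] ^ j * [:1/2, 1/2:] ^ (n - j)) = n"
    "coeff ([:-1/2, 1/2::real:] ^ j * [:1/2, 1/2:] ^ (n - j)) n = (1/2)^n"
proof -
  let ?p = "[:-1/2, 1/2::real:] ^ j * [:1/2, 1/2:] ^ (n - j)"
  show d: "degree ?p = n" using assms by (simp add: degree_mult_eq degree_power_eq)
  have "lead_coeff ?p = (1/2)^j * (1/2)^(n-j)" by (simp only: lead_coeff_mult lead_coeff_power) simp
  also have "... = (1/2)^n" using assms by (simp only: power_add[symmetric] le_add_diff_inverse)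
  finally show "coeff ?p n = (1/2)^n" unfolding d .
qed

lemma degree_Jp_le: "degree (Jp n a) \<le> n"
  unfolding Jp_def
proof (rule degree_sum_le)
  fix j assume "j \<in> {..n}"
  then show "degree (smult (jacobi_coeff n a j) ([:-1/2, 1/2:] ^ j * [:1/2, 1/2:] ^ (n - j))) \<le> n"
    using degree_smult_le[of "jacobi_coeff n a j"] coeff_jacobi_term(1)[of j n] by (metis atMost_iff)
qed simp

lemma coeff_Jp_pos: assumes "a > -1" shows "coeff (Jp n a) n > 0"
proof -
  have "coeff (Jp n a) n = (\<Sum>j\<le>n. jacobi_coeff n a j * (1/2)^n)"
    unfolding Jp_def coeff_sum coeff_smult by (intro sum.cong refl) (subst coeff_jacobi_term, auto)
  also have "... > 0" using jacobi_coeff_pos[OF assms] by (intro sum_pos) auto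
  finally show ?thesis .
qed

text \<open>The Gamma factors of the two binomials cancel against those of the Beta moment; what
  still depends on \<open>j\<close> is a binomial coefficient times a Pochhammer polynomial, the
  shape needed for \<open>alternating_pochhammer_sum\<close>.\<close>

lemma jacobi_coeff_Beta:
  fixes m i j :: nat
  assumes a: "a > -1" and j: "j \<le> m"
  shows "jacobi_coeff m a j * Beta (real (m - j + i) + 1 + a) (real j + 1 + a)
     = (Gamma (real m + a + 1))^2 / (fact m * Gamma (real m + real i + 2 * a + 2)) * (of_nat (m choose j) * pochhammer (real m + a + 1 - real j) i)"
proof -
  have nz: "x \<notin> \<int>\<^sub>\<le>\<^sub>0" if "x > 0" for x :: real using that by (auto elim!: nonpos_Ints_cases)
  have mj: "real (m - j) = real m - real j" using j by simp
  have b1: "(real m + a) gchoose (m - j) = Gamma (real m + a + 1) / (fact (m - j) * Gamma (real j + 1 + a))"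
    using gbinomial_Gamma[of "real m + a" "m - j"] nz[of "real m + a + 1"] a by (simp add: mj algebra_simps)
  have b2: "(real m + a) gchoose j = Gamma (real m + a + 1) / (fact j * Gamma (real m + a + 1 - real j))"
    using gbinomial_Gamma[of "real m + a" "j"] nz[of "real m + a + 1"] a by (simp add: algebra_simps)
  have B: "Beta (real (m - j + i) + 1 + a) (real j + 1 + a) = Gamma (real m + a + 1 - real j + real i) * Gamma (real j + 1 + a) / Gamma (real m + real i + 2 * a + 2)"
    unfolding Beta_def using mj by (simp add: algebra_simps)
  have P: "pochhammer (real m + a + 1 - real j) i = Gamma (real m + a + 1 - real j + real i) / Gamma (real m + a + 1 - real j)"
    using nz[of "real m + a + 1 - real j"] a j by (intro pochhammer_Gamma) auto
  have C: "of_nat (m choose j) = (fact m / (fact j * fact (m - j)) :: real)"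
    using j by (rule binomial_fact)
  have g: "Gamma (real j + 1 + a) \<noteq> 0" using a by (simp add: Gamma_real_pos less_imp_neq[symmetric])
  show ?thesis unfolding jacobi_coeff_def b1 b2 B P C using g by (simp add: power2_eq_square)
qed

lemma jacobiP_minus: "jacobiP n a a (- y) = (-1)^n * jacobiP n a a y"
proof -
  have "jacobiP n a a (- y) = (\<Sum>j\<le>n. jacobi_coeff n a j * ((- y - 1) / 2) ^ j * ((- y + 1) / 2) ^ (n - j))"
    unfolding jacobiP_def jacobi_coeff_def by simp
  also have "... = (\<Sum>j\<le>n. jacobi_coeff n a (n - j) * ((- y - 1) / 2) ^ (n - j) * ((- y + 1) / 2) ^ j)"
    by (rule sum.reindex_bij_witness[of _ "\<lambda>j. n - j" "\<lambda>j. n - j"]) auto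
  also have "... = (\<Sum>j\<le>n. (-1)^n * (jacobi_coeff n a j * ((y - 1) / 2) ^ j * ((y + 1) / 2) ^ (n - j)))"
  proof (intro sum.cong refl)
    fix j assume j: "j \<in> {..n}"
    have "jacobi_coeff n a (n - j) = jacobi_coeff n a j" using j by (simp add: jacobi_coeff_def mult.commute)
    moreover have "((- y - 1) / 2) ^ (n - j) = (-1)^(n-j) * ((y + 1) / 2) ^ (n - j)"
      unfolding power_mult_distrib[symmetric] by (rule arg_cong[where f="\<lambda>x. x ^ (n - j)"]) (simp add: field_simps)
    moreover have "((- y + 1) / 2) ^ j = (-1)^j * ((y - 1) / 2) ^ j"
      unfolding power_mult_distrib[symmetric] by (rule arg_cong[where f="\<lambda>x. x ^ j"]) (simp add: field_simps)
    moreover have "(-1)^(n-j) * (-1)^j = (-1::real)^n" using j by (simp add: power_add[symmetric])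
    ultimately show "jacobi_coeff n a (n - j) * ((- y - 1) / 2) ^ (n - j) * ((- y + 1) / 2) ^ j =
       (-1)^n * (jacobi_coeff n a j * ((y - 1) / 2) ^ j * ((y + 1) / 2) ^ (n - j))"
      by (simp add: mult_ac)
  qed
  finally show ?thesis unfolding jacobiP_def jacobi_coeff_def sum_distrib_left by simp
qed

lemma coeff_Jp_parity: assumes "odd (j + n)" shows "coeff (Jp n a) j = 0"
proof -
  have "pcompose (Jp n a) [:0, -1:] = smult ((-1)^n) (Jp n a)"
    by (simp add: poly_eq_poly_eq_iff[symmetric] fun_eq_iff poly_pcompose poly_Jp jacobiP_minus)
  then have "(-1)^j * coeff (Jp n a) j = (-1)^n * coeff (Jp n a) j"
    using coeff_pcompose_linear[of "Jp n a" "-1" j] by (metis coeff_smult)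
  then show ?thesis using assms by (cases "even n"; cases "even j") auto
qed

locale disk_weight = fixes \<gamma> :: real assumes gam: "\<gamma> > -1"
begin

sublocale A: finite_measure "mA \<gamma>" by (rule finite_measure_mA[OF gam])
sublocale T: finite_measure "mT \<gamma>" by (rule finite_measure_mT[OF gam])
sublocale W: finite_measure "mW \<gamma>" by (rule finite_measure_mW[OF gam])
sublocale O: finite_measure mO by (rule finite_measure_mO)
sublocale AT: pair_sigma_finite "mA \<gamma>" "mT \<gamma>" ..

text \<open>The Jacobi weight with both parameters \<open>\<gamma> + 1/2\<close>. It is the image of
  \<open>mA \<gamma>\<close> under \<open>sin\<close> and also of \<open>mT (\<gamma> + 1/2)\<close>
  under \<open>tanh\<close>, which turns integrals over angles into the Beta moments of
  \<open>sech_moment\<close>.\<close>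

definition mY :: "real measure" where
  "mY = density lborel (\<lambda>y. ennreal ((1 - y^2) powr (\<gamma> + 1/2) * indicator {-1<..<1} y))"

lemma distr_mA_sin: "distr (mA \<gamma>) borel sin = mY"
proof -
  have img: "sin ` Iang = {-1<..<1}"
  proof (intro equalityI subsetI)
    fix y :: real assume "y \<in> {-1<..<1}"
    then have "arcsin y \<in> Iang" "sin (arcsin y) = y" using arcsin_lt_bounded[of y] by auto
    then show "y \<in> sin ` Iang" by (metis imageI)
  next
    fix y assume "y \<in> sin ` Iang"
    then obtain al where a: "al \<in> Iang" "y = sin al" by auto
    have "(sin al)^2 < 1" using cos_Iang[OF a(1)] by (simp add: sin_squared_eq)
    then show "y \<in> {-1<..<1}" using a by (simp add: abs_square_less_1 abs_less_iff)
  qed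
  have inj: "inj_on sin Iang"
    by (rule inj_onI) (metis arcsin_sin greaterThanLessThan_iff less_imp_le)
  have "mA \<gamma> = density (density lborel (\<lambda>x. ennreal \<bar>cos x\<bar> * indicator Iang x)) (\<lambda>x. ennreal ((1 - (sin x)^2) powr (\<gamma> + 1/2)))"
    unfolding mA_def
  proof (subst density_density_eq, simp, simp, rule density_cong, simp, simp, rule AE_I2)
    fix x :: real
    show "ennreal (cos x powr (2*\<gamma>+2) * indicator Iang x) = ennreal \<bar>cos x\<bar> * indicator Iang x * ennreal ((1 - (sin x)^2) powr (\<gamma> + 1/2))"
    proof (cases "x \<in> Iang")
      case True
      note c = cos_Iang[OF True]
      have "cos x powr (2*\<gamma>+2) = cos x powr 1 * (cos x powr 2) powr (\<gamma> + 1/2)"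
        unfolding powr_powr powr_add[symmetric] by (simp add: algebra_simps)
      also have "... = \<bar>cos x\<bar> * (1 - (sin x)^2) powr (\<gamma> + 1/2)"
        using c by (simp add: powr_numeral sin_squared_eq)
      finally show ?thesis using True by (simp add: ennreal_mult[symmetric])
    qed simp
  qed
  then have "distr (mA \<gamma>) borel sin = density (distr (density lborel (\<lambda>x. ennreal \<bar>cos x\<bar> * indicator Iang x)) borel sin) (\<lambda>y. ennreal ((1 - y^2) powr (\<gamma> + 1/2)))"
    by (subst density_distr) auto
  also have "... = density (density lborel (indicator {-1<..<1})) (\<lambda>y. ennreal ((1 - y^2) powr (\<gamma> + 1/2)))"
    by (subst substitution_real[OF _ _ _ img _ inj DERIV_sin]) auto
  also have "... = mY" unfolding mY_def
    by (subst density_density_eq) (auto intro!: density_cong simp: indicator_def)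
  finally show ?thesis .
qed

lemma distr_mT_tanh: "distr (mT (\<gamma> + 1/2)) borel tanh = mY"
proof -
  have img: "tanh ` (UNIV::real set) = {-1<..<1}"
  proof (intro equalityI subsetI)
    fix y :: real assume "y \<in> {-1<..<1}"
    then have "tanh (artanh y) = y" by (intro tanh_artanh) auto
    then show "y \<in> tanh ` UNIV" by (metis rangeI)
  next
    fix y :: real assume "y \<in> range tanh"
    then show "y \<in> {-1<..<1}" using tanh_real_bounds by auto
  qed
  have "mT (\<gamma> + 1/2) = density (density lborel (\<lambda>x. ennreal \<bar>1 - (tanh x)^2\<bar> * indicator UNIV x)) (\<lambda>x. ennreal ((1 - (tanh x)^2) powr (\<gamma> + 1/2)))"
    unfolding mT_def
  proof (subst density_density_eq, simp, simp, rule density_cong, simp, simp, rule AE_I2)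
    fix x :: real
    have t: "1 - (tanh x)^2 = (1 / cosh x)^2"
      using cosh_real_pos[of x] unfolding tanh_def power_divide sinh_square_eq by (simp add: field_simps)
    have p: "1 / cosh x > 0" using cosh_real_pos[of x] by simp
    have "(1 / cosh x) powr (2*(\<gamma>+1/2)+2) = (1 / cosh x) powr 2 * ((1 / cosh x) powr 2) powr (\<gamma> + 1/2)"
      unfolding powr_powr powr_add[symmetric] by (simp add: algebra_simps)
    also have "(1 / cosh x) powr 2 = 1 - (tanh x)^2" using p t by (simp add: powr_numeral)
    finally show "ennreal ((1 / cosh x) powr (2*(\<gamma>+1/2)+2)) = ennreal \<bar>1 - (tanh x)^2\<bar> * indicator UNIV x * ennreal ((1 - (tanh x)^2) powr (\<gamma> + 1/2))"
      using t by (simp add: ennreal_mult[symmetric])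
  qed
  then have "distr (mT (\<gamma> + 1/2)) borel tanh = density (distr (density lborel (\<lambda>x. ennreal \<bar>1 - (tanh x)^2\<bar> * indicator UNIV x)) borel tanh) (\<lambda>y. ennreal ((1 - y^2) powr (\<gamma> + 1/2)))"
    by (subst density_distr) auto
  also have "... = density (density lborel (indicator {-1<..<1})) (\<lambda>y. ennreal ((1 - y^2) powr (\<gamma> + 1/2)))"
    by (subst substitution_real[OF _ _ _ img]) (auto intro!: injI derivative_eq_intros)
  also have "... = mY" unfolding mY_def
    by (subst density_density_eq) (auto intro!: density_cong simp: indicator_def)
  finally show ?thesis .
qed

lemma integral_sin_tanh:
  fixes h :: "real \<Rightarrow> 'b::{banach, second_countable_topology}"
  assumes [measurable]: "h \<in> borel_measurable borel"
  shows "(LINT al|mA \<gamma>. h (sin al)) = (LINT T|mT (\<gamma> + 1/2). h (tanh T))"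
proof -
  have "(LINT al|mA \<gamma>. h (sin al)) = (LINT y|mY. h y)"
    unfolding distr_mA_sin[symmetric] by (rule integral_distr[symmetric]) auto
  also have "... = (LINT T|mT (\<gamma> + 1/2). h (tanh T))"
    unfolding distr_mT_tanh[symmetric] by (rule integral_distr) auto
  finally show ?thesis .
qed

end

lemma borel_measurable_poly [measurable]: "poly (p :: real poly) \<in> borel_measurable borel"
  by (intro borel_measurable_continuous_onI continuous_intros)

lemma poly_bounded:
  obtains B :: real where "B \<ge> 0" "\<And>y. \<bar>y\<bar> \<le> 1 \<Longrightarrow> \<bar>poly q y\<bar> \<le> B"
proof -
  have "compact (poly q ` {-1..1::real})" by (intro compact_continuous_image continuous_intros) auto
  then obtain B where "\<forall>x\<in>poly q ` {-1..1::real}. norm x \<le> B" using compact_imp_bounded bounded_iff by blast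
  then have B: "\<bar>poly q y\<bar> \<le> B" if "\<bar>y\<bar> \<le> 1" for y using that by (auto simp: abs_le_iff)
  have "B \<ge> 0" using order_trans[OF abs_ge_zero B[of 0]] by simp
  then show ?thesis using B that by blast
qed

lemma sech_moment_integral:
  fixes a b :: nat
  assumes "\<gamma> > -1"
  shows "integrable (mT \<gamma>) (\<lambda>T. lgst T ^ a * (1 - lgst T) ^ b)"
    and "(LINT T|mT \<gamma>. lgst T ^ a * (1 - lgst T) ^ b) = 2 powr (2*\<gamma>+1) * Beta (real a + 1 + \<gamma>) (real b + 1 + \<gamma>)"
proof -
  have nn: "0 \<le> lgst T ^ a * (1 - lgst T) ^ b" for T using lgst_bounds[of T] by simp
  show "integrable (mT \<gamma>) (\<lambda>T. lgst T ^ a * (1 - lgst T) ^ b)"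
    by (rule integrableI_nonneg) (use nn sech_moment[OF assms, of a b] in auto)
  have "Beta (real a + 1 + \<gamma>) (real b + 1 + \<gamma>) \<ge> 0"
    unfolding Beta_def using assms by (intro divide_nonneg_nonneg mult_nonneg_nonneg less_imp_le[OF Gamma_real_pos]) auto
  then show "(LINT T|mT \<gamma>. lgst T ^ a * (1 - lgst T) ^ b) = 2 powr (2*\<gamma>+1) * Beta (real a + 1 + \<gamma>) (real b + 1 + \<gamma>)"
    by (subst integral_eq_nn_integral) (use nn sech_moment[OF assms, of a b] in auto)
qed

context disk_weight
begin

lemma integrable_poly_sin: "integrable (mA \<gamma>) (\<lambda>al. poly q (sin al))"
proof -
  obtain B where "B \<ge> 0" "\<And>y. \<bar>y\<bar> \<le> 1 \<Longrightarrow> \<bar>poly q y\<bar> \<le> B" using poly_bounded[of q] by blast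
  then show ?thesis by (intro A.integrable_const_bound[where B=B]) auto
qed

abbreviation "Jm m \<equiv> Jp m (\<gamma> + 1/2)"

text \<open>After \<open>y = tanh T\<close> every term of the Jacobi sum is a Beta moment, and the
  total is a vanishing finite difference.\<close>

lemma Jacobi_orth_shifted:
  assumes "i < m"
  shows "(LINT al|mA \<gamma>. poly (Jm m) (sin al) * ((1 + sin al) / 2) ^ i) = 0"
proof -
  let ?a = "\<gamma> + 1/2"
  have a: "?a > -1" using gam by simp
  have "(LINT al|mA \<gamma>. poly (Jm m) (sin al) * ((1 + sin al) / 2) ^ i) = (LINT T|mT ?a. poly (Jm m) (tanh T) * ((1 + tanh T) / 2) ^ i)"
    by (rule integral_sin_tanh[of "\<lambda>y. poly (Jm m) y * ((1 + y) / 2) ^ i"]) measurable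
  also have "... = (LINT T|mT ?a. (\<Sum>j\<le>m. (-1)^j * jacobi_coeff m ?a j * (lgst T ^ (m - j + i) * (1 - lgst T) ^ j)))"
  proof (rule Bochner_Integration.integral_cong[OF refl])
    fix T :: real
    have 1: "(1 + tanh T) / 2 = lgst T" "(tanh T + 1) / 2 = lgst T" "(tanh T - 1) / 2 = - (1 - lgst T)"
      by (simp_all add: lgst_tanh field_simps)
    show "poly (Jm m) (tanh T) * ((1 + tanh T) / 2) ^ i = (\<Sum>j\<le>m. (-1)^j * jacobi_coeff m ?a j * (lgst T ^ (m - j + i) * (1 - lgst T) ^ j))"
      unfolding poly_Jp jacobiP_def 1 sum_distrib_right jacobi_coeff_def
      by (intro sum.cong refl) (subst power_minus[of "1 - lgst T"], simp only: power_add mult_ac)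
  qed
  also have "... = (\<Sum>j\<le>m. (-1)^j * jacobi_coeff m ?a j * (2 powr (2*?a+1) * Beta (real (m - j + i) + 1 + ?a) (real j + 1 + ?a)))"
    by (subst Bochner_Integration.integral_sum) (auto simp: sech_moment_integral[OF a])
  also have "... = 2 powr (2*?a+1) * (\<Sum>j\<le>m. (-1)^j * (jacobi_coeff m ?a j * Beta (real (m - j + i) + 1 + ?a) (real j + 1 + ?a)))"
    unfolding sum_distrib_left by (intro sum.cong) (auto simp: mult_ac)
  also have "(\<Sum>j\<le>m. (-1)^j * (jacobi_coeff m ?a j * Beta (real (m - j + i) + 1 + ?a) (real j + 1 + ?a)))
    = (Gamma (real m + ?a + 1))^2 / (fact m * Gamma (real m + real i + 2 * ?a + 2)) *
      (\<Sum>j\<le>m. (-1)^j * of_nat (m choose j) * pochhammer ((real m + ?a + 1) - real j) i)"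
    unfolding sum_distrib_left
  proof (intro sum.cong refl)
    fix j assume "j \<in> {..m}"
    then have "j \<le> m" by simp
    show "(-1)^j * (jacobi_coeff m ?a j * Beta (real (m - j + i) + 1 + ?a) (real j + 1 + ?a)) =
      (Gamma (real m + ?a + 1))^2 / (fact m * Gamma (real m + real i + 2 * ?a + 2)) * ((-1)^j * of_nat (m choose j) * pochhammer ((real m + ?a + 1) - real j) i)"
      unfolding jacobi_coeff_Beta[OF a \<open>j \<le> m\<close>] by (simp only: mult_ac)
  qed
  also have "... = 0" unfolding alternating_pochhammer_sum[OF assms] by simp
  finally show ?thesis by simp
qed

lemma Jacobi_orth:
  assumes "degree q < m"
  shows "(LINT al|mA \<gamma>. poly (Jm m) (sin al) * poly q (sin al)) = 0"
proof -
  obtain c where c: "\<And>y. poly q y = (\<Sum>i\<le>degree q. c i * ((1 + y) / 2) ^ i)" using poly_eq_sum_shifted by blast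
  have int: "integrable (mA \<gamma>) (\<lambda>al. c i * (poly (Jm m) (sin al) * ((1 + sin al) / 2) ^ i))" for i
    using integrable_poly_sin[of "smult (c i) (Jm m * [:1/2, 1/2:] ^ i)"] by (simp add: add_divide_distrib)
  have "(LINT al|mA \<gamma>. poly (Jm m) (sin al) * poly q (sin al)) = (LINT al|mA \<gamma>. (\<Sum>i\<le>degree q. c i * (poly (Jm m) (sin al) * ((1 + sin al) / 2) ^ i)))"
    unfolding c sum_distrib_left by (simp add: mult_ac)
  also have "... = (\<Sum>i\<le>degree q. c i * (LINT al|mA \<gamma>. poly (Jm m) (sin al) * ((1 + sin al) / 2) ^ i))"
    using int by (subst Bochner_Integration.integral_sum) auto
  also have "... = 0" using Jacobi_orth_shifted assms by (intro sum.neutral) auto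
  finally show ?thesis .
qed

lemma emeasure_mA_pos: "emeasure (mA \<gamma>) UNIV > 0"
proof (rule ccontr)
  assume "\<not> emeasure (mA \<gamma>) UNIV > 0"
  then have "(\<integral>\<^sup>+al. ennreal (cos al powr (2*\<gamma>+2) * indicator Iang al) \<partial>lborel) = 0"
    unfolding mA_def by (subst (asm) emeasure_density) auto
  then have "AE al in lborel. ennreal (cos al powr (2*\<gamma>+2) * indicator Iang al) = 0"
    by (subst (asm) nn_integral_0_iff_AE) auto
  then have "AE al in lborel. al \<notin> Iang"
    by eventually_elim (use cos_Iang in \<open>fastforce simp: indicator_def split: if_splits\<close>)
  then have "emeasure lborel Iang = 0"
    by (intro AE_iff_measurable[THEN iffD1, of _ lborel "\<lambda>al. al \<notin> Iang"]) auto
  then show False using pi_gt_zero by simp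
qed

text \<open>A nonzero polynomial has finitely many roots, and \<open>sin\<close> is injective on
  \<open>Iang\<close>, so it would vanish only on a null set of angles.\<close>

lemma poly_L2_zero:
  assumes "(LINT al|mA \<gamma>. (poly r (sin al))^2) = 0"
  shows "r = 0"
proof (rule ccontr)
  assume r: "r \<noteq> 0"
  have int: "integrable (mA \<gamma>) (\<lambda>al. (poly r (sin al))^2)" using integrable_poly_sin[of "r^2"] by simp
  have "AE al in mA \<gamma>. (poly r (sin al))^2 = 0"
    using integral_nonneg_eq_0_iff_AE[OF int] assms by simp
  then have ae: "AE al in mA \<gamma>. al \<in> arcsin ` {y. poly r y = 0}"
    using AE_mA_Iang
  proof eventually_elim
    case (elim al)
    then have "poly r (sin al) = 0" "al = arcsin (sin al)" by (auto intro!: arcsin_sin[symmetric])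
    then show ?case by blast
  qed
  have fin: "finite (arcsin ` {y. poly r y = 0})" using poly_roots_finite[OF r] by simp
  have "AE al in lborel. al \<notin> arcsin ` {y. poly r y = 0}"
    by (rule AE_not_in) (intro finite_imp_null_set_lborel fin)
  then have "AE al in mA \<gamma>. al \<notin> arcsin ` {y. poly r y = 0}"
    unfolding mA_def by (subst AE_density) (auto elim: eventually_mono)
  with ae have "AE al in mA \<gamma>. False" by eventually_elim auto
  then have "emeasure (mA \<gamma>) UNIV = 0" by (subst (asm) AE_iff_measurable[of UNIV]) auto
  then show False using emeasure_mA_pos by simp
qed

definition Nm :: "nat \<Rightarrow> real" where
  "Nm m = (LINT al|mA \<gamma>. (poly (Jm m) (sin al))^2)"

definition pg :: "nat \<Rightarrow> real poly" where
  "pg m = smult (1 / sqrt (2 * pi * Nm m)) (Jm m)"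

lemma Jm_nz: "Jm m \<noteq> 0" using coeff_Jp_pos[of "\<gamma> + 1/2" m] gam by auto

lemma Nm_pos: "Nm m > 0"
proof -
  have "Nm m \<ge> 0" unfolding Nm_def by (rule integral_nonneg_AE) simp
  moreover have "Nm m \<noteq> 0" using poly_L2_zero[of "Jm m"] Jm_nz unfolding Nm_def by blast
  ultimately show ?thesis by simp
qed

text \<open>The normalisation of \<open>p_gamma\<close> is a gauge integral over the closed
  interval; passing through \<open>mY\<close> identifies it with \<open>Nm\<close>.\<close>

lemma p_gamma_eq: "p_gamma \<gamma> m = poly (pg m)"
proof -
  let ?f = "\<lambda>y. (poly (Jm m) y)^2 * (1 - y^2) powr (\<gamma> + 1/2)"
  have int: "integrable mY (\<lambda>y. (poly (Jm m) y)^2)"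
    unfolding distr_mA_sin[symmetric] using integrable_poly_sin[of "(Jm m)^2"]
    by (subst integrable_distr_eq) auto
  have eq: "(\<lambda>y. ((1 - y^2) powr (\<gamma> + 1/2) * indicator {-1<..<1} y) *\<^sub>R (poly (Jm m) y)^2) = (\<lambda>y. indicator {-1<..<1} y *\<^sub>R ?f y)"
    by (auto simp: fun_eq_iff)
  have i2: "integrable lborel (\<lambda>y. indicator {-1<..<1} y *\<^sub>R ?f y)"
    using int unfolding mY_def by (subst (asm) integrable_density) (auto simp: eq[simplified])
  have "Nm m = (LINT y|mY. (poly (Jm m) y)^2)"
    unfolding Nm_def distr_mA_sin[symmetric] by (rule integral_distr[symmetric]) auto
  also have "... = (LINT y|lborel. indicator {-1<..<1} y *\<^sub>R ?f y)"
    unfolding mY_def by (subst integral_density) (auto simp: eq[simplified])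
  also have "... = integral {-1<..<1} ?f"
    using set_borel_integral_eq_integral(2)[of "{-1<..<1}" ?f] i2
    unfolding set_integrable_def set_lebesgue_integral_def by simp
  also have "... = integral {-1..1} ?f" by (rule integral_open_interval_real[symmetric])
  finally have N: "integral {-1..1} ?f = Nm m" by simp
  show ?thesis unfolding fun_eq_iff p_gamma_def pg_def poly_Jp[symmetric] N by simp
qed

lemma coeff_pg_pos: "coeff (pg m) m > 0"
  unfolding pg_def using coeff_Jp_pos[of "\<gamma> + 1/2" m] gam Nm_pos[of m] by simp

lemma degree_pg: "degree (pg m) = m"
proof (rule antisym)
  show "degree (pg m) \<le> m" unfolding pg_def using degree_Jp_le degree_smult_le order_trans by blast
  show "m \<le> degree (pg m)" using coeff_pg_pos[of m] by (intro le_degree) simp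
qed

lemma coeff_pg_parity: "odd (j + m) \<Longrightarrow> coeff (pg m) j = 0"
  unfolding pg_def using coeff_Jp_parity by simp

lemma pg_orth: "degree q < m \<Longrightarrow> (LINT al|mA \<gamma>. poly (pg m) (sin al) * poly q (sin al)) = 0"
  unfolding pg_def using Jacobi_orth[of q m] by simp

lemma pg_norm: "(LINT al|mA \<gamma>. (poly (pg m) (sin al))^2) = 1 / (2*pi)"
proof -
  have "(LINT al|mA \<gamma>. (poly (pg m) (sin al))^2) = (1 / sqrt (2 * pi * Nm m))^2 * Nm m"
    unfolding pg_def Nm_def by (simp add: power_mult_distrib power_divide)
  then show ?thesis using Nm_pos[of m] by (simp add: power_divide)
qed

lemma pg_ortho: "(LINT al|mA \<gamma>. poly (pg m) (sin al) * poly (pg n) (sin al)) = (if m = n then 1 / (2*pi) else 0)"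
proof (cases m n rule: linorder_cases)
  case less
  then show ?thesis using pg_orth[of "pg m" n] degree_pg by (simp add: mult.commute)
next
  case greater
  then show ?thesis using pg_orth[of "pg n" m] degree_pg by simp
qed (use pg_norm[of n] in \<open>simp add: power2_eq_square\<close>)

lemma pg_span: "degree q \<le> n \<Longrightarrow> \<exists>c. q = (\<Sum>j\<le>n. smult (c j) (pg j))"
proof (induction n arbitrary: q)
  case 0
  then obtain a where a: "q = [:a:]" by (auto elim: degree_eq_zeroE)
  obtain b where b: "pg 0 = [:b:]" using degree_pg[of 0] by (auto elim: degree_eq_zeroE)
  have "b \<noteq> 0" using coeff_pg_pos[of 0] b by auto
  then show ?case by (intro exI[of _ "\<lambda>_. a / b"]) (simp add: a b)
next
  case (Suc n)
  define k where "k = coeff q (Suc n) / coeff (pg (Suc n)) (Suc n)"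
  let ?r = "q - smult k (pg (Suc n))"
  have "degree ?r \<le> n"
  proof (rule degree_le, intro allI impI)
    fix i assume "n < i"
    then consider "i = Suc n" | "i > Suc n" by linarith
    then show "coeff ?r i = 0"
    proof cases
      case 1 then show ?thesis using coeff_pg_pos[of "Suc n"] by (simp add: k_def)
    next
      case 2 then show ?thesis using Suc.prems degree_pg[of "Suc n"] by (simp add: coeff_eq_0)
    qed
  qed
  then obtain c where c: "?r = (\<Sum>j\<le>n. smult (c j) (pg j))" using Suc.IH by blast
  then have "q = (\<Sum>j\<le>n. smult (c j) (pg j)) + smult k (pg (Suc n))" by (simp add: algebra_simps)
  also have "... = (\<Sum>j\<le>Suc n. smult ((c(Suc n := k)) j) (pg j))" by simp
  finally show ?case by blast
qed

end

section \<open>The transform of plane waves\<close>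

lemma distr_mT_uminus: "distr (mT \<gamma>) borel uminus = mT \<gamma>"
proof -
  have "mT \<gamma> = density (distr lborel borel uminus) (\<lambda>T. ennreal ((1 / cosh T) powr (2*\<gamma>+2)))"
    unfolding mT_def by (simp only: lborel_distr_uminus)
  also have "... = distr (density lborel (\<lambda>T. ennreal ((1 / cosh (- T)) powr (2*\<gamma>+2)))) borel uminus"
    by (rule density_distr) auto
  finally show ?thesis unfolding mT_def by simp
qed

lemma integral_mT_reflect:
  fixes f :: "real \<Rightarrow> 'b::{banach, second_countable_topology}"
  assumes "f \<in> borel_measurable borel"
  shows "(LINT T|mT \<gamma>. f (- T)) = (LINT T|mT \<gamma>. f T)"
proof -
  have "(LINT T|mT \<gamma>. f T) = (LINT T|distr (mT \<gamma>) borel uminus. f T)" by (simp only: distr_mT_uminus)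
  also have "... = (LINT T|mT \<gamma>. f (- T))" by (rule integral_distr) (use assms in auto)
  finally show ?thesis by simp
qed

lemma Fubini_bounded:
  fixes E :: "'a \<Rightarrow> 'b \<Rightarrow> 'c::{banach, second_countable_topology}"
  assumes "finite_measure M" "finite_measure N" and m: "case_prod E \<in> borel_measurable (M \<Otimes>\<^sub>M N)"
    and B: "\<And>x y. norm (E x y) \<le> B"
  shows "(LINT y|N. LINT x|M. E x y) = (LINT x|M. LINT y|N. E x y)"
    "integrable M (\<lambda>x. LINT y|N. E x y)" "integrable N (\<lambda>y. LINT x|M. E x y)"
proof -
  interpret M: finite_measure M by fact
  interpret N: finite_measure N by fact
  interpret P: pair_sigma_finite M N ..
  interpret F: finite_measure "M \<Otimes>\<^sub>M N" by (rule finite_measure_pair_measure) unfold_locales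
  have i: "integrable (M \<Otimes>\<^sub>M N) (case_prod E)"
    by (rule F.integrable_const_bound[where B=B]) (use B m in auto)
  show "(LINT y|N. LINT x|M. E x y) = (LINT x|M. LINT y|N. E x y)" by (rule P.Fubini_integral[OF i])
  show "integrable M (\<lambda>x. LINT y|N. E x y)" using P.integrable_fst[OF i] by simp
  show "integrable N (\<lambda>y. LINT x|M. E x y)" using P.integrable_snd[OF i] by simp
qed

text \<open>Cauchy-Schwarz against the unit vector \<open>(cos \<delta>, sin \<delta>)\<close>, with
  the deficit written out as a square.\<close>

lemma abs_chord_le_1:
  assumes "\<bar>t\<bar> \<le> 1" shows "\<bar>sin al * cos \<delta> + cos al * t * sin \<delta>\<bar> \<le> (1::real)"
proof -
  have "(sin al * cos \<delta> + (cos al * t) * sin \<delta>)^2 \<le> ((sin al)^2 + (cos al * t)^2) * ((cos \<delta>)^2 + (sin \<delta>)^2)"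
  proof -
    have "(sin al * cos \<delta> + (cos al * t) * sin \<delta>)^2 = ((sin al)^2 + (cos al * t)^2) * ((cos \<delta>)^2 + (sin \<delta>)^2) - (sin al * sin \<delta> - cos al * t * cos \<delta>)^2"
      by algebra
    then show ?thesis by simp
  qed
  also have "... = (sin al)^2 + (cos al)^2 * t^2" by (simp add: power_mult_distrib)
  also have "... \<le> (sin al)^2 + (cos al)^2 * 1"
    using assms by (intro add_left_mono mult_left_mono) (auto simp: abs_square_le_1)
  also have "... = 1" by simp
  finally show ?thesis by (simp add: abs_square_le_1)
qed

section \<open>The averaging operator on polynomials and its eigenvalues\<close>

context disk_weight
begin

definition nu :: "nat \<Rightarrow> real" where "nu i = (LINT T|mT \<gamma>. (tanh T) ^ i)"

lemma abs_tanh_le_1: "\<bar>tanh (T::real)\<bar> \<le> 1"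
  using tanh_real_bounds[of T] by auto

lemma integrable_mT_bounded:
  fixes f :: "real \<Rightarrow> 'b::{banach, second_countable_topology}"
  assumes "f \<in> borel_measurable borel" "\<And>T. norm (f T) \<le> B"
  shows "integrable (mT \<gamma>) f"
  by (rule T.integrable_const_bound[where B=B]) (use assms in auto)

lemma integrable_tanh_power: "integrable (mT \<gamma>) (\<lambda>T. (tanh T) ^ i)"
  by (rule integrable_mT_bounded[where B=1]) (auto simp: power_abs power_le_one abs_tanh_le_1)

lemma nu_odd: assumes "odd i" shows "nu i = 0"
proof -
  have "nu i = (LINT T|mT \<gamma>. (tanh (- T)) ^ i)"
    unfolding nu_def by (rule integral_mT_reflect[symmetric]) measurable
  also have "... = - nu i" unfolding nu_def using assms by simp
  finally show ?thesis by simp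
qed

text \<open>The eigenvalue of \<open>Td \<delta>\<close> in degree \<open>m\<close>. For leading
  coefficients in \<open>y = sin al\<close> the factor \<open>cos al = sqrt (1 - y^2)\<close>
  behaves like \<open>\<i> * y\<close>, which explains the imaginary unit.\<close>

definition Lam :: "nat \<Rightarrow> real \<Rightarrow> complex" where
  "Lam m \<delta> = (LINT T|mT \<gamma>. (complex_of_real (cos \<delta>) + \<i> * complex_of_real (tanh T * sin \<delta>)) ^ m)"

text \<open>The average of the wave with profile \<open>q\<close> along a chord whose direction
  differs by \<open>\<delta>\<close> (compare \<open>yc_zc\<close>).\<close>

definition Td :: "real \<Rightarrow> real poly \<Rightarrow> real \<Rightarrow> real" where
  "Td \<delta> q al = (LINT T|mT \<gamma>. poly q (sin al * cos \<delta> + cos al * tanh T * sin \<delta>))"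

lemma integrable_Td: "integrable (mT \<gamma>) (\<lambda>T. poly q (sin al * cos \<delta> + cos al * tanh T * sin \<delta>))"
proof -
  obtain B where B: "B \<ge> 0" "\<And>y. \<bar>y\<bar> \<le> 1 \<Longrightarrow> \<bar>poly q y\<bar> \<le> B" using poly_bounded[of q] by blast
  show ?thesis
    by (rule integrable_mT_bounded[where B=B]) (auto intro!: B(2) abs_chord_le_1 abs_tanh_le_1)
qed

lemma Lam_sum: "Lam m \<delta> = (\<Sum>i\<le>m. complex_of_real (of_nat (m choose i) * (sin \<delta>)^i * (cos \<delta>)^(m-i) * nu i) * \<i>^i)"
proof -
  have "Lam m \<delta> = (LINT T|mT \<gamma>. (\<Sum>i\<le>m. (complex_of_real (of_nat (m choose i) * (sin \<delta>)^i * (cos \<delta>)^(m-i)) * \<i>^i) * complex_of_real ((tanh T)^i)))"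
    unfolding Lam_def
  proof (rule Bochner_Integration.integral_cong[OF refl])
    fix T :: real
    show "(complex_of_real (cos \<delta>) + \<i> * complex_of_real (tanh T * sin \<delta>)) ^ m =
      (\<Sum>i\<le>m. (complex_of_real (of_nat (m choose i) * (sin \<delta>)^i * (cos \<delta>)^(m-i)) * \<i>^i) * complex_of_real ((tanh T)^i))"
      by (subst add.commute, subst binomial_ring) (intro sum.cong refl, simp add: power_mult_distrib mult_ac)
  qed
  also have "... = (\<Sum>i\<le>m. (complex_of_real (of_nat (m choose i) * (sin \<delta>)^i * (cos \<delta>)^(m-i)) * \<i>^i) * complex_of_real (nu i))"
    unfolding nu_def
    by (subst Bochner_Integration.integral_sum)
       (auto simp del: of_real_power of_real_mult intro!: integrable_mult_right integrable_of_real integrable_tanh_power)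
  finally show ?thesis by (simp add: mult_ac)
qed

text \<open>Odd moments of \<open>tanh\<close> vanish, so only even powers of \<open>cos al\<close>
  survive and these are polynomials in \<open>sin al\<close>. The leading coefficient of
  \<open>(1 - y^2)^(i div 2)\<close> is \<open>\<i>^i\<close>, which reproduces the binomial sum of
  \<open>Lam\<close>.\<close>

lemma Td_monom:
  "\<exists>r. degree r \<le> j \<and> (\<forall>al. (LINT T|mT \<gamma>. (sin al * cos \<delta> + cos al * tanh T * sin \<delta>)^j) = poly r (sin al)) \<and>
       complex_of_real (coeff r j) = Lam j \<delta>"
proof -
  define e where "e i = ([:0, 1::real:] ^ (j - i) * [:1, 0, -1:] ^ (i div 2))" for i
  define k where "k i = of_nat (j choose i) * (sin \<delta>)^i * (cos \<delta>)^(j-i) * nu i" for i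
  define r where "r = (\<Sum>i\<le>j. smult (k i) (e i))"
  have de: "degree (e i) = j \<and> coeff (e i) j = (-1)^(i div 2)" if "i \<le> j" "even i" for i
  proof -
    have d: "degree (e i) = j" unfolding e_def using that by (auto simp: degree_mult_eq degree_power_eq elim!: evenE)
    have "lead_coeff (e i) = (-1)^(i div 2)" unfolding e_def by (simp only: lead_coeff_mult lead_coeff_power) simp
    then show ?thesis using d by simp
  qed
  have "degree r \<le> j" unfolding r_def
  proof (rule degree_sum_le)
    fix i assume "i \<in> {..j}"
    then show "degree (smult (k i) (e i)) \<le> j" using de[of i] nu_odd[of i] by (cases "even i") (auto simp: k_def)
  qed simp
  moreover have "(LINT T|mT \<gamma>. (sin al * cos \<delta> + cos al * tanh T * sin \<delta>)^j) = poly r (sin al)" for al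
  proof -
    have "(LINT T|mT \<gamma>. (sin al * cos \<delta> + cos al * tanh T * sin \<delta>)^j)
      = (LINT T|mT \<gamma>. (\<Sum>i\<le>j. (of_nat (j choose i) * (sin \<delta>)^i * (cos \<delta>)^(j-i) * (cos al)^i * (sin al)^(j-i)) * (tanh T)^i))"
      by (rule Bochner_Integration.integral_cong[OF refl], subst add.commute, subst binomial_ring)
        (intro sum.cong refl, simp add: power_mult_distrib mult_ac)
    also have "... = (\<Sum>i\<le>j. (of_nat (j choose i) * (sin \<delta>)^i * (cos \<delta>)^(j-i) * (cos al)^i * (sin al)^(j-i)) * nu i)"
      unfolding nu_def using integrable_tanh_power by (subst Bochner_Integration.integral_sum) auto
    also have "... = poly r (sin al)"
      unfolding r_def poly_sum
    proof (intro sum.cong refl)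
      fix i assume "i \<in> {..j}"
      show "(of_nat (j choose i) * (sin \<delta>)^i * (cos \<delta>)^(j-i) * (cos al)^i * (sin al)^(j-i)) * nu i = poly (smult (k i) (e i)) (sin al)"
      proof (cases "even i")
        case True
        then have "(cos al)^i = ((cos al)^2)^(i div 2)" by (simp add: power_mult[symmetric])
        also have "... = (1 - (sin al)^2)^(i div 2)" by (simp add: cos_squared_eq)
        finally show ?thesis by (simp add: k_def e_def power2_eq_square mult_ac)
      qed (simp add: nu_odd k_def)
    qed
    finally show ?thesis .
  qed
  moreover have "complex_of_real (coeff r j) = Lam j \<delta>"
  proof -
    have "complex_of_real (coeff r j) = (\<Sum>i\<le>j. complex_of_real (k i * coeff (e i) j))"
      unfolding r_def by (simp add: coeff_sum)
    also have "... = (\<Sum>i\<le>j. complex_of_real (k i) * \<i>^i)"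
    proof (intro sum.cong refl)
      fix i assume i: "i \<in> {..j}"
      show "complex_of_real (k i * coeff (e i) j) = complex_of_real (k i) * \<i>^i"
      proof (cases "even i")
        case True
        then have "\<i>^i = (\<i>^2)^(i div 2)" by (simp only: power_mult[symmetric]) simp
        then show ?thesis using de[of i] i True by simp
      qed (simp add: nu_odd k_def)
    qed
    finally show ?thesis unfolding Lam_sum k_def .
  qed
  ultimately show ?thesis by blast
qed

lemma Td_poly:
  assumes "degree q \<le> n"
  shows "\<exists>r. degree r \<le> n \<and> (\<forall>al. Td \<delta> q al = poly r (sin al)) \<and> complex_of_real (coeff r n) = complex_of_real (coeff q n) * Lam n \<delta>"
proof -
  obtain R where R: "\<And>j. degree (R j) \<le> j"
    "\<And>j al. (LINT T|mT \<gamma>. (sin al * cos \<delta> + cos al * tanh T * sin \<delta>)^j) = poly (R j) (sin al)"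
    "\<And>j. complex_of_real (coeff (R j) j) = Lam j \<delta>"
    using Td_monom[of _ \<delta>] by metis
  define r where "r = (\<Sum>j\<le>n. smult (coeff q j) (R j))"
  have "degree r \<le> n" unfolding r_def
    by (rule degree_sum_le) (auto intro: order_trans[OF degree_smult_le] order_trans[OF R(1)])
  moreover have "Td \<delta> q al = poly r (sin al)" for al
  proof -
    have pq: "poly q y = (\<Sum>j\<le>n. coeff q j * y^j)" for y
      unfolding poly_altdef by (rule sum.mono_neutral_left) (use assms in \<open>auto simp: coeff_eq_0\<close>)
    have "Td \<delta> q al = (\<Sum>j\<le>n. coeff q j * (LINT T|mT \<gamma>. (sin al * cos \<delta> + cos al * tanh T * sin \<delta>)^j))"
      unfolding Td_def pq using integrable_Td[of "[:0,1:]^j" al \<delta> for j]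
      by (subst Bochner_Integration.integral_sum) auto
    also have "... = poly r (sin al)" unfolding R(2) r_def by (simp add: poly_sum)
    finally show ?thesis .
  qed
  moreover have "coeff r n = coeff q n * coeff (R n) n"
  proof -
    have "coeff r n = (\<Sum>j\<le>n. coeff q j * coeff (R j) n)" unfolding r_def by (simp add: coeff_sum)
    also have "... = (\<Sum>j\<in>{n}. coeff q j * coeff (R j) n)"
      using R(1) by (intro sum.mono_neutral_right) (auto intro!: coeff_eq_0 le_less_trans[OF R(1)])
    finally show ?thesis by simp
  qed
  ultimately show ?thesis using R(3) by (intro exI[of _ r]) auto
qed

lemma Td_reflect: "Td (- \<delta>) q al = Td \<delta> q al"
proof -
  have "Td (- \<delta>) q al = (LINT T|mT \<gamma>. poly q (sin al * cos \<delta> + cos al * tanh (- T) * sin \<delta>))"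
    unfolding Td_def by simp
  also have "... = Td \<delta> q al" unfolding Td_def
    by (rule integral_mT_reflect[of "\<lambda>T. poly q (sin al * cos \<delta> + cos al * tanh T * sin \<delta>)"]) measurable
  finally show ?thesis .
qed

text \<open>Both sides are the integral over the disk of a product of two plane waves, computed in
  the chord coordinates of one direction or of the other. Exchanging the directions flips the sign
  of \<open>\<delta>\<close>, which \<open>Td_reflect\<close> undoes.\<close>

lemma Td_selfadjoint:
  "(LINT al|mA \<gamma>. poly q (sin al) * Td \<delta> r al) = (LINT al|mA \<gamma>. poly r (sin al) * Td \<delta> q al)"
proof -
  have *: "(LINT z|mW \<gamma>. poly q (yc om z) * poly r (yc om' z)) = (LINT al|mA \<gamma>. poly q (sin al) * Td (om - om') r al)" for q r om om'
  proof -
    obtain B1 where B1: "B1 \<ge> 0" "\<And>y. \<bar>y\<bar> \<le> 1 \<Longrightarrow> \<bar>poly q y\<bar> \<le> B1" using poly_bounded[of q] by blast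
    obtain B2 where B2: "B2 \<ge> 0" "\<And>y. \<bar>y\<bar> \<le> 1 \<Longrightarrow> \<bar>poly r y\<bar> \<le> B2" using poly_bounded[of r] by blast
    have "(LINT z|mW \<gamma>. poly q (yc om z) * poly r (yc om' z)) = (LINT al|mA \<gamma>. LINT T|mT \<gamma>. poly q (yc om (zc om al T)) * poly r (yc om' (zc om al T)))"
      by (rule integral_mW[OF gam, where B="B1 * B2"])
        (auto simp: abs_mult intro!: mult_mono B1 B2 abs_yc_le_1)
    also have "... = (LINT al|mA \<gamma>. poly q (sin al) * Td (om - om') r al)"
    proof (rule integral_mA_cong)
      fix al assume a: "al \<in> Iang"
      show "(LINT T|mT \<gamma>. poly q (yc om (zc om al T)) * poly r (yc om' (zc om al T))) = poly q (sin al) * Td (om - om') r al"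
        unfolding Td_def using cos_Iang[OF a] by (simp add: yc_zc)
    qed (unfold Td_def, measurable)
    finally show ?thesis .
  qed
  have "(LINT al|mA \<gamma>. poly q (sin al) * Td \<delta> r al) = (LINT z|mW \<gamma>. poly q (yc \<delta> z) * poly r (yc 0 z))"
    using *[of q \<delta> r 0] by simp
  also have "... = (LINT z|mW \<gamma>. poly r (yc 0 z) * poly q (yc \<delta> z))" by (simp add: mult.commute)
  also have "... = (LINT al|mA \<gamma>. poly r (sin al) * Td \<delta> q al)"
    unfolding * by (simp add: Td_reflect)
  finally show ?thesis .
qed

text \<open>A symmetric operator that preserves the degree filtration is diagonal in the orthogonal
  polynomials. Concretely, after removing the leading term the remainder \<open>r\<close> has degree
  below \<open>m\<close>; moving \<open>Td\<close> across shows that \<open>r\<close> is orthogonal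
  to itself.\<close>

lemma Td_pg: "complex_of_real (Td \<delta> (pg m) al) = Lam m \<delta> * complex_of_real (poly (pg m) (sin al))"
proof -
  obtain q where q: "degree q \<le> m" "\<And>al. Td \<delta> (pg m) al = poly q (sin al)"
     "complex_of_real (coeff q m) = complex_of_real (coeff (pg m) m) * Lam m \<delta>"
    using Td_poly[of "pg m" m \<delta>] degree_pg by auto
  define l where "l = coeff q m / coeff (pg m) m"
  have L: "Lam m \<delta> = complex_of_real l"
    unfolding l_def of_real_divide q(3) using coeff_pg_pos[of m] by simp
  define r where "r = q - smult l (pg m)"
  have "r = 0"
  proof (rule ccontr)
    assume "r \<noteq> 0"
    have "degree r \<le> m" unfolding r_def using q(1) degree_pg by (intro degree_diff_le order_trans[OF degree_smult_le]) auto
    moreover have "coeff r m = 0" unfolding r_def l_def using coeff_pg_pos[of m] by simp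
    ultimately have dr: "degree r < m" using \<open>r \<noteq> 0\<close> by (metis leading_coeff_0_iff order_le_imp_less_or_eq)
    obtain r' where r': "degree r' \<le> degree r" "\<And>al. Td \<delta> r al = poly r' (sin al)"
      using Td_poly[of r "degree r" \<delta>] by auto
    have "(LINT al|mA \<gamma>. (poly r (sin al))^2) = (LINT al|mA \<gamma>. poly r (sin al) * Td \<delta> (pg m) al - l * (poly (pg m) (sin al) * poly r (sin al)))"
      unfolding q(2) r_def by (intro Bochner_Integration.integral_cong refl) (simp add: power2_eq_square algebra_simps)
    also have "... = (LINT al|mA \<gamma>. poly r (sin al) * Td \<delta> (pg m) al) - l * (LINT al|mA \<gamma>. poly (pg m) (sin al) * poly r (sin al))"
      unfolding q(2) using integrable_poly_sin[of "r * q"] integrable_poly_sin[of "pg m * r"]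
      by (subst Bochner_Integration.integral_diff) auto
    also have "... = 0"
      unfolding Td_selfadjoint[of r \<delta> "pg m"] r'(2) using pg_orth[of r m] pg_orth[of r' m] dr r'(1) by simp
    finally show False using poly_L2_zero \<open>r \<noteq> 0\<close> by blast
  qed
  then have "q = smult l (pg m)" unfolding r_def by simp
  then show ?thesis unfolding q(2) L by simp
qed

definition lamk :: "nat \<Rightarrow> nat \<Rightarrow> real" where
  "lamk m k = of_nat (m choose k) * (2 powr (2*\<gamma>+1) * Beta (real (m - k) + 1 + \<gamma>) (real k + 1 + \<gamma>))"

text \<open>\<open>cos \<delta> + \<i> * tanh T * sin \<delta>\<close> is the convex combination of
  \<open>cis \<delta>\<close> and \<open>cis (- \<delta>)\<close> with weights \<open>lgst T\<close>
  and \<open>1 - lgst T\<close>. Its binomial expansion integrates to Beta values, so all Fourier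
  coefficients are positive.\<close>

lemma Lam_trig: "Lam m \<delta> = (\<Sum>k\<le>m. complex_of_real (lamk m k) * cis ((real m - 2 * real k) * \<delta>))"
proof -
  have "Lam m \<delta> = (LINT T|mT \<gamma>. (\<Sum>k\<le>m. (of_nat (m choose k) * cis ((real m - 2 * real k) * \<delta>)) * complex_of_real (lgst T ^ (m - k) * (1 - lgst T) ^ k)))"
    unfolding Lam_def
  proof (rule Bochner_Integration.integral_cong[OF refl])
    fix T :: real
    have "complex_of_real (cos \<delta>) + \<i> * complex_of_real (tanh T * sin \<delta>) = (1 - lgst T) * cis (-\<delta>) + lgst T * cis \<delta>"
      by (simp add: complex_eq_iff lgst_tanh algebra_simps)
    then have "(complex_of_real (cos \<delta>) + \<i> * complex_of_real (tanh T * sin \<delta>)) ^ m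
       = (\<Sum>k\<le>m. of_nat (m choose k) * ((1 - lgst T) * cis (-\<delta>)) ^ k * (lgst T * cis \<delta>) ^ (m - k))"
      by (simp only: binomial_ring)
    also have "... = (\<Sum>k\<le>m. (of_nat (m choose k) * cis ((real m - 2 * real k) * \<delta>)) * complex_of_real (lgst T ^ (m - k) * (1 - lgst T) ^ k))"
    proof (intro sum.cong refl)
      fix k assume "k \<in> {..m}"
      then have "cis (-\<delta>) ^ k * cis \<delta> ^ (m - k) = cis ((real m - 2 * real k) * \<delta>)"
        unfolding Complex.DeMoivre cis_mult by (intro arg_cong[where f=cis]) (simp add: of_nat_diff algebra_simps)
      moreover have "of_nat (m choose k) * ((1 - lgst T) * cis (-\<delta>)) ^ k * (lgst T * cis \<delta>) ^ (m - k)
        = of_nat (m choose k) * (cis (-\<delta>) ^ k * cis \<delta> ^ (m - k)) * complex_of_real (lgst T ^ (m - k) * (1 - lgst T) ^ k)"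
        by (simp add: power_mult_distrib mult_ac)
      ultimately show "of_nat (m choose k) * ((1 - lgst T) * cis (-\<delta>)) ^ k * (lgst T * cis \<delta>) ^ (m - k)
        = (of_nat (m choose k) * cis ((real m - 2 * real k) * \<delta>)) * complex_of_real (lgst T ^ (m - k) * (1 - lgst T) ^ k)"
        by simp
    qed
    finally show "(complex_of_real (cos \<delta>) + \<i> * complex_of_real (tanh T * sin \<delta>)) ^ m = ..." .
  qed
  also have "... = (\<Sum>k\<le>m. (of_nat (m choose k) * cis ((real m - 2 * real k) * \<delta>)) * complex_of_real (LINT T|mT \<gamma>. lgst T ^ (m - k) * (1 - lgst T) ^ k))"
    using sech_moment_integral(1)[OF gam]
    by (subst Bochner_Integration.integral_sum) (auto intro!: integrable_mult_right simp del: of_real_mult)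
  finally show ?thesis unfolding sech_moment_integral(2)[OF gam] lamk_def
    by (simp add: mult_ac)
qed

text \<open>The factor \<open>2 * pi\<close> is the length of the circle of directions over which
  \<open>Zk\<close> superposes waves; the binomial coefficient in \<open>lamk\<close> accounts for
  the factor \<open>m + 1\<close> and the second Beta value in \<open>sigma2\<close>.\<close>

lemma lamk_sigma2: assumes "k \<le> m" shows "2 * pi * lamk m k = sigma2 \<gamma> m k"
proof -
  have mk: "real (m - k) = real m - real k" using assms by (simp add: of_nat_diff)
  have B: "Beta (real m - real k + 1) (real k + 1) = fact (m - k) * fact k / fact (m + 1)"
  proof -
    have "Gamma (real m - real k + 1) = fact (m - k)" using Gamma_fact[of "m - k", where 'a=real] mk by (simp add: add.commute)
    moreover have "Gamma (real k + 1) = fact k" using Gamma_fact[of k, where 'a=real] by (simp add: add.commute)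
    moreover have "Gamma (real m - real k + 1 + (real k + 1)) = fact (m + 1)"
      using Gamma_fact[of "m+1", where 'a=real] by (simp add: add_ac)
    ultimately show ?thesis unfolding Beta_def by simp
  qed
  have C: "of_nat (m choose k) = (fact m / (fact k * fact (m - k)) :: real)" using assms by (rule binomial_fact)
  have p: "2 powr (2*\<gamma>+2) = 2 powr (2*\<gamma>+1) * (2::real)"
    using powr_add[of 2 "2*\<gamma>+1" 1] by (simp add: algebra_simps)
  have f: "fact (m + 1) = (real m + 1) * fact m" by simp
  show ?thesis unfolding lamk_def sigma2_def B C mk p f by (simp add: mult_ac)
qed

end

section \<open>Zernike functions\<close>

lemma integral_mO:
  fixes f :: "real \<Rightarrow> 'b::euclidean_space"
  assumes "continuous_on {0..2*pi} f" and that: "f \<in> borel_measurable borel"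
  shows "(LINT om|mO. f om) = integral {0..2*pi} f"
proof -
  have "(LINT om|mO. f om) = (LINT om:{0..2*pi}|lborel. f om)"
    unfolding mO_def set_lebesgue_integral_def using that by (subst integral_density) auto
  also have "... = integral {0..2*pi} f"
    by (rule set_borel_integral_eq_integral(2)[OF borel_integrable_atLeastAtMost'[OF assms(1)]])
  finally show ?thesis .
qed

lemma continuous_on_cis_mult [continuous_intros]: "continuous_on S (\<lambda>om. cis (c * om))"
  by (intro continuous_intros)

lemma integral_mO_cis:
  fixes n :: int
  shows "(LINT om|mO. cis (of_int n * om)) = (if n = 0 then 2*pi else 0)"
proof (cases "n = 0")
  case True
  have "(LINT om|mO. (1::complex)) = integral {0..2*pi} (\<lambda>_. 1)"
    by (rule integral_mO) auto
  then show ?thesis using True by (simp add: scaleR_conv_of_real)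
next
  case False
  let ?F = "\<lambda>om. cis (of_int n * om) / (\<i> * of_int n)"
  have "((\<lambda>om. cis (of_int n * om)) has_integral (?F (2*pi) - ?F 0)) {0..2*pi}"
  proof (rule fundamental_theorem_of_calculus)
    fix x :: real
    have "((\<lambda>om. cis (of_int n * om)) has_vector_derivative of_int n *\<^sub>R (\<i> * cis (of_int n * x))) (at x within {0..2*pi})"
      unfolding has_vector_derivative_def
      by (rule has_derivative_eq_rhs[OF has_derivative_cis[OF has_derivative_mult_right[OF has_derivative_ident]]]) (auto simp: fun_eq_iff)
    then have "(?F has_vector_derivative (of_int n *\<^sub>R (\<i> * cis (of_int n * x))) / (\<i> * of_int n)) (at x within {0..2*pi})"
      by (rule has_vector_derivative_divide)
    then show "(?F has_vector_derivative cis (of_int n * x)) (at x within {0..2*pi})"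
      using False by (simp add: scaleR_conv_of_real)
  qed auto
  moreover have "?F (2*pi) - ?F 0 = 0"
    using cis_multiple_2pi[of "of_int n"] by (simp add: mult_ac)
  ultimately have "integral {0..2*pi} (\<lambda>om. cis (of_int n * om)) = 0" by (simp add: integral_unique)
  then show ?thesis using False by (subst integral_mO) (auto intro!: continuous_intros)
qed

lemma integral_mO_cis_ortho:
  assumes "k \<le> m" "k' \<le> m"
  shows "(LINT om|mO. cis ((real m - 2 * real k) * om) * cis (- ((real m - 2 * real k') * om))) = (if k = k' then 2*pi else 0)"
proof -
  have "(\<lambda>om. cis ((real m - 2 * real k) * om) * cis (- ((real m - 2 * real k') * om))) = (\<lambda>om. cis (of_int (2 * (int k' - int k)) * om))"
    by (auto simp: cis_mult fun_eq_iff algebra_simps)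
  then show ?thesis using integral_mO_cis[of "2 * (int k' - int k)"] by simp
qed

lemma integral_mO_periodic_shift_real:
  fixes F :: "real \<Rightarrow> real"
  assumes [measurable]: "F \<in> borel_measurable borel" and per: "\<And>x. F (x + 2*pi) = F x" and c: "0 \<le> c" "c \<le> 2*pi"
    and B: "\<And>x. \<bar>F x\<bar> \<le> B"
  shows "(LINT x|mO. F (x + c)) = (LINT x|mO. F x)"
proof -
  interpret O: finite_measure mO by (rule finite_measure_mO)
  have i: "integrable mO (\<lambda>x. F (x + c))" "integrable mO F"
    by (rule O.integrable_const_bound[where B=B]; use B in auto)+
  have nn: "0 \<le> F x + B" for x using B[of x] by linarith
  \<comment> \<open>Adding the bound makes the integrand nonnegative, so the
    \<open>nn_integral\<close> version applies.\<close>
  have "(LINT x|mO. F (x + c) + B) = (LINT x|mO. F x + B)"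
    using nn nn_integral_periodic_shift[of "\<lambda>x. ennreal (F x + B)" c] per c
    by (simp add: integral_eq_nn_integral)
  then show ?thesis using i by simp
qed

lemma integral_mO_periodic_shift:
  fixes F :: "real \<Rightarrow> complex"
  assumes [measurable]: "F \<in> borel_measurable borel" and per: "\<And>x. F (x + 2*pi) = F x" and c: "0 \<le> c" "c \<le> 2*pi"
    and B: "\<And>x. cmod (F x) \<le> B"
  shows "(LINT x|mO. F (x + c)) = (LINT x|mO. F x)"
proof -
  interpret O: finite_measure mO by (rule finite_measure_mO)
  have i: "integrable mO (\<lambda>x. F (x + c))" "integrable mO F"
    by (rule O.integrable_const_bound[where B=B]; use B in auto)+
  have re: "(LINT x|mO. Re (F (x + c))) = (LINT x|mO. Re (F x))"
    by (rule integral_mO_periodic_shift_real[where B=B]) (auto simp: per c intro: order_trans[OF abs_Re_le_cmod B])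
  have im: "(LINT x|mO. Im (F (x + c))) = (LINT x|mO. Im (F x))"
    by (rule integral_mO_periodic_shift_real[where B=B]) (auto simp: per c intro: order_trans[OF abs_Im_le_cmod B])
  show ?thesis unfolding complex_eq_iff using re im integral_Re[OF i(1)] integral_Re[OF i(2)] integral_Im[OF i(1)] integral_Im[OF i(2)] by simp
qed

lemma cis_mult_2pi_int: "cis ((real m - 2 * real k) * (x + 2*pi)) = cis ((real m - 2 * real k) * x)"
proof -
  have "(real m - 2 * real k) * (x + 2*pi) = (real m - 2 * real k) * x + 2 * pi * of_int (int m - 2 * int k)"
    by (simp add: algebra_simps)
  then show ?thesis by (simp add: cis_mult[symmetric] cis_multiple_2pi)
qed

lemma yc_periodic: "yc (om + 2*pi) z = yc om z"
  unfolding yc_def by (simp add: cis_mult[symmetric])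

lemma continuous_on_yc: "continuous_on UNIV (\<lambda>p. yc (fst p) (snd p))"
  unfolding yc_def by (intro continuous_intros continuous_on_compose2[OF continuous_on_PhiK]) auto

text \<open>In the frame rotated by \<open>\<theta>\<close> the entry point is
  \<open>Complex (- d) (Im q)\<close>, where \<open>d\<close> is half the length of the chord.
  Dividing the direction by the inward normal \<open>- e\<close> gives
  \<open>Complex d (Im q)\<close>, whose parts are the cosine and sine of the entry angle.\<close>

lemma entry_chord:
  fixes p :: complex and \<theta> :: real
  assumes "cmod p < 1"
  defines "e \<equiv> entry_pt p \<theta>"
  shows "cmod e = 1" "Re (cis \<theta> / (- e)) > 0" "Im (cis \<theta> / (- e)) = - Im (cis \<theta> * cnj p)"
proof -
  define q where "q = p * cnj (cis \<theta>)"
  define b where "b = Re q"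
  define d where "d = sqrt (b^2 + 1 - (cmod p)^2)"
  have cq: "(cmod p)^2 = b^2 + (Im q)^2"
  proof -
    have "cmod q = cmod p" unfolding q_def by (simp add: norm_mult)
    then show ?thesis unfolding b_def by (metis cmod_power2)
  qed
  have "(cmod p)^2 < 1" using assms(1) by (simp add: power_less_one_iff abs_square_less_1)
  then have "(Im q)^2 < 1" using cq zero_le_power2[of b] by linarith
  moreover have "b^2 + 1 - (cmod p)^2 = 1 - (Im q)^2" using cq by linarith
  ultimately have d2: "d^2 = 1 - (Im q)^2" and dpos: "d > 0" unfolding d_def by auto
  have e: "e = cis \<theta> * Complex (- d) (Im q)"
  proof -
    have "p = cis \<theta> * q" unfolding q_def by (simp add: cis_cnj cis_mult mult.left_commute[of "cis \<theta>"])
    moreover have "e = p - complex_of_real (b + d) * cis \<theta>"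
      unfolding e_def entry_pt_def Let_def b_def d_def q_def by simp
    moreover have "Complex (- d) (Im q) = q - complex_of_real (b + d)" unfolding b_def by (simp add: complex_eq_iff)
    moreover have "cis \<theta> * q - complex_of_real (b + d) * cis \<theta> = cis \<theta> * (q - complex_of_real (b + d))"
      by (simp only: right_diff_distrib mult.commute)
    ultimately show ?thesis by metis
  qed
  have n1: "cmod (Complex (- d) (Im q)) = 1" using d2 by (simp add: cmod_def)
  then show "cmod e = 1" unfolding e by (simp add: norm_mult)
  define Y where "Y = - Complex (- d) (Im q)"
  have Y0: "Y \<noteq> 0" using n1 unfolding Y_def by (metis norm_minus_cancel norm_zero zero_neq_one)
  have "- e = cis \<theta> * Y" unfolding e Y_def by simp
  then have "cis \<theta> / (- e) = 1 / Y" by (simp add: nonzero_divide_mult_cancel_left)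
  also have "... = Complex d (Im q)"
  proof -
    have "Complex d (Im q) * Y = 1" unfolding Y_def using d2 by (simp add: complex_eq_iff power2_eq_square algebra_simps)
    then show ?thesis using Y0 by (simp add: divide_eq_eq)
  qed
  finally have r: "cis \<theta> / (- e) = Complex d (Im q)" .
  show "Re (cis \<theta> / (- e)) > 0" "Im (cis \<theta> / (- e)) = - Im (cis \<theta> * cnj p)"
    using dpos unfolding r by (simp_all add: q_def algebra_simps)
qed

context disk_weight
begin

definition Zk :: "nat \<Rightarrow> nat \<Rightarrow> complex \<Rightarrow> complex" where
  "Zk n k z = (LINT om|mO. cis ((real n - 2 * real k) * om) * complex_of_real (poly (pg n) (yc om z)))"

text \<open>The two powers of the cosine cancel, and the sine of the entry angle is the chord
  coordinate of direction \<open>\<theta> + 3*pi/2\<close>. The phase agrees with that angle only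
  modulo \<open>2*pi\<close>, which suffices because \<open>n - 2*k\<close> is an integer.\<close>

lemma ZernE_integrand:
  assumes "cmod z < 1"
  shows "complex_of_real ((cos (alpha_of (PhiK z) \<theta>)) powr (-2*\<gamma>-1)) * psiE \<gamma> n k (beta_of (PhiK z) \<theta>) (alpha_of (PhiK z) \<theta>)
    = cis ((real n - 2 * real k) * (\<theta> + 3*pi/2)) * complex_of_real (poly (pg n) (yc (\<theta> + 3*pi/2) z))"
proof -
  let ?p = "PhiK z"
  let ?a = "alpha_of ?p \<theta>" and ?b = "beta_of ?p \<theta>" and ?e = "entry_pt ?p \<theta>"
  note E = entry_chord[OF cmod_PhiK_less_1[OF assms], of \<theta>]
  have n: "cmod (cis \<theta> / (- ?e)) = 1" using E(1) by (simp add: norm_divide)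
  have nz: "?e \<noteq> 0" "cis \<theta> / (- ?e) \<noteq> 0" using E(1) n by auto
  have ca: "cis ?a = cis \<theta> / (- ?e)" unfolding alpha_of_def using nz(2) n by (simp add: cis_Arg sgn_div_norm)
  have cb: "cis ?b = ?e" unfolding beta_of_def using nz(1) E(1) by (simp add: cis_Arg sgn_div_norm)
  have cos: "cos ?a > 0" using E(2) arg_cong[OF ca, of Re] by simp
  have c3: "cis (3*pi/2) = - \<i>"
  proof -
    have "cis (3*pi/2) = cis (pi + pi/2)" by (simp add: field_simps)
    also have "... = cis pi * cis (pi/2)" by (rule cis_mult[symmetric])
    finally show ?thesis by simp
  qed
  have sin: "sin ?a = yc (\<theta> + 3*pi/2) z"
  proof -
    have "sin ?a = - Im (cis \<theta> * cnj ?p)" using E(3) arg_cong[OF ca, of Im] by simp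
    moreover have "cis (\<theta> + 3*pi/2) = cis \<theta> * (- \<i>)" by (simp add: cis_mult[symmetric] c3)
    ultimately show ?thesis unfolding yc_def by (simp add: algebra_simps)
  qed
  have "cis (?b + ?a + pi/2) = cis (\<theta> + 3*pi/2)"
  proof -
    have "cis (?b + ?a + pi/2) = cis ?b * cis ?a * \<i>" by (simp add: cis_mult[symmetric])
    also have "... = cis \<theta> * (- \<i>)" unfolding ca cb using nz by simp
    also have "... = cis (\<theta> + 3*pi/2)" by (simp add: cis_mult[symmetric] c3)
    finally show ?thesis .
  qed
  then have "sin (?b + ?a + pi/2) = sin (\<theta> + 3*pi/2) \<and> cos (?b + ?a + pi/2) = cos (\<theta> + 3*pi/2)"
    by (metis cis.sel)
  then have "\<exists>j::int. (?b + ?a + pi/2) = (\<theta> + 3*pi/2) + 2 * pi * of_int j"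
    unfolding sin_cos_eq_iff .
  then obtain j :: int where j: "(?b + ?a + pi/2) = (\<theta> + 3*pi/2) + 2 * pi * of_int j" by blast
  have ck: "cis ((real n - 2 * real k) * (?b + ?a + pi/2)) = cis ((real n - 2 * real k) * (\<theta> + 3*pi/2))"
  proof -
    have "(real n - 2 * real k) * (?b + ?a + pi/2) = (real n - 2 * real k) * (\<theta> + 3*pi/2) + 2 * pi * of_int ((int n - 2 * int k) * j)"
      unfolding j by (simp add: algebra_simps)
    then show ?thesis by (simp add: cis_mult[symmetric] cis_multiple_2pi)
  qed
  have pw: "(cos ?a) powr (-2*\<gamma>-1) * (cos ?a) powr (2*\<gamma>+1) = 1"
    using cos by (simp add: powr_add[symmetric])
  have "complex_of_real ((cos ?a) powr (-2*\<gamma>-1)) * psiE \<gamma> n k ?b ?a =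
     complex_of_real ((cos ?a) powr (-2*\<gamma>-1) * (cos ?a) powr (2*\<gamma>+1)) * (cis ((real n - 2 * real k) * (?b + ?a + pi/2)) * complex_of_real (p_gamma \<gamma> n (sin ?a)))"
    unfolding psiE_def by (simp only: of_real_mult mult_ac)
  then show ?thesis unfolding pw ck sin p_gamma_eq by simp
qed

lemma borel_measurable_wave [measurable (raw)]:
  assumes [measurable]: "f \<in> borel_measurable M" "g \<in> borel_measurable M"
  shows "(\<lambda>x. cis (c * f x) * complex_of_real (poly q (yc (f x) (g x)))) \<in> borel_measurable M"
  by measurable

lemma ZernE_eq:
  assumes "cmod z < 1"
  shows "ZernE \<gamma> n k (PhiK z) = Zk n k z"
proof -
  let ?F = "\<lambda>om. cis ((real n - 2 * real k) * om) * complex_of_real (poly (pg n) (yc om z))"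
  obtain B where B: "B \<ge> 0" "\<And>y. \<bar>y\<bar> \<le> 1 \<Longrightarrow> \<bar>poly (pg n) y\<bar> \<le> B" using poly_bounded[of "pg n"] by blast
  have Fc: "continuous_on S ?F" for S
    by (intro continuous_intros continuous_on_compose2[OF continuous_on_yc, of S "\<lambda>om. (om, z)", simplified])
  have Fm [measurable]: "?F \<in> borel_measurable borel" by measurable
  have "ZernE \<gamma> n k (PhiK z) = integral {0..2*pi} (\<lambda>\<theta>. ?F (\<theta> + 3*pi/2))"
    unfolding ZernE_def ZernE_integrand[OF assms] ..
  also have "... = (LINT \<theta>|mO. ?F (\<theta> + 3*pi/2))"
    by (rule integral_mO[symmetric]) (measurable, intro continuous_on_compose2[OF Fc] continuous_intros, auto)
  also have "... = (LINT om|mO. ?F om)"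
    by (rule integral_mO_periodic_shift[where B=B])
      (auto simp: cis_mult_2pi_int yc_periodic norm_mult intro!: B abs_yc_le_1)
  finally show ?thesis unfolding Zk_def .
qed

lemma pg_bound_ex: "\<exists>B\<ge>0. \<forall>y. \<bar>y\<bar> \<le> 1 \<longrightarrow> \<bar>poly (pg n) y\<bar> \<le> B"
  using poly_bounded[of "pg n"] by blast

lemma Zk_measurable [measurable]: "Zk n k \<in> borel_measurable borel"
  unfolding Zk_def[abs_def]
  by (rule sigma_finite_measure.borel_measurable_lebesgue_integral) (unfold_locales, measurable)

lemma wave_bound: "\<exists>B\<ge>0. \<forall>om z. cmod (cis (c * om) * complex_of_real (poly (pg n) (yc om z))) \<le> B"
  using pg_bound_ex[of n] abs_yc_le_1 by (auto simp: norm_mult)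

lemma Zk_bounded: "\<exists>B. \<forall>z. cmod (Zk n k z) \<le> B"
proof -
  obtain B where B: "B \<ge> 0" "\<And>om z. cmod (cis ((real n - 2 * real k) * om) * complex_of_real (poly (pg n) (yc om z))) \<le> B"
    using wave_bound by blast
  have "cmod (Zk n k z) \<le> B * measure mO UNIV" for z
  proof -
    have "cmod (Zk n k z) \<le> (LINT om|mO. B)"
      unfolding Zk_def by (rule Bochner_Integration.integral_norm_bound_integral) (auto intro!: O.integrable_const_bound[where B=B] B)
    then show ?thesis by (simp add: mult.commute)
  qed
  then show ?thesis by blast
qed

text \<open>The singular value relation. Averaging each wave along the chord first produces the
  eigenvalue \<open>Lam n (om - om')\<close>; integrating over \<open>om'\<close> against a
  character picks out one Fourier coefficient \<open>lamk n k\<close>.\<close>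

lemma UU_IHw_Zk:
  assumes a: "al \<in> Iang" and k: "k \<le> n"
  shows "UU \<gamma> (IHw \<gamma> (Zk n k)) om al = complex_of_real (sigma2 \<gamma> n k * poly (pg n) (sin al)) * cis ((real n - 2 * real k) * om)"
proof -
  let ?c = "real n - 2 * real k"
  obtain B where B: "B \<ge> 0" "\<And>om z. cmod (cis (?c * om) * complex_of_real (poly (pg n) (yc om z))) \<le> B"
    using wave_bound by blast
  have "UU \<gamma> (IHw \<gamma> (Zk n k)) om al = (LINT T|mT \<gamma>. LINT om'|mO. cis (?c * om') * complex_of_real (poly (pg n) (yc om' (zc om al T))))"
    by (subst UU_IHw[OF a]) (auto simp: Zk_def)
  also have "... = (LINT om'|mO. LINT T|mT \<gamma>. cis (?c * om') * complex_of_real (poly (pg n) (yc om' (zc om al T))))"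
    by (rule Fubini_bounded(1)[where B=B]) (unfold_locales, measurable, rule B)
  also have "... = (LINT om'|mO. cis (?c * om') * (Lam n (om - om') * complex_of_real (poly (pg n) (sin al))))"
  proof (rule Bochner_Integration.integral_cong[OF refl])
    fix om'
    have "(LINT T|mT \<gamma>. cis (?c * om') * complex_of_real (poly (pg n) (yc om' (zc om al T)))) = cis (?c * om') * complex_of_real (Td (om - om') (pg n) al)"
      unfolding Td_def using cos_Iang[OF a] by (simp add: yc_zc)
    then show "(LINT T|mT \<gamma>. cis (?c * om') * complex_of_real (poly (pg n) (yc om' (zc om al T)))) = cis (?c * om') * (Lam n (om - om') * complex_of_real (poly (pg n) (sin al)))"
      unfolding Td_pg .
  qed
  also have "... = (LINT om'|mO. (\<Sum>j\<le>n. (complex_of_real (lamk n j * poly (pg n) (sin al)) * cis ((real n - 2 * real j) * om)) * (cis (?c * om') * cis (- ((real n - 2 * real j) * om')))))"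
  proof (rule Bochner_Integration.integral_cong[OF refl])
    fix om'
    have "cis ((real n - 2 * real j) * (om - om')) = cis ((real n - 2 * real j) * om) * cis (- ((real n - 2 * real j) * om'))" for j
      by (simp add: cis_mult algebra_simps)
    then show "cis (?c * om') * (Lam n (om - om') * complex_of_real (poly (pg n) (sin al))) =
      (\<Sum>j\<le>n. (complex_of_real (lamk n j * poly (pg n) (sin al)) * cis ((real n - 2 * real j) * om)) * (cis (?c * om') * cis (- ((real n - 2 * real j) * om'))))"
      unfolding Lam_trig sum_distrib_left sum_distrib_right by (intro sum.cong refl) (simp add: mult_ac)
  qed
  also have "... = (\<Sum>j\<le>n. (complex_of_real (lamk n j * poly (pg n) (sin al)) * cis ((real n - 2 * real j) * om)) * (LINT om'|mO. cis (?c * om') * cis (- ((real n - 2 * real j) * om'))))"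
    by (subst Bochner_Integration.integral_sum)
       (auto intro!: integrable_mult_right O.integrable_const_bound[where B=1] simp: norm_mult simp del: of_real_mult)
  also have "... = (\<Sum>j\<le>n. (complex_of_real (lamk n j * poly (pg n) (sin al)) * cis ((real n - 2 * real j) * om)) * (if k = j then 2*pi else 0))"
    by (intro sum.cong refl) (simp add: integral_mO_cis_ortho[OF k])
  also have "... = complex_of_real (2 * pi * lamk n k * poly (pg n) (sin al)) * cis (?c * om)"
    by (subst sum.mono_neutral_right[of "{..n}" "{k}"]) (use k in \<open>auto simp: mult_ac\<close>)
  finally show ?thesis unfolding lamk_sigma2[OF k] .
qed

text \<open>The canonical candidate for the array \<open>M\<close> in \<open>moment_data\<close>,
  available before any moment condition is known; \<open>moment_data_unique\<close> shows that it is
  the only one.\<close>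

definition Mc :: "(real \<times> real \<Rightarrow> complex) \<Rightarrow> nat \<Rightarrow> nat \<Rightarrow> complex" where
  "Mc u n k = (LINT om|mO. cis (- ((real n - 2 * real k) * om)) * moment_int u (p_gamma \<gamma> n) om) / (2*pi)"

text \<open>Pairing with a superposition of waves is, by Fubini, a superposition of moments of the
  transform. So the Zernike coefficients of \<open>f\<close> can be read from its transform
  alone.\<close>

lemma inner_Zk:
  assumes [measurable]: "f \<in> borel_measurable borel" and B: "\<And>z. cmod (f z) \<le> B"
  shows "L2D_inner \<gamma> f (Zk n k) = 2 * pi * Mc (IHw \<gamma> f) n k"
proof -
  let ?c = "real n - 2 * real k"
  obtain Q where Q: "Q \<ge> 0" "\<And>y. \<bar>y\<bar> \<le> 1 \<Longrightarrow> \<bar>poly (pg n) y\<bar> \<le> Q" using pg_bound_ex by blast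
  have "L2D_inner \<gamma> f (Zk n k) = (LINT z|mW \<gamma>. LINT om|mO. f z * cnj (cis (?c * om) * complex_of_real (poly (pg n) (yc om z))))"
    by (subst L2D_inner_eq) (auto simp: Zk_def integral_cnj[symmetric] simp del: integral_cnj complex_cnj_mult)
  also have "... = (LINT om|mO. LINT z|mW \<gamma>. f z * cnj (cis (?c * om) * complex_of_real (poly (pg n) (yc om z))))"
  proof (rule Fubini_bounded(1)[where B="B * Q"])
    show "cmod (f z * cnj (cis (?c * om) * complex_of_real (poly (pg n) (yc om z)))) \<le> B * Q" for om z
      using mult_mono[OF B[of z] Q(2)[OF abs_yc_le_1[of om z]]] order_trans[OF norm_ge_zero B] by (simp add: norm_mult)
  qed (unfold_locales, measurable)
  also have "... = (LINT om|mO. cis (- (?c * om)) * moment_int (IHw \<gamma> f) (p_gamma \<gamma> n) om)"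
  proof (rule Bochner_Integration.integral_cong[OF refl])
    fix om
    have "moment_int (IHw \<gamma> f) (p_gamma \<gamma> n) om = (LINT z|mW \<gamma>. complex_of_real (poly (pg n) (yc om z)) * f z)"
      unfolding p_gamma_eq by (rule moment_int_IHw[OF gam _ B _ Q(2)]) auto
    then have "cis (- (?c * om)) * moment_int (IHw \<gamma> f) (p_gamma \<gamma> n) om = (LINT z|mW \<gamma>. cis (- (?c * om)) * (complex_of_real (poly (pg n) (yc om z)) * f z))"
      by simp
    also have "... = (LINT z|mW \<gamma>. f z * cnj (cis (?c * om) * complex_of_real (poly (pg n) (yc om z))))"
      by (intro Bochner_Integration.integral_cong) (auto simp: cis_cnj mult_ac)
    finally show "(LINT z|mW \<gamma>. f z * cnj (cis (?c * om) * complex_of_real (poly (pg n) (yc om z)))) = cis (- (?c * om)) * moment_int (IHw \<gamma> f) (p_gamma \<gamma> n) om" by simp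
  qed
  finally show ?thesis unfolding Mc_def by simp
qed

end

lemma L2D_inner_cong:
  assumes "\<And>z. z \<in> ball 0 1 \<Longrightarrow> f z = f' z" "\<And>z. z \<in> ball 0 1 \<Longrightarrow> g z = g' z"
  shows "L2D_inner \<gamma> f g = L2D_inner \<gamma> f' g'"
  unfolding L2D_inner_def by (rule set_lebesgue_integral_cong) (use assms in auto)

context disk_weight
begin

lemma moment_int_Zk:
  assumes k: "k \<le> m"
  shows "moment_int (IHw \<gamma> (Zk m k)) (p_gamma \<gamma> n) om = (if m = n then complex_of_real (sigma2 \<gamma> m k / (2*pi)) * cis ((real m - 2 * real k) * om) else 0)"
proof -
  have "moment_int (IHw \<gamma> (Zk m k)) (p_gamma \<gamma> n) om = (LINT al|mA \<gamma>. complex_of_real (poly (pg n) (sin al)) * UU \<gamma> (IHw \<gamma> (Zk m k)) om al)"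
    unfolding p_gamma_eq by (rule moment_int_eq) measurable
  also have "... = (LINT al|mA \<gamma>. (complex_of_real (sigma2 \<gamma> m k) * cis ((real m - 2 * real k) * om)) * complex_of_real (poly (pg n) (sin al) * poly (pg m) (sin al)))"
    by (rule integral_mA_cong) (auto simp: UU_IHw_Zk[OF _ k] mult_ac)
  also have "... = (complex_of_real (sigma2 \<gamma> m k) * cis ((real m - 2 * real k) * om)) * complex_of_real (if n = m then 1 / (2*pi) else 0)"
    unfolding pg_ortho[symmetric] by (simp only: integral_mult_right_zero integral_complex_of_real)
  finally show ?thesis by auto
qed

lemma Mc_Zk:
  assumes k: "k \<le> m" and k': "k' \<le> n"
  shows "Mc (IHw \<gamma> (Zk m k)) n k' = (if m = n \<and> k = k' then complex_of_real (sigma2 \<gamma> m k / (2*pi)) else 0)"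
proof (cases "m = n")
  case True
  have "(LINT om|mO. cis (- ((real n - 2 * real k') * om)) * moment_int (IHw \<gamma> (Zk m k)) (p_gamma \<gamma> n) om)
     = (LINT om|mO. complex_of_real (sigma2 \<gamma> m k / (2*pi)) * (cis ((real n - 2 * real k) * om) * cis (- ((real n - 2 * real k') * om))))"
    unfolding moment_int_Zk[OF k] using True by (simp add: mult_ac)
  also have "... = complex_of_real (sigma2 \<gamma> m k / (2*pi)) * (if k = k' then 2*pi else 0)"
    by (subst integral_mult_right_zero, subst integral_mO_cis_ortho) (use k k' True in auto)
  finally show ?thesis unfolding Mc_def using True by auto
qed (simp add: Mc_def moment_int_Zk[OF k])

lemma sigma2_pos: assumes "k \<le> m" shows "sigma2 \<gamma> m k > 0"
proof -
  have "Beta (real (m - k) + 1 + \<gamma>) (real k + 1 + \<gamma>) > 0"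
    unfolding Beta_def using gam by (intro divide_pos_pos mult_pos_pos Gamma_real_pos) auto
  then have "lamk m k > 0" unfolding lamk_def using assms by (simp add: zero_less_mult_iff)
  then show ?thesis unfolding lamk_sigma2[OF assms, symmetric] by simp
qed

text \<open>Orthogonality is inherited from the images, where characters and \<open>pg m\<close> are
  orthogonal. The squared norm is \<open>sigma2\<close>, whose root is the normalisation in
  \<open>coefH\<close>.\<close>

lemma inner_Zk_Zk:
  assumes k: "k \<le> m" and k': "k' \<le> n"
  shows "L2D_inner \<gamma> (Zk m k) (Zk n k') = (if m = n \<and> k = k' then sigma2 \<gamma> m k else 0)"
proof -
  obtain B where "\<And>z. cmod (Zk m k z) \<le> B" using Zk_bounded by blast
  then show ?thesis by (subst inner_Zk) (auto simp: Mc_Zk[OF k k'])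
qed

lemma coefH_eq:
  assumes f: "f \<in> borel_measurable borel" and B: "\<And>z. cmod (f z) \<le> B" and k: "k \<le> n"
  shows "coefH \<gamma> n k f = 2 * pi * Mc (IHw \<gamma> f) n k / complex_of_real (sqrt (sigma2 \<gamma> n k))"
proof -
  have "L2D_inner \<gamma> f (\<lambda>z. ZernE \<gamma> n k (PhiK z)) = L2D_inner \<gamma> f (Zk n k)"
    by (rule L2D_inner_cong) (auto simp: ZernE_eq)
  moreover have "L2D_inner \<gamma> (\<lambda>z. ZernE \<gamma> n k (PhiK z)) (\<lambda>z. ZernE \<gamma> n k (PhiK z)) = L2D_inner \<gamma> (Zk n k) (Zk n k)"
    by (rule L2D_inner_cong) (auto simp: ZernE_eq)
  ultimately show ?thesis unfolding coefH_def Let_def by (simp add: inner_Zk[OF f B] inner_Zk_Zk[OF k k])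
qed

end

section \<open>Trigonometric polynomials\<close>

definition trig :: "nat \<Rightarrow> (nat \<Rightarrow> complex) \<Rightarrow> real \<Rightarrow> complex" where
  "trig m M om = (\<Sum>k\<le>m. M k * cis ((real m - 2 * real k) * om))"

text \<open>Exactly the restrictions to the unit circle of homogeneous polynomials of degree
  \<open>m\<close> (\<open>hom_poly_TR\<close> and \<open>TR_hom_poly\<close>), in a form that
  exposes the Fourier coefficients.\<close>

definition TR :: "nat \<Rightarrow> (real \<Rightarrow> complex) set" where
  "TR m = {f. \<exists>M. \<forall>om. f om = trig m M om}"

lemma TR_I: "(\<And>om. f om = trig m M om) \<Longrightarrow> f \<in> TR m" unfolding TR_def by blast

lemma TR_add: assumes "f \<in> TR m" "g \<in> TR m" shows "(\<lambda>om. f om + g om) \<in> TR m"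
proof -
  obtain M N where "\<And>om. f om = trig m M om" "\<And>om. g om = trig m N om" using assms unfolding TR_def by blast
  then show ?thesis by (intro TR_I[of _ _ "\<lambda>k. M k + N k"]) (simp add: trig_def sum.distrib distrib_right)
qed

lemma TR_scale: assumes "f \<in> TR m" shows "(\<lambda>om. c * f om) \<in> TR m"
proof -
  obtain M where "\<And>om. f om = trig m M om" using assms unfolding TR_def by blast
  then show ?thesis by (intro TR_I[of _ _ "\<lambda>k. c * M k"]) (simp add: trig_def sum_distrib_left mult.assoc)
qed

lemma TR_zero: "(\<lambda>om. 0) \<in> TR m"
  by (rule TR_I[of _ _ "\<lambda>_. 0"]) (simp add: trig_def)

lemma TR_sum: assumes "\<And>i. i \<in> I \<Longrightarrow> f i \<in> TR m" shows "(\<lambda>om. \<Sum>i\<in>I. f i om) \<in> TR m"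
  using assms by (induction I rule: infinite_finite_induct) (auto intro: TR_zero TR_add)

lemma TR_cis: assumes "f \<in> TR m" shows "(\<lambda>om. cis om * f om) \<in> TR (Suc m)"
proof -
  obtain M where M: "\<And>om. f om = trig m M om" using assms unfolding TR_def by blast
  show ?thesis
  proof (rule TR_I[of _ _ "\<lambda>k. if k \<le> m then M k else 0"])
    fix om
    have "trig (Suc m) (\<lambda>k. if k \<le> m then M k else 0) om = (\<Sum>k\<le>m. M k * cis ((real (Suc m) - 2 * real k) * om))"
      unfolding trig_def by simp
    also have "... = cis om * f om" unfolding M trig_def sum_distrib_left
      by (intro sum.cong refl) (simp add: cis_mult mult.left_commute algebra_simps)
    finally show "cis om * f om = trig (Suc m) (\<lambda>k. if k \<le> m then M k else 0) om" by simp
  qed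
qed

lemma TR_cis_minus: assumes "f \<in> TR m" shows "(\<lambda>om. cis (- om) * f om) \<in> TR (Suc m)"
proof -
  obtain M where M: "\<And>om. f om = trig m M om" using assms unfolding TR_def by blast
  show ?thesis
  proof (rule TR_I[of _ _ "\<lambda>k. if k = 0 then 0 else M (k - 1)"])
    fix om
    have "trig (Suc m) (\<lambda>k. if k = 0 then 0 else M (k - 1)) om = (\<Sum>k\<le>m. M k * cis ((real (Suc m) - 2 * real (Suc k)) * om))"
      unfolding trig_def by (subst sum.atMost_Suc_shift) simp
    also have "... = cis (- om) * f om" unfolding M trig_def sum_distrib_left
      by (intro sum.cong refl) (simp add: cis_mult mult.left_commute algebra_simps)
    finally show "cis (- om) * f om = trig (Suc m) (\<lambda>k. if k = 0 then 0 else M (k - 1)) om" by simp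
  qed
qed

lemma TR_linear:
  assumes "f \<in> TR m" shows "(\<lambda>om. (a * cis om + b * cis (- om)) * f om) \<in> TR (Suc m)"
proof -
  have "(\<lambda>om. a * (cis om * f om) + b * (cis (- om) * f om)) \<in> TR (Suc m)"
    by (intro TR_add TR_scale TR_cis TR_cis_minus assms)
  then show ?thesis by (simp add: algebra_simps)
qed

text \<open>The counterpart of multiplying a homogeneous polynomial by \<open>X^2 + Y^2\<close>,
  which is 1 on the circle.\<close>

lemma TR_Suc_Suc: assumes "f \<in> TR m" shows "f \<in> TR (Suc (Suc m))"
proof -
  have "(\<lambda>om. cis (- om) * (cis om * f om)) \<in> TR (Suc (Suc m))" by (intro TR_cis TR_cis_minus assms)
  then show ?thesis by (simp add: cis_mult flip: mult.assoc)
qed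

lemma TR_one: "(\<lambda>om. 1) \<in> TR 0"
  by (rule TR_I[of _ _ "\<lambda>_. 1"]) (simp add: trig_def)

lemma TR_power:
  assumes "\<And>om. L om = a * cis om + b * cis (- om)" shows "(\<lambda>om. L om ^ j) \<in> TR j"
proof (induction j)
  case (Suc j)
  then show ?case using TR_linear[OF Suc, of a b] by (simp add: assms)
qed (simp add: TR_one)

lemma TR_add_even: "f \<in> TR j \<Longrightarrow> f \<in> TR (j + 2 * i)"
  by (induction i) (auto intro: TR_Suc_Suc)

lemma TR_mono: assumes "f \<in> TR j" "j \<le> m" "even (j + m)" shows "f \<in> TR m"
proof -
  have "m = j + 2 * ((m - j) div 2)" using assms by presburger
  then show ?thesis using TR_add_even[OF assms(1)] by metis
qed

lemma cos_cis: "complex_of_real (cos om) = (1/2) * cis om + (1/2) * cis (- om)"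
  and sin_cis: "complex_of_real (sin om) = (- \<i>/2) * cis om + (\<i>/2) * cis (- om)"
  by (simp_all add: complex_eq_iff)

lemma hom_poly_TR: "(\<lambda>om. hom_poly m c (cos om) (sin om)) \<in> TR m"
proof -
  have "(\<lambda>om. complex_of_real (cos om) ^ i * complex_of_real (sin om) ^ j) \<in> TR (j + i)" for i j
  proof (induction i)
    case (Suc i)
    then show ?case using TR_linear[OF Suc, of "1/2" "1/2"] by (simp only: cos_cis[symmetric]) (simp add: mult_ac)
  qed (use TR_power[OF sin_cis, of j] in simp)
  from this[of j "m - j" for j] have "(\<lambda>om. complex_of_real (cos om ^ j * sin om ^ (m - j))) \<in> TR m" if "j \<le> m" for j
    using that by (metis (no_types, lifting) le_add_diff_inverse2 of_real_mult of_real_power ext)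
  then show ?thesis unfolding hom_poly_def by (intro TR_sum TR_scale) auto
qed

text \<open>The character of frequency \<open>m - 2*k\<close> is a product of \<open>m - k\<close>
  factors \<open>cis om\<close> and \<open>k\<close> factors \<open>cis (- om)\<close>, each a
  linear form in cosine and sine.\<close>

lemma TR_hom_poly: assumes "f \<in> TR m" shows "\<exists>c. \<forall>om. f om = hom_poly m c (cos om) (sin om)"
proof -
  define HP where "HP n = {f. \<exists>c. \<forall>om. f om = hom_poly n c (cos om) (sin om)}" for n
  have add: "(\<lambda>om. f om + g om) \<in> HP n" if fg: "f \<in> HP n" "g \<in> HP n" for f g n
  proof -
    obtain c d where "\<And>om. f om = hom_poly n c (cos om) (sin om)" "\<And>om. g om = hom_poly n d (cos om) (sin om)"
      using fg unfolding HP_def by blast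
    then have "f om + g om = hom_poly n (\<lambda>j. c j + d j) (cos om) (sin om)" for om
      by (simp add: hom_poly_def sum.distrib distrib_right)
    then show ?thesis unfolding HP_def by blast
  qed
  have scale: "(\<lambda>om. a * f om) \<in> HP n" if ff: "f \<in> HP n" for f n a
  proof -
    obtain c where "\<And>om. f om = hom_poly n c (cos om) (sin om)" using ff unfolding HP_def by blast
    then have "a * f om = hom_poly n (\<lambda>j. a * c j) (cos om) (sin om)" for om
      by (simp add: hom_poly_def sum_distrib_left mult.assoc)
    then show ?thesis unfolding HP_def by blast
  qed
  have cosm: "(\<lambda>om. complex_of_real (cos om) * f om) \<in> HP (Suc n)" if ff: "f \<in> HP n" for f n
  proof -
    obtain c where c: "\<And>om. f om = hom_poly n c (cos om) (sin om)" using ff unfolding HP_def by blast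
    have "complex_of_real (cos om) * f om = hom_poly (Suc n) (\<lambda>j. if j = 0 then 0 else c (j - 1)) (cos om) (sin om)" for om
      unfolding hom_poly_def c by (subst sum.atMost_Suc_shift) (simp add: sum_distrib_left mult_ac)
    then show ?thesis unfolding HP_def by blast
  qed
  have sinm: "(\<lambda>om. complex_of_real (sin om) * f om) \<in> HP (Suc n)" if ff: "f \<in> HP n" for f n
  proof -
    obtain c where c: "\<And>om. f om = hom_poly n c (cos om) (sin om)" using ff unfolding HP_def by blast
    have "complex_of_real (sin om) * f om = hom_poly (Suc n) (\<lambda>j. if j \<le> n then c j else 0) (cos om) (sin om)" for om
    proof -
      have "hom_poly (Suc n) (\<lambda>j. if j \<le> n then c j else 0) (cos om) (sin om) = (\<Sum>j\<le>n. c j * complex_of_real (cos om ^ j * sin om ^ (Suc n - j)))"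
        unfolding hom_poly_def by simp
      also have "... = complex_of_real (sin om) * f om"
        unfolding c hom_poly_def sum_distrib_left by (intro sum.cong refl) (simp add: Suc_diff_le mult_ac)
      finally show ?thesis by simp
    qed
    then show ?thesis unfolding HP_def by blast
  qed
  have cism: "(\<lambda>om. cis om * f om) \<in> HP (Suc n)" "(\<lambda>om. cis (- om) * f om) \<in> HP (Suc n)" if ff: "f \<in> HP n" for f n
  proof -
    have e: "cis om = complex_of_real (cos om) + \<i> * complex_of_real (sin om)" "cis (- om) = complex_of_real (cos om) + (- \<i>) * complex_of_real (sin om)" for om
      by (simp_all add: complex_eq_iff)
    show "(\<lambda>om. cis om * f om) \<in> HP (Suc n)"
      unfolding e(1) distrib_right mult.assoc by (intro add scale cosm sinm ff)
    show "(\<lambda>om. cis (- om) * f om) \<in> HP (Suc n)"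
      unfolding e(2) distrib_right mult.assoc by (intro add scale cosm sinm ff)
  qed
  have "(\<lambda>om. cis (real i * om) * cis (- (real j * om))) \<in> HP (j + i)" for i j
  proof (induction i)
    case 0
    show ?case
    proof (induction j)
      case 0
      have "(\<lambda>om. 1) \<in> HP 0" unfolding HP_def by (intro CollectI exI[of _ "\<lambda>_. 1"]) (simp add: hom_poly_def)
      then show ?case by simp
    next
      case (Suc j) then show ?case using cism(2)[OF Suc] by (simp add: cis_mult algebra_simps)
    qed
  next
    case (Suc i) then show ?case using cism(1)[OF Suc] by (simp add: cis_mult algebra_simps flip: mult.assoc)
  qed
  note ij = this
  have e: "(\<lambda>om. cis ((real m - 2 * real k) * om)) \<in> HP m" if "k \<le> m" for k
  proof -
    have "(\<lambda>om. cis (real (m - k) * om) * cis (- (real k * om))) = (\<lambda>om. cis ((real m - 2 * real k) * om))"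
      using that by (auto simp: fun_eq_iff cis_mult of_nat_diff algebra_simps)
    moreover have "k + (m - k) = m" using that by simp
    ultimately show ?thesis using ij[of "m - k" k] by simp
  qed
  obtain M where M: "\<And>om. f om = trig m M om" using assms unfolding TR_def by blast
  have "(\<lambda>om. \<Sum>k\<in>K. M k * cis ((real m - 2 * real k) * om)) \<in> HP m" if "K \<subseteq> {..m}" for K
    using finite_subset[OF that finite_atMost] that
  proof (induction K rule: finite_induct)
    case empty
    show ?case unfolding HP_def by (intro CollectI exI[of _ "\<lambda>_. 0"]) (simp add: hom_poly_def)
  next
    case (insert k K) then show ?case by (simp add: add scale e)
  qed
  from this[of "{..m}"] show ?thesis unfolding HP_def M trig_def by blast
qed

definition fcoef :: "nat \<Rightarrow> (real \<Rightarrow> complex) \<Rightarrow> nat \<Rightarrow> complex" where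
  "fcoef m f k = (LINT om|mO. cis (- ((real m - 2 * real k) * om)) * f om) / (2*pi)"

lemma fcoef_trig: assumes k: "k \<le> m" shows "fcoef m (trig m M) k = M k"
proof -
  interpret O: finite_measure mO by (rule finite_measure_mO)
  have "(LINT om|mO. cis (- ((real m - 2 * real k) * om)) * trig m M om) = (LINT om|mO. (\<Sum>j\<le>m. M j * (cis ((real m - 2 * real j) * om) * cis (- ((real m - 2 * real k) * om)))))"
    unfolding trig_def sum_distrib_left by (simp add: mult_ac)
  also have "... = (\<Sum>j\<le>m. M j * (LINT om|mO. cis ((real m - 2 * real j) * om) * cis (- ((real m - 2 * real k) * om))))"
    by (subst Bochner_Integration.integral_sum) (auto intro!: integrable_mult_right O.integrable_const_bound[where B=1] simp: norm_mult)
  also have "... = (\<Sum>j\<le>m. M j * (if j = k then 2*pi else 0))"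
    by (intro sum.cong refl) (simp add: integral_mO_cis_ortho k)
  also have "... = M k * (2*pi)"
    by (subst sum.mono_neutral_right[of "{..m}" "{k}"]) (use k in auto)
  finally show ?thesis unfolding fcoef_def by simp
qed

lemma TR_fcoef: assumes "f \<in> TR m" shows "f om = trig m (fcoef m f) om"
proof -
  obtain M where M: "f = trig m M" using assms unfolding TR_def by blast
  show ?thesis unfolding M trig_def[of m "fcoef m (trig m M)"] by (simp add: fcoef_trig) (simp add: trig_def)
qed

lemma yc_cis: "complex_of_real (yc om z) = (- cnj (PhiK z) / 2) * cis om + (- PhiK z / 2) * cis (- om)"
  unfolding yc_def by (simp add: complex_eq_iff) (simp add: field_simps)

text \<open>\<open>yc\<close> is a linear form in cosine and sine of \<open>om\<close>, so its
  \<open>j\<close>-th power has degree \<open>j\<close>; the parity of \<open>q\<close> allows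
  lifting every occurring power to degree \<open>m\<close>.\<close>

lemma poly_yc_TR:
  assumes "degree q = m" and par: "\<And>j. odd (j + m) \<Longrightarrow> coeff q j = 0"
  shows "(\<lambda>om. complex_of_real (poly q (yc om z))) \<in> TR m"
proof -
  have "(\<lambda>om. \<Sum>j\<le>m. complex_of_real (coeff q j) * complex_of_real (yc om z) ^ j) \<in> TR m"
  proof (rule TR_sum)
    fix j assume j: "j \<in> {..m}"
    show "(\<lambda>om. complex_of_real (coeff q j) * complex_of_real (yc om z) ^ j) \<in> TR m"
    proof (cases "odd (j + m)")
      case True then show ?thesis using par TR_zero by simp
    next
      case False then show ?thesis using TR_mono[OF TR_power[OF yc_cis]] j by (intro TR_scale) auto
    qed
  qed
  then show ?thesis using assms(1) by (simp add: poly_altdef)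
qed

context disk_weight
begin

text \<open>The moment is an integral over \<open>z\<close> of trigonometric polynomials in
  \<open>om\<close>. Their Fourier coefficients are bounded and measurable in \<open>z\<close>, so
  they can be integrated one by one.\<close>

lemma moment_IHw_TR:
  assumes f [measurable]: "f \<in> borel_measurable borel" and B: "\<And>z. cmod (f z) \<le> B"
    and "degree q = m" and "\<And>j. odd (j + m) \<Longrightarrow> coeff q j = 0"
  shows "moment_int (IHw \<gamma> f) (poly q) \<in> TR m"
proof -
  obtain Q where Q: "Q \<ge> 0" "\<And>y. \<bar>y\<bar> \<le> 1 \<Longrightarrow> \<bar>poly q y\<bar> \<le> Q" using poly_bounded[of q] by blast
  define b where "b k z = fcoef m (\<lambda>om. complex_of_real (poly q (yc om z))) k" for k z
  have bm: "b k \<in> borel_measurable borel" for k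
  proof -
    have "(\<lambda>z. LINT om|mO. cis (- ((real m - 2 * real k) * om)) * complex_of_real (poly q (yc om z))) \<in> borel_measurable borel"
      by (rule sigma_finite_measure.borel_measurable_lebesgue_integral) (unfold_locales, measurable)
    then show ?thesis unfolding b_def[abs_def] fcoef_def by measurable
  qed
  have bb: "cmod (b k z) \<le> Q * measure mO UNIV" for k z
  proof -
    have "cmod (LINT om|mO. cis (- ((real m - 2 * real k) * om)) * complex_of_real (poly q (yc om z))) \<le> (LINT om|mO. Q)"
      by (rule Bochner_Integration.integral_norm_bound_integral)
        (auto intro!: O.integrable_const_bound[where B=Q] Q abs_yc_le_1 simp: norm_mult)
    then have "cmod (LINT om|mO. cis (- ((real m - 2 * real k) * om)) * complex_of_real (poly q (yc om z))) / (2*pi) \<le> Q * measure mO UNIV / (2*pi)"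
      by (intro divide_right_mono) (auto simp: mult.commute)
    also have "... \<le> Q * measure mO UNIV"
    proof -
      have X: "0 \<le> Q * measure mO UNIV" using Q(1) by simp
      have "Q * measure mO UNIV * 1 \<le> Q * measure mO UNIV * (2*pi)" by (rule mult_left_mono[OF _ X]) (use pi_ge_two in linarith)
      then show ?thesis by (simp add: divide_le_eq)
    qed
    finally show ?thesis unfolding b_def fcoef_def by (simp add: norm_divide)
  qed
  have "moment_int (IHw \<gamma> f) (poly q) om = trig m (\<lambda>k. LINT z|mW \<gamma>. b k z * f z) om" for om
  proof -
    have "moment_int (IHw \<gamma> f) (poly q) om = (LINT z|mW \<gamma>. complex_of_real (poly q (yc om z)) * f z)"
      by (rule moment_int_IHw[OF gam f B _ Q(2)]) auto
    also have "... = (LINT z|mW \<gamma>. (\<Sum>k\<le>m. cis ((real m - 2 * real k) * om) * (b k z * f z)))"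
    proof (rule Bochner_Integration.integral_cong[OF refl])
      fix z
      have "complex_of_real (poly q (yc om z)) = trig m (\<lambda>k. b k z) om"
        unfolding b_def by (rule TR_fcoef[OF poly_yc_TR]) (use assms in auto)
      then show "complex_of_real (poly q (yc om z)) * f z = (\<Sum>k\<le>m. cis ((real m - 2 * real k) * om) * (b k z * f z))"
        unfolding trig_def by (simp add: sum_distrib_left mult_ac)
    qed
    also have "... = (\<Sum>k\<le>m. cis ((real m - 2 * real k) * om) * (LINT z|mW \<gamma>. b k z * f z))"
    proof (subst Bochner_Integration.integral_sum)
      fix k
      have X: "0 \<le> Q * measure mO UNIV" using Q(1) by simp
      have "cmod (b k z * f z) \<le> Q * measure mO UNIV * B" for z
        using mult_mono[OF bb B X] by (simp add: norm_mult)
      then have "integrable (mW \<gamma>) (\<lambda>z. b k z * f z)"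
        using bm[of k] by (intro W.integrable_const_bound) auto
      then show "integrable (mW \<gamma>) (\<lambda>z. cis ((real m - 2 * real k) * om) * (b k z * f z))" by (rule integrable_mult_right)
    qed simp
    finally show ?thesis unfolding trig_def by (simp add: mult_ac)
  qed
  then show ?thesis by (rule TR_I)
qed

lemma Mc_fcoef: "Mc u n = fcoef n (moment_int u (p_gamma \<gamma> n))"
  unfolding Mc_def fcoef_def by auto

lemma borel_measurable_moment_int [measurable]:
  assumes [measurable]: "u \<in> borel_measurable borel" "q \<in> borel_measurable borel"
  shows "moment_int u q \<in> borel_measurable borel"
proof -
  have "moment_int u q = (\<lambda>om. LINT al|mA \<gamma>. complex_of_real (q (sin al)) * UU \<gamma> u om al)"
    by (rule ext, rule moment_int_eq) measurable
  also have "... \<in> borel_measurable borel"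
    by (rule sigma_finite_measure.borel_measurable_lebesgue_integral) (unfold_locales, measurable)
  finally show ?thesis .
qed

text \<open>Hence the quantification over all \<open>M\<close> in \<open>cond_sobolev\<close> and
  \<open>cond_smooth\<close> concerns the single array \<open>Mc u\<close>.\<close>

lemma moment_data_unique:
  assumes "moment_data \<gamma> u c M" "k \<le> m" and [measurable]: "u \<in> borel_measurable borel"
  shows "M m k = Mc u m k"
proof -
  have "AE om in lborel. moment_int u (p_gamma \<gamma> m) om = trig m (M m) om"
  proof -
    have *: "trig m (M m) om = hom_poly m (c m) (cos om) (sin om)" for om
      using assms(1) unfolding moment_data_def trig_def by metis
    show ?thesis unfolding * using assms(1) unfolding moment_data_def by blast
  qed
  then have ae: "AE om in mO. moment_int u (p_gamma \<gamma> m) om = trig m (M m) om"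
    unfolding mO_def by (subst AE_density) (auto elim: eventually_mono)
  have [measurable]: "trig m (M m) \<in> borel_measurable borel" unfolding trig_def[abs_def] by measurable
  have "Mc u m k = fcoef m (trig m (M m)) k"
    unfolding Mc_fcoef fcoef_def p_gamma_eq
    by (rule arg_cong2[where f="(/)", OF _ refl], rule integral_cong_AE)
      (use ae in \<open>auto simp: p_gamma_eq elim: eventually_mono\<close>)
  then show ?thesis using fcoef_trig assms(2) by simp
qed

end

section \<open>Moments and limits\<close>

lemma AE_lborel_shift:
  assumes "AE x in lborel. P (x::real)" shows "AE x in lborel. P (x + c)"
proof -
  have "AE x in distr lborel borel ((+) c). P x" using assms by (subst lborel_distr_plus)
  then have "AE x in lborel. P (c + x)" by (rule AE_distrD[rotated]) simp
  then show ?thesis by (simp add: add.commute)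
qed

text \<open>Countably many translates of one period cover the line.\<close>

lemma AE_mO_periodic:
  assumes ae: "AE om in mO. P om" and per: "\<And>om. P (om + 2*pi) \<longleftrightarrow> P om"
  shows "AE om in lborel. P om"
proof -
  have per_nat: "P (om + 2*pi * real n) \<longleftrightarrow> P om" for om n
  proof (induction n)
    case (Suc n)
    have "om + 2*pi * real (Suc n) = (om + 2*pi * real n) + 2*pi" by (simp add: algebra_simps)
    then show ?case using Suc per[of "om + 2*pi * real n"] by metis
  qed simp
  have per_int: "P (om + 2*pi * of_int k) \<longleftrightarrow> P om" for om k
  proof (cases "k \<ge> 0")
    case True then show ?thesis using per_nat[of om "nat k"] by simp
  next
    case False then show ?thesis using per_nat[of "om + 2*pi * of_int k" "nat (- k)"] by simp
  qed
  have "AE om in lborel. ennreal (indicator {0..2*pi} om) > 0 \<longrightarrow> P om"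
    using ae unfolding mO_def by (subst (asm) AE_density) auto
  then have "AE om in lborel. om \<in> {0..2*pi} \<longrightarrow> P om" by (rule eventually_mono) (auto simp: indicator_def)
  then have "AE om in lborel. \<forall>k::int. (om + 2*pi * of_int k \<in> {0..2*pi} \<longrightarrow> P (om + 2*pi * of_int k))"
    unfolding AE_all_countable by (intro allI) (rule AE_lborel_shift)
  then show ?thesis
  proof (rule eventually_mono)
    fix om assume a: "\<forall>k::int. (om + 2*pi * of_int k \<in> {0..2*pi} \<longrightarrow> P (om + 2*pi * of_int k))"
    define k where "k = \<lfloor>om / (2*pi)\<rfloor>"
    have "of_int k \<le> om / (2*pi)" "om / (2*pi) < of_int k + 1" unfolding k_def by linarith+
    then have "0 \<le> om + 2*pi * of_int (- k)" "om + 2*pi * of_int (- k) \<le> 2*pi"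
      by (auto simp: field_simps)
    then have "P (om + 2*pi * of_int (- k))" using a by (metis atLeastAtMost_iff)
    then show "P om" using per_int by blast
  qed
qed

lemma UU_zero [simp]: "UU \<gamma> (\<lambda>_. 0) om al = 0" by (simp add: UU_def)

lemma UU_zero_fun [simp]: "UU \<gamma> (\<lambda>_. 0) om = (\<lambda>_. 0)" by (simp add: fun_eq_iff)

lemma moment_int_zero [simp]: "moment_int (\<lambda>_. 0) q om = 0" by (simp add: moment_int_def u_v_def)

lemma moment_int_periodic:
  assumes "\<And>\<beta> a. u (\<beta> + 2*pi, a) = u (\<beta>, a)" shows "moment_int u q (om + 2*pi) = moment_int u q om"
proof -
  have "u_v u (om + 2*pi) s = u_v u om s" for s
    using assms[of "om + 3*pi/2 + 2 * arctan s"] unfolding u_v_def by (simp add: add_ac)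
  then show ?thesis unfolding moment_int_def by simp
qed

context disk_weight
begin

definition N1 :: "(real \<times> real \<Rightarrow> complex) \<Rightarrow> (real \<times> real \<Rightarrow> complex) \<Rightarrow> ennreal" where
  "N1 v w = (\<integral>\<^sup>+om. \<integral>\<^sup>+al. ennreal (cmod (UU \<gamma> v om al - UU \<gamma> w om al)) \<partial>mA \<gamma> \<partial>mO)"

definition goodG :: "(real \<times> real \<Rightarrow> complex) \<Rightarrow> bool" where
  "goodG u \<longleftrightarrow> u \<in> borel_measurable borel \<and> (\<forall>\<beta> a. u (\<beta> + 2*pi, a) = u (\<beta>, a)) \<and> L2G_dist2 \<gamma> u (\<lambda>_. 0) < \<infinity>"

lemma goodG_L2plus: "u \<in> L2plus \<gamma> \<Longrightarrow> goodG u"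
  unfolding goodG_def L2plus_def by auto

text \<open>Replaces Cauchy-Schwarz on a finite measure space: pointwise
  \<open>x <= x^2 / e + e\<close>, where \<open>e\<close> is free to be adapted to the size of the
  distance.\<close>

lemma N1_le_L2:
  assumes v [measurable]: "v \<in> borel_measurable borel" and w [measurable]: "w \<in> borel_measurable borel"
    and p: "\<And>\<beta> a. v (\<beta> + 2*pi, a) = v (\<beta>, a)" "\<And>\<beta> a. w (\<beta> + 2*pi, a) = w (\<beta>, a)" and e: "e > 0"
  shows "N1 v w \<le> ennreal (1/e) * L2G_dist2 \<gamma> v w + ennreal (e * (measure (mA \<gamma>) UNIV * measure mO UNIV))"
proof -
  have pt: "x \<le> x^2 / e + e" if "x \<ge> 0" for x :: real
  proof (cases "x \<le> e")
    case True then show ?thesis using e by (smt (verit) divide_nonneg_pos zero_le_power2)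
  next
    case False
    then have "x * e \<le> x^2" using that by (simp add: power2_eq_square mult_left_mono)
    then have "x \<le> x^2 / e" using e by (simp add: pos_le_divide_eq)
    then show ?thesis using e by simp
  qed
  have "N1 v w \<le> (\<integral>\<^sup>+om. \<integral>\<^sup>+al. ennreal (1/e) * ennreal ((cmod (UU \<gamma> v om al - UU \<gamma> w om al))^2) + ennreal e \<partial>mA \<gamma> \<partial>mO)"
    unfolding N1_def using e pt
    by (intro nn_integral_mono) (auto simp: ennreal_mult[symmetric] ennreal_plus[symmetric] simp del: ennreal_plus intro!: ennreal_leI)
  also have "... = (\<integral>\<^sup>+om. ennreal (1/e) * (\<integral>\<^sup>+al. ennreal ((cmod (UU \<gamma> v om al - UU \<gamma> w om al))^2) \<partial>mA \<gamma>) + ennreal e * emeasure (mA \<gamma>) UNIV \<partial>mO)"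
    by (intro nn_integral_cong) (subst nn_integral_add, auto simp: nn_integral_cmult)
  also have "... = ennreal (1/e) * L2G_dist2 \<gamma> v w + ennreal e * emeasure (mA \<gamma>) UNIV * emeasure mO UNIV"
    unfolding L2G_dist2_eq[OF gam v w p] by (subst nn_integral_add) (auto simp: nn_integral_cmult)
  also have "ennreal e * emeasure (mA \<gamma>) UNIV * emeasure mO UNIV = ennreal (e * (measure (mA \<gamma>) UNIV * measure mO UNIV))"
    using e by (simp add: A.emeasure_eq_measure O.emeasure_eq_measure ennreal_mult[symmetric] mult.assoc)
  finally show ?thesis .
qed

lemma N1_tendsto:
  assumes v: "\<And>j. v j \<in> borel_measurable borel" and w: "w \<in> borel_measurable borel"
    and p: "\<And>j \<beta> a. v j (\<beta> + 2*pi, a) = v j (\<beta>, a)" "\<And>\<beta> a. w (\<beta> + 2*pi, a) = w (\<beta>, a)"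
    and lim: "(\<lambda>j. L2G_dist2 \<gamma> (v j) w) \<longlonglongrightarrow> 0"
  shows "(\<lambda>j. N1 (v j) w) \<longlonglongrightarrow> 0"
proof -
  define l where "l j = enn2real (L2G_dist2 \<gamma> (v j) w)" for j
  define C where "C = measure (mA \<gamma>) UNIV * measure mO UNIV"
  define r where "r j = sqrt (l j) + (sqrt (l j) + 1 / real (Suc j)) * C" for j :: nat
  have l0: "l j \<ge> 0" for j by (simp add: l_def)
  have "l \<longlonglongrightarrow> 0" unfolding l_def using tendsto_enn2real[of "\<lambda>j. L2G_dist2 \<gamma> (v j) w" 0 sequentially] lim by simp
  then have "(\<lambda>j. sqrt (l j)) \<longlonglongrightarrow> sqrt 0" by (rule tendsto_real_sqrt)
  then have "r \<longlonglongrightarrow> 0 + (0 + 0) * C" unfolding r_def by (intro tendsto_intros LIMSEQ_Suc[OF lim_1_over_n]) auto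
  then have r: "(\<lambda>j. ennreal (r j)) \<longlonglongrightarrow> 0" using tendsto_ennrealI[of r 0] by simp
  have "eventually (\<lambda>j. L2G_dist2 \<gamma> (v j) w < 1) sequentially" using lim by (rule order_tendstoD) simp
  then have "eventually (\<lambda>j. N1 (v j) w \<le> ennreal (r j)) sequentially"
  proof (rule eventually_mono)
    fix j assume "L2G_dist2 \<gamma> (v j) w < 1"
    then have "L2G_dist2 \<gamma> (v j) w < top" by (rule order_less_trans) simp
    then have lj: "L2G_dist2 \<gamma> (v j) w = ennreal (l j)" unfolding l_def by simp
    \<comment> \<open>The square root balances the two terms; the summand
      \<open>1 / real (Suc j)\<close> keeps \<open>e\<close> positive when \<open>l j\<close>
      vanishes.\<close>
    define e where "e = sqrt (l j) + 1 / real (Suc j)"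
    have e: "e > 0" unfolding e_def using l0[of j] by (intro add_nonneg_pos) auto
    have "l j / e \<le> sqrt (l j)"
    proof -
      have "l j = sqrt (l j) * sqrt (l j)" using l0 by simp
      also have "... \<le> sqrt (l j) * e" unfolding e_def by (intro mult_left_mono) (auto simp: l0)
      finally show ?thesis using e by (simp add: divide_le_eq)
    qed
    then have "1/e * l j + e * C \<le> r j" unfolding r_def e_def by simp
    moreover have "N1 (v j) w \<le> ennreal (1/e) * ennreal (l j) + ennreal (e * C)"
      using N1_le_L2[OF v[of j] w p(1)[of j] p(2) e] unfolding lj C_def .
    moreover have "ennreal (1/e) * ennreal (l j) + ennreal (e * C) = ennreal (1/e * l j + e * C)"
      using e l0[of j] by (subst ennreal_plus) (auto simp: ennreal_mult[symmetric] C_def)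
    ultimately show "N1 (v j) w \<le> ennreal (r j)" by (metis ennreal_leI order_trans)
  qed
  then show ?thesis by (intro tendsto_sandwich[OF _ _ tendsto_const r]) auto
qed

lemma goodG_AE:
  assumes "goodG u"
  shows "AE om in mO. integrable (mA \<gamma>) (UU \<gamma> u om) \<and> integrable (mA \<gamma>) (\<lambda>al. (cmod (UU \<gamma> u om al))^2)"
proof -
  have u [measurable]: "u \<in> borel_measurable borel" and p: "\<And>\<beta> a. u (\<beta> + 2*pi, a) = u (\<beta>, a)" and fin: "L2G_dist2 \<gamma> u (\<lambda>_. 0) < \<infinity>"
    using assms unfolding goodG_def by auto
  have "(\<integral>\<^sup>+om. \<integral>\<^sup>+al. ennreal ((cmod (UU \<gamma> u om al))^2) \<partial>mA \<gamma> \<partial>mO) \<noteq> \<infinity>"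
    using fin L2G_dist2_eq[OF gam u, of "\<lambda>_. 0"] p by simp
  then have "AE om in mO. (\<integral>\<^sup>+al. ennreal ((cmod (UU \<gamma> u om al))^2) \<partial>mA \<gamma>) \<noteq> \<infinity>"
    by (intro nn_integral_PInf_AE) auto
  then show ?thesis
  proof (rule eventually_mono)
    fix om assume a: "(\<integral>\<^sup>+al. ennreal ((cmod (UU \<gamma> u om al))^2) \<partial>mA \<gamma>) \<noteq> \<infinity>"
    have i2: "integrable (mA \<gamma>) (\<lambda>al. (cmod (UU \<gamma> u om al))^2)"
      by (rule integrableI_nonneg) (use a in \<open>auto simp: less_top\<close>)
    have "integrable (mA \<gamma>) (UU \<gamma> u om)"
    proof (rule Bochner_Integration.integrable_bound[of _ "\<lambda>al. (cmod (UU \<gamma> u om al))^2 + 1"])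
      show "integrable (mA \<gamma>) (\<lambda>al. (cmod (UU \<gamma> u om al))^2 + 1)" using i2 by simp
      have "x \<le> x^2 + 1" for x :: real using sum_squares_bound[of x 1] zero_le_power2[of x] by (simp; smt (verit) zero_le_power2)
      then show "AE al in mA \<gamma>. cmod (UU \<gamma> u om al) \<le> norm ((cmod (UU \<gamma> u om al))^2 + 1)" by (intro AE_I2) (simp add: abs_of_nonneg add_nonneg_nonneg)
    qed simp
    with i2 show "integrable (mA \<gamma>) (UU \<gamma> u om) \<and> integrable (mA \<gamma>) (\<lambda>al. (cmod (UU \<gamma> u om al))^2)" by blast
  qed
qed

lemma integrable_poly_mult:
  assumes "integrable (mA \<gamma>) U"
  shows "integrable (mA \<gamma>) (\<lambda>al. complex_of_real (poly q (sin al)) * U al)"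
proof -
  obtain Q where Q: "Q \<ge> 0" "\<And>y. \<bar>y\<bar> \<le> 1 \<Longrightarrow> \<bar>poly q y\<bar> \<le> Q" using poly_bounded[of q] by blast
  have m: "U \<in> borel_measurable borel" using borel_measurable_integrable[OF assms] by simp
  show ?thesis
  proof (rule Bochner_Integration.integrable_bound[of _ "\<lambda>al. Q * cmod (U al)"])
    show "AE al in mA \<gamma>. norm (complex_of_real (poly q (sin al)) * U al) \<le> norm (Q * cmod (U al))"
      using Q by (intro AE_I2) (auto simp: norm_mult abs_mult intro!: mult_right_mono)
  qed (use assms m in auto)
qed

lemma moment_L1:
  assumes v [measurable]: "v \<in> borel_measurable borel" and w [measurable]: "w \<in> borel_measurable borel"
    and iv: "AE om in mO. integrable (mA \<gamma>) (UU \<gamma> v om)" and iw: "AE om in mO. integrable (mA \<gamma>) (UU \<gamma> w om)"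
    and Q: "Q \<ge> 0" "\<And>y. \<bar>y\<bar> \<le> 1 \<Longrightarrow> \<bar>poly q y\<bar> \<le> Q"
  shows "(\<integral>\<^sup>+om. ennreal (cmod (moment_int v (poly q) om - moment_int w (poly q) om)) \<partial>mO) \<le> ennreal Q * N1 v w"
proof -
  have "(\<integral>\<^sup>+om. ennreal (cmod (moment_int v (poly q) om - moment_int w (poly q) om)) \<partial>mO)
     \<le> (\<integral>\<^sup>+om. ennreal Q * (\<integral>\<^sup>+al. ennreal (cmod (UU \<gamma> v om al - UU \<gamma> w om al)) \<partial>mA \<gamma>) \<partial>mO)"
  proof (rule nn_integral_mono_AE, use iv iw in eventually_elim)
    fix om assume i: "integrable (mA \<gamma>) (UU \<gamma> v om)" "integrable (mA \<gamma>) (UU \<gamma> w om)"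
    let ?d = "\<lambda>al. complex_of_real (poly q (sin al)) * UU \<gamma> v om al - complex_of_real (poly q (sin al)) * UU \<gamma> w om al"
    note i' = integrable_poly_mult[OF i(1), of q] integrable_poly_mult[OF i(2), of q]
    have e: "moment_int v (poly q) om - moment_int w (poly q) om = (LINT al|mA \<gamma>. ?d al)"
      using i' by (simp add: moment_int_eq[where \<gamma>=\<gamma>])
    have "ennreal (cmod (LINT al|mA \<gamma>. ?d al)) \<le> (\<integral>\<^sup>+al. norm (?d al) \<partial>mA \<gamma>)"
      by (rule integral_norm_bound_ennreal) (use i' in auto)
    also have "... \<le> (\<integral>\<^sup>+al. ennreal Q * ennreal (cmod (UU \<gamma> v om al - UU \<gamma> w om al)) \<partial>mA \<gamma>)"
      using Q by (intro nn_integral_mono)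
       (auto simp: right_diff_distrib[symmetric] norm_mult ennreal_mult[symmetric] intro!: ennreal_leI mult_right_mono)
    also have "... = ennreal Q * (\<integral>\<^sup>+al. ennreal (cmod (UU \<gamma> v om al - UU \<gamma> w om al)) \<partial>mA \<gamma>)"
      by (rule nn_integral_cmult) measurable
    finally show "ennreal (cmod (moment_int v (poly q) om - moment_int w (poly q) om)) \<le> ennreal Q * (\<integral>\<^sup>+al. ennreal (cmod (UU \<gamma> v om al - UU \<gamma> w om al)) \<partial>mA \<gamma>)"
      unfolding e .
  qed
  also have "... = ennreal Q * N1 v w" unfolding N1_def by (rule nn_integral_cmult) measurable
  finally show ?thesis .
qed

lemma integrable_moment:
  assumes u: "goodG u" shows "integrable mO (moment_int u (poly q))"
proof -
  obtain Q where Q: "Q \<ge> 0" "\<And>y. \<bar>y\<bar> \<le> 1 \<Longrightarrow> \<bar>poly q y\<bar> \<le> Q" using poly_bounded[of q] by blast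
  have um [measurable]: "u \<in> borel_measurable borel" and p: "\<And>\<beta> a. u (\<beta> + 2*pi, a) = u (\<beta>, a)" and fin: "L2G_dist2 \<gamma> u (\<lambda>_. 0) < \<infinity>"
    using u unfolding goodG_def by auto
  have a: "(\<integral>\<^sup>+om. ennreal (cmod (moment_int u (poly q) om - moment_int (\<lambda>_. 0) (poly q) om)) \<partial>mO) \<le> ennreal Q * N1 u (\<lambda>_. 0)"
    by (rule moment_L1[OF _ _ _ _ Q]) (use goodG_AE[OF u] in \<open>auto elim: eventually_mono\<close>)
  have "N1 u (\<lambda>_. 0) \<le> ennreal (1/1) * L2G_dist2 \<gamma> u (\<lambda>_. 0) + ennreal (1 * (measure (mA \<gamma>) UNIV * measure mO UNIV))"
    by (rule N1_le_L2) (use p in auto)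
  also have "... < \<infinity>" using fin by simp
  finally have "ennreal Q * N1 u (\<lambda>_. 0) < \<infinity>" by (simp add: ennreal_mult_less_top)
  then show ?thesis using a by (intro integrableI_bounded) auto
qed

lemma fcoef_diff:
  assumes "integrable mO a" "integrable mO b"
  shows "cmod (fcoef m a k - fcoef m b k) \<le> (LINT om|mO. cmod (a om - b om))"
proof -
  have i: "integrable mO (\<lambda>om. cis (- ((real m - 2 * real k) * om)) * f om)" if "integrable mO f" for f
    by (rule Bochner_Integration.integrable_bound[OF that]) (use borel_measurable_integrable[OF that] in \<open>auto simp: norm_mult\<close>)
  have "fcoef m a k - fcoef m b k = (LINT om|mO. cis (- ((real m - 2 * real k) * om)) * (a om - b om)) / (2*pi)"
    unfolding fcoef_def using i[OF assms(1)] i[OF assms(2)] by (simp add: right_diff_distrib diff_divide_distrib)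
  then have "cmod (fcoef m a k - fcoef m b k) = cmod (LINT om|mO. cis (- ((real m - 2 * real k) * om)) * (a om - b om)) / (2*pi)"
    by (simp add: norm_divide)
  also have "... \<le> (LINT om|mO. cmod (cis (- ((real m - 2 * real k) * om)) * (a om - b om))) / (2*pi)"
    by (intro divide_right_mono integral_norm_bound) simp
  also have "... = (LINT om|mO. cmod (a om - b om)) / (2*pi)" by (simp add: norm_mult)
  also have "... \<le> (LINT om|mO. cmod (a om - b om))"
  proof -
    have X: "0 \<le> (LINT om|mO. cmod (a om - b om))" by simp
    have "(LINT om|mO. cmod (a om - b om)) * 1 \<le> (LINT om|mO. cmod (a om - b om)) * (2*pi)" by (rule mult_left_mono[OF _ X]) (use pi_ge_two in linarith)
    then show ?thesis by (simp add: divide_le_eq)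
  qed
  finally show ?thesis .
qed

lemma cmod_trig_le: "cmod (trig m M om - trig m N om) \<le> (\<Sum>k\<le>m. cmod (M k - N k))"
proof -
  have "trig m M om - trig m N om = (\<Sum>k\<le>m. (M k - N k) * cis ((real m - 2 * real k) * om))"
    unfolding trig_def by (simp add: sum_subtractf left_diff_distrib)
  also have "cmod ... \<le> (\<Sum>k\<le>m. cmod ((M k - N k) * cis ((real m - 2 * real k) * om)))" by (rule norm_sum)
  finally show ?thesis by (simp add: norm_mult)
qed

lemma goodG_IHw:
  assumes f [measurable]: "f \<in> borel_measurable borel" and B: "\<And>z. cmod (f z) \<le> B"
  shows "goodG (IHw \<gamma> f)"
proof -
  have b: "cmod (UU \<gamma> (IHw \<gamma> f) om al) \<le> B * measure (mT \<gamma>) UNIV" if "al \<in> Iang" for om al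
  proof -
    have "cmod (LINT T|mT \<gamma>. f (zc om al T)) \<le> (LINT T|mT \<gamma>. B)"
      by (rule Bochner_Integration.integral_norm_bound_integral) (auto intro!: T.integrable_const_bound[where B=B] B)
    then show ?thesis by (subst UU_IHw[OF that f]) (simp add: mult.commute)
  qed
  have "L2G_dist2 \<gamma> (IHw \<gamma> f) (\<lambda>_. 0) = (\<integral>\<^sup>+om. \<integral>\<^sup>+al. ennreal ((cmod (UU \<gamma> (IHw \<gamma> f) om al))^2) \<partial>mA \<gamma> \<partial>mO)"
    by (subst L2G_dist2_eq[OF gam]) (auto simp: IHw_periodic)
  also have "... \<le> (\<integral>\<^sup>+om. \<integral>\<^sup>+al. ennreal ((B * measure (mT \<gamma>) UNIV)^2) \<partial>mA \<gamma> \<partial>mO)"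
    by (intro nn_integral_mono nn_integral_mono_AE)
       (rule eventually_mono[OF AE_mA_Iang], auto intro!: ennreal_leI power_mono b)
  also have "... < \<infinity>"
    by (simp add: ennreal_mult_less_top A.emeasure_eq_measure O.emeasure_eq_measure)
  finally show ?thesis unfolding goodG_def by (auto simp: IHw_periodic)
qed

text \<open>Moments are continuous from the weighted square norm to integrable functions on the
  circle, and trigonometric polynomials of fixed degree form a closed finite-dimensional subspace.
  Hence the moment condition survives limits of transforms, coefficient by coefficient.\<close>

lemma moments_of_limit:
  assumes u: "goodG u" and f: "\<And>j. f j \<in> borel_measurable borel" and B: "\<And>j. \<exists>B. \<forall>z. cmod (f j z) \<le> B"
    and lim: "(\<lambda>j. L2G_dist2 \<gamma> (IHw \<gamma> (f j)) u) \<longlonglongrightarrow> 0"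
    and q: "degree q = m" "\<And>j. odd (j + m) \<Longrightarrow> coeff q j = 0"
  shows "AE om in lborel. moment_int u (poly q) om = trig m (fcoef m (moment_int u (poly q))) om"
    and "(\<lambda>j. fcoef m (moment_int (IHw \<gamma> (f j)) (poly q)) k) \<longlonglongrightarrow> fcoef m (moment_int u (poly q)) k"
proof -
  obtain Q where Q: "Q \<ge> 0" "\<And>y. \<bar>y\<bar> \<le> 1 \<Longrightarrow> \<bar>poly q y\<bar> \<le> Q" using poly_bounded[of q] by blast
  define b where "b = moment_int u (poly q)"
  define a where "a j = moment_int (IHw \<gamma> (f j)) (poly q)" for j
  have um [measurable]: "u \<in> borel_measurable borel" and p: "\<And>\<beta> a. u (\<beta> + 2*pi, a) = u (\<beta>, a)"
    using u unfolding goodG_def by auto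
  have gj: "goodG (IHw \<gamma> (f j))" for j using goodG_IHw[OF f] B by blast
  have ib: "integrable mO b" unfolding b_def by (rule integrable_moment[OF u])
  have ia: "integrable mO (a j)" for j unfolding a_def by (rule integrable_moment[OF gj])
  define E where "E j = (LINT om|mO. cmod (a j om - b om))" for j
  have "(\<lambda>j. N1 (IHw \<gamma> (f j)) u) \<longlonglongrightarrow> 0"
    by (rule N1_tendsto[OF _ _ _ _ lim]) (use f p in \<open>auto simp: IHw_periodic\<close>)
  then have "(\<lambda>j. ennreal Q * N1 (IHw \<gamma> (f j)) u) \<longlonglongrightarrow> ennreal Q * 0" by (intro ennreal_tendsto_cmult) auto
  then have lim0: "(\<lambda>j. ennreal Q * N1 (IHw \<gamma> (f j)) u) \<longlonglongrightarrow> 0" by simp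
  have Ej: "ennreal (E j) \<le> ennreal Q * N1 (IHw \<gamma> (f j)) u" for j
  proof -
    have "ennreal (E j) = (\<integral>\<^sup>+om. ennreal (cmod (a j om - b om)) \<partial>mO)"
      unfolding E_def using ia[of j] ib by (intro nn_integral_eq_integral[symmetric]) auto
    also have "... \<le> ennreal Q * N1 (IHw \<gamma> (f j)) u"
      unfolding a_def b_def
      by (rule moment_L1[OF _ _ _ _ Q]) (use f goodG_AE[OF u] goodG_AE[OF gj] in \<open>auto elim: eventually_mono\<close>)
    finally show ?thesis .
  qed
  have "(\<lambda>j. ennreal (E j)) \<longlonglongrightarrow> 0"
    by (rule tendsto_sandwich[OF _ _ tendsto_const lim0]) (auto simp: Ej)
  then have "(\<lambda>j. enn2real (ennreal (E j))) \<longlonglongrightarrow> 0" using tendsto_enn2real[of "\<lambda>j. ennreal (E j)" 0] by simp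
  moreover have "E j \<ge> 0" for j unfolding E_def by simp
  ultimately have E0: "E \<longlonglongrightarrow> 0" by simp
  have fc: "(\<lambda>j. fcoef m (a j) k) \<longlonglongrightarrow> fcoef m b k" for k
  proof -
    have "(\<lambda>j. fcoef m (a j) k - fcoef m b k) \<longlonglongrightarrow> 0"
      by (rule Lim_null_comparison[OF _ E0]) (use fcoef_diff[OF ia ib] in \<open>auto simp: E_def\<close>)
    then show ?thesis by (simp add: LIM_zero_iff)
  qed
  then show "(\<lambda>j. fcoef m (moment_int (IHw \<gamma> (f j)) (poly q)) k) \<longlonglongrightarrow> fcoef m (moment_int u (poly q)) k"
    unfolding a_def b_def .
  have aTR: "a j om = trig m (fcoef m (a j)) om" for j om
  proof -
    obtain Bj where "\<And>z. cmod (f j z) \<le> Bj" using B by blast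
    then show ?thesis unfolding a_def using moment_IHw_TR[OF f _ q] by (intro TR_fcoef) blast
  qed
  let ?t = "trig m (fcoef m b)"
  have tm [measurable]: "trig m M \<in> borel_measurable borel" for M unfolding trig_def[abs_def] by measurable
  have tb: "cmod (trig m M om) \<le> (\<Sum>k\<le>m. cmod (M k))" for M om
    using cmod_trig_le[of m M om "\<lambda>_. 0"] by (simp add: trig_def)
  have it: "integrable mO ?t" by (rule O.integrable_const_bound[where B="\<Sum>k\<le>m. cmod (fcoef m b k)"]) (auto intro!: AE_I2 tb)
  define D where "D = (LINT om|mO. cmod (b om - ?t om))"
  \<comment> \<open>Insert \<open>a j\<close>, which equals its own trigonometric polynomial; both
    error terms tend to 0 while \<open>D\<close> does not depend on \<open>j\<close>.\<close>
  have "D \<le> E j + measure mO UNIV * (\<Sum>k\<le>m. cmod (fcoef m (a j) k - fcoef m b k))" for j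
  proof -
    have "D \<le> (LINT om|mO. cmod (a j om - b om) + (\<Sum>k\<le>m. cmod (fcoef m (a j) k - fcoef m b k)))"
      unfolding D_def
    proof (rule integral_mono)
      fix om
      have "cmod (b om - ?t om) \<le> cmod (a j om - b om) + cmod (a j om - ?t om)"
        using norm_triangle_ineq4[of "a j om - ?t om" "a j om - b om"] by (simp add: norm_minus_commute)
      also have "cmod (a j om - ?t om) \<le> (\<Sum>k\<le>m. cmod (fcoef m (a j) k - fcoef m b k))"
        by (subst aTR) (rule cmod_trig_le)
      finally show "cmod (b om - ?t om) \<le> cmod (a j om - b om) + (\<Sum>k\<le>m. cmod (fcoef m (a j) k - fcoef m b k))" by simp
    qed (use ia[of j] ib it in auto)
    also have "... = E j + measure mO UNIV * (\<Sum>k\<le>m. cmod (fcoef m (a j) k - fcoef m b k))"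
      unfolding E_def using ia[of j] ib by simp
    finally show ?thesis .
  qed
  moreover have "(\<lambda>j. E j + measure mO UNIV * (\<Sum>k\<le>m. cmod (fcoef m (a j) k - fcoef m b k))) \<longlonglongrightarrow> 0 + measure mO UNIV * (\<Sum>k\<le>m. 0)"
    by (intro tendsto_intros E0 tendsto_norm_zero LIM_zero fc)
  ultimately have "D \<le> 0" by (intro LIMSEQ_le_const[of _ 0]) auto
  moreover have "D \<ge> 0" unfolding D_def by simp
  ultimately have "D = 0" by simp
  then have "AE om in mO. cmod (b om - ?t om) = 0"
    unfolding D_def using ib it by (subst (asm) integral_nonneg_eq_0_iff_AE) auto
  then have ae: "AE om in mO. b om = ?t om" by (rule eventually_mono) simp
  have "AE om in lborel. b om = ?t om"
  proof (rule AE_mO_periodic[OF ae])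
    fix om
    have "?t (om + 2*pi) = ?t om" unfolding trig_def by (simp only: cis_mult_2pi_int)
    then show "(b (om + 2*pi) = ?t (om + 2*pi)) = (b om = ?t om)"
      unfolding b_def using moment_int_periodic[OF p] by simp
  qed
  then show "AE om in lborel. moment_int u (poly q) om = trig m (fcoef m (moment_int u (poly q))) om"
    unfolding b_def .
qed

end

section \<open>Completeness\<close>

definition clamp1 :: "real \<Rightarrow> real \<Rightarrow> real" where "clamp1 n x = max (- n) (min n x)"

lemma clamp1_bound: "n \<ge> 0 \<Longrightarrow> \<bar>clamp1 n x\<bar> \<le> n" by (auto simp: clamp1_def)

lemma clamp1_id: "\<bar>x\<bar> \<le> n \<Longrightarrow> clamp1 n x = x" by (auto simp: clamp1_def)

lemma clamp1_diff: "n \<ge> 0 \<Longrightarrow> \<bar>x - clamp1 n x\<bar> \<le> \<bar>x\<bar>" by (auto simp: clamp1_def)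

lemma continuous_clamp1: "continuous_on UNIV (clamp1 n)"
  unfolding clamp1_def[abs_def] by (intro continuous_intros)

lemma borel_measurable_clamp1 [measurable]: "clamp1 n \<in> borel_measurable borel"
  by (rule borel_measurable_continuous_onI[OF continuous_clamp1])

text \<open>Clamping the approximating continuous functions keeps them bounded by \<open>n\<close>
  and does not disturb the limit, so dominated convergence becomes applicable.\<close>

lemma AE_limit_continuous:
  fixes V :: "real \<Rightarrow> real"
  assumes "V \<in> borel_measurable borel" and b: "\<And>x. \<bar>V x\<bar> \<le> n"
  shows "\<exists>g. (\<forall>k. continuous_on UNIV (g k)) \<and> (\<forall>k x. \<bar>g k x\<bar> \<le> n) \<and> (AE x in lborel. (\<lambda>k. g k x) \<longlonglongrightarrow> V x)"
proof -
  have n: "n \<ge> 0" using order_trans[OF abs_ge_zero b] .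
  have "V \<in> borel_measurable lebesgue" by (rule measurable_completion) (use assms(1) in simp)
  then have "V measurable_on UNIV" by (intro lebesgue_measurable_imp_measurable_on_real) auto
  then obtain N g where N: "negligible N" and g: "\<And>k. continuous_on UNIV (g k)" "\<And>x. x \<notin> N \<Longrightarrow> (\<lambda>k. g k x) \<longlonglongrightarrow> V x"
    unfolding measurable_on_def by auto
  have "AE x in lebesgue. x \<notin> N" using N by (intro AE_not_in) (simp add: negligible_iff_null_sets)
  then have ae: "AE x in lborel. x \<notin> N" by (simp add: AE_completion_iff)
  have "AE x in lborel. (\<lambda>k. clamp1 n (g k x)) \<longlonglongrightarrow> V x"
    using ae
  proof (rule eventually_mono)
    fix x assume "x \<notin> N"
    then have "(\<lambda>k. clamp1 n (g k x)) \<longlonglongrightarrow> clamp1 n (V x)"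
      using continuous_on_tendsto_compose[OF continuous_clamp1 g(2)] by simp
    then show "(\<lambda>k. clamp1 n (g k x)) \<longlonglongrightarrow> V x" using clamp1_id[OF b] by simp
  qed
  moreover have "continuous_on UNIV (\<lambda>x. clamp1 n (g k x))" for k
    by (rule continuous_on_compose2[OF continuous_clamp1 g(1)]) auto
  ultimately show ?thesis using clamp1_bound[OF n] by (intro exI[of _ "\<lambda>k x. clamp1 n (g k x)"]) auto
qed

lemma real_polynomial_function_poly:
  assumes "real_polynomial_function p" obtains q where "p = poly q"
proof -
  obtain a n where a: "p = (\<lambda>x. \<Sum>i\<le>n. a i * x^i)" using assms real_polynomial_function_iff_sum by auto
  have "p = poly (\<Sum>i\<le>n. monom (a i) i)" unfolding a by (simp add: fun_eq_iff poly_sum poly_monom)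
  then show ?thesis by (rule that)
qed

text \<open>\<open>sin\<close> identifies the closed angle interval with \<open>[-1, 1]\<close>,
  where Stone-Weierstrass provides the polynomial.\<close>

lemma poly_approx_sin:
  assumes g: "continuous_on UNIV g" and e: "e > 0"
  shows "\<exists>q. \<forall>al\<in>{-(pi/2)..pi/2}. \<bar>g al - poly q (sin al)\<bar> < (e::real)"
proof -
  have "continuous_on {-1..1} (\<lambda>y. g (arcsin y))"
    by (rule continuous_on_compose2[OF g]) (auto intro!: continuous_intros)
  then obtain p where p: "real_polynomial_function p" "\<And>y. y \<in> {-1..1} \<Longrightarrow> \<bar>g (arcsin y) - p y\<bar> < e"
    using Stone_Weierstrass_real_polynomial_function[of "{-1..1::real}" "\<lambda>y. g (arcsin y)" e] e by auto
  obtain q where q: "p = poly q" using real_polynomial_function_poly[OF p(1)] .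
  have "\<bar>g al - poly q (sin al)\<bar> < e" if "al \<in> {-(pi/2)..pi/2}" for al
    using p(2)[of "sin al"] that unfolding q by (simp add: arcsin_sin)
  then show ?thesis by blast
qed

context disk_weight
begin

lemma AE_lborel_mA: "AE x in lborel. P x \<Longrightarrow> AE x in mA \<gamma>. P x"
  unfolding mA_def by (subst AE_density) (auto elim: eventually_mono)

lemma L2_small_limit:
  fixes g :: "nat \<Rightarrow> real \<Rightarrow> real"
  assumes [measurable]: "\<And>k. g k \<in> borel_measurable borel" and w: "integrable (mA \<gamma>) w"
    and b: "\<And>k x. (g k x)^2 \<le> w x" and lim: "AE x in mA \<gamma>. (\<lambda>k. g k x) \<longlonglongrightarrow> 0" and e: "e > 0"
  shows "\<exists>k. (LINT x|mA \<gamma>. (g k x)^2) < e"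
proof -
  have "(\<lambda>k. LINT x|mA \<gamma>. (g k x)^2) \<longlonglongrightarrow> (LINT x|mA \<gamma>. 0)"
  proof (rule integral_dominated_convergence[OF _ _ w])
    show "AE x in mA \<gamma>. (\<lambda>k. (g k x)^2) \<longlonglongrightarrow> 0"
      using lim by (rule eventually_mono) (auto intro: tendsto_eq_intros)
    show "AE x in mA \<gamma>. norm ((g k x)^2) \<le> w x" for k using b by auto
  qed auto
  then have "eventually (\<lambda>k. (LINT x|mA \<gamma>. (g k x)^2) < e) sequentially" using e by (intro order_tendstoD) auto
  then show ?thesis by (auto simp: eventually_sequentially)
qed

lemma poly_dense_L2:
  assumes [measurable]: "U \<in> borel_measurable borel" and U2: "integrable (mA \<gamma>) (\<lambda>al. (U al)^2)" and e: "e > 0"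
  shows "\<exists>q. (LINT al|mA \<gamma>. (U al - poly q (sin al))^2) < e"
proof -
  \<comment> \<open>Three errors below \<open>d\<close> (truncation, continuous approximation,
    polynomial approximation), each entering with the factor 3 of
    \<open>(x + y + z)^2 <= 3*x^2 + 3*y^2 + 3*z^2\<close>.\<close>
  define d where "d = e / 9"
  have d: "d > 0" using e by (simp add: d_def)
  have "\<exists>n::nat. (LINT al|mA \<gamma>. (U al - clamp1 (real n) (U al))^2) < d"
  proof (rule L2_small_limit[OF _ U2 _ _ d])
    show "(U x - clamp1 (real k) (U x))^2 \<le> (U x)^2" for k x
      using clamp1_diff[of "real k" "U x"] abs_le_square_iff by auto
    show "AE x in mA \<gamma>. (\<lambda>k. U x - clamp1 (real k) (U x)) \<longlonglongrightarrow> 0"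
    proof (rule AE_I2)
      fix x
      obtain m :: nat where m: "\<bar>U x\<bar> \<le> real m" using real_arch_simple by blast
      have "eventually (\<lambda>k. U x - clamp1 (real k) (U x) = 0) sequentially"
        using eventually_ge_at_top[of m] by (rule eventually_mono) (use m in \<open>auto intro!: clamp1_id[symmetric]\<close>)
      then show "(\<lambda>k. U x - clamp1 (real k) (U x)) \<longlonglongrightarrow> 0" by (rule tendsto_eventually)
    qed
  qed measurable
  then obtain n :: nat where n: "(LINT al|mA \<gamma>. (U al - clamp1 (real n) (U al))^2) < d" by blast
  define V where "V al = clamp1 (real n) (U al)" for al
  have Vm [measurable]: "V \<in> borel_measurable borel" unfolding V_def[abs_def] by measurable
  have Vb: "\<bar>V x\<bar> \<le> real n" for x unfolding V_def by (rule clamp1_bound) simp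
  obtain g where g: "\<And>k. continuous_on UNIV (g k)" "\<And>k x. \<bar>g k x\<bar> \<le> real n" "AE x in lborel. (\<lambda>k. g k x) \<longlonglongrightarrow> V x"
    using AE_limit_continuous[OF Vm Vb] by blast
  have gm [measurable]: "g k \<in> borel_measurable borel" for k using g(1) by (rule borel_measurable_continuous_onI)
  have "\<exists>k. (LINT al|mA \<gamma>. (V al - g k al)^2) < d"
  proof (rule L2_small_limit[where w="\<lambda>_. (2 * real n)^2", OF _ _ _ _ d])
    show "(V x - g k x)^2 \<le> (2 * real n)^2" for k x
    proof -
      have "\<bar>V x - g k x\<bar> \<le> \<bar>2 * real n\<bar>" using Vb[of x] g(2)[of k x] by linarith
      then show ?thesis unfolding abs_le_square_iff .
    qed
    show "AE x in mA \<gamma>. (\<lambda>k. V x - g k x) \<longlonglongrightarrow> 0"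
      using AE_lborel_mA[OF g(3)] by (rule eventually_mono) (auto intro: tendsto_eq_intros)
  qed auto
  then obtain k where k: "(LINT al|mA \<gamma>. (V al - g k al)^2) < d" by blast
  \<comment> \<open>Chosen so that \<open>\<delta>^2\<close> times the total mass stays below
    \<open>d\<close>; the summand 1 makes positivity of the denominator immediate.\<close>
  define \<delta> where "\<delta> = sqrt (d / (2 * (measure (mA \<gamma>) UNIV + 1)))"
  have mp: "measure (mA \<gamma>) UNIV + 1 > 0" by (simp add: add_nonneg_pos)
  have dl: "\<delta> > 0" unfolding \<delta>_def using d mp by simp
  obtain q where q: "\<And>al. al \<in> {-(pi/2)..pi/2} \<Longrightarrow> \<bar>g k al - poly q (sin al)\<bar> < \<delta>"
    using poly_approx_sin[OF g(1) dl] by blast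
  obtain B where B: "B \<ge> 0" "\<And>y. \<bar>y\<bar> \<le> 1 \<Longrightarrow> \<bar>poly q y\<bar> \<le> B" using poly_bounded[of q] by blast
  have i3: "integrable (mA \<gamma>) (\<lambda>al. (g k al - poly q (sin al))^2)"
  proof (rule A.integrable_const_bound[where B="(real n + B)^2"])
    have "\<bar>g k x - poly q (sin x)\<bar> \<le> \<bar>real n + B\<bar>" for x using g(2)[of k x] B(2)[of "sin x"] B(1) by simp
    then show "AE x in mA \<gamma>. norm ((g k x - poly q (sin x))^2) \<le> (real n + B)^2" unfolding abs_le_square_iff by simp
  qed measurable
  have i2: "integrable (mA \<gamma>) (\<lambda>al. (V al - g k al)^2)"
  proof (rule A.integrable_const_bound[where B="(2 * real n)^2"])
    have "\<bar>V x - g k x\<bar> \<le> \<bar>2 * real n\<bar>" for x using Vb[of x] g(2)[of k x] by linarith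
    then show "AE x in mA \<gamma>. norm ((V x - g k x)^2) \<le> (2 * real n)^2" unfolding abs_le_square_iff by simp
  qed measurable
  have i1: "integrable (mA \<gamma>) (\<lambda>al. (U al - V al)^2)"
    by (rule Bochner_Integration.integrable_bound[OF U2])
      (use clamp1_diff[of "real n"] abs_le_square_iff in \<open>auto simp: V_def\<close>)
  have "(LINT al|mA \<gamma>. (g k al - poly q (sin al))^2) \<le> (LINT al|mA \<gamma>. \<delta>^2)"
  proof (rule integral_mono_AE[OF i3])
    show "AE al in mA \<gamma>. (g k al - poly q (sin al))^2 \<le> \<delta>^2"
    proof (rule eventually_mono[OF AE_mA_Iang])
      fix al assume "al \<in> Iang"
      then have "\<bar>g k al - poly q (sin al)\<bar> \<le> \<bar>\<delta>\<bar>" using q[of al] dl by auto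
      then show "(g k al - poly q (sin al))^2 \<le> \<delta>^2" unfolding abs_le_square_iff .
    qed
  qed simp
  also have "... = measure (mA \<gamma>) UNIV * (d / (2 * (measure (mA \<gamma>) UNIV + 1)))" unfolding \<delta>_def using d mp by simp
  also have "... < d"
  proof -
    have "measure (mA \<gamma>) UNIV * d < d * (2 * (measure (mA \<gamma>) UNIV + 1))"
      using d measure_nonneg[of "mA \<gamma>" UNIV] by (simp add: algebra_simps add_pos_nonneg)
    then show ?thesis using mp by (simp add: divide_less_eq mult.commute)
  qed
  finally have 3: "(LINT al|mA \<gamma>. (g k al - poly q (sin al))^2) < d" .
  have "(LINT al|mA \<gamma>. (U al - poly q (sin al))^2) \<le> (LINT al|mA \<gamma>. 3 * (U al - V al)^2 + 3 * (V al - g k al)^2 + 3 * (g k al - poly q (sin al))^2)"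
  proof (rule integral_mono')
    show "integrable (mA \<gamma>) (\<lambda>al. 3 * (U al - V al)^2 + 3 * (V al - g k al)^2 + 3 * (g k al - poly q (sin al))^2)" using i1 i2 i3 by simp
    fix al
    define x y z where "x = U al - V al" and "y = V al - g k al" and "z = g k al - poly q (sin al)"
    have "(x + y + z)^2 = 3 * x^2 + 3 * y^2 + 3 * z^2 - (x - y)^2 - (y - z)^2 - (x - z)^2" by algebra
    then have "(x + y + z)^2 \<le> 3 * x^2 + 3 * y^2 + 3 * z^2"
      using zero_le_power2[of "x - y"] zero_le_power2[of "y - z"] zero_le_power2[of "x - z"] by linarith
    moreover have "x + y + z = U al - poly q (sin al)" unfolding x_def y_def z_def by simp
    ultimately show "(U al - poly q (sin al))^2 \<le> 3 * (U al - V al)^2 + 3 * (V al - g k al)^2 + 3 * (g k al - poly q (sin al))^2"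
      unfolding x_def y_def z_def by simp
  qed simp
  also have "... = 3 * (LINT al|mA \<gamma>. (U al - V al)^2) + 3 * (LINT al|mA \<gamma>. (V al - g k al)^2) + 3 * (LINT al|mA \<gamma>. (g k al - poly q (sin al))^2)"
    using i1 i2 i3 by simp
  also have "... < 3 * d + 3 * d + 3 * d" using n k 3 unfolding V_def by linarith
  also have "... = e" by (simp add: d_def)
  finally show ?thesis by blast
qed

text \<open>The orthogonal projection to polynomials of degree at most \<open>J\<close>; the factor
  \<open>2 * pi\<close> compensates the squared norm \<open>1 / (2*pi)\<close> of
  \<open>pg m\<close>.\<close>

definition SJ :: "(real \<Rightarrow> real) \<Rightarrow> nat \<Rightarrow> real \<Rightarrow> real" where
  "SJ U J al = (\<Sum>m\<le>J. 2 * pi * (LINT al|mA \<gamma>. poly (pg m) (sin al) * U al) * poly (pg m) (sin al))"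

lemma integrable_from_square:
  assumes "U \<in> borel_measurable borel" "integrable (mA \<gamma>) (\<lambda>al. (U al)^2)"
  shows "integrable (mA \<gamma>) (\<lambda>al. poly q (sin al) * U al)"
proof -
  obtain B where B: "B \<ge> 0" "\<And>y. \<bar>y\<bar> \<le> 1 \<Longrightarrow> \<bar>poly q y\<bar> \<le> B" using poly_bounded[of q] by blast
  show ?thesis
  proof (rule Bochner_Integration.integrable_bound[of _ "\<lambda>al. B^2 + (U al)^2"])
    show "AE al in mA \<gamma>. norm (poly q (sin al) * U al) \<le> norm (B^2 + (U al)^2)"
    proof (rule AE_I2)
      fix al
      have "\<bar>poly q (sin al) * U al\<bar> \<le> B * \<bar>U al\<bar>" using B by (simp add: abs_mult mult_right_mono)
      also have "... \<le> B^2 + \<bar>U al\<bar>^2" using sum_squares_bound[of B "\<bar>U al\<bar>"] mult_nonneg_nonneg[OF B(1) abs_ge_zero[of "U al"]] by simp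
      finally show "norm (poly q (sin al) * U al) \<le> norm (B^2 + (U al)^2)" by simp
    qed
  qed (use assms in auto)
qed

lemma L2_expand:
  assumes U: "U \<in> borel_measurable borel" and U2: "integrable (mA \<gamma>) (\<lambda>al. (U al)^2)"
  defines "a \<equiv> \<lambda>m. (LINT al|mA \<gamma>. poly (pg m) (sin al) * U al)"
  shows "(LINT al|mA \<gamma>. (U al - (\<Sum>j\<le>J. c j * poly (pg j) (sin al)))^2) = (LINT al|mA \<gamma>. (U al)^2) - 2 * (\<Sum>j\<le>J. c j * a j) + (\<Sum>j\<le>J. (c j)^2) / (2*pi)"
proof -
  have i1: "integrable (mA \<gamma>) (\<lambda>al. c j * (poly (pg j) (sin al) * U al))" for j using integrable_from_square[OF U U2] by simp
  have i2: "integrable (mA \<gamma>) (\<lambda>al. c i * c j * (poly (pg i) (sin al) * poly (pg j) (sin al)))" for i j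
    using integrable_poly_sin[of "pg i * pg j"] by simp
  have "(LINT al|mA \<gamma>. (U al - (\<Sum>j\<le>J. c j * poly (pg j) (sin al)))^2)
     = (LINT al|mA \<gamma>. (U al)^2 - 2 * (\<Sum>j\<le>J. c j * (poly (pg j) (sin al) * U al)) + (\<Sum>i\<le>J. \<Sum>j\<le>J. c i * c j * (poly (pg i) (sin al) * poly (pg j) (sin al))))"
  proof (rule Bochner_Integration.integral_cong[OF refl])
    fix al
    let ?S = "\<Sum>j\<le>J. c j * poly (pg j) (sin al)"
    have "(U al - ?S)^2 = (U al)^2 - 2 * (?S * U al) + ?S * ?S" by (simp add: power2_eq_square algebra_simps)
    moreover have "?S * U al = (\<Sum>j\<le>J. c j * (poly (pg j) (sin al) * U al))" by (simp add: sum_distrib_right mult.assoc)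
    moreover have "?S * ?S = (\<Sum>i\<le>J. \<Sum>j\<le>J. c i * c j * (poly (pg i) (sin al) * poly (pg j) (sin al)))" unfolding sum_product by (simp add: mult_ac)
    ultimately show "(U al - ?S)^2 = (U al)^2 - 2 * (\<Sum>j\<le>J. c j * (poly (pg j) (sin al) * U al)) + (\<Sum>i\<le>J. \<Sum>j\<le>J. c i * c j * (poly (pg i) (sin al) * poly (pg j) (sin al)))" by simp
  qed
  also have "... = (LINT al|mA \<gamma>. (U al)^2) - 2 * (\<Sum>j\<le>J. c j * a j) + (\<Sum>i\<le>J. \<Sum>j\<le>J. c i * c j * (if i = j then 1 / (2*pi) else 0))"
    unfolding a_def using U2 i1 i2 pg_ortho by (simp add: Bochner_Integration.integral_sum)
  also have "(\<Sum>i\<le>J. \<Sum>j\<le>J. c i * c j * (if i = j then 1 / (2*pi) else 0)) = (\<Sum>j\<le>J. (c j)^2) / (2*pi)"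
  proof -
    have "(\<Sum>j\<le>J. c i * c j * (if i = j then 1 / (2*pi) else 0)) = (c i)^2 / (2*pi)" if "i \<le> J" for i
      by (subst sum.mono_neutral_right[of "{..J}" "{i}"]) (use that in \<open>auto simp: power2_eq_square\<close>)
    then show ?thesis by (simp add: sum_divide_distrib)
  qed
  finally show ?thesis .
qed

text \<open>By \<open>L2_expand\<close> the error is a quadratic in the coefficients, and completing
  the square identifies its minimum.\<close>

lemma L2_best:
  assumes U: "U \<in> borel_measurable borel" and U2: "integrable (mA \<gamma>) (\<lambda>al. (U al)^2)" and q: "degree q \<le> J"
  shows "(LINT al|mA \<gamma>. (U al - SJ U J al)^2) \<le> (LINT al|mA \<gamma>. (U al - poly q (sin al))^2)"
proof -
  obtain c where c: "q = (\<Sum>j\<le>J. smult (c j) (pg j))" using pg_span[OF q] by blast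
  define a where "a = (\<lambda>m. (LINT al|mA \<gamma>. poly (pg m) (sin al) * U al))"
  have 1: "(LINT al|mA \<gamma>. (U al - poly q (sin al))^2) = (LINT al|mA \<gamma>. (U al)^2) - 2 * (\<Sum>j\<le>J. c j * a j) + (\<Sum>j\<le>J. (c j)^2) / (2*pi)"
    unfolding c a_def using L2_expand[OF U U2, of c J] by (simp add: poly_sum)
  have 2: "(LINT al|mA \<gamma>. (U al - SJ U J al)^2) = (LINT al|mA \<gamma>. (U al)^2) - 2 * (\<Sum>j\<le>J. (2*pi*a j) * a j) + (\<Sum>j\<le>J. (2*pi*a j)^2) / (2*pi)"
    unfolding SJ_def a_def using L2_expand[OF U U2, of "\<lambda>j. 2*pi*(LINT al|mA \<gamma>. poly (pg j) (sin al) * U al)" J] by simp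
  have "0 \<le> (\<Sum>j\<le>J. (c j - 2*pi*a j)^2) / (2*pi)" by (intro divide_nonneg_pos sum_nonneg) auto
  also have "... = (- 2 * (\<Sum>j\<le>J. c j * a j) + (\<Sum>j\<le>J. (c j)^2) / (2*pi)) - (- 2 * (\<Sum>j\<le>J. (2*pi*a j) * a j) + (\<Sum>j\<le>J. (2*pi*a j)^2) / (2*pi))"
  proof -
    have "(c j - 2*pi*a j)^2 / (2*pi) = - 2 * (c j * a j) + (c j)^2 / (2*pi) - (- 2 * ((2*pi*a j) * a j) + (2*pi*a j)^2 / (2*pi))" for j
      by (simp add: power2_eq_square field_simps)
    then show ?thesis unfolding sum_divide_distrib sum_distrib_left sum.distrib[symmetric] sum_subtractf[symmetric] by simp
  qed
  finally show ?thesis unfolding 1 2 by linarith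
qed

lemma L2_converge:
  assumes U: "U \<in> borel_measurable borel" and U2: "integrable (mA \<gamma>) (\<lambda>al. (U al)^2)"
  shows "(\<lambda>J. LINT al|mA \<gamma>. (U al - SJ U J al)^2) \<longlonglongrightarrow> 0"
    "(LINT al|mA \<gamma>. (U al - SJ U J al)^2) \<le> (LINT al|mA \<gamma>. (U al)^2)"
proof -
  show "(LINT al|mA \<gamma>. (U al - SJ U J al)^2) \<le> (LINT al|mA \<gamma>. (U al)^2)" using L2_best[OF U U2, of 0 J] by simp
  show "(\<lambda>J. LINT al|mA \<gamma>. (U al - SJ U J al)^2) \<longlonglongrightarrow> 0"
  proof (rule LIMSEQ_I)
    fix e :: real assume e: "e > 0"
    obtain q where q: "(LINT al|mA \<gamma>. (U al - poly q (sin al))^2) < e" using poly_dense_L2[OF U U2 e] by blast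
    have "norm ((LINT al|mA \<gamma>. (U al - SJ U J al)^2) - 0) < e" if "J \<ge> degree q" for J
      using L2_best[OF U U2 that] q by simp
    then show "\<exists>no. \<forall>J\<ge>no. norm ((LINT al|mA \<gamma>. (U al - SJ U J al)^2) - 0) < e" by blast
  qed
qed

text \<open>Truncated inversion of the transform: each \<open>Zk m k\<close> is multiplied by
  \<open>sigma2 \<gamma> m k\<close> under it, and \<open>2*pi\<close> comes from the norm of
  \<open>pg m\<close>. Its image is the projection \<open>SJ\<close> of \<open>UU\<close> when
  \<open>M\<close> is the moment array.\<close>

definition FJ :: "(nat \<Rightarrow> nat \<Rightarrow> complex) \<Rightarrow> nat \<Rightarrow> complex \<Rightarrow> complex" where
  "FJ M J z = (\<Sum>m\<le>J. \<Sum>k\<le>m. (complex_of_real (2*pi) * M m k / complex_of_real (sigma2 \<gamma> m k)) * Zk m k z)"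

lemma FJ_measurable [measurable]: "FJ M J \<in> borel_measurable borel"
  unfolding FJ_def[abs_def] by measurable

lemma FJ_bounded: "\<exists>B. \<forall>z. cmod (FJ M J z) \<le> B"
proof -
  obtain B where B: "\<And>m k z. cmod (Zk m k z) \<le> B m k" using Zk_bounded by metis
  have "cmod (FJ M J z) \<le> (\<Sum>m\<le>J. \<Sum>k\<le>m. cmod (complex_of_real (2*pi) * M m k / complex_of_real (sigma2 \<gamma> m k)) * B m k)" for z
    unfolding FJ_def by (intro sum_norm_le) (auto simp only: norm_mult intro!: mult_left_mono B norm_ge_zero)
  then show ?thesis by blast
qed

lemma UU_IHw_sum:
  assumes a: "al \<in> Iang" and [measurable]: "\<And>i. i \<in> I \<Longrightarrow> f i \<in> borel_measurable borel" and B: "\<And>i z. i \<in> I \<Longrightarrow> cmod (f i z) \<le> B i"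
  shows "UU \<gamma> (IHw \<gamma> (\<lambda>z. \<Sum>i\<in>I. c i * f i z)) om al = (\<Sum>i\<in>I. c i * UU \<gamma> (IHw \<gamma> (f i)) om al)"
proof -
  have int: "integrable (mT \<gamma>) (\<lambda>T. f i (zc om al T))" if i: "i \<in> I" for i
  proof -
    have [measurable]: "f i \<in> borel_measurable borel" using assms(2) i by blast
    show ?thesis by (rule T.integrable_const_bound[where B="B i"]) (use B i in auto)
  qed
  have "UU \<gamma> (IHw \<gamma> (\<lambda>z. \<Sum>i\<in>I. c i * f i z)) om al = (LINT T|mT \<gamma>. (\<Sum>i\<in>I. c i * f i (zc om al T)))"
    by (rule UU_IHw[OF a]) measurable
  also have "... = (\<Sum>i\<in>I. c i * (LINT T|mT \<gamma>. f i (zc om al T)))"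
    using int by (subst Bochner_Integration.integral_sum) auto
  also have "... = (\<Sum>i\<in>I. c i * UU \<gamma> (IHw \<gamma> (f i)) om al)"
    using assms(2) by (intro sum.cong refl) (simp add: UU_IHw[OF a])
  finally show ?thesis .
qed

lemma UU_FJ:
  assumes a: "al \<in> Iang"
  shows "UU \<gamma> (IHw \<gamma> (FJ M J)) om al = (\<Sum>m\<le>J. complex_of_real (2*pi) * trig m (M m) om * complex_of_real (poly (pg m) (sin al)))"
proof -
  obtain B where B: "\<And>m k z. cmod (Zk m k z) \<le> B m k" using Zk_bounded by metis
  let ?c = "\<lambda>p. complex_of_real (2*pi) * M (fst p) (snd p) / complex_of_real (sigma2 \<gamma> (fst p) (snd p))"
  let ?I = "SIGMA m:{..J}. {..m}"
  have "FJ M J = (\<lambda>z. \<Sum>p\<in>?I. ?c p * Zk (fst p) (snd p) z)"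
    unfolding FJ_def[abs_def] by (subst sum.Sigma) (auto simp: case_prod_beta')
  then have "UU \<gamma> (IHw \<gamma> (FJ M J)) om al = (\<Sum>p\<in>?I. ?c p * UU \<gamma> (IHw \<gamma> (Zk (fst p) (snd p))) om al)"
    using UU_IHw_sum[OF a, of ?I "\<lambda>p. Zk (fst p) (snd p)" "\<lambda>p. B (fst p) (snd p)" ?c] B by simp
  also have "... = (\<Sum>m\<le>J. \<Sum>k\<le>m. complex_of_real (2*pi) * M m k / complex_of_real (sigma2 \<gamma> m k) * UU \<gamma> (IHw \<gamma> (Zk m k)) om al)"
    by (subst sum.Sigma) (auto simp: case_prod_beta')
  also have "... = (\<Sum>m\<le>J. \<Sum>k\<le>m. complex_of_real (2*pi) * (M m k * cis ((real m - 2 * real k) * om)) * complex_of_real (poly (pg m) (sin al)))"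
  proof (intro sum.cong refl)
    fix m k :: nat assume "k \<in> {..m}"
    then have k: "k \<le> m" by simp
    show "complex_of_real (2*pi) * M m k / complex_of_real (sigma2 \<gamma> m k) * UU \<gamma> (IHw \<gamma> (Zk m k)) om al = complex_of_real (2*pi) * (M m k * cis ((real m - 2 * real k) * om)) * complex_of_real (poly (pg m) (sin al))"
      unfolding UU_IHw_Zk[OF a k] using sigma2_pos[OF k] by simp
  qed
  also have "... = (\<Sum>m\<le>J. complex_of_real (2*pi) * trig m (M m) om * complex_of_real (poly (pg m) (sin al)))"
    unfolding trig_def sum_distrib_left sum_distrib_right ..
  finally show ?thesis .
qed

text \<open>The second claim supplies the dominating function for integrating over \<open>om\<close>
  in \<open>partial_sums_converge\<close>.\<close>

lemma L2_converge_complex: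
  assumes [measurable]: "U \<in> borel_measurable borel" and i1: "integrable (mA \<gamma>) U" and i2: "integrable (mA \<gamma>) (\<lambda>al. (cmod (U al))^2)"
  defines "S \<equiv> \<lambda>J al. (\<Sum>m\<le>J. complex_of_real (2*pi) * (LINT al|mA \<gamma>. complex_of_real (poly (pg m) (sin al)) * U al) * complex_of_real (poly (pg m) (sin al)))"
  shows "(\<lambda>J. \<integral>\<^sup>+al. ennreal ((cmod (S J al - U al))^2) \<partial>mA \<gamma>) \<longlonglongrightarrow> 0"
    and "(\<integral>\<^sup>+al. ennreal ((cmod (S J al - U al))^2) \<partial>mA \<gamma>) \<le> (\<integral>\<^sup>+al. ennreal ((cmod (U al))^2) \<partial>mA \<gamma>)"
proof -
  define R I where "R = (\<lambda>al. Re (U al))" and "I = (\<lambda>al. Im (U al))"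
  have m [measurable]: "R \<in> borel_measurable borel" "I \<in> borel_measurable borel" unfolding R_def I_def by measurable
  have cm: "(cmod x)^2 = (Re x)^2 + (Im x)^2" for x by (rule cmod_power2)
  have R2: "integrable (mA \<gamma>) (\<lambda>al. (R al)^2)" and I2: "integrable (mA \<gamma>) (\<lambda>al. (I al)^2)"
    by (rule Bochner_Integration.integrable_bound[OF i2]; force simp: R_def I_def cm)+
  have ip: "integrable (mA \<gamma>) (\<lambda>al. complex_of_real (poly (pg m) (sin al)) * U al)" for m by (rule integrable_poly_mult[OF i1])
  have SR: "Re (S J al) = SJ R J al" and SI: "Im (S J al) = SJ I J al" for J al
    unfolding S_def SJ_def R_def I_def using integral_Re[OF ip] integral_Im[OF ip] by (simp_all add: mult_ac)
  have SJint: "integrable (mA \<gamma>) (\<lambda>al. (V al - SJ V J al)^2)" if V [measurable]: "V \<in> borel_measurable borel" and V2: "integrable (mA \<gamma>) (\<lambda>al. (V al)^2)" for V J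
  proof -
    define q where "q = (\<Sum>m\<le>J. smult (2 * pi * (LINT al|mA \<gamma>. poly (pg m) (sin al) * V al)) (pg m))"
    have q: "SJ V J al = poly q (sin al)" for al unfolding SJ_def q_def by (simp add: poly_sum)
    have "(\<lambda>al. (V al - SJ V J al)^2) = (\<lambda>al. (V al)^2 - 2 * (poly q (sin al) * V al) + poly (q^2) (sin al))"
      unfolding q by (simp add: fun_eq_iff power2_eq_square algebra_simps)
    then show ?thesis using V2 integrable_from_square[OF V V2, of q] integrable_poly_sin[of "q^2"] by simp
  qed
  define E where "E J = (LINT al|mA \<gamma>. (R al - SJ R J al)^2) + (LINT al|mA \<gamma>. (I al - SJ I J al)^2)" for J
  have E: "(\<integral>\<^sup>+al. ennreal ((cmod (S J al - U al))^2) \<partial>mA \<gamma>) = ennreal (E J)" for J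
  proof -
    have eq: "(cmod (S J al - U al))^2 = (R al - SJ R J al)^2 + (I al - SJ I J al)^2" for al
      unfolding cm by (simp add: SR SI R_def I_def power2_commute)
    show ?thesis unfolding eq E_def using SJint[OF m(1) R2, of J] SJint[OF m(2) I2, of J]
      by (subst nn_integral_eq_integral) auto
  qed
  have "E \<longlonglongrightarrow> 0 + 0" unfolding E_def by (intro tendsto_add L2_converge m R2 I2)
  then show "(\<lambda>J. \<integral>\<^sup>+al. ennreal ((cmod (S J al - U al))^2) \<partial>mA \<gamma>) \<longlonglongrightarrow> 0"
    unfolding E using tendsto_ennrealI[of E 0] by simp
  have "(\<integral>\<^sup>+al. ennreal ((cmod (U al))^2) \<partial>mA \<gamma>) = ennreal ((LINT al|mA \<gamma>. (R al)^2) + (LINT al|mA \<gamma>. (I al)^2))"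
    unfolding cm R_def[symmetric, THEN fun_cong] I_def[symmetric, THEN fun_cong] using R2 I2 by (subst nn_integral_eq_integral) (auto simp: R_def I_def)
  moreover have "E J \<le> (LINT al|mA \<gamma>. (R al)^2) + (LINT al|mA \<gamma>. (I al)^2)"
    unfolding E_def by (intro add_mono L2_converge m R2 I2)
  ultimately show "(\<integral>\<^sup>+al. ennreal ((cmod (S J al - U al))^2) \<partial>mA \<gamma>) \<le> (\<integral>\<^sup>+al. ennreal ((cmod (U al))^2) \<partial>mA \<gamma>)"
    unfolding E by (simp only: ennreal_leI)
qed

text \<open>For almost every \<open>om\<close> the moment identities make \<open>UU\<close> of the
  image of \<open>FJ M J\<close> the \<open>J\<close>-th projection of
  \<open>UU \<gamma> u om\<close>. Completeness gives convergence on each fibre, dominated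
  convergence the rest.\<close>

lemma partial_sums_converge:
  assumes u: "goodG u" and M: "\<And>m. AE om in lborel. moment_int u (poly (pg m)) om = trig m (M m) om"
  shows "(\<lambda>J. L2G_dist2 \<gamma> (IHw \<gamma> (FJ M J)) u) \<longlonglongrightarrow> 0"
proof -
  have um [measurable]: "u \<in> borel_measurable borel" and p: "\<And>\<beta> a. u (\<beta> + 2*pi, a) = u (\<beta>, a)" and fin: "L2G_dist2 \<gamma> u (\<lambda>_. 0) < \<infinity>"
    using u unfolding goodG_def by auto
  define S where "S J om al = (\<Sum>m\<le>J. complex_of_real (2*pi) * trig m (M m) om * complex_of_real (poly (pg m) (sin al)))" for J om al
  have tm [measurable]: "trig m M \<in> borel_measurable borel" for m M unfolding trig_def[abs_def] by measurable
  have Sm [measurable (raw)]: "(\<lambda>x. S J (f x) (g x)) \<in> borel_measurable N" if [measurable]: "f \<in> borel_measurable N" "g \<in> borel_measurable N" for J f g and N :: "(real \<times> real) measure"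
    unfolding S_def by measurable
  have Sm1 [measurable (raw)]: "(\<lambda>x. S J (f x) (g x)) \<in> borel_measurable N" if [measurable]: "f \<in> borel_measurable N" "g \<in> borel_measurable N" for J f g and N :: "real measure"
    unfolding S_def by measurable
  have eq: "L2G_dist2 \<gamma> (IHw \<gamma> (FJ M J)) u = (\<integral>\<^sup>+om. \<integral>\<^sup>+al. ennreal ((cmod (S J om al - UU \<gamma> u om al))^2) \<partial>mA \<gamma> \<partial>mO)" for J
    by (subst L2G_dist2_eq[OF gam], measurable, rule IHw_periodic, rule p)
       (intro nn_integral_cong nn_integral_cong_AE eventually_mono[OF AE_mA_Iang], simp add: UU_FJ S_def)
  have "AE om in lborel. \<forall>m. moment_int u (poly (pg m)) om = trig m (M m) om" using M by (subst AE_all_countable) blast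
  then have aeM: "AE om in mO. \<forall>m. moment_int u (poly (pg m)) om = trig m (M m) om"
    unfolding mO_def by (subst AE_density) (auto elim: eventually_mono)
  have main: "AE om in mO. (\<lambda>J. \<integral>\<^sup>+al. ennreal ((cmod (S J om al - UU \<gamma> u om al))^2) \<partial>mA \<gamma>) \<longlonglongrightarrow> 0 \<and>
      (\<forall>J. (\<integral>\<^sup>+al. ennreal ((cmod (S J om al - UU \<gamma> u om al))^2) \<partial>mA \<gamma>) \<le> (\<integral>\<^sup>+al. ennreal ((cmod (UU \<gamma> u om al))^2) \<partial>mA \<gamma>))"
    using aeM goodG_AE[OF u]
  proof eventually_elim
    case (elim om)
    have e: "S J om al = (\<Sum>m\<le>J. complex_of_real (2*pi) * (LINT al|mA \<gamma>. complex_of_real (poly (pg m) (sin al)) * UU \<gamma> u om al) * complex_of_real (poly (pg m) (sin al)))" for J al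
      unfolding S_def using elim(1) moment_int_eq[OF um, of "poly (pg _)" om \<gamma>] by simp
    show ?case unfolding e using elim(2) by (intro conjI allI L2_converge_complex) auto
  qed
  have "(\<lambda>J. \<integral>\<^sup>+om. \<integral>\<^sup>+al. ennreal ((cmod (S J om al - UU \<gamma> u om al))^2) \<partial>mA \<gamma> \<partial>mO) \<longlonglongrightarrow> (\<integral>\<^sup>+om. 0 \<partial>mO)"
  proof (rule nn_integral_dominated_convergence[where w="\<lambda>om. \<integral>\<^sup>+al. ennreal ((cmod (UU \<gamma> u om al))^2) \<partial>mA \<gamma>"])
    show "(\<integral>\<^sup>+om. \<integral>\<^sup>+al. ennreal ((cmod (UU \<gamma> u om al))^2) \<partial>mA \<gamma> \<partial>mO) < \<infinity>"
      using fin L2G_dist2_eq[OF gam um, of "\<lambda>_. 0"] p by simp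
  qed (use main in \<open>auto elim: eventually_mono\<close>)
  then show ?thesis unfolding eq by simp
qed

end

section \<open>Families closed under differentiation\<close>

text \<open>Bookkeeping for smoothness with a parameter: if the derivative of each generator is
  again a polynomial expression in generators, then all members have continuous derivatives of every
  order.\<close>

inductive_set alg :: "('p \<Rightarrow> 'e \<Rightarrow> complex) set \<Rightarrow> ('p \<Rightarrow> 'e \<Rightarrow> complex) set" for G where
  gen: "a \<in> G \<Longrightarrow> a \<in> alg G"
| add: "a \<in> alg G \<Longrightarrow> b \<in> alg G \<Longrightarrow> (\<lambda>p x. a p x + b p x) \<in> alg G"
| mult: "a \<in> alg G \<Longrightarrow> b \<in> alg G \<Longrightarrow> (\<lambda>p x. a p x * b p x) \<in> alg G"

lemma alg_mono: "G \<subseteq> H \<Longrightarrow> a \<in> alg G \<Longrightarrow> a \<in> alg H"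
  by (erule alg.induct) (auto intro: alg.intros)

definition dir_deriv :: "('p \<times> 'e::real_normed_vector) set \<Rightarrow> 'e \<Rightarrow> ('p \<Rightarrow> 'e \<Rightarrow> complex) \<Rightarrow> ('p \<Rightarrow> 'e \<Rightarrow> complex) \<Rightarrow> bool" where
  "dir_deriv D v a a' \<longleftrightarrow> (\<forall>p x. (p, x) \<in> D \<longrightarrow> ((\<lambda>t. a p (x + t *\<^sub>R v)) has_vector_derivative a' p x) (at 0))"

definition alg_closed :: "('p::topological_space \<times> 'e::real_normed_vector) set \<Rightarrow> 'e set \<Rightarrow> ('p \<Rightarrow> 'e \<Rightarrow> complex) set \<Rightarrow> bool" where
  "alg_closed D V G \<longleftrightarrow> (\<forall>a\<in>G. continuous_on D (\<lambda>q. a (fst q) (snd q)) \<and> (\<forall>v\<in>V. \<exists>a'\<in>alg G. dir_deriv D v a a'))"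

lemma alg_closed_all:
  assumes G: "alg_closed D V G" and a: "a \<in> alg G"
  shows "continuous_on D (\<lambda>q. a (fst q) (snd q)) \<and> (\<forall>v\<in>V. \<exists>a'\<in>alg G. dir_deriv D v a a')"
  using a
proof induction
  case (gen a) then show ?case using G unfolding alg_closed_def by blast
next
  case (add a b)
  have "\<exists>c\<in>alg G. dir_deriv D v (\<lambda>p x. a p x + b p x) c" if v: "v \<in> V" for v
  proof -
    obtain a' b' where "a' \<in> alg G" "dir_deriv D v a a'" "b' \<in> alg G" "dir_deriv D v b b'" using add.IH v by blast
    then show ?thesis by (intro bexI[of _ "\<lambda>p x. a' p x + b' p x"] alg.add) (auto simp: dir_deriv_def intro!: has_vector_derivative_add)
  qed
  then show ?case using add.IH by (auto intro!: continuous_intros)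
next
  case (mult a b)
  have "\<exists>c\<in>alg G. dir_deriv D v (\<lambda>p x. a p x * b p x) c" if v: "v \<in> V" for v
  proof -
    obtain a' b' where a': "a' \<in> alg G" "dir_deriv D v a a'" "b' \<in> alg G" "dir_deriv D v b b'" using mult.IH v by blast
    have "dir_deriv D v (\<lambda>p x. a p x * b p x) (\<lambda>p x. a p x * b' p x + a' p x * b p x)"
      unfolding dir_deriv_def
    proof (intro allI impI)
      fix p x assume "(p, x) \<in> D"
      then have "((\<lambda>t. a p (x + t *\<^sub>R v)) has_vector_derivative a' p x) (at 0)" "((\<lambda>t. b p (x + t *\<^sub>R v)) has_vector_derivative b' p x) (at 0)"
        using a' unfolding dir_deriv_def by auto
      from has_vector_derivative_mult[OF this]
      show "((\<lambda>t. a p (x + t *\<^sub>R v) * b p (x + t *\<^sub>R v)) has_vector_derivative a p x * b' p x + a' p x * b p x) (at 0)" by simp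
    qed
    then show ?thesis using a' mult.hyps by (intro bexI[of _ "\<lambda>p x. a p x * b' p x + a' p x * b p x"]) (auto intro!: alg.add alg.mult)
  qed
  then show ?case using mult.IH by (auto intro!: continuous_intros)
qed

lemma dir_deriv_at:
  fixes a :: "'p \<Rightarrow> real \<Rightarrow> complex"
  assumes "dir_deriv D 1 a a'" "(p, x) \<in> D" shows "(a p has_vector_derivative a' p x) (at x)"
proof -
  have 1: "((\<lambda>t. a p (x + t)) has_vector_derivative a' p x) (at (x - x))" using assms unfolding dir_deriv_def by simp
  have 2: "((\<lambda>r. r - x) has_vector_derivative 1) (at x)" by (auto intro!: derivative_eq_intros)
  from vector_diff_chain_at[OF 2 1] show ?thesis by (simp add: o_def)
qed

text \<open>Iterating a choice of derivative inside \<open>alg G\<close>. Continuity is joint in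
  parameter and variable, which later yields bounds uniform over compact parameter sets.\<close>

lemma alg_chain:
  fixes G :: "('p::topological_space \<Rightarrow> real \<Rightarrow> complex) set"
  assumes G: "alg_closed D {1} G" and a: "a \<in> alg G"
  shows "\<exists>K. K 0 = a \<and> (\<forall>n. continuous_on D (\<lambda>q. K n (fst q) (snd q)) \<and>
     (\<forall>p x. (p, x) \<in> D \<longrightarrow> (K n p has_vector_derivative K (Suc n) p x) (at x)))"
proof -
  obtain d where d: "\<And>a. a \<in> alg G \<Longrightarrow> d a \<in> alg G \<and> dir_deriv D 1 a (d a)"
    using bchoice[of "alg G" "\<lambda>a a'. a' \<in> alg G \<and> dir_deriv D 1 a a'"] alg_closed_all[OF G] by blast
  define K where "K n = (d ^^ n) a" for n
  have K: "K n \<in> alg G" for n by (induction n) (use a d in \<open>auto simp: K_def\<close>)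
  have dd: "dir_deriv D 1 (K n) (K (Suc n))" for n using d[OF K[of n]] by (simp add: K_def)
  have "continuous_on D (\<lambda>q. K n (fst q) (snd q))" for n using alg_closed_all[OF G K[of n]] by blast
  moreover have "(K n p has_vector_derivative K (Suc n) p x) (at x)" if "(p, x) \<in> D" for n p x
    by (rule dir_deriv_at[OF dd that])
  moreover have "K 0 = a" by (simp add: K_def)
  ultimately show ?thesis by blast
qed

text \<open>Members of \<open>alg\<close> are complex valued; this recovers the real derivative of a
  real generator so that it can be used in a chain rule.\<close>

lemma dir_deriv_real:
  assumes "dir_deriv D v (\<lambda>p x. complex_of_real (r p x)) a'" "(p, x) \<in> D"
  shows "((\<lambda>t. r p (x + t *\<^sub>R v)) has_vector_derivative Re (a' p x)) (at 0)" "complex_of_real (Re (a' p x)) = a' p x"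
proof -
  have d: "((\<lambda>t. complex_of_real (r p (x + t *\<^sub>R v))) has_vector_derivative a' p x) (at 0)" using assms unfolding dir_deriv_def by auto
  show "((\<lambda>t. r p (x + t *\<^sub>R v)) has_vector_derivative Re (a' p x)) (at 0)"
    using bounded_linear.has_vector_derivative[OF bounded_linear_Re d] by simp
  have "((\<lambda>t::real. 0::real) has_vector_derivative Im (a' p x)) (at 0)"
    using bounded_linear.has_vector_derivative[OF bounded_linear_Im d] by simp
  then have "Im (a' p x) = 0" using vector_derivative_at vector_derivative_const_at by fastforce
  then show "complex_of_real (Re (a' p x)) = a' p x" by (simp add: complex_eq_iff)
qed

section \<open>Superpositions of plane waves with a smooth profile\<close>

definition Az :: "complex \<Rightarrow> real" where "Az z = 1 / (1 + (cmod z)^2)"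

text \<open>\<open>Az\<close> is the denominator of \<open>PhiK\<close>; including it makes the
  family closed, since its derivatives are polynomials in \<open>Re z\<close>, \<open>Im z\<close>
  and \<open>Az\<close> itself.\<close>

definition wave_gen0 :: "(real \<Rightarrow> complex \<Rightarrow> complex) set" where
  "wave_gen0 = {\<lambda>om z. c om |c. continuous_on UNIV c} \<union>
     {\<lambda>om z. complex_of_real (Re z), \<lambda>om z. complex_of_real (Im z), \<lambda>om z. complex_of_real (Az z)}"

lemma has_vector_derivative_complex_of_real:
  "(f has_real_derivative d) (at x) \<Longrightarrow> ((\<lambda>t. complex_of_real (f t)) has_vector_derivative complex_of_real d) (at x)"
  by (rule bounded_linear.has_vector_derivative[OF bounded_linear_of_real])
     (simp add: has_real_derivative_iff_has_vector_derivative)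

lemma continuous_on_Az: "continuous_on UNIV Az"
proof -
  have "1 + (cmod z)^2 \<noteq> 0" for z by (smt (verit) zero_le_power2)
  then show ?thesis unfolding Az_def[abs_def] by (intro continuous_intros) auto
qed

lemma wave_gen0_const: "continuous_on UNIV c \<Longrightarrow> (\<lambda>om z. c om) \<in> alg wave_gen0"
  by (rule alg.gen) (auto simp: wave_gen0_def)

lemma wave_gen0_closed: "alg_closed D {1, \<i>} wave_gen0"
  unfolding alg_closed_def
proof (intro ballI conjI)
  fix a assume "a \<in> wave_gen0"
  then consider c where "continuous_on UNIV c" "a = (\<lambda>om z. c om)" | "a = (\<lambda>om z. complex_of_real (Re z))" | "a = (\<lambda>om z. complex_of_real (Im z))" | "a = (\<lambda>om z. complex_of_real (Az z))"
    unfolding wave_gen0_def by blast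
  note cs = this
  have p: "1 + (cmod z)^2 > 0" for z by (simp add: add_pos_nonneg)
  show "continuous_on D (\<lambda>q. a (fst q) (snd q))"
    using cs
  proof cases
    case 1 then show ?thesis by (auto intro!: continuous_on_compose2[of UNIV c] continuous_intros)
  next
    case 4 then show ?thesis by (auto intro!: continuous_intros continuous_on_compose2[OF continuous_on_Az])
  qed (auto intro!: continuous_intros)
  fix v assume v: "v \<in> {1, \<i>}"
  have Reg: "(\<lambda>om z. complex_of_real (Re z)) \<in> alg wave_gen0" "(\<lambda>om z. complex_of_real (Im z)) \<in> alg wave_gen0" "(\<lambda>om z. complex_of_real (Az z)) \<in> alg wave_gen0"
    by (auto intro!: alg.gen simp: wave_gen0_def)
  show "\<exists>a'\<in>alg wave_gen0. dir_deriv D v a a'"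
    using cs
  proof cases
    case 1
    then show ?thesis by (intro bexI[of _ "\<lambda>om z. 0"] wave_gen0_const) (auto simp: dir_deriv_def)
  next
    case 2
    then show ?thesis using v
      by (intro bexI[of _ "\<lambda>om z. complex_of_real (Re v)"] wave_gen0_const) (auto simp: dir_deriv_def intro!: derivative_eq_intros)
  next
    case 3
    then show ?thesis using v
      by (intro bexI[of _ "\<lambda>om z. complex_of_real (Im v)"] wave_gen0_const) (auto simp: dir_deriv_def intro!: derivative_eq_intros)
  next
    case 4
    let ?a' = "\<lambda>om::real. \<lambda>z. complex_of_real (-2 * Re v) * (complex_of_real (Re z) * (complex_of_real (Az z) * complex_of_real (Az z))) +
       complex_of_real (-2 * Im v) * (complex_of_real (Im z) * (complex_of_real (Az z) * complex_of_real (Az z)))"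
    have "?a' \<in> alg wave_gen0" using Reg by (intro alg.add alg.mult wave_gen0_const) auto
    moreover have "dir_deriv D v a ?a'"
      unfolding dir_deriv_def 4
    proof (intro allI impI)
      fix p x
      have q: "1 + (Re x)^2 + (Im x)^2 > 0" by (simp add: add_pos_nonneg)
      have A: "Az (x + t *\<^sub>R v) = 1 / (1 + (Re x + t * Re v)^2 + (Im x + t * Im v)^2)" for t
        unfolding Az_def cmod_power2 by (simp add: add.assoc)
      have "((\<lambda>t. Az (x + t *\<^sub>R v)) has_real_derivative (-2 * Re v * (Re x * (Az x * Az x)) + -2 * Im v * (Im x * (Az x * Az x)))) (at 0)"
      proof -
        let ?q = "\<lambda>t. 1 + (Re x + t * Re v)^2 + (Im x + t * Im v)^2"
        have dq: "(?q has_real_derivative (2 * Re x * Re v + 2 * Im x * Im v)) (at 0)"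
          by (auto intro!: derivative_eq_intros)
        have A0: "Az x = inverse (?q 0)" using A[of 0] by (simp add: inverse_eq_divide)
        have "((\<lambda>t. inverse (?q t)) has_real_derivative - (inverse (?q 0) * (2 * Re x * Re v + 2 * Im x * Im v) * inverse (?q 0))) (at 0)"
          by (rule DERIV_inverse'[OF dq]) (use q in auto)
        moreover have "- (inverse (?q 0) * (2 * Re x * Re v + 2 * Im x * Im v) * inverse (?q 0)) = -2 * Re v * (Re x * (Az x * Az x)) + -2 * Im v * (Im x * (Az x * Az x))"
          unfolding A0[symmetric] by (simp add: algebra_simps)
        ultimately show ?thesis unfolding A inverse_eq_divide by simp
      qed
      from has_vector_derivative_complex_of_real[OF this]
      show "((\<lambda>t. complex_of_real (Az (x + t *\<^sub>R v))) has_vector_derivative ?a' p x) (at 0)" by simp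
    qed
    ultimately show ?thesis by blast
  qed
qed

lemma yc_alg: "(\<lambda>om z. complex_of_real (yc om z)) \<in> alg wave_gen0"
proof -
  have e: "(\<lambda>om z. complex_of_real (yc om z)) = (\<lambda>om z. (complex_of_real (-2 * cos om) * complex_of_real (Re z) + complex_of_real (-2 * sin om) * complex_of_real (Im z)) * complex_of_real (Az z))"
  proof (intro ext)
    fix om z
    have "yc om z = (-2 * cos om * Re z + -2 * sin om * Im z) * Az z"
      unfolding yc_def PhiK_def Az_def by (simp add: add_divide_distrib algebra_simps)
    then show "complex_of_real (yc om z) = (complex_of_real (-2 * cos om) * complex_of_real (Re z) + complex_of_real (-2 * sin om) * complex_of_real (Im z)) * complex_of_real (Az z)" by simp
  qed
  show ?thesis unfolding e
    by (intro alg.add alg.mult wave_gen0_const) (auto intro!: continuous_intros alg.gen simp: wave_gen0_def)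
qed

text \<open>\<open>H j om\<close> plays the role of the \<open>j\<close>-th derivative in
  \<open>y\<close> of a wave profile depending on the direction. Derivatives within
  \<open>[-1, 1]\<close> are enough because \<open>yc\<close> takes values there.\<close>

locale wave_family =
  fixes H :: "nat \<Rightarrow> real \<Rightarrow> real \<Rightarrow> complex"
  assumes Hc: "\<And>j. continuous_on ({0..2*pi} \<times> {-1..1}) (\<lambda>q. H j (fst q) (snd q))"
    and Hd: "\<And>j om y. om \<in> {0..2*pi} \<Longrightarrow> y \<in> {-1..1} \<Longrightarrow> (H j om has_vector_derivative H (Suc j) om y) (at y within {-1..1})"
begin

definition WG :: "(real \<Rightarrow> complex \<Rightarrow> complex) set" where
  "WG = wave_gen0 \<union> {\<lambda>om z. H j om (yc om z) |j. True}"

lemma yc_mem: "yc om z \<in> {-1..1}" using abs_yc_le_1[of om z] by (auto simp: abs_le_iff)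

lemma WG_closed: "alg_closed ({0..2*pi} \<times> UNIV) {1, \<i>} WG"
  unfolding alg_closed_def
proof (intro ballI)
  fix a assume "a \<in> WG"
  then consider "a \<in> wave_gen0" | j where "a = (\<lambda>om z. H j om (yc om z))" unfolding WG_def by blast
  then show "continuous_on ({0..2*pi} \<times> UNIV) (\<lambda>q. a (fst q) (snd q)) \<and> (\<forall>v\<in>{1, \<i>}. \<exists>a'\<in>alg WG. dir_deriv ({0..2*pi} \<times> UNIV) v a a')"
  proof cases
    case 1
    then show ?thesis using wave_gen0_closed[of "{0..2*pi} \<times> UNIV"] alg_mono[of wave_gen0 WG] unfolding alg_closed_def WG_def by blast
  next
    case 2
    have "continuous_on ({0..2*pi} \<times> UNIV) (\<lambda>q. H j (fst (fst q, yc (fst q) (snd q))) (snd (fst q, yc (fst q) (snd q))))"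
      by (rule continuous_on_compose2[OF Hc[of j]])
        (auto intro!: continuous_intros continuous_on_subset[OF continuous_on_yc] simp: yc_mem[simplified])
    moreover have "\<exists>a'\<in>alg WG. dir_deriv ({0..2*pi} \<times> UNIV) v a a'" if v: "v \<in> {1, \<i>}" for v
    proof -
      obtain y' where y': "y' \<in> alg wave_gen0" "dir_deriv ({0..2*pi} \<times> UNIV) v (\<lambda>om z. complex_of_real (yc om z)) y'"
        using alg_closed_all[OF wave_gen0_closed yc_alg] v by blast
      let ?a' = "\<lambda>om z. y' om z * H (Suc j) om (yc om z)"
      have "?a' \<in> alg WG"
        by (intro alg.mult alg_mono[OF _ y'(1)] alg.gen) (auto simp: WG_def)
      moreover have "dir_deriv ({0..2*pi} \<times> UNIV) v a ?a'"
        unfolding dir_deriv_def 2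
      proof (intro allI impI)
        fix om z assume wz: "(om, z) \<in> {0..2*pi} \<times> (UNIV :: complex set)"
        note dr = dir_deriv_real[OF y'(2) wz]
        \<comment> \<open>The values of \<open>yc\<close> never leave \<open>[-1, 1]\<close>, so the
          one-sided derivative suffices for the chain rule even where \<open>yc\<close> attains an
          endpoint.\<close>
        have "(H j om has_vector_derivative H (Suc j) om (yc om (z + 0 *\<^sub>R v))) (at (yc om (z + 0 *\<^sub>R v)) within (\<lambda>t. yc om (z + t *\<^sub>R v)) ` UNIV)"
          by (rule has_vector_derivative_within_subset[OF Hd]) (use wz yc_mem in auto)
        from vector_diff_chain_within[OF dr(1) this]
        show "((\<lambda>t. H j om (yc om (z + t *\<^sub>R v))) has_vector_derivative ?a' om z) (at 0)"
          by (simp add: o_def scaleR_conv_of_real dr(2))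
      qed
      ultimately show ?thesis by blast
    qed
    ultimately show ?thesis using 2 by simp
  qed
qed

definition WI :: "(real \<Rightarrow> complex \<Rightarrow> complex) \<Rightarrow> complex \<Rightarrow> complex" where
  "WI E z = integral {0..2*pi} (\<lambda>om. E om z)"

lemma WI_continuous: assumes "E \<in> alg WG" shows "continuous_on UNIV (WI E)"
proof -
  have c: "continuous_on ({0..2*pi} \<times> UNIV) (\<lambda>q. E (fst q) (snd q))" using alg_closed_all[OF WG_closed assms] by blast
  have "continuous_on (UNIV \<times> cbox 0 (2*pi)) (\<lambda>(z, om). E om z)"
    unfolding case_prod_beta'
    by (rule continuous_on_compose2[OF c, of _ "\<lambda>q. (snd q, fst q)", simplified]) (auto intro!: continuous_intros)
  from integral_continuous_on_param[OF this] show ?thesis unfolding WI_def[abs_def] by simp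
qed

lemma WI_deriv:
  assumes "E \<in> alg WG" and d: "dir_deriv ({0..2*pi} \<times> UNIV) v E E'" "E' \<in> alg WG"
  shows "((\<lambda>t. WI E (z + t *\<^sub>R v)) has_vector_derivative WI E' z) (at 0)"
proof -
  have c: "continuous_on ({0..2*pi} \<times> UNIV) (\<lambda>q. E (fst q) (snd q))" and c': "continuous_on ({0..2*pi} \<times> UNIV) (\<lambda>q. E' (fst q) (snd q))"
    using alg_closed_all[OF WG_closed assms(1)] alg_closed_all[OF WG_closed assms(3)] by blast+
  have "((\<lambda>t. integral (cbox 0 (2*pi)) (\<lambda>om. E om (z + t *\<^sub>R v))) has_vector_derivative integral (cbox 0 (2*pi)) (\<lambda>om. E' om (z + 0 *\<^sub>R v))) (at 0 within UNIV)"
  proof (rule leibniz_rule_vector_derivative)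
    fix t :: real and om assume w: "om \<in> cbox 0 (2*pi)"
    have 1: "((\<lambda>s. E om ((z + t *\<^sub>R v) + s *\<^sub>R v)) has_vector_derivative E' om (z + t *\<^sub>R v)) (at (t - t))"
      using d(1) w unfolding dir_deriv_def by simp
    have 2: "((\<lambda>r. r - t) has_vector_derivative 1) (at t)" by (auto intro!: derivative_eq_intros)
    from vector_diff_chain_at[OF 2 1]
    show "((\<lambda>t. E om (z + t *\<^sub>R v)) has_vector_derivative E' om (z + t *\<^sub>R v)) (at t within UNIV)"
      by (simp add: o_def algebra_simps)
  next
    fix t :: real
    have "continuous_on (cbox 0 (2*pi)) (\<lambda>om. E om (z + t *\<^sub>R v))"
      by (rule continuous_on_compose2[OF c, of _ "\<lambda>om. (om, z + t *\<^sub>R v)", simplified]) (auto intro!: continuous_intros)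
    then show "(\<lambda>om. E om (z + t *\<^sub>R v)) integrable_on cbox 0 (2*pi)" by (rule integrable_continuous)
  next
    show "continuous_on (UNIV \<times> cbox 0 (2*pi)) (\<lambda>(t, om). E' om (z + t *\<^sub>R v))"
      unfolding case_prod_beta'
      by (rule continuous_on_compose2[OF c', of _ "\<lambda>q. (snd q, z + fst q *\<^sub>R v)", simplified]) (auto intro!: continuous_intros)
  qed auto
  then show ?thesis unfolding WI_def by simp
qed

lemma ipartial_WI:
  assumes "set vs \<subseteq> {1, \<i>}"
  shows "\<exists>E\<in>alg WG. ipartial vs (WI (\<lambda>om z. H 0 om (yc om z))) = WI E"
  using assms
proof (induction vs)
  case Nil
  show ?case by (intro bexI[of _ "\<lambda>om z. H 0 om (yc om z)"] alg.gen) (auto simp: WG_def)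
next
  case (Cons v vs)
  then obtain E where E: "E \<in> alg WG" "ipartial vs (WI (\<lambda>om z. H 0 om (yc om z))) = WI E" by auto
  obtain E' where E': "E' \<in> alg WG" "dir_deriv ({0..2*pi} \<times> UNIV) v E E'"
    using alg_closed_all[OF WG_closed E(1)] Cons.prems by auto
  have "vector_derivative (\<lambda>t. WI E (z + complex_of_real t * v)) (at 0) = WI E' z" for z
    using WI_deriv[OF E(1) E'(2,1), of z] by (intro vector_derivative_at) (simp add: scaleR_conv_of_real)
  then show ?case using E' E(2) by (intro bexI[of _ E']) auto
qed

lemma smooth_WI: "smooth_open UNIV (WI (\<lambda>om z. H 0 om (yc om z)))"
  unfolding smooth_open_def
proof (intro conjI allI impI ballI)
  fix vs :: "complex list" assume vs: "set vs \<subseteq> {1, \<i>}"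
  obtain E where E: "E \<in> alg WG" "ipartial vs (WI (\<lambda>om z. H 0 om (yc om z))) = WI E" using ipartial_WI[OF vs] by blast
  show "continuous_on UNIV (ipartial vs (WI (\<lambda>om z. H 0 om (yc om z))))" unfolding E(2) by (rule WI_continuous[OF E(1)])
  fix v z assume "v \<in> {1, \<i>::complex}"
  then obtain E' where E': "E' \<in> alg WG" "dir_deriv ({0..2*pi} \<times> UNIV) v E E'"
    using alg_closed_all[OF WG_closed E(1)] by auto
  show "(\<lambda>t. ipartial vs (WI (\<lambda>om z. H 0 om (yc om z))) (z + complex_of_real t * v)) differentiable at 0"
    unfolding E(2) using WI_deriv[OF E(1) E'(2,1), of z] by (auto simp: scaleR_conv_of_real intro: differentiableI_vector)
qed auto

end

section \<open>Smooth functions along curves and in the boundary coordinate\<close>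

lemma smooth_open_partial:
  assumes "smooth_open U g" "set vs \<subseteq> {1, \<i>}" "v \<in> {1, \<i>}" "z \<in> U"
  shows "((\<lambda>t. ipartial vs g (z + complex_of_real t * v)) has_vector_derivative ipartial (v # vs) g z) (at 0)"
  using assms unfolding smooth_open_def by (auto simp: vector_derivative_works)

text \<open>\<open>smooth_open\<close> only speaks of iterated derivatives along the two axes;
  composing with curves needs a total derivative, which follows from continuity of the
  partials.\<close>

lemma smooth_open_has_derivative:
  assumes g: "smooth_open U g" and vs: "set vs \<subseteq> {1, \<i>}" and z: "z \<in> U"
  shows "(ipartial vs g has_derivative (\<lambda>h. Re h *\<^sub>R ipartial (1 # vs) g z + Im h *\<^sub>R ipartial (\<i> # vs) g z)) (at z)"
proof -
  let ?h = "ipartial vs g" and ?h1 = "ipartial (1 # vs) g" and ?h2 = "ipartial (\<i> # vs) g"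
  have U: "open U" using g unfolding smooth_open_def by blast
  obtain e where e: "e > 0" "ball z e \<subseteq> U" using U z open_contains_ball by blast
  \<comment> \<open>Half-width \<open>e/2\<close> in each coordinate keeps the square inside the
    ball of radius \<open>e\<close>, by the bound of the norm through the sum of the
    coordinates.\<close>
  define X where "X = {Re z - e/2 <..< Re z + e/2}"
  define Y where "Y = {Im z - e/2 <..< Im z + e/2}"
  have XY: "Complex x y \<in> U" if "x \<in> X" "y \<in> Y" for x y
  proof -
    have "cmod (z - Complex x y) \<le> \<bar>Re z - x\<bar> + \<bar>Im z - y\<bar>" using cmod_le[of "z - Complex x y"] by simp
    also have "... < e" using that unfolding X_def Y_def by auto
    finally show ?thesis using e(2) by (auto simp: dist_norm)
  qed
  have zXY: "Re z \<in> X" "Im z \<in> Y" unfolding X_def Y_def using e by auto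
  have shift: "((\<lambda>y. ?h (Complex x y)) has_vector_derivative ?h2 (Complex x y)) (at y)" if "x \<in> X" "y \<in> Y" for x y
  proof -
    have 1: "((\<lambda>t. ?h (Complex x y + complex_of_real t * \<i>)) has_vector_derivative ?h2 (Complex x y)) (at (y - y))"
      using smooth_open_partial[OF g vs, of \<i>] XY[OF that] by simp
    have 2: "((\<lambda>r. r - y) has_vector_derivative 1) (at y)" by (auto intro!: derivative_eq_intros)
    have "Complex x y + complex_of_real (r - y) * \<i> = Complex x r" for r by (simp add: complex_eq_iff)
    then show ?thesis using vector_diff_chain_at[OF 2 1] by (simp add: o_def)
  qed
  have shift1: "((\<lambda>x. ?h (Complex x (Im z))) has_vector_derivative ?h1 z) (at (Re z))"
  proof -
    have 1: "((\<lambda>t. ?h (z + complex_of_real t * 1)) has_vector_derivative ?h1 z) (at (Re z - Re z))"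
      using smooth_open_partial[OF g vs, of 1] z by simp
    have 2: "((\<lambda>r. r - Re z) has_vector_derivative 1) (at (Re z))" by (auto intro!: derivative_eq_intros)
    have "z + complex_of_real (r - Re z) * 1 = Complex r (Im z)" for r by (simp add: complex_eq_iff)
    then show ?thesis using vector_diff_chain_at[OF 2 1] by (simp add: o_def)
  qed
  have h2c: "continuous_on U ?h2" using g vs unfolding smooth_open_def by (metis insert_subset insertI1 insertI2 list.simps(15))
  have "((\<lambda>(x, y). ?h (Complex x y)) has_derivative (\<lambda>(tx, ty). tx *\<^sub>R ?h1 z + blinfun_apply (blinfun_scaleR_left (?h2 (Complex (Re z) (Im z)))) ty)) (at (Re z, Im z) within X \<times> Y)"
  proof (rule has_derivative_partialsI[where fy="\<lambda>x y. blinfun_scaleR_left (?h2 (Complex x y))"])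
    show "((\<lambda>x. ?h (Complex x (Im z))) has_derivative (\<lambda>tx. tx *\<^sub>R ?h1 z)) (at (Re z) within X)"
      using shift1 unfolding has_vector_derivative_def by (rule has_derivative_at_withinI)
    show "((\<lambda>y. ?h (Complex x y)) has_derivative blinfun_apply (blinfun_scaleR_left (?h2 (Complex x y)))) (at y within Y)" if "x \<in> X" "y \<in> Y" for x y
      using shift[OF that] unfolding has_vector_derivative_def by (auto intro: has_derivative_at_withinI)
    have "isCont ?h2 z" using h2c U z continuous_on_eq_continuous_at by blast
    then have h2z: "isCont ?h2 (Complex (fst (Re z, Im z)) (snd (Re z, Im z)))" by (simp only: fst_conv snd_conv complex_surj)
    have k: "isCont (\<lambda>q. Complex (fst q) (snd q)) (Re z, Im z)" unfolding Complex_eq by (intro continuous_intros)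
    have "isCont (\<lambda>q. ?h2 (Complex (fst q) (snd q))) (Re z, Im z)"
      by (rule isCont_o2[OF k h2z])
    then have "isCont (\<lambda>q. blinfun_scaleR_left (?h2 (Complex (fst q) (snd q)))) (Re z, Im z)"
      by (rule bounded_linear.continuous[OF bounded_linear_blinfun_scaleR_left])
    then show "continuous (at (Re z, Im z) within X \<times> Y) (\<lambda>(x, y). blinfun_scaleR_left (?h2 (Complex x y)))"
      by (simp add: case_prod_beta' continuous_at_imp_continuous_at_within)
  qed (use zXY in \<open>auto simp: Y_def\<close>)
  note dd = this
  have "open (X \<times> Y)" unfolding X_def Y_def by (intro open_Times) auto
  then have aw: "at (Re z, Im z) within X \<times> Y = at (Re z, Im z)" by (rule at_within_open[rotated]) (use zXY in simp)
  have d: "((\<lambda>q. ?h (Complex (fst q) (snd q))) has_derivative (\<lambda>q. fst q *\<^sub>R ?h1 z + snd q *\<^sub>R ?h2 z)) (at (Re z, Im z))"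
    using dd unfolding aw case_prod_beta' by (simp only: blinfun_scaleR_left.rep_eq complex_surj)
  have "((\<lambda>w. (Re w, Im w)) has_derivative (\<lambda>w. (Re w, Im w))) (at z)"
    by (intro has_derivative_Pair bounded_linear_imp_has_derivative bounded_linear_Re bounded_linear_Im)
  from has_derivative_compose[OF this d] show ?thesis by (simp only: fst_conv snd_conv complex_surj)
qed

text \<open>The chain rule expresses the derivative of a partial of \<open>g\<close> along the curve
  through higher partials along the same curve and derivatives of the curve's components, so the
  enlarged family stays closed.\<close>

lemma curve_alg_closed:
  fixes c :: "'p::topological_space \<Rightarrow> real \<Rightarrow> complex"
  assumes g: "smooth_open U g" and G0: "alg_closed D {1} G0"
    and cr: "(\<lambda>p t. complex_of_real (Re (c p t))) \<in> alg G0" and ci: "(\<lambda>p t. complex_of_real (Im (c p t))) \<in> alg G0"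
    and cU: "\<And>p t. (p, t) \<in> D \<Longrightarrow> c p t \<in> U"
  shows "alg_closed D {1} (G0 \<union> {\<lambda>p t. ipartial vs g (c p t) |vs. set vs \<subseteq> {1, \<i>}})" (is "alg_closed D {1} ?G")
  unfolding alg_closed_def
proof (intro ballI)
  fix a assume "a \<in> ?G"
  then consider "a \<in> G0" | vs where "set vs \<subseteq> {1, \<i>}" "a = (\<lambda>p t. ipartial vs g (c p t))" by blast
  then show "continuous_on D (\<lambda>q. a (fst q) (snd q)) \<and> (\<forall>v\<in>{1}. \<exists>a'\<in>alg ?G. dir_deriv D v a a')"
  proof cases
    case 1
    have s: "alg G0 \<subseteq> alg ?G" using alg_mono[of G0 ?G] by blast
    show ?thesis using G0 1 s unfolding alg_closed_def by blast
  next
    case 2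
    have rc: "continuous_on D (\<lambda>q. c (fst q) (snd q))"
    proof -
      have "continuous_on D (\<lambda>q. complex_of_real (Re (c (fst q) (snd q))) + \<i> * complex_of_real (Im (c (fst q) (snd q))))"
        using alg_closed_all[OF G0 cr] alg_closed_all[OF G0 ci] by (intro continuous_on_add continuous_on_mult continuous_on_const) auto
      then show ?thesis by (simp flip: complex_eq)
    qed
    have "continuous_on U (ipartial vs g)" using g 2(1) unfolding smooth_open_def by blast
    then have "continuous_on D (\<lambda>q. a (fst q) (snd q))" unfolding 2(2)
      by (rule continuous_on_compose2[OF _ rc]) (use cU in auto)
    moreover
    obtain r' where r': "r' \<in> alg G0" "dir_deriv D 1 (\<lambda>p t. complex_of_real (Re (c p t))) r'" using alg_closed_all[OF G0 cr] by blast
    obtain i' where i': "i' \<in> alg G0" "dir_deriv D 1 (\<lambda>p t. complex_of_real (Im (c p t))) i'" using alg_closed_all[OF G0 ci] by blast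
    let ?a' = "\<lambda>p t. r' p t * ipartial (1 # vs) g (c p t) + i' p t * ipartial (\<i> # vs) g (c p t)"
    have gens: "(\<lambda>p t. ipartial (1 # vs) g (c p t)) \<in> ?G" "(\<lambda>p t. ipartial (\<i> # vs) g (c p t)) \<in> ?G"
      using 2(1) by (intro UnI2 CollectI exI[of _ "1 # vs"]; simp) (intro UnI2 CollectI exI[of _ "\<i> # vs"]; use 2(1) in simp)
    have "r' \<in> alg ?G" "i' \<in> alg ?G" using alg_mono[OF _ r'(1), of ?G] alg_mono[OF _ i'(1), of ?G] by auto
    then have "?a' \<in> alg ?G" by (intro alg.add alg.mult alg.gen[OF gens(1)] alg.gen[OF gens(2)])
    moreover have "dir_deriv D 1 a ?a'"
      unfolding dir_deriv_def 2(2)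
    proof (intro allI impI)
      fix p x assume px: "(p, x) \<in> D"
      note dr = dir_deriv_real[OF r'(2) px] and di = dir_deriv_real[OF i'(2) px]
      have "((\<lambda>t. complex_of_real (Re (c p (x + t *\<^sub>R 1))) + \<i> * complex_of_real (Im (c p (x + t *\<^sub>R 1)))) has_vector_derivative r' p x + \<i> * i' p x) (at 0)"
        using r'(2) i'(2) px unfolding dir_deriv_def by (intro has_vector_derivative_add has_vector_derivative_mult_right) auto
      then have 1: "((\<lambda>t. c p (x + t *\<^sub>R 1)) has_vector_derivative r' p x + \<i> * i' p x) (at 0)" by (simp flip: complex_eq)
      have 2: "(ipartial vs g has_derivative (\<lambda>h. Re h *\<^sub>R ipartial (1 # vs) g (c p x) + Im h *\<^sub>R ipartial (\<i> # vs) g (c p x))) (at (c p (x + 0 *\<^sub>R 1)))"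
        using smooth_open_has_derivative[OF g 2(1) cU[OF px]] by simp
      have ri: "Im (r' p x) = 0" "Im (i' p x) = 0" using dr(2) di(2) by (metis Im_complex_of_real)+
      from has_derivative_compose[OF 1[unfolded has_vector_derivative_def] 2]
      have "((\<lambda>t. ipartial vs g (c p (x + t *\<^sub>R 1))) has_derivative (\<lambda>t. t *\<^sub>R (Re (r' p x) *\<^sub>R ipartial (1 # vs) g (c p x) + Re (i' p x) *\<^sub>R ipartial (\<i> # vs) g (c p x)))) (at 0)"
        by (rule has_derivative_eq_rhs) (simp add: fun_eq_iff ri scaleR_right_distrib del: ipartial.simps)
      then show "((\<lambda>t. ipartial vs g (c p (x + t *\<^sub>R 1))) has_vector_derivative ?a' p x) (at 0)"
        unfolding has_vector_derivative_def using dr(2) di(2) by (simp add: scaleR_conv_of_real del: ipartial.simps)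
    qed
    ultimately show ?thesis by blast
  qed
qed

text \<open>The derivative of \<open>rx\<close> is minus the product of
  \<open>(1 / (1 + y))^2\<close> and \<open>1 / rx y\<close>; adjoining both reciprocals closes the
  family.\<close>

definition rx_gen :: "(real \<Rightarrow> real \<Rightarrow> complex) set" where
  "rx_gen = {\<lambda>\<theta> y. c \<theta> |c. continuous_on UNIV c} \<union>
     {\<lambda>\<theta> y. complex_of_real (rx y), \<lambda>\<theta> y. complex_of_real (1 / rx y), \<lambda>\<theta> y. complex_of_real (1 / (1 + y))}"

lemma rx_pos: "\<bar>y\<bar> < 1 \<Longrightarrow> rx y > 0" unfolding rx_def by (auto intro!: divide_pos_pos)

lemma DERIV_rx: assumes "\<bar>y\<bar> < 1" shows "(rx has_real_derivative - (1 / (1 + y) * (1 / (1 + y)) * (1 / rx y))) (at y)"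
proof -
  have p: "1 + y > 0" "1 - y > 0" using assms by auto
  have u: "((\<lambda>y. (1 - y) / (1 + y)) has_real_derivative - 2 / (1 + y)^2) (at y)"
    using p by (auto intro!: derivative_eq_intros simp: power2_eq_square field_simps)
  have "((\<lambda>y. sqrt ((1 - y) / (1 + y))) has_real_derivative inverse (sqrt ((1 - y) / (1 + y))) / 2 * (- 2 / (1 + y)^2)) (at y)"
    by (rule DERIV_chain2[OF DERIV_real_sqrt u]) (use p in simp)
  then show ?thesis unfolding rx_def[abs_def] by (rule DERIV_cong) (simp add: inverse_eq_divide power2_eq_square)
qed

lemma rx_gen_closed:
  assumes "e \<le> 1" shows "alg_closed (UNIV \<times> {-e<..<e}) {1} rx_gen"
  unfolding alg_closed_def
proof (intro ballI conjI)
  fix a assume "a \<in> rx_gen"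
  then consider c where "continuous_on UNIV c" "a = (\<lambda>\<theta> y. c \<theta>)" | "a = (\<lambda>\<theta> y. complex_of_real (rx y))" | "a = (\<lambda>\<theta> y. complex_of_real (1 / rx y))" | "a = (\<lambda>\<theta> y. complex_of_real (1 / (1 + y)))"
    unfolding rx_gen_def by blast
  note cs = this
  have const: "continuous_on UNIV c \<Longrightarrow> (\<lambda>\<theta> y. c \<theta>) \<in> alg rx_gen" for c by (rule alg.gen) (auto simp: rx_gen_def)
  have m: "(\<lambda>\<theta> y. complex_of_real (rx y)) \<in> alg rx_gen" "(\<lambda>\<theta> y. complex_of_real (1 / rx y)) \<in> alg rx_gen" "(\<lambda>\<theta> y. complex_of_real (1 / (1 + y))) \<in> alg rx_gen"
    by (auto intro!: alg.gen simp: rx_gen_def)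
  have y1: "\<bar>y\<bar> < 1" if "(p, y) \<in> UNIV \<times> {-e<..<e}" for p :: real and y using that assms by auto
  have der: "dir_deriv (UNIV \<times> {-e<..<e}) 1 (\<lambda>\<theta> y. complex_of_real (f y)) (\<lambda>\<theta>::real. \<lambda>y. complex_of_real (f' y))"
    if "\<And>y. \<bar>y\<bar> < 1 \<Longrightarrow> (f has_real_derivative f' y) (at y)" for f f'
    unfolding dir_deriv_def
  proof (intro allI impI)
    fix p y assume "(p::real, y) \<in> UNIV \<times> {-e<..<e}"
    then have "(f has_real_derivative f' y) (at (0 + y))" using that y1 by simp
    then have "((\<lambda>t. f (t + y)) has_real_derivative f' y) (at 0)" by (simp only: DERIV_shift)
    then have "((\<lambda>t. f (y + t)) has_real_derivative f' y) (at 0)" by (simp add: add.commute)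
    from has_vector_derivative_complex_of_real[OF this]
    show "((\<lambda>t. complex_of_real (f (y + t *\<^sub>R 1))) has_vector_derivative complex_of_real (f' y)) (at 0)" by simp
  qed
  have drx: "dir_deriv (UNIV \<times> {-e<..<e}) 1 (\<lambda>\<theta> y. complex_of_real (rx y)) (\<lambda>\<theta>::real. \<lambda>y. complex_of_real (- (1 / (1 + y) * (1 / (1 + y)) * (1 / rx y))))"
    by (rule der[OF DERIV_rx])
  have dirx: "dir_deriv (UNIV \<times> {-e<..<e}) 1 (\<lambda>\<theta> y. complex_of_real (1 / rx y)) (\<lambda>\<theta>::real. \<lambda>y. complex_of_real (1 / (1 + y) * (1 / (1 + y)) * (1 / rx y * (1 / rx y * (1 / rx y)))))"
  proof (rule der)
    fix y :: real assume y: "\<bar>y\<bar> < 1"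
    show "((\<lambda>y. 1 / rx y) has_real_derivative 1 / (1 + y) * (1 / (1 + y)) * (1 / rx y * (1 / rx y * (1 / rx y)))) (at y)"
      using DERIV_inverse'[OF DERIV_rx[OF y]] rx_pos[OF y] by (simp add: inverse_eq_divide mult_ac)
  qed
  have diy: "dir_deriv (UNIV \<times> {-e<..<e}) 1 (\<lambda>\<theta> y. complex_of_real (1 / (1 + y))) (\<lambda>\<theta>::real. \<lambda>y. complex_of_real (- (1 / (1 + y) * (1 / (1 + y)))))"
  proof (rule der)
    fix y :: real assume y: "\<bar>y\<bar> < 1"
    then have "1 + y \<noteq> 0" by auto
    then show "((\<lambda>y. 1 / (1 + y)) has_real_derivative - (1 / (1 + y) * (1 / (1 + y)))) (at y)"
      by (auto intro!: derivative_eq_intros simp: power2_eq_square)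
  qed
  have "continuous_on {-e<..<e} rx"
    by (rule continuous_at_imp_continuous_on) (use y1 DERIV_isCont[OF DERIV_rx] in auto)
  then have rxc: "continuous_on (UNIV \<times> {-e<..<e}) (\<lambda>q::real\<times>real. rx (snd q))"
    by (rule continuous_on_compose2[OF _ continuous_on_snd[OF continuous_on_id]]) auto
  have nz: "rx (snd q) \<noteq> 0" and nz1: "1 + snd q \<noteq> 0" if "q \<in> UNIV \<times> {-e<..<e}" for q :: "real \<times> real"
  proof -
    have "\<bar>snd q\<bar> < 1" using that y1[of "fst q" "snd q"] by simp
    then show "rx (snd q) \<noteq> 0" "1 + snd q \<noteq> 0" using rx_pos[of "snd q"] by auto
  qed
  show "continuous_on (UNIV \<times> {-e<..<e}) (\<lambda>q. a (fst q) (snd q))"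
    using cs
  proof cases
    case 1 then show ?thesis by (auto intro!: continuous_on_compose2[of UNIV c] continuous_intros)
  next
    case 2
    show ?thesis unfolding 2 by (rule continuous_on_of_real[OF rxc])
  next
    case 3
    have "continuous_on (UNIV \<times> {-e<..<e}) (\<lambda>q::real\<times>real. 1 / rx (snd q))"
      by (intro continuous_on_divide continuous_on_const rxc ballI nz)
    then show ?thesis unfolding 3 by (rule continuous_on_of_real)
  next
    case 4
    have "continuous_on (UNIV \<times> {-e<..<e}) (\<lambda>q::real\<times>real. 1 / (1 + snd q))"
      by (intro continuous_on_divide continuous_on_const continuous_on_add continuous_on_snd continuous_on_id ballI nz1)
    then show ?thesis unfolding 4 by (rule continuous_on_of_real)
  qed
  fix v :: real assume "v \<in> {1}"
  then have v: "v = 1" by simp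
  have "\<exists>a'\<in>alg rx_gen. dir_deriv (UNIV \<times> {-e<..<e}) 1 a a'"
    using cs
  proof cases
    case 1 then show ?thesis by (intro bexI[of _ "\<lambda>om z. 0"] const) (auto simp: dir_deriv_def)
  next
    case 2
    have "(\<lambda>\<theta> y. (\<lambda>\<theta>::real. -1) \<theta> * (complex_of_real (1 / (1 + y)) * complex_of_real (1 / (1 + y)) * complex_of_real (1 / rx y))) \<in> alg rx_gen"
      by (intro alg.mult m const continuous_intros)
    then show ?thesis using drx unfolding 2 by (intro bexI[rotated]) (assumption, simp)
  next
    case 3
    have "(\<lambda>\<theta> y. complex_of_real (1 / (1 + y)) * complex_of_real (1 / (1 + y)) * (complex_of_real (1 / rx y) * (complex_of_real (1 / rx y) * complex_of_real (1 / rx y)))) \<in> alg rx_gen"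
      by (intro alg.mult m)
    then show ?thesis using dirx unfolding 3 by (intro bexI[rotated]) (assumption, simp)
  next
    case 4
    have "(\<lambda>\<theta> y. (\<lambda>\<theta>::real. -1) \<theta> * (complex_of_real (1 / (1 + y)) * complex_of_real (1 / (1 + y)))) \<in> alg rx_gen"
      by (intro alg.mult m const continuous_intros)
    then show ?thesis using diy unfolding 4 by (intro bexI[rotated]) (assumption, simp)
  qed
  then show "\<exists>a'\<in>alg rx_gen. dir_deriv (UNIV \<times> {-e<..<e}) v a a'" unfolding v .
qed

lemma cball_thicken:
  assumes "open U" "cball 0 1 \<subseteq> U" obtains d where "d > 0" "cball (0::complex) (1 + d) \<subseteq> U"
proof -
  obtain d where d: "d > 0" "(\<Union>x\<in>cball 0 1. cball x d) \<subseteq> U"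
    using compact_subset_open_imp_cball_epsilon_subset[OF compact_cball assms] by auto
  have "cball 0 (1 + d) \<subseteq> U"
  proof
    fix z :: complex assume z: "z \<in> cball 0 (1 + d)"
    show "z \<in> U"
    proof (cases "cmod z \<le> 1")
      case True then show ?thesis using assms by auto
    next
      case False
      have "z - sgn z = (1 - 1 / cmod z) *\<^sub>R z" by (simp add: sgn_div_norm scaleR_left_diff_distrib divide_inverse)
      then have "cmod (z - sgn z) = \<bar>1 - 1 / cmod z\<bar> * cmod z" by simp
      also have "... = cmod z - 1"
      proof -
        have "z \<noteq> 0" using False by auto
        then show ?thesis using False by (simp add: abs_if field_simps)
      qed
      finally have "z \<in> cball (sgn z) d" using z by (simp add: dist_norm norm_minus_commute)
      moreover have "sgn z \<in> cball 0 1" by (simp add: norm_sgn)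
      ultimately show ?thesis using d(2) by blast
    qed
  qed
  with d(1) show ?thesis by (rule that)
qed

lemma rx_0 [simp]: "rx 0 = 1" by (simp add: rx_def)

text \<open>For negative \<open>y\<close> the point lies outside the unit disk, since then
  \<open>rx y > 1\<close>. The open set \<open>U\<close> contains a slightly larger closed disk, and
  this determines \<open>e\<close>.\<close>

lemma rx_curve_chain:
  assumes g: "smooth_open U g" and U: "cball 0 1 \<subseteq> U"
  shows "\<exists>e K. 0 < e \<and> e < 1 \<and> K 0 = (\<lambda>\<theta> y. g (complex_of_real (rx y) * cis \<theta>)) \<and>
    (\<forall>n. continuous_on (UNIV \<times> {-e<..<e}) (\<lambda>q. K n (fst q) (snd q))) \<and>
    (\<forall>n \<theta> y. \<bar>y\<bar> < e \<longrightarrow> (K n \<theta> has_vector_derivative K (Suc n) \<theta> y) (at y))"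
proof -
  have oU: "open U" using g unfolding smooth_open_def by blast
  obtain d where d: "d > 0" "cball (0::complex) (1 + d) \<subseteq> U" using cball_thicken[OF oU U] .
  have "isCont rx 0" using DERIV_rx[of 0] DERIV_isCont by fastforce
  then have "eventually (\<lambda>y. dist (rx y) (rx 0) < d) (at 0)" using d(1) by (simp add: isCont_def tendsto_iff)
  then obtain e0 where e0: "e0 > 0" "\<And>y. y \<noteq> 0 \<Longrightarrow> dist y 0 < e0 \<Longrightarrow> dist (rx y) (rx 0) < d" unfolding eventually_at by auto
  define e where "e = min e0 (1/2)"
  have e: "0 < e" "e < 1" "e \<le> 1" using e0 by (auto simp: e_def)
  have rxd: "rx y \<le> 1 + d" if "\<bar>y\<bar> < e" for y
    using e0(2)[of y] that d(1) by (cases "y = 0") (auto simp: e_def dist_real_def)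
  let ?c = "\<lambda>\<theta> y. complex_of_real (rx y) * cis \<theta>"
  let ?D = "UNIV \<times> {-e<..<e} :: (real \<times> real) set"
  have cr: "(\<lambda>\<theta> y. complex_of_real (Re (?c \<theta> y))) \<in> alg rx_gen"
  proof -
    have "(\<lambda>\<theta> y. complex_of_real (rx y) * complex_of_real (cos \<theta>)) \<in> alg rx_gen"
      by (intro alg.mult alg.gen) (auto simp: rx_gen_def intro!: exI[of _ "\<lambda>\<theta>. complex_of_real (cos \<theta>)"] continuous_intros)
    then show ?thesis by simp
  qed
  have ci: "(\<lambda>\<theta> y. complex_of_real (Im (?c \<theta> y))) \<in> alg rx_gen"
  proof -
    have "(\<lambda>\<theta> y. complex_of_real (rx y) * complex_of_real (sin \<theta>)) \<in> alg rx_gen"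
      by (intro alg.mult alg.gen) (auto simp: rx_gen_def intro!: exI[of _ "\<lambda>\<theta>. complex_of_real (sin \<theta>)"] continuous_intros)
    then show ?thesis by simp
  qed
  have cU: "?c \<theta> y \<in> U" if "(\<theta>, y) \<in> ?D" for \<theta> y
  proof -
    have "\<bar>y\<bar> < e" using that by auto
    then have "rx y \<le> 1 + d" "rx y > 0" using rxd rx_pos[of y] e by auto
    then have "?c \<theta> y \<in> cball 0 (1 + d)" by (simp add: norm_mult)
    then show ?thesis using d(2) by blast
  qed
  note cl = curve_alg_closed[OF g rx_gen_closed[OF e(3)] cr ci cU]
  have "(\<lambda>\<theta> y. g (?c \<theta> y)) \<in> alg (rx_gen \<union> {\<lambda>p t. ipartial vs g (?c p t) |vs. set vs \<subseteq> {1, \<i>}})"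
    by (rule alg.gen, rule UnI2, rule CollectI, rule exI[of _ "[]"]) simp
  from alg_chain[OF cl this] obtain K where K: "K 0 = (\<lambda>\<theta> y. g (?c \<theta> y))"
    "\<And>n. continuous_on ?D (\<lambda>q. K n (fst q) (snd q))" "\<And>n p x. (p, x) \<in> ?D \<Longrightarrow> (K n p has_vector_derivative K (Suc n) p x) (at x)" by blast
  show ?thesis
  proof (intro exI[of _ e] exI[of _ K] conjI allI impI e(1,2) K(1,2))
    fix n \<theta> y assume "\<bar>y\<bar> < e"
    then have "(\<theta>, y) \<in> ?D" by auto
    then show "(K n \<theta> has_vector_derivative K (Suc n) \<theta> y) (at y)" by (rule K(3))
  qed
qed

section \<open>Iterated derivatives and evenness across the boundary\<close>

lemma deriv_chain:
  fixes K :: "nat \<Rightarrow> real \<Rightarrow> real"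
  assumes "\<And>n y. \<bar>y\<bar> < e \<Longrightarrow> (K n has_real_derivative K (Suc n) y) (at y)" "\<bar>y\<bar> < e"
  shows "(deriv ^^ n) (K 0) y = K n y"
  using assms(2)
proof (induction n arbitrary: y)
  case (Suc n)
  have "eventually (\<lambda>x. x \<in> {-e<..<e}) (nhds y)" using Suc.prems by (intro eventually_nhds_in_open) auto
  then have "eventually (\<lambda>x. (deriv ^^ n) (K 0) x = K n x) (nhds y)"
    by (rule eventually_mono) (use Suc.IH in auto)
  then have "deriv ((deriv ^^ n) (K 0)) y = deriv (K n) y" by (intro deriv_cong_ev) auto
  also have "... = K (Suc n) y" using assms(1)[OF Suc.prems] by (rule DERIV_imp_deriv)
  finally show ?case by simp
qed simp

lemma even_chain:
  fixes K :: "nat \<Rightarrow> real \<Rightarrow> real"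
  assumes d: "\<And>n y. \<bar>y\<bar> < e \<Longrightarrow> (K n has_real_derivative K (Suc n) y) (at y)"
    and ev: "\<And>y. \<bar>y\<bar> < e \<Longrightarrow> K 0 (- y) = K 0 y" and "\<bar>y\<bar> < e"
  shows "K n (- y) = (-1)^n * K n y"
  using assms(3)
proof (induction n arbitrary: y)
  case (Suc n)
  have "(K n has_real_derivative K (Suc n) (- y)) (at (- y))" using d Suc.prems by simp
  then have "((\<lambda>x. K n (- x)) has_real_derivative - K (Suc n) (- y)) (at y)"
    by (rule DERIV_chain2[of "K n" _ uminus y, THEN DERIV_cong]) (auto intro!: derivative_eq_intros)
  moreover have "((\<lambda>x. (-1)^n * K n x) has_real_derivative (-1)^n * K (Suc n) y) (at y)"
    by (rule DERIV_cmult[OF d[OF Suc.prems]])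
  moreover have "eventually (\<lambda>x. K n (- x) = (-1)^n * K n x) (nhds y)"
  proof -
    have "eventually (\<lambda>x. x \<in> {-e<..<e}) (nhds y)" using Suc.prems by (intro eventually_nhds_in_open) auto
    then show ?thesis by (rule eventually_mono) (use Suc.IH in auto)
  qed
  then have "(((\<lambda>x. K n (- x)) has_real_derivative - K (Suc n) (- y)) (at y)) = (((\<lambda>x. (-1)^n * K n x) has_real_derivative - K (Suc n) (- y)) (at y))"
    by (intro DERIV_cong_ev) auto
  ultimately have "- K (Suc n) (- y) = (-1)^n * K (Suc n) y" using DERIV_unique by blast
  then show ?case by simp
qed (use ev in simp)

text \<open>In the Klein model the point depends on \<open>y\<close> only through
  \<open>y^2\<close>; this is why every function of \<open>PhiK z\<close>, in particular every plane
  wave, is even in the boundary coordinate.\<close>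

lemma PhiK_rx: assumes "\<bar>y\<bar> < 1" shows "PhiK (complex_of_real (rx y) * cis \<theta>) = complex_of_real (sqrt (1 - y^2)) * cis \<theta>"
proof -
  have p: "1 + y > 0" "1 - y > 0" using assms by auto
  have r2: "(rx y)^2 = (1 - y) / (1 + y)" unfolding rx_def using p by simp
  have "2 / (1 + (rx y)^2) = 1 + y" unfolding r2 using p by (simp add: divide_simps)
  moreover have "(1 + y) * rx y = sqrt (1 - y^2)"
  proof -
    have "((1 + y) * rx y)^2 = 1 - y^2" unfolding power_mult_distrib r2 using p by (simp add: power2_eq_square field_simps)
    moreover have "(1 + y) * rx y \<ge> 0" using p rx_pos[OF assms] by simp
    ultimately show ?thesis by (metis real_sqrt_unique)
  qed
  moreover have "cmod (complex_of_real (rx y) * cis \<theta>) = rx y" using rx_pos[OF assms] by (simp add: norm_mult)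
  ultimately show ?thesis unfolding PhiK_def by (metis (no_types, lifting) mult.assoc of_real_mult)
qed

context wave_family
begin

text \<open>Evenness in \<open>y\<close> holds exactly on a whole neighbourhood of 0 by
  \<open>PhiK_rx\<close>, and then odd derivatives vanish at 0.\<close>

lemma WI_Cinf_ev: "WI (\<lambda>om z. H 0 om (yc om z)) \<in> Cinf_ev"
proof -
  let ?f = "WI (\<lambda>om z. H 0 om (yc om z))"
  obtain e K where e: "0 < e" "e < 1" and K0: "K 0 = (\<lambda>\<theta> y. ?f (complex_of_real (rx y) * cis \<theta>))"
    and Kc: "\<And>n. continuous_on (UNIV \<times> {-e<..<e}) (\<lambda>q. K n (fst q) (snd q))"
    and Kd: "\<And>n \<theta> y. \<bar>y\<bar> < e \<Longrightarrow> (K n \<theta> has_vector_derivative K (Suc n) \<theta> y) (at y)"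
    using rx_curve_chain[OF smooth_WI subset_UNIV] by blast
  have ev: "?f (complex_of_real (rx (- y)) * cis \<theta>) = ?f (complex_of_real (rx y) * cis \<theta>)" if "\<bar>y\<bar> < e" for y \<theta>
  proof -
    have "PhiK (complex_of_real (rx (- y)) * cis \<theta>) = PhiK (complex_of_real (rx y) * cis \<theta>)"
      using PhiK_rx[of y \<theta>] PhiK_rx[of "-y" \<theta>] that e by simp
    then show ?thesis unfolding WI_def yc_def by simp
  qed
  have dR: "((\<lambda>y. Re (K n \<theta> y)) has_real_derivative Re (K (Suc n) \<theta> y)) (at y)" and dI: "((\<lambda>y. Im (K n \<theta> y)) has_real_derivative Im (K (Suc n) \<theta> y)) (at y)" if "\<bar>y\<bar> < e" for n \<theta> y
    using bounded_linear.has_vector_derivative[OF bounded_linear_Re Kd[OF that]] bounded_linear.has_vector_derivative[OF bounded_linear_Im Kd[OF that]]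
    by (simp_all add: has_real_derivative_iff_has_vector_derivative)
  have "(deriv ^^ j) (\<lambda>y. Re (?f (complex_of_real (rx y) * cis \<theta>))) 0 = 0 \<and> (deriv ^^ j) (\<lambda>y. Im (?f (complex_of_real (rx y) * cis \<theta>))) 0 = 0" if "odd j" for \<theta> j
  proof -
    have 1: "(deriv ^^ j) (\<lambda>y. Re (K 0 \<theta> y)) 0 = Re (K j \<theta> 0)" "(deriv ^^ j) (\<lambda>y. Im (K 0 \<theta> y)) 0 = Im (K j \<theta> 0)"
      using deriv_chain[of e "\<lambda>n y. Re (K n \<theta> y)" 0 j] deriv_chain[of e "\<lambda>n y. Im (K n \<theta> y)" 0 j] dR dI e by auto
    have "Re (K j \<theta> (- 0)) = (-1)^j * Re (K j \<theta> 0)" "Im (K j \<theta> (- 0)) = (-1)^j * Im (K j \<theta> 0)"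
      using even_chain[of e "\<lambda>n y. Re (K n \<theta> y)" 0 j] even_chain[of e "\<lambda>n y. Im (K n \<theta> y)" 0 j] dR dI e ev by (auto simp: K0)
    then show ?thesis using 1 that unfolding K0 by simp
  qed
  then show ?thesis unfolding Cinf_ev_def using smooth_WI by (intro CollectI exI[of _ UNIV] exI[of _ ?f]) auto
qed

end

section \<open>Polynomial bounds\<close>

text \<open>Chebyshev polynomials of the first kind.\<close>

fun Ch :: "nat \<Rightarrow> real poly" where
  "Ch 0 = 1" | "Ch (Suc 0) = [:0, 1:]" | "Ch (Suc (Suc n)) = [:0, 2:] * Ch (Suc n) - Ch n"

text \<open>Chebyshev polynomials of the second kind with the index shifted by one, so that
  \<open>pderiv (Ch n)\<close> is \<open>n\<close> times \<open>ChU n\<close>. This recursion,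
  rather than the usual one, lets bounds for \<open>Ch\<close> sum up to bounds for
  \<open>ChU\<close>.\<close>

fun ChU :: "nat \<Rightarrow> real poly" where
  "ChU 0 = 0" | "ChU (Suc 0) = 1" | "ChU (Suc (Suc n)) = smult 2 (Ch (Suc n)) + ChU n"

lemma poly_Ch_cos: "poly (Ch n) (cos \<eta>) = cos (real n * \<eta>)"
proof (induction n rule: Ch.induct)
  case (3 n)
  have "cos (real (Suc (Suc n)) * \<eta>) = 2 * cos \<eta> * cos (real (Suc n) * \<eta>) - cos (real n * \<eta>)"
  proof -
    have 1: "real (Suc (Suc n)) * \<eta> = real (Suc n) * \<eta> + \<eta>" and 2: "real n * \<eta> = real (Suc n) * \<eta> - \<eta>" by (simp_all add: algebra_simps)
    show ?thesis unfolding 1 2 cos_add cos_diff by simp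
  qed
  then show ?case using 3 by simp
qed auto

lemma degree_Ch_le: "degree (Ch n) \<le> n"
proof (induction n rule: Ch.induct)
  case (3 n)
  have "degree ([:0, 2:] * Ch (Suc n)) \<le> 1 + Suc n" using 3(1) degree_mult_le[of "[:0, 2:]" "Ch (Suc n)"] by (simp del: mult_pCons_left)
  then show ?case using 3(2) unfolding Ch.simps by (intro degree_diff_le) linarith+
qed auto

lemma ChU_rel: "y * poly (ChU (Suc n)) y = poly (Ch (Suc n)) y + poly (ChU n) y"
proof (induction n rule: induct_nat_012)
  case (ge2 n)
  then show ?case by (simp add: algebra_simps)
qed simp_all

lemma pderiv_Ch: "pderiv (Ch n) = smult (real n) (ChU n)"
proof -
  have "poly (pderiv (Ch n)) y = real n * poly (ChU n) y" for y
  proof (induction n rule: Ch.induct)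
    case (3 n)
    have "poly (pderiv (Ch (Suc (Suc n)))) y = 2 * poly (Ch (Suc n)) y + 2 * (real n + 1) * (y * poly (ChU (Suc n)) y) - real n * poly (ChU n) y"
      using 3 by (simp add: pderiv_mult pderiv_diff pderiv_pCons pderiv_smult algebra_simps)
    also have "... = real (Suc (Suc n)) * poly (ChU (Suc (Suc n))) y"
      unfolding ChU_rel by (simp add: algebra_simps)
    finally show ?case .
  qed (simp_all add: pderiv_pCons)
  then show ?thesis by (intro poly_eq_poly_eq_iff[THEN iffD1] ext) simp
qed

lemma pderiv_funpow_add: "(pderiv ^^ j) (p + q) = (pderiv ^^ j) p + (pderiv ^^ j) (q :: real poly)"
  by (induction j) (simp_all add: pderiv_add)

lemma pderiv_funpow_smult: "(pderiv ^^ j) (smult c p) = smult c ((pderiv ^^ j) (p :: real poly))"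
  by (induction j) (simp_all add: pderiv_smult)

lemma pderiv_funpow_sum: "(pderiv ^^ j) (\<Sum>i\<in>I. f i) = (\<Sum>i\<in>I. (pderiv ^^ j) (f i :: real poly))"
proof (induction I rule: infinite_finite_induct)
  case empty
  show ?case by (induction j) simp_all
next
  case (infinite A)
  show ?case using infinite by (induction j) simp_all
qed (simp_all add: pderiv_funpow_add)

text \<open>A crude Markov inequality: each derivative costs one factor \<open>n\<close> from
  \<open>pderiv_Ch\<close> and another from writing \<open>ChU n\<close> as a sum of at most about
  \<open>n\<close> values of \<open>Ch\<close>.\<close>

lemma Ch_deriv_bound:
  assumes y: "\<bar>y\<bar> \<le> 1"
  shows "\<bar>poly ((pderiv ^^ j) (Ch n)) y\<bar> \<le> real n ^ (2 * j)"
proof (induction j arbitrary: n)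
  case 0
  have "poly (Ch n) y = cos (real n * arccos y)" using poly_Ch_cos[of n "arccos y"] y by (simp add: abs_le_iff)
  then show ?case by simp
next
  case (Suc j)
  have U: "\<bar>poly ((pderiv ^^ j) (ChU n)) y\<bar> \<le> real n ^ (2 * j + 1)" for n
  proof (induction n rule: ChU.induct)
    case 1
    have "(pderiv ^^ j) 0 = (0 :: real poly)" by (induction j) simp_all
    then show ?case by simp
  next
    case 2
    have "\<bar>poly ((pderiv ^^ j) (1 :: real poly)) y\<bar> \<le> 1"
    proof (cases j)
      case (Suc i)
      have "(pderiv ^^ Suc i) (1 :: real poly) = 0" by (induction i) simp_all
      then show ?thesis unfolding Suc by simp
    qed simp
    then show ?case by simp
  next
    case (3 n)
    have "\<bar>poly ((pderiv ^^ j) (ChU (Suc (Suc n)))) y\<bar> \<le> 2 * \<bar>poly ((pderiv ^^ j) (Ch (Suc n))) y\<bar> + \<bar>poly ((pderiv ^^ j) (ChU n)) y\<bar>"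
      by (auto simp: pderiv_funpow_add pderiv_funpow_smult abs_mult intro!: order_trans[OF abs_triangle_ineq])
    also have "... \<le> 2 * real (Suc n) ^ (2 * j) + real n ^ (2 * j + 1)" using Suc.IH[of "Suc n"] 3 by linarith
    also have "... \<le> 2 * real (Suc (Suc n)) ^ (2 * j) + real n * real (Suc (Suc n)) ^ (2 * j)"
      unfolding power_add power_one_right mult.commute[of _ "real n"] by (intro add_mono mult_left_mono power_mono) auto
    also have "... = real (Suc (Suc n)) ^ (2 * j + 1)" by (simp add: algebra_simps)
    finally show ?case .
  qed
  have "\<bar>poly ((pderiv ^^ Suc j) (Ch n)) y\<bar> = real n * \<bar>poly ((pderiv ^^ j) (ChU n)) y\<bar>"
    by (simp add: funpow_Suc_right pderiv_Ch pderiv_funpow_smult abs_mult del: funpow.simps)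
  also have "... \<le> real n * real n ^ (2 * j + 1)" by (intro mult_left_mono U) simp
  finally show ?case by simp
qed

section \<open>Growth of the orthogonal polynomials and of the inverse singular values\<close>

context disk_weight
begin

lemma nu0: "nu 0 = measure (mT \<gamma>) UNIV" by (simp add: nu_def)

lemma Lam_0: "Lam m 0 = complex_of_real (nu 0)" by (simp add: Lam_def nu_def scaleR_conv_of_real)

lemma lamk_pos: "k \<le> m \<Longrightarrow> lamk m k > 0"
  using lamk_sigma2[of k m] sigma2_pos[of k m] by (metis zero_less_mult_pos mult_pos_pos pi_gt_zero zero_less_numeral)

lemma nu0_pos: "nu 0 > 0"
proof -
  have "complex_of_real (nu 0) = complex_of_real (lamk 0 0)" using Lam_trig[of 0 0] Lam_0[of 0] by simp
  then have "nu 0 = lamk 0 0" using of_real_eq_iff by blast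
  then show ?thesis using lamk_pos[of 0 0] by simp
qed

lemma sum_lamk: "(\<Sum>k\<le>m. lamk m k) = nu 0"
proof -
  have "complex_of_real (\<Sum>k\<le>m. lamk m k) = complex_of_real (nu 0)" using Lam_trig[of m 0] Lam_0[of m] by simp
  then show ?thesis using of_real_eq_iff by blast
qed

text \<open>At \<open>al = pi/2\<close> the chord degenerates to a point and
  \<open>Td \<delta>\<close> is just evaluation at \<open>cos \<delta>\<close> times the total mass.
  The eigenvalue relation therefore gives \<open>pg m\<close> explicitly as a cosine sum with
  positive coefficients.\<close>

lemma pg_cos: "nu 0 * poly (pg m) (cos \<delta>) = poly (pg m) 1 * (\<Sum>k\<le>m. lamk m k * cos ((real m - 2 * real k) * \<delta>))"
proof -
  have "complex_of_real (nu 0 * poly (pg m) (cos \<delta>)) = Lam m \<delta> * complex_of_real (poly (pg m) 1)"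
    using Td_pg[of \<delta> m "pi/2"] unfolding Td_def nu0 by simp
  then have "Re (complex_of_real (nu 0 * poly (pg m) (cos \<delta>))) = Re (Lam m \<delta> * complex_of_real (poly (pg m) 1))" by simp
  then show ?thesis unfolding Lam_trig by (simp add: mult.commute)
qed

text \<open>\<open>pg_cos\<close> read as a polynomial identity: both sides agree on infinitely many
  points.\<close>

lemma pg_Ch: "pg m = smult (poly (pg m) 1 / nu 0) (\<Sum>k\<le>m. smult (lamk m k) (Ch (nat \<bar>int m - 2 * int k\<bar>)))" (is "_ = ?q")
proof -
  have c: "cos (real (nat \<bar>int m - 2 * int k\<bar>) * \<delta>) = cos ((real m - 2 * real k) * \<delta>)" for k \<delta>
  proof -
    have "real (nat \<bar>int m - 2 * int k\<bar>) = \<bar>real m - 2 * real k\<bar>" by simp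
    then show ?thesis by (auto simp: abs_if) (metis cos_minus minus_diff_eq mult_minus_left)
  qed
  have "poly (pg m) y = poly ?q y" if "y \<in> {-1..1}" for y
  proof -
    have "cos (arccos y) = y" using that by simp
    then show ?thesis using pg_cos[of m "arccos y"] nu0_pos poly_Ch_cos[of _ "arccos y"] c[of _ "arccos y"]
      by (simp add: poly_sum field_simps)
  qed
  then have "{-1..1} \<subseteq> {y. poly (pg m - ?q) y = 0}" unfolding poly_diff by (intro subsetI CollectI) (metis right_minus_eq)
  moreover have "infinite {-1..1::real}" by (simp add: infinite_Icc)
  ultimately have "infinite {y. poly (pg m - ?q) y = 0}" using infinite_super by blast
  then have "pg m - ?q = 0" using poly_roots_finite by blast
  then show ?thesis by simp
qed

text \<open>The Chebyshev coefficients are positive with sum \<open>nu 0\<close>, so Markov bounds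
  for \<open>Ch\<close> pass to \<open>pg m\<close> with no loss except the value at 1.\<close>

lemma pg_deriv_bound:
  assumes y: "\<bar>y\<bar> \<le> 1"
  shows "\<bar>poly ((pderiv ^^ j) (pg m)) y\<bar> \<le> \<bar>poly (pg m) 1\<bar> * real m ^ (2 * j)"
proof -
  let ?n = "\<lambda>k. nat \<bar>int m - 2 * int k\<bar>"
  have "poly ((pderiv ^^ j) (pg m)) y = poly (pg m) 1 / nu 0 * (\<Sum>k\<le>m. lamk m k * poly ((pderiv ^^ j) (Ch (?n k))) y)"
    by (subst pg_Ch) (simp add: pderiv_funpow_smult pderiv_funpow_sum poly_sum)
  then have "\<bar>poly ((pderiv ^^ j) (pg m)) y\<bar> = \<bar>poly (pg m) 1\<bar> / nu 0 * \<bar>\<Sum>k\<le>m. lamk m k * poly ((pderiv ^^ j) (Ch (?n k))) y\<bar>"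
    using nu0_pos by (simp add: abs_mult)
  also have "... \<le> \<bar>poly (pg m) 1\<bar> / nu 0 * (\<Sum>k\<le>m. lamk m k * real m ^ (2 * j))"
  proof (intro mult_left_mono, rule order_trans[OF sum_abs], rule sum_mono)
    fix k assume "k \<in> {..m}"
    then have k: "k \<le> m" by simp
    have "\<bar>poly ((pderiv ^^ j) (Ch (?n k))) y\<bar> \<le> real (?n k) ^ (2 * j)" by (rule Ch_deriv_bound[OF y])
    also have "... \<le> real m ^ (2 * j)" using k by (intro power_mono) auto
    finally show "\<bar>lamk m k * poly ((pderiv ^^ j) (Ch (?n k))) y\<bar> \<le> lamk m k * real m ^ (2 * j)"
      using lamk_pos[OF k] by (simp add: abs_mult)
  qed (use nu0_pos in simp)
  also have "(\<Sum>k\<le>m. lamk m k * real m ^ (2 * j)) = nu 0 * real m ^ (2 * j)" unfolding sum_distrib_right[symmetric] sum_lamk ..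
  finally show ?thesis using nu0_pos by simp
qed

text \<open>All frequencies are at most \<open>m\<close>, so every cosine in \<open>pg_cos\<close>
  is at least \<open>1/2\<close>; with positive coefficients nothing cancels.\<close>

lemma pg_lower:
  assumes "\<bar>\<delta>\<bar> * real m \<le> 1" shows "\<bar>poly (pg m) (cos \<delta>)\<bar> \<ge> \<bar>poly (pg m) 1\<bar> / 2"
proof -
  have "(\<Sum>k\<le>m. lamk m k * (1/2)) \<le> (\<Sum>k\<le>m. lamk m k * cos ((real m - 2 * real k) * \<delta>))"
  proof (rule sum_mono)
    fix k assume "k \<in> {..m}"
    then have k: "k \<le> m" by simp
    let ?x = "(real m - 2 * real k) * \<delta>"
    have "\<bar>?x\<bar> \<le> real m * \<bar>\<delta>\<bar>" unfolding abs_mult using k by (intro mult_right_mono) auto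
    then have "\<bar>?x\<bar> \<le> 1" using assms by (simp add: mult.commute)
    then have "?x^2 \<le> 1" by (simp add: abs_square_le_1)
    moreover have "cos ?x \<ge> 1 - ?x^2 / 2"
    proof -
      have "(sin (?x/2))^2 \<le> (?x/2)^2" using abs_sin_x_le_abs_x[of "?x/2"] by (simp only: abs_le_square_iff)
      moreover have "cos ?x = 1 - 2 * (sin (?x/2))^2" using cos_double_sin[of "?x/2"] by simp
      ultimately show ?thesis by (simp add: power_divide)
    qed
    ultimately have "1/2 \<le> cos ?x" by linarith
    then show "lamk m k * (1/2) \<le> lamk m k * cos ?x" using lamk_pos[OF k] by (intro mult_left_mono) auto
  qed
  then have S: "nu 0 / 2 \<le> (\<Sum>k\<le>m. lamk m k * cos ((real m - 2 * real k) * \<delta>))"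
    by (simp add: sum_divide_distrib[symmetric] sum_lamk)
  have "nu 0 * \<bar>poly (pg m) (cos \<delta>)\<bar> = \<bar>poly (pg m) 1\<bar> * \<bar>\<Sum>k\<le>m. lamk m k * cos ((real m - 2 * real k) * \<delta>)\<bar>"
    using arg_cong[OF pg_cos[of m \<delta>], of abs] nu0_pos by (simp add: abs_mult)
  also have "... \<ge> \<bar>poly (pg m) 1\<bar> * (nu 0 / 2)" using S by (intro mult_left_mono) auto
  finally have "nu 0 * (\<bar>poly (pg m) 1\<bar> / 2) \<le> nu 0 * \<bar>poly (pg m) (cos \<delta>)\<bar>" by (simp add: mult_ac)
  then show ?thesis using nu0_pos by simp
qed

text \<open>On an angle window of width comparable to \<open>1/m\<close> next to
  \<open>pi/2\<close>, the polynomial is at least half its endpoint value. The fixed norm of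
  \<open>pg m\<close> then bounds that value polynomially in \<open>m\<close>.\<close>

lemma pg1_bound: "\<exists>C L. C > 0 \<and> (\<forall>m. \<bar>poly (pg m) 1\<bar> \<le> C * (1 + real m) ^ L)"
proof -
  obtain K :: nat where K: "2*\<gamma>+2 \<le> real K" using real_arch_simple by blast
  define C :: real where "C = 1 + 8 * 4 ^ K"
  have "\<bar>poly (pg m) 1\<bar> \<le> C * (1 + real m) ^ (K + 1)" for m
  proof -
    \<comment> \<open>Small enough that \<open>pg_lower\<close> applies throughout the window,
      including for \<open>m = 0\<close>.\<close>
    define h where "h = 1 / (1 + real m)"
    have h: "0 < h" "h \<le> 1" by (auto simp: h_def)
    let ?J = "{pi/2 - h .. pi/2 - h/2}"
    have JI: "?J \<subseteq> Iang" using h pi_gt3 by auto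
    let ?p = "\<bar>poly (pg m) 1\<bar>"
    \<comment> \<open>Lower bound for the integrand on the window: \<open>?p^2 / 4\<close> from half
      the endpoint value, \<open>(h/4) ^ K\<close> from the weight, since
      \<open>cos al = sin \<delta> \<ge> \<delta>/2 \<ge> h/4\<close> and \<open>K\<close> is at
      least the exponent.\<close>
    let ?c = "?p^2 / 4 * (h/4) ^ K"
    have low: "?c * indicator ?J al \<le> cos al powr (2*\<gamma>+2) * indicator Iang al * (poly (pg m) (sin al))^2" for al
    proof (cases "al \<in> ?J")
      case True
      define \<delta> where "\<delta> = pi/2 - al"
      have d: "h/2 \<le> \<delta>" "\<delta> \<le> h" using True by (auto simp: \<delta>_def)
      have sn: "sin al = cos \<delta>" "cos al = sin \<delta>" unfolding \<delta>_def by (simp_all add: cos_diff sin_diff)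
      have "\<bar>\<delta>\<bar> * real m \<le> h * real m" using d h by (intro mult_right_mono) auto
      also have "... \<le> 1" by (simp add: h_def divide_simps)
      finally have "?p / 2 \<le> \<bar>poly (pg m) (sin al)\<bar>" unfolding sn by (rule pg_lower)
      then have "(?p / 2)^2 \<le> \<bar>poly (pg m) (sin al)\<bar>^2" by (intro power_mono) auto
      then have p: "?p^2 / 4 \<le> (poly (pg m) (sin al))^2" by (simp add: power_divide)
      have "sin \<delta> \<ge> \<delta> / 2"
      proof -
        obtain \<xi> where x: "0 < \<xi>" "\<xi> < \<delta>" "sin \<delta> - sin 0 = (\<delta> - 0) * cos \<xi>"
          using MVT2[of 0 \<delta> sin cos] d h by (auto intro: DERIV_sin)
        have "cos (pi/3) \<le> cos \<xi>" using x d h pi_gt3 by (intro cos_monotone_0_pi_le) auto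
        then have "\<delta> * (1/2) \<le> \<delta> * cos \<xi>" using d h by (intro mult_left_mono) (auto simp: cos_60)
        then show ?thesis using x by simp
      qed
      then have c: "cos al \<ge> h/4" unfolding sn using d by linarith
      have "(h/4) ^ K = (h/4) powr (real K)" using h by (simp add: powr_realpow)
      also have "... \<le> (h/4) powr (2*\<gamma>+2)" using h K by (intro powr_mono') auto
      also have "... \<le> cos al powr (2*\<gamma>+2)" using c h gam by (intro powr_mono2) auto
      finally have "(h/4) ^ K \<le> cos al powr (2*\<gamma>+2)" .
      then have "?p^2 / 4 * (h/4) ^ K \<le> (poly (pg m) (sin al))^2 * cos al powr (2*\<gamma>+2)"
        using p h by (intro mult_mono) auto
      moreover have "al \<in> Iang" using True JI by blast
      ultimately show ?thesis using True by (simp add: mult.commute)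
    qed simp
    have "ennreal (?c * (h/2)) = (\<integral>\<^sup>+al. ennreal (?c * indicator ?J al) \<partial>lborel)"
    proof -
      have "(\<integral>\<^sup>+al. ennreal (?c * indicator ?J al) \<partial>lborel) = (\<integral>\<^sup>+al. ennreal ?c * indicator ?J al \<partial>lborel)"
        by (intro nn_integral_cong) (auto simp: indicator_def)
      also have "... = ennreal ?c * ennreal (h/2)" using h by (simp add: nn_integral_cmult_indicator)
      finally show ?thesis using h by (simp add: ennreal_mult[symmetric])
    qed
    also have "... \<le> (\<integral>\<^sup>+al. ennreal (cos al powr (2*\<gamma>+2) * indicator Iang al * (poly (pg m) (sin al))^2) \<partial>lborel)"
      using low by (intro nn_integral_mono ennreal_leI)
    also have "... = (\<integral>\<^sup>+al. ennreal ((poly (pg m) (sin al))^2) \<partial>mA \<gamma>)"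
      unfolding mA_def by (subst nn_integral_density) (auto simp: ennreal_mult[symmetric] indicator_def intro!: nn_integral_cong)
    also have "... = ennreal (1 / (2*pi))"
      unfolding pg_norm[of m, symmetric] using integrable_poly_sin[of "(pg m)^2"] by (intro nn_integral_eq_integral) auto
    finally have "?c * (h/2) \<le> 1 / (2*pi)" by (simp add: ennreal_le_iff)
    also have "... \<le> 1" using pi_ge_two by (simp add: divide_le_eq)
    finally have "?p^2 * (h ^ (K+1)) \<le> 8 * 4 ^ K" using h by (simp add: power_divide field_simps)
    then have "?p^2 \<le> 8 * 4 ^ K * (1 + real m) ^ (K+1)" unfolding h_def power_divide by (simp add: divide_le_eq)
    moreover have "?p \<le> 1 + ?p^2" using zero_le_power2[of "?p - 1/2"] unfolding power2_diff by (simp add: power_divide)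
    moreover have "1 \<le> (1 + real m) ^ (K+1)" by (rule one_le_power) simp
    ultimately show ?thesis unfolding C_def by (simp add: algebra_simps)
  qed
  moreover have "C > 0" unfolding C_def by (simp add: add_pos_pos)
  ultimately show ?thesis by blast
qed

lemma fact_add_le: "fact (m + n) \<le> real (m + n) ^ n * fact m"
proof (induction n)
  case (Suc n)
  have "fact (m + Suc n) = real (m + Suc n) * fact (m + n)" by simp
  also have "... \<le> real (m + Suc n) * (real (m + n) ^ n * fact m)" using Suc by (intro mult_left_mono) auto
  also have "... \<le> real (m + Suc n) * (real (m + Suc n) ^ n * fact m)" by (intro mult_left_mono mult_right_mono power_mono) auto
  finally show ?case by (simp add: mult_ac)
qed simp

text \<open>The Beta function decreases in its arguments, so replacing \<open>\<gamma>\<close> by an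
  integer \<open>K \<ge> \<gamma>\<close> bounds it below by a quotient of factorials, which is
  polynomial in \<open>m\<close> after multiplication by the binomial coefficient.\<close>

lemma sigma2_lower: "\<exists>c L. c > 0 \<and> (\<forall>m k. k \<le> m \<longrightarrow> 1 / sigma2 \<gamma> m k \<le> c * (1 + real m) ^ L)"
proof -
  obtain K :: nat where K: "\<gamma> \<le> real K" using real_arch_simple by blast
  \<comment> \<open>The two Beta arguments with \<open>K\<close> add up to \<open>m + L + 1\<close>,
    so the denominator of the Beta value is the factorial of \<open>m + L\<close>.\<close>
  define L where "L = 2 * K + 1"
  define a where "a = 2 * pi * 2 powr (2*\<gamma>+1)"
  have a: "a > 0" by (simp add: a_def)
  have "1 / sigma2 \<gamma> m k \<le> (real L ^ L / a) * (1 + real m) ^ L" if k: "k \<le> m" for m k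
  proof -
    have G: "Gamma (real n + 1 + real K) = fact (n + K)" for n
      using Gamma_fact[of "n + K", where 'a=real] by (simp add: add_ac)
    have "Beta (real (m - k) + 1 + real K) (real k + 1 + real K) = fact (m - k + K) * fact (k + K) / fact (m + L)"
    proof -
      have "real (m - k) + 1 + real K + (real k + 1 + real K) = real (m + L) + 1" using k by (simp add: L_def of_nat_diff)
      then have "Gamma (real (m - k) + 1 + real K + (real k + 1 + real K)) = fact (m + L)" using Gamma_fact[of "m + L", where 'a=real] by (simp add: add_ac)
      then show ?thesis unfolding Beta_def G by simp
    qed
    moreover have "Beta (real (m - k) + 1 + real K) (real k + 1 + real K) \<le> Beta (real (m - k) + 1 + \<gamma>) (real k + 1 + \<gamma>)"
      using K gam by (intro Beta_real_mono) auto
    moreover have "fact (m - k) * fact k / fact (m + L) \<le> fact (m - k + K) * fact (k + K) / (fact (m + L) :: real)"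
      by (intro divide_right_mono mult_mono fact_mono) auto
    ultimately have B: "fact (m - k) * fact k / fact (m + L) \<le> Beta (real (m - k) + 1 + \<gamma>) (real k + 1 + \<gamma>)" by linarith
    have C: "of_nat (m choose k) = (fact m / (fact k * fact (m - k)) :: real)" using k by (rule binomial_fact)
    have "1 / (real L * (1 + real m)) ^ L \<le> 1 / real (m + L) ^ L"
    proof -
      have "real (m + L) \<le> real L * (1 + real m)" unfolding L_def by (simp add: algebra_simps)
      then show ?thesis by (intro divide_left_mono power_mono) (auto simp: L_def)
    qed
    also have "... \<le> fact m / fact (m + L)"
      using fact_add_le[of m L] by (simp add: divide_simps L_def mult_ac)
    also have "... = of_nat (m choose k) * (fact (m - k) * fact k / fact (m + L))" unfolding C by simp
    also have "... \<le> of_nat (m choose k) * Beta (real (m - k) + 1 + \<gamma>) (real k + 1 + \<gamma>)" by (intro mult_left_mono B) simp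
    finally have "a * (1 / (real L * (1 + real m)) ^ L) \<le> sigma2 \<gamma> m k"
      unfolding lamk_sigma2[OF k, symmetric] lamk_def a_def using mult_left_mono[OF _ less_imp_le[OF a], unfolded a_def, of "1 / (real L * (1 + real m)) ^ L" "of_nat (m choose k) * Beta (real (m - k) + 1 + \<gamma>) (real k + 1 + \<gamma>)"] by (simp add: mult.assoc mult.left_commute)
    moreover have "a * (1 / (real L * (1 + real m)) ^ L) > 0" using a by (simp add: L_def)
    ultimately have "1 / sigma2 \<gamma> m k \<le> 1 / (a * (1 / (real L * (1 + real m)) ^ L))" using sigma2_pos[OF k] by (intro divide_left_mono mult_pos_pos[of _ "a * _"]) auto
    then show ?thesis by (simp add: power_mult_distrib)
  qed
  moreover have "real L ^ L / a > 0" using a by (simp add: L_def)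
  ultimately show ?thesis by blast
qed

end

section \<open>Rapidly decaying coefficients give smooth even functions\<close>

definition rapid :: "(nat \<Rightarrow> nat \<Rightarrow> complex) \<Rightarrow> bool" where
  "rapid M \<longleftrightarrow> (\<forall>N::nat. \<exists>C. \<forall>m. \<forall>k\<le>m. cmod (M m k) \<le> C * (1 + real m) powr (- real N))"

context disk_weight
begin

text \<open>Block \<open>m\<close> of the wave profile of the inversion series, differentiated
  \<open>j\<close> times in the profile variable; for \<open>j = 0\<close>, putting
  \<open>y = yc om z\<close> and integrating over \<open>om\<close> gives the block of
  \<open>FJ\<close>.\<close>

definition Wt :: "(nat \<Rightarrow> nat \<Rightarrow> complex) \<Rightarrow> nat \<Rightarrow> nat \<Rightarrow> real \<Rightarrow> real \<Rightarrow> complex" where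
  "Wt M j m om y = (\<Sum>k\<le>m. (complex_of_real (2*pi) * M m k / complex_of_real (sigma2 \<gamma> m k)) * cis ((real m - 2 * real k) * om))
     * complex_of_real (poly ((pderiv ^^ j) (pg m)) y)"

lemma Wt_bound:
  assumes M: "rapid M"
  shows "\<exists>b. summable b \<and> (\<forall>m om y. \<bar>y\<bar> \<le> 1 \<longrightarrow> cmod (Wt M j m om y) \<le> b m)"
proof -
  obtain c L where c: "c > 0" "\<And>m k. k \<le> m \<Longrightarrow> 1 / sigma2 \<gamma> m k \<le> c * (1 + real m) ^ L" using sigma2_lower by blast
  obtain c' L' where c': "c' > 0" "\<And>m. \<bar>poly (pg m) 1\<bar> \<le> c' * (1 + real m) ^ L'" using pg1_bound by blast
  \<comment> \<open>One power for the \<open>m + 1\<close> terms of the sum over \<open>k\<close>,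
    \<open>L\<close> for the inverse singular values, \<open>L' + 2 * j\<close> for the derivative
    of \<open>pg m\<close>, and 2 for summability.\<close>
  define N where "N = 1 + L + L' + 2 * j + 2"
  obtain C where C: "\<And>m k. k \<le> m \<Longrightarrow> cmod (M m k) \<le> C * (1 + real m) powr (- real N)" using M unfolding rapid_def by blast
  have C0: "C \<ge> 0" using C[of 0 0] norm_ge_zero[of "M 0 0"] by (simp add: order_trans[OF norm_ge_zero])
  define b where "b m = (2*pi*C*c*c') * inverse (real (Suc m) ^ 2)" for m
  have "summable b" unfolding b_def
    using inverse_power_summable[of 2, where 'a=real] by (intro summable_mult) (simp only: summable_Suc_iff[of "\<lambda>m. inverse (real m ^ 2)"] le_refl)
  moreover have "cmod (Wt M j m om y) \<le> b m" if y: "\<bar>y\<bar> \<le> 1" for m om y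
  proof -
    let ?x = "1 + real m"
    have x: "?x > 0" by simp
    have q: "cmod (M m k) / sigma2 \<gamma> m k \<le> C * inverse (?x ^ N) * (c * ?x ^ L)" if k: "k \<le> m" for k
    proof -
      have "cmod (M m k) * (1 / sigma2 \<gamma> m k) \<le> (C * ?x powr (- real N)) * (c * ?x ^ L)"
        using C[OF k] c(2)[OF k] sigma2_pos[OF k] C0 by (intro mult_mono) auto
      then show ?thesis by (simp add: powr_minus powr_realpow)
    qed
    have "cmod (\<Sum>k\<le>m. (complex_of_real (2*pi) * M m k / complex_of_real (sigma2 \<gamma> m k)) * cis ((real m - 2 * real k) * om))
        \<le> (\<Sum>k\<le>m. 2 * pi * (C * inverse (?x ^ N) * (c * ?x ^ L)))"
    proof (rule sum_norm_le)
      fix k assume "k \<in> {..m}"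
      then have k: "k \<le> m" by simp
      have "cmod ((complex_of_real (2*pi) * M m k / complex_of_real (sigma2 \<gamma> m k)) * cis ((real m - 2 * real k) * om))
         = 2 * pi * (cmod (M m k) / sigma2 \<gamma> m k)" using sigma2_pos[OF k] by (simp add: norm_mult norm_divide)
      also have "... \<le> 2 * pi * (C * inverse (?x ^ N) * (c * ?x ^ L))" using q[OF k] by (intro mult_left_mono) auto
      finally show "cmod ((complex_of_real (2*pi) * M m k / complex_of_real (sigma2 \<gamma> m k)) * cis ((real m - 2 * real k) * om))
        \<le> 2 * pi * (C * inverse (?x ^ N) * (c * ?x ^ L))" .
    qed
    also have "... = ?x * (2 * pi * (C * inverse (?x ^ N) * (c * ?x ^ L)))" by simp
    finally have Q: "cmod (\<Sum>k\<le>m. (complex_of_real (2*pi) * M m k / complex_of_real (sigma2 \<gamma> m k)) * cis ((real m - 2 * real k) * om))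
        \<le> ?x * (2 * pi * (C * inverse (?x ^ N) * (c * ?x ^ L)))" .
    have "\<bar>poly ((pderiv ^^ j) (pg m)) y\<bar> \<le> \<bar>poly (pg m) 1\<bar> * real m ^ (2 * j)" by (rule pg_deriv_bound[OF y])
    also have "... \<le> (c' * ?x ^ L') * ?x ^ (2 * j)" using c' by (intro mult_mono power_mono) auto
    finally have "cmod (Wt M j m om y) \<le> (?x * (2 * pi * (C * inverse (?x ^ N) * (c * ?x ^ L)))) * ((c' * ?x ^ L') * ?x ^ (2 * j))"
      unfolding Wt_def norm_mult norm_of_real using C0 c x by (intro mult_mono[OF Q]) auto
    also have "... = (2*pi*C*c*c') * (?x ^ (1 + L + L' + 2 * j) * inverse (?x ^ N))" by (simp add: power_add)
    also have "?x ^ (1 + L + L' + 2 * j) * inverse (?x ^ N) = inverse (?x ^ 2)"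
    proof -
      have N: "N = (1 + L + L' + 2 * j) + 2" by (simp add: N_def)
      have i: "?x ^ n * inverse (?x ^ n) = 1" for n using x by (intro right_inverse) simp
      show ?thesis unfolding N power_add[of ?x "1 + L + L' + 2 * j" 2] inverse_mult_distrib mult.assoc[symmetric] i by simp
    qed
    finally show ?thesis unfolding b_def by (simp add: add.commute)
  qed
  ultimately show ?thesis by blast
qed

lemma Wt_derivative: "(Wt M j m om has_vector_derivative Wt M (Suc j) m om y) (at y within S)"
proof -
  have "((\<lambda>y. complex_of_real (poly ((pderiv ^^ j) (pg m)) y)) has_vector_derivative complex_of_real (poly ((pderiv ^^ Suc j) (pg m)) y)) (at y within S)"
    by (rule has_vector_derivative_at_within, rule has_vector_derivative_complex_of_real) (simp add: poly_DERIV)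
  then show ?thesis unfolding Wt_def[abs_def] by (rule has_vector_derivative_mult_right)
qed

lemma Wt_continuous: "continuous_on UNIV (\<lambda>q. Wt M j m (fst q) (snd q))"
  unfolding Wt_def by (intro continuous_intros continuous_on_cis)

text \<open>The summable majorants of \<open>Wt_bound\<close> exist for every order
  \<open>j\<close>; they give uniform convergence of all differentiated series and hence termwise
  differentiation.\<close>

lemma wave_family_Wt:
  assumes M: "rapid M" shows "wave_family (\<lambda>j om y. \<Sum>m. Wt M j m om y)"
proof
  have ul: "uniform_limit (UNIV \<times> {-1..1}) (\<lambda>n q. \<Sum>m<n. Wt M j m (fst q) (snd q)) (\<lambda>q. \<Sum>m. Wt M j m (fst q) (snd q)) sequentially" for j
  proof -
    obtain b where b: "summable b" "\<forall>m om y. \<bar>y\<bar> \<le> 1 \<longrightarrow> cmod (Wt M j m om y) \<le> b m" using Wt_bound[OF M] by blast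
    show ?thesis by (rule Weierstrass_m_test[OF _ b(1)]) (use b(2) in \<open>auto simp: abs_le_iff\<close>)
  qed
  show "continuous_on ({0..2*pi} \<times> {-1..1}) (\<lambda>q. \<Sum>m. Wt M j m (fst q) (snd q))" for j
  proof (rule uniform_limit_theorem)
    show "uniform_limit ({0..2*pi} \<times> {-1..1}) (\<lambda>n q. \<Sum>m<n. Wt M j m (fst q) (snd q)) (\<lambda>q. \<Sum>m. Wt M j m (fst q) (snd q)) sequentially"
      by (rule uniform_limit_on_subset[OF ul]) auto
    show "\<forall>\<^sub>F n in sequentially. continuous_on ({0..2*pi} \<times> {-1..1}) (\<lambda>q. \<Sum>m<n. Wt M j m (fst q) (snd q))"
      by (intro always_eventually allI continuous_on_sum continuous_on_subset[OF Wt_continuous]) simp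
  qed simp
  fix j :: nat and om y :: real assume y: "y \<in> {-1..1}"
  let ?g' = "\<lambda>x h. h *\<^sub>R (\<Sum>m. Wt M (Suc j) m om x)"
  obtain b where b: "summable b" "\<forall>m om y. \<bar>y\<bar> \<le> 1 \<longrightarrow> cmod (Wt M j m om y) \<le> b m" using Wt_bound[OF M] by blast
  have "summable (\<lambda>n. Wt M j n om y)" using y b(2) by (intro summable_comparison_test'[OF b(1), of 0]) (auto simp: abs_le_iff)
  then have sy: "(\<lambda>n. Wt M j n om y) sums (\<Sum>n. Wt M j n om y)" by (rule summable_sums)
  have ev: "\<forall>\<^sub>F n in sequentially. \<forall>x\<in>{-1..1}. \<forall>h. norm ((\<Sum>i<n. h *\<^sub>R Wt M (Suc j) i om x) - ?g' x h) \<le> e * norm h" if "e > 0" for e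
  proof -
    have "\<forall>\<^sub>F n in sequentially. \<forall>q\<in>UNIV \<times> {-1..1}. dist (\<Sum>m<n. Wt M (Suc j) m (fst q) (snd q)) (\<Sum>m. Wt M (Suc j) m (fst q) (snd q)) < e"
      using ul[of "Suc j"] that by (rule uniform_limitD)
    then show ?thesis
    proof (rule eventually_mono, intro ballI allI)
      fix n x h assume a: "\<forall>q\<in>UNIV \<times> {-1..1}. dist (\<Sum>m<n. Wt M (Suc j) m (fst q) (snd q)) (\<Sum>m. Wt M (Suc j) m (fst q) (snd q)) < e"
        and x: "x \<in> {-1..1::real}"
      have "norm ((\<Sum>i<n. h *\<^sub>R Wt M (Suc j) i om x) - ?g' x h) = \<bar>h\<bar> * norm ((\<Sum>m<n. Wt M (Suc j) m om x) - (\<Sum>m. Wt M (Suc j) m om x))"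
        unfolding scaleR_sum_right[symmetric] scaleR_diff_right[symmetric] by simp
      also have "... \<le> \<bar>h\<bar> * e" using bspec[OF a, of "(om, x)"] x by (intro mult_left_mono) (auto simp: dist_norm)
      finally show "norm ((\<Sum>i<n. h *\<^sub>R Wt M (Suc j) i om x) - ?g' x h) \<le> e * norm h" by (simp add: mult.commute)
    qed
  qed
  have "\<exists>g. \<forall>x\<in>{-1..1}. (\<lambda>n. Wt M j n om x) sums (g x) \<and> (g has_derivative ?g' x) (at x within {-1..1})"
    by (rule has_derivative_series[where f="\<lambda>n. Wt M j n om" and f'="\<lambda>i x h. h *\<^sub>R Wt M (Suc j) i om x" and x=y])
      (use Wt_derivative ev y sy in \<open>auto simp: has_vector_derivative_def\<close>)
  then obtain g where g: "\<And>x. x \<in> {-1..1} \<Longrightarrow> (\<lambda>n. Wt M j n om x) sums (g x)"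
    "\<And>x. x \<in> {-1..1} \<Longrightarrow> (g has_derivative ?g' x) (at x within {-1..1})" by blast
  show "((\<lambda>y. \<Sum>m. Wt M j m om y) has_vector_derivative (\<Sum>m. Wt M (Suc j) m om y)) (at y within {-1..1})"
    unfolding has_vector_derivative_def by (rule has_derivative_transform[OF y _ g(2)[OF y]]) (rule sums_unique[OF g(1), symmetric])
qed

definition Fsum :: "(nat \<Rightarrow> nat \<Rightarrow> complex) \<Rightarrow> complex \<Rightarrow> complex" where
  "Fsum M z = integral {0..2*pi} (\<lambda>om. \<Sum>m. Wt M 0 m om (yc om z))"

lemma Fsum_Cinf_ev: assumes "rapid M" shows "Fsum M \<in> Cinf_ev"
proof -
  interpret wave_family "\<lambda>j om y. \<Sum>m. Wt M j m om y" by (rule wave_family_Wt[OF assms])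
  have "Fsum M = WI (\<lambda>om z. \<Sum>m. Wt M 0 m om (yc om z))" by (rule ext) (simp add: Fsum_def WI_def)
  then show ?thesis using WI_Cinf_ev by simp
qed

lemma Wt_measurable [measurable]: "(\<lambda>om. Wt M 0 m om (yc om z)) \<in> borel_measurable borel"
  unfolding Wt_def by measurable

lemma FJ_Wt: "FJ M J z = (LINT om|mO. (\<Sum>m\<le>J. Wt M 0 m om (yc om z)))"
proof -
  have I: "integrable mO (\<lambda>om. cis ((real m - 2 * real k) * om) * complex_of_real (poly (pg m) (yc om z)))" for m k :: nat
  proof -
    obtain B where "\<forall>om z. cmod (cis ((real m - 2 * real k) * om) * complex_of_real (poly (pg m) (yc om z))) \<le> B" using wave_bound by blast
    then show ?thesis by (intro O.integrable_const_bound[where B=B]) auto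
  qed
  have "(\<Sum>m\<le>J. Wt M 0 m om (yc om z)) = (\<Sum>m\<le>J. \<Sum>k\<le>m. (complex_of_real (2*pi) * M m k / complex_of_real (sigma2 \<gamma> m k)) *
      (cis ((real m - 2 * real k) * om) * complex_of_real (poly (pg m) (yc om z))))" for om
    unfolding Wt_def by (simp add: sum_distrib_right mult.assoc)
  then show ?thesis unfolding FJ_def Zk_def using I
    by (simp add: Bochner_Integration.integral_sum Bochner_Integration.integrable_sum)
qed

text \<open>The second claim is uniform in both \<open>J\<close> and \<open>z\<close>; it is the
  constant dominating the chord averages in \<open>smooth_sufficient\<close>.\<close>

lemma FJ_tendsto_Fsum:
  assumes M: "rapid M"
  shows "(\<lambda>J. FJ M J z) \<longlonglongrightarrow> Fsum M z" "\<exists>B. \<forall>J z. cmod (FJ M J z) \<le> B"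
proof -
  interpret wave_family "\<lambda>j om y. \<Sum>m. Wt M j m om y" by (rule wave_family_Wt[OF M])
  obtain b where b: "summable b" "\<forall>m om y. \<bar>y\<bar> \<le> 1 \<longrightarrow> cmod (Wt M 0 m om y) \<le> b m" using Wt_bound[OF M] by blast
  then have W: "cmod (Wt M 0 m om (yc om z)) \<le> b m" for m om z using abs_yc_le_1 by blast
  then have b0: "b m \<ge> 0" for m using order_trans[OF norm_ge_zero] by blast
  have S: "cmod (\<Sum>m\<le>J. Wt M 0 m om (yc om z)) \<le> suminf b" for J om z
  proof -
    have "cmod (\<Sum>m\<le>J. Wt M 0 m om (yc om z)) \<le> sum b {..J}" by (rule sum_norm_le) (rule W)
    also have "... \<le> suminf b" using b0 by (intro sum_le_suminf b(1)) auto
    finally show ?thesis .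
  qed
  have su: "(\<lambda>J. \<Sum>m\<le>J. Wt M 0 m om (yc om z)) \<longlonglongrightarrow> (\<Sum>m. Wt M 0 m om (yc om z))" for om
    by (intro summable_LIMSEQ' summable_comparison_test'[OF b(1), of 0]) (rule W)
  have m: "(\<lambda>om. \<Sum>m. Wt M 0 m om (yc om z)) \<in> borel_measurable borel"
    by (rule borel_measurable_LIMSEQ_metric[OF _ su]) measurable
  have "continuous_on {0..2*pi} ((\<lambda>q. \<Sum>m. Wt M 0 m (fst q) (snd q)) \<circ> (\<lambda>om. (om, yc om z)))"
  proof (rule continuous_on_compose)
    show "continuous_on {0..2*pi} (\<lambda>om. (om, yc om z))"
      by (intro continuous_intros continuous_on_compose2[OF continuous_on_yc, of _ "\<lambda>om. (om, z)", simplified])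
    show "continuous_on ((\<lambda>om. (om, yc om z)) ` {0..2*pi}) (\<lambda>q. \<Sum>m. Wt M 0 m (fst q) (snd q))"
      by (rule continuous_on_subset[OF Hc[of 0]]) (use yc_mem in auto)
  qed
  then have "Fsum M z = (LINT om|mO. (\<Sum>m. Wt M 0 m om (yc om z)))" unfolding Fsum_def using m by (intro integral_mO[symmetric]) (simp_all add: comp_def)
  moreover have "(\<lambda>J. LINT om|mO. (\<Sum>m\<le>J. Wt M 0 m om (yc om z))) \<longlonglongrightarrow> (LINT om|mO. (\<Sum>m. Wt M 0 m om (yc om z)))"
    by (rule integral_dominated_convergence[where w="\<lambda>_. suminf b"]) (use su S m in auto)
  ultimately show "(\<lambda>J. FJ M J z) \<longlonglongrightarrow> Fsum M z" unfolding FJ_Wt by simp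
  have "cmod (FJ M J z) \<le> (LINT om|mO. suminf b)" for J z unfolding FJ_Wt
  proof (rule Bochner_Integration.integral_norm_bound_integral)
    show "integrable mO (\<lambda>om. \<Sum>m\<le>J. Wt M 0 m om (yc om z))"
      by (rule O.integrable_const_bound[where B="suminf b"]) (use S in auto)
  qed (use S in auto)
  then show "\<exists>B. \<forall>J z. cmod (FJ M J z) \<le> B" by blast
qed

text \<open>Cutting \<open>M\<close> off beyond \<open>J\<close> gives an array that is trivially
  rapid, and its full series is the finite sum \<open>FJ M J\<close>.\<close>

lemma FJ_Cinf_ev: "FJ M J \<in> Cinf_ev"
proof -
  define M' where "M' m k = (if m \<le> J then M m k else 0)" for m k
  have "rapid M'" unfolding rapid_def
  proof
    fix N :: nat
    define C where "C = (\<Sum>m\<le>J. \<Sum>k\<le>m. cmod (M m k) * (1 + real m) powr real N)"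
    have "cmod (M' m k) \<le> C * (1 + real m) powr (- real N)" if "k \<le> m" for m k
    proof (cases "m \<le> J")
      case True
      have "cmod (M m k) * (1 + real m) powr real N \<le> (\<Sum>k\<le>m. cmod (M m k) * (1 + real m) powr real N)" using that by (intro member_le_sum) auto
      also have "... \<le> C" unfolding C_def using True by (intro member_le_sum[of m "{..J}" "\<lambda>m. \<Sum>k\<le>m. cmod (M m k) * (1 + real m) powr real N"] sum_nonneg) auto
      finally have "cmod (M m k) \<le> C / (1 + real m) powr real N" by (simp add: pos_le_divide_eq add_pos_nonneg)
      then show ?thesis using True by (simp add: M'_def powr_minus divide_inverse)
    next
      case False
      have "C \<ge> 0" unfolding C_def by (intro sum_nonneg) auto
      then show ?thesis using False by (simp add: M'_def)
    qed
    then show "\<exists>C. \<forall>m. \<forall>k\<le>m. cmod (M' m k) \<le> C * (1 + real m) powr (- real N)" by blast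
  qed
  have "Fsum M' z = FJ M J z" for z
  proof -
    have "FJ M' J' z = FJ M J z" if "J' \<ge> J" for J'
    proof -
      have "FJ M' J' z = (\<Sum>m\<le>J. \<Sum>k\<le>m. (complex_of_real (2*pi) * M' m k / complex_of_real (sigma2 \<gamma> m k)) * Zk m k z)"
        unfolding FJ_def using that by (intro sum.mono_neutral_right) (auto simp: M'_def)
      also have "... = FJ M J z" unfolding FJ_def by (intro sum.cong) (auto simp: M'_def)
      finally show ?thesis .
    qed
    then have "(\<lambda>J'. FJ M' J' z) \<longlonglongrightarrow> FJ M J z"
      by (intro tendsto_eventually) (auto simp: eventually_sequentially)
    then show ?thesis using FJ_tendsto_Fsum(1)[OF \<open>rapid M'\<close>] LIMSEQ_unique by blast
  qed
  then have "FJ M J = Fsum M'" by auto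
  then show ?thesis using Fsum_Cinf_ev[OF \<open>rapid M'\<close>] by simp
qed

end

section \<open>Cosine series of smooth even functions\<close>

abbreviation Icl :: "real set" where "Icl \<equiv> {-(pi/2)..pi/2}"

text \<open>The cosine basis of the angle interval, with vanishing derivative at both ends. It is
  also a polynomial of degree at most \<open>n\<close> in \<open>sin al\<close>
  (\<open>Cn_poly\<close>), which links cosine truncation to orthogonality of
  \<open>pg m\<close>.\<close>

definition Cn :: "nat \<Rightarrow> real \<Rightarrow> real" where "Cn n al = cos (real n * (al + pi/2))"

lemma continuous_Cn [continuous_intros]: "continuous_on S (Cn n)"
  unfolding Cn_def[abs_def] by (intro continuous_intros)

lemma abs_Cn_le_1: "\<bar>Cn n al\<bar> \<le> 1" by (simp add: Cn_def)

lemma Cn_poly: "Cn n al = poly (pcompose (Ch n) [:0, -1:]) (sin al)"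
  using poly_Ch_cos[of n "al + pi/2"] by (simp add: Cn_def poly_pcompose cos_add)

lemma sin_Cn_0: "sin al * Cn 0 al = - Cn 1 al" by (simp add: Cn_def cos_add)

lemma sin_Cn_Suc: "sin al * Cn (Suc k) al = - (Cn (Suc (Suc k)) al + Cn k al) / 2"
proof -
  let ?\<eta> = "al + pi/2"
  have 1: "real (Suc (Suc k)) * ?\<eta> = real (Suc k) * ?\<eta> + ?\<eta>" and 2: "real k * ?\<eta> = real (Suc k) * ?\<eta> - ?\<eta>" by (simp_all only: of_nat_Suc distrib_right mult_1)
  have "Cn (Suc (Suc k)) al + Cn k al = 2 * cos ?\<eta> * cos (real (Suc k) * ?\<eta>)" unfolding Cn_def 1 2 cos_add[of _ ?\<eta>] cos_diff[of _ ?\<eta>] by simp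
  moreover have "cos ?\<eta> = - sin al" by (simp add: cos_add)
  ultimately show ?thesis unfolding Cn_def by simp
qed

lemma Cn_ends: "sin (real n * (pi/2 + pi/2)) = 0" "sin (real n * (-(pi/2) + pi/2)) = 0" by simp_all

text \<open>Two integrations by parts at once, through an explicit primitive; at the ends one
  boundary term dies with the sine and the other with \<open>s1\<close>.\<close>

lemma integral_Cn_parts:
  fixes s0 s1 s2 :: "real \<Rightarrow> real"
  assumes 0: "\<And>al. al \<in> Icl \<Longrightarrow> (s0 has_real_derivative s1 al) (at al within Icl)"
    and 1: "\<And>al. al \<in> Icl \<Longrightarrow> (s1 has_real_derivative s2 al) (at al within Icl)"
    and e: "s1 (pi/2) = 0" "s1 (-(pi/2)) = 0" and c: "continuous_on Icl s0" "continuous_on Icl s2"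
  shows "(real n)^2 * integral Icl (\<lambda>al. s0 al * Cn n al) = - integral Icl (\<lambda>al. s2 al * Cn n al)"
proof -
  let ?F = "\<lambda>al. real n * s0 al * sin (real n * (al + pi/2)) + s1 al * cos (real n * (al + pi/2))"
  have i: "(\<lambda>al. (real n)^2 * (s0 al * Cn n al)) integrable_on Icl" "(\<lambda>al. s2 al * Cn n al) integrable_on Icl"
    by (intro integrable_continuous_real continuous_intros c)+
  have "((\<lambda>al. (real n)^2 * (s0 al * Cn n al) + s2 al * Cn n al) has_integral ?F (pi/2) - ?F (-(pi/2))) Icl"
  proof (rule fundamental_theorem_of_calculus)
    fix al assume a: "al \<in> Icl"
    have "(?F has_real_derivative (real n)^2 * (s0 al * Cn n al) + s2 al * Cn n al) (at al within Icl)"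
      by (rule derivative_eq_intros refl 0[OF a] 1[OF a])+ (simp add: Cn_def algebra_simps power2_eq_square)
    then show "(?F has_vector_derivative (real n)^2 * (s0 al * Cn n al) + s2 al * Cn n al) (at al within Icl)"
      by (simp add: has_real_derivative_iff_has_vector_derivative)
  qed simp
  moreover have "?F (pi/2) - ?F (-(pi/2)) = 0" unfolding Cn_ends e by simp
  ultimately have "integral Icl (\<lambda>al. (real n)^2 * (s0 al * Cn n al) + s2 al * Cn n al) = 0" by (simp add: has_integral_iff)
  moreover have "integral Icl (\<lambda>al. (real n)^2 * (s0 al * Cn n al) + s2 al * Cn n al)
      = (real n)^2 * integral Icl (\<lambda>al. s0 al * Cn n al) + integral Icl (\<lambda>al. s2 al * Cn n al)"
    by (simp only: Henstock_Kurzweil_Integration.integral_add[OF i] Henstock_Kurzweil_Integration.integral_mult_right)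
  ultimately show ?thesis by simp
qed

text \<open>For different indices these are eigenfunctions of the second derivative with different
  eigenvalues under the same boundary conditions, so \<open>integral_Cn_parts\<close> forces
  orthogonality.\<close>

lemma integral_Cn_Cn: "integral Icl (\<lambda>al. Cn k al * Cn n al) = (if k = n then (if n = 0 then pi else pi/2) else 0)"
proof (cases "k = n")
  case False
  have "(real n)^2 * integral Icl (\<lambda>al. Cn k al * Cn n al) = - integral Icl (\<lambda>al. (- (real k)\<^sup>2 * Cn k al) * Cn n al)"
  proof (rule integral_Cn_parts[where ?s1.0="\<lambda>al. - real k * sin (real k * (al + pi/2))"])
    show "(Cn k has_real_derivative - real k * sin (real k * (al + pi/2))) (at al within Icl)" for al
      unfolding Cn_def[abs_def] by (rule derivative_eq_intros refl)+ simp
    show "((\<lambda>al. - real k * sin (real k * (al + pi/2))) has_real_derivative - (real k)\<^sup>2 * Cn k al) (at al within Icl)" for al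
      unfolding Cn_def[abs_def] by (rule derivative_eq_intros refl)+ (simp add: power2_eq_square)
  qed (simp_all only: Cn_ends, auto intro!: continuous_intros)
  then have "((real n)^2 - (real k)\<^sup>2) * integral Icl (\<lambda>al. Cn k al * Cn n al) = 0" by (simp add: mult.assoc left_diff_distrib)
  moreover have "(real n)^2 \<noteq> (real k)^2" using False by (simp add: power2_eq_iff)
  ultimately show ?thesis using False by simp
next
  case True
  show ?thesis
  proof (cases "n = 0")
    case True
    then show ?thesis using \<open>k = n\<close> by (simp add: Cn_def)
  next
    case n: False
    let ?F = "\<lambda>al. al / 2 + sin (real n * (al + pi/2)) * cos (real n * (al + pi/2)) / (2 * real n)"
    have "((\<lambda>al. Cn n al * Cn n al) has_integral ?F (pi/2) - ?F (-(pi/2))) Icl"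
    proof (rule fundamental_theorem_of_calculus)
      fix al
      have "(?F has_real_derivative Cn n al * Cn n al) (at al within Icl)"
      proof -
        let ?x = "real n * (al + pi/2)"
        have "(?F has_real_derivative 1/2 + (cos ?x * real n * cos ?x + sin ?x * (- sin ?x * real n)) / (2 * real n)) (at al within Icl)"
          by (rule derivative_eq_intros refl | simp add: n)+ (use n in \<open>simp add: field_simps\<close>)
        moreover have "1/2 + (cos ?x * real n * cos ?x + sin ?x * (- sin ?x * real n)) / (2 * real n) = Cn n al * Cn n al"
        proof -
          have "(cos ?x * real n * cos ?x + sin ?x * (- sin ?x * real n)) / (2 * real n) = (cos ?x * cos ?x - sin ?x * sin ?x) / 2"
            using n by (simp add: field_simps)
          then show ?thesis unfolding Cn_def using sin_cos_squared_add3[of ?x] by (simp only:) argo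
        qed
        ultimately show ?thesis by simp
      qed
      then show "(?F has_vector_derivative Cn n al * Cn n al) (at al within Icl)"
        by (simp add: has_real_derivative_iff_has_vector_derivative)
    qed simp
    moreover have "?F (pi/2) - ?F (-(pi/2)) = pi/2" unfolding Cn_ends by simp
    ultimately show ?thesis using True n by (simp add: has_integral_iff)
  qed
qed

text \<open>Since \<open>sin al * Cn k al\<close> is a combination of neighbouring
  \<open>Cn\<close>, orthogonality to all \<open>Cn\<close> extends to all polynomials in
  \<open>sin al\<close>. These approximate \<open>T\<close> uniformly, so the integral of
  \<open>T^2\<close> is 0.\<close>

lemma Cn_complete:
  fixes T :: "real \<Rightarrow> real"
  assumes T: "continuous_on Icl T" and 0: "\<And>k. integral Icl (\<lambda>al. T al * Cn k al) = 0" and al: "al \<in> Icl"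
  shows "T al = 0"
proof -
  have z: "integral Icl (\<lambda>al. T al * sin al ^ j * Cn k al) = 0" for j k
  proof (induction j arbitrary: k)
    case (Suc j)
    have i: "(\<lambda>al. c * (T al * sin al ^ j * Cn k al)) integrable_on Icl" for c k
      by (intro integrable_continuous_real continuous_intros T)
    show ?case
    proof (cases k)
      case 0
      have "T al * sin al ^ Suc j * Cn k al = - (T al * sin al ^ j * Cn 1 al)" for al
        unfolding 0 minus_mult_right sin_Cn_0[symmetric] by (simp only: power_Suc mult_ac)
      then show ?thesis using Suc.IH[of 1] by simp
    next
      case (Suc k')
      have "T al * sin al ^ Suc j * Cn k al = (-1/2) * (T al * sin al ^ j * Cn (Suc k) al) + (-1/2) * (T al * sin al ^ j * Cn k' al)" for al
      proof -
        have "T al * sin al ^ Suc j * Cn k al = T al * sin al ^ j * (sin al * Cn (Suc k') al)" unfolding Suc by (simp only: power_Suc mult_ac)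
        then show ?thesis unfolding sin_Cn_Suc Suc by (simp add: algebra_simps)
      qed
      then have "integral Icl (\<lambda>al. T al * sin al ^ Suc j * Cn k al) = (-1/2) * integral Icl (\<lambda>al. T al * sin al ^ j * Cn (Suc k) al) + (-1/2) * integral Icl (\<lambda>al. T al * sin al ^ j * Cn k' al)"

        by (simp only: Henstock_Kurzweil_Integration.integral_add[OF i i] Henstock_Kurzweil_Integration.integral_mult_right)
      then show ?thesis unfolding Suc.IH by simp
    qed
  qed (use 0 in simp)
  have p0: "integral Icl (\<lambda>al. T al * poly q (sin al)) = 0" for q
  proof -
    have i: "(\<lambda>al. coeff q j * (T al * sin al ^ j)) integrable_on Icl" for j
      by (intro integrable_continuous_real continuous_intros T)
    have "integral Icl (\<lambda>al. T al * sin al ^ j) = 0" for j using z[of j 0] by (simp add: Cn_def)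
    then have "integral Icl (\<lambda>al. coeff q j * (T al * sin al ^ j)) = 0" for j by simp
    moreover have "T al * poly q (sin al) = (\<Sum>j\<le>degree q. coeff q j * (T al * sin al ^ j))" for al
      unfolding poly_altdef sum_distrib_left by (simp only: mult_ac)
    moreover have "integral Icl (\<lambda>al. \<Sum>j\<le>degree q. coeff q j * (T al * sin al ^ j)) = (\<Sum>j\<le>degree q. integral Icl (\<lambda>al. coeff q j * (T al * sin al ^ j)))"
      by (rule Henstock_Kurzweil_Integration.integral_sum) (use i in auto)
    ultimately show ?thesis by (simp only: sum.neutral_const)
  qed
  obtain K where K: "\<And>x. x \<in> Icl \<Longrightarrow> \<bar>T x\<bar> \<le> K" "K > 0"
  proof -
    have "bounded (T ` Icl)" by (intro compact_imp_bounded compact_continuous_image T) simp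
    then obtain K where "\<forall>y\<in>T ` Icl. norm y \<le> K" unfolding bounded_iff by blast
    then have "\<bar>T x\<bar> \<le> K" if "x \<in> Icl" for x using that by simp
    then have "\<bar>T x\<bar> \<le> \<bar>K\<bar> + 1" if "x \<in> Icl" for x using that by (smt (verit))
    then show ?thesis by (rule that) simp_all
  qed
  have small: "integral Icl (\<lambda>al. (T al)^2) \<le> K * e * pi" if e: "e > 0" for e
  proof -
    \<comment> \<open>Clamping the argument extends \<open>T\<close> continuously to the line, the
      form required by \<open>poly_approx_sin\<close>.\<close>
    have "continuous_on UNIV (\<lambda>al. T (clamp1 (pi/2) al))"
      by (rule continuous_on_compose2[OF T continuous_clamp1]) (use pi_gt_zero in \<open>auto simp: clamp1_def max_def min_def\<close>)
    then obtain q where q: "\<forall>al\<in>Icl. \<bar>T (clamp1 (pi/2) al) - poly q (sin al)\<bar> < e" using poly_approx_sin[OF _ e] by blast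
    have q': "\<bar>T al - poly q (sin al)\<bar> < e" if "al \<in> Icl" for al
    proof -
      have "clamp1 (pi/2) al = al" using that by (intro clamp1_id) auto
      then show ?thesis using bspec[OF q that] by simp
    qed
    have i: "(\<lambda>al. T al * (T al - poly q (sin al))) integrable_on Icl" "(\<lambda>al. T al * poly q (sin al)) integrable_on Icl"
      by (intro integrable_continuous_real continuous_intros T)+
    have "integral Icl (\<lambda>al. (T al)^2) = integral Icl (\<lambda>al. T al * (T al - poly q (sin al)) + T al * poly q (sin al))"
      by (simp add: algebra_simps power2_eq_square)
    also have "... = integral Icl (\<lambda>al. T al * (T al - poly q (sin al)))" using i p0 by (subst integral_add) auto
    also have "... \<le> norm (integral Icl (\<lambda>al. T al * (T al - poly q (sin al))))" by simp
    also have "... \<le> (K * e) * (pi/2 - -(pi/2))"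
    proof (rule integral_bound)
      show "continuous_on Icl (\<lambda>al. T al * (T al - poly q (sin al)))" by (intro continuous_intros T)
      show "norm (T t * (T t - poly q (sin t))) \<le> K * e" if "t \<in> Icl" for t
        unfolding real_norm_def abs_mult using K(1)[OF that] q'[OF that] K(2) by (intro mult_mono) auto
    qed simp
    finally show ?thesis by simp
  qed
  have "integral Icl (\<lambda>al. (T al)^2) \<le> 0"
  proof (rule field_le_epsilon)
    fix e :: real assume "e > 0"
    then show "integral Icl (\<lambda>al. (T al)^2) \<le> 0 + e" using small[of "e / (K * pi)"] K(2) by simp
  qed
  moreover have "integral Icl (\<lambda>al. (T al)^2) \<ge> 0" by (intro integral_nonneg integrable_continuous_real continuous_intros T) auto
  ultimately have "integral Icl (\<lambda>al. (T al)^2) = 0" by simp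
  then have "(T al)^2 = 0"
    using al by (subst (asm) integral_eq_0_iff) (auto intro!: continuous_intros T)
  then show ?thesis by simp
qed

text \<open>Vanishing odd derivatives remove the boundary terms in all \<open>N + 1\<close> double
  integrations by parts, so the cosine coefficients are of order \<open>n^(-2*N-2)\<close>.
  Truncating before \<open>m\<close> gives a polynomial in \<open>sin al\<close> of degree below
  \<open>m\<close>; the two spare powers sum the tail.\<close>

lemma cosine_approx:
  fixes S :: "nat \<Rightarrow> real \<Rightarrow> real"
  assumes d: "\<And>n al. al \<in> Icl \<Longrightarrow> (S n has_real_derivative S (Suc n) al) (at al within Icl)"
    and odd: "\<And>n. odd n \<Longrightarrow> S n (pi/2) = 0" "\<And>n. odd n \<Longrightarrow> S n (-(pi/2)) = 0"
    and B: "\<And>al. al \<in> Icl \<Longrightarrow> \<bar>S (2 * N + 2) al\<bar> \<le> B" and m: "m \<ge> 1"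
  shows "\<exists>q. degree q < m \<and> (\<forall>al\<in>Icl. \<bar>S 0 al - poly q (sin al)\<bar> \<le> 2 * B * (\<Sum>n. inverse (real (Suc n) ^ 2)) / real m ^ (2 * N))"
proof -
  have Sc: "continuous_on Icl (S n)" for n using d[of _ n] DERIV_continuous continuous_on_eq_continuous_within by blast
  have B0: "B \<ge> 0" using B[of 0] by (auto intro: order_trans[OF abs_ge_zero])
  have rec: "(real n)^(2*j) * \<bar>integral Icl (\<lambda>al. S 0 al * Cn n al)\<bar> = \<bar>integral Icl (\<lambda>al. S (2*j) al * Cn n al)\<bar>" for n j
  proof (induction j)
    case (Suc j)
    have "(real n)^2 * integral Icl (\<lambda>al. S (2*j) al * Cn n al) = - integral Icl (\<lambda>al. S (2 * Suc j) al * Cn n al)"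
      by (rule integral_Cn_parts[where ?s1.0="S (2*j+1)"]) (use d[of _ "2*j"] d[of _ "2*j+1"] odd Sc in auto)
    note eq = this
    have "\<bar>integral Icl (\<lambda>al. S (2 * Suc j) al * Cn n al)\<bar> = \<bar>(real n)^2 * integral Icl (\<lambda>al. S (2*j) al * Cn n al)\<bar>"
      unfolding eq abs_minus_cancel ..
    then have "\<bar>integral Icl (\<lambda>al. S (2 * Suc j) al * Cn n al)\<bar> = (real n)^2 * \<bar>integral Icl (\<lambda>al. S (2*j) al * Cn n al)\<bar>"
      by (simp only: abs_mult abs_power2)
    then show ?case unfolding Suc.IH[symmetric] by (simp add: power_add power2_eq_square mult_ac)
  qed simp
  define c where "c n = (if n = 0 then 1 else 2) / pi * integral Icl (\<lambda>al. S 0 al * Cn n al)" for n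
  have cb: "\<bar>c n\<bar> \<le> 2 * B / real n ^ (2*N+2)" if n: "n \<ge> 1" for n
  proof -
    have "\<bar>integral Icl (\<lambda>al. S (2*(N+1)) al * Cn n al)\<bar> \<le> B * (pi/2 - -(pi/2))"
      unfolding real_norm_def[symmetric]
    proof (rule integral_bound)
      show "continuous_on Icl (\<lambda>al. S (2*(N+1)) al * Cn n al)" by (intro continuous_intros Sc)
      show "norm (S (2*(N+1)) t * Cn n t) \<le> B" if "t \<in> Icl" for t
        using mult_mono[OF B[OF that] abs_Cn_le_1[of n t]] B0 by (simp add: abs_mult)
    qed simp
    then have "(real n)^(2*(N+1)) * \<bar>integral Icl (\<lambda>al. S 0 al * Cn n al)\<bar> \<le> B * pi" unfolding rec by simp
    then have "(real n)^(2*(N+1)) * \<bar>c n\<bar> \<le> 2 * B" using n by (simp add: c_def abs_mult field_simps)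
    then show ?thesis using n by (simp add: field_simps)
  qed
  define b where "b n = (if n = 0 then \<bar>c 0\<bar> else 2 * B / real n ^ (2*N+2))" for n
  have inv2: "summable (\<lambda>n. inverse (real (Suc n) ^ 2))"
    using inverse_power_summable[of 2, where 'a=real] by (simp only: summable_Suc_iff[of "\<lambda>m. inverse (real m ^ 2)"] le_refl)
  \<comment> \<open>Split the power of \<open>n + m\<close>: \<open>2*N\<close> factors are at least
    \<open>m\<close>, and because \<open>m \<ge> 1\<close> the last two are at least
    \<open>Suc n\<close>.\<close>
  have bt: "b (n + m) \<le> 2 * B / real m ^ (2*N) * inverse (real (Suc n) ^ 2)" for n
  proof -
    have "real m ^ (2*N) * real (Suc n) ^ 2 \<le> real (n + m) ^ (2*N) * real (n + m) ^ 2" using m by (intro mult_mono power_mono) auto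
    then have "2 * B / real (n + m) ^ (2*N+2) \<le> 2 * B / (real m ^ (2*N) * real (Suc n) ^ 2)"
      using m B0 unfolding power_add by (intro divide_left_mono mult_pos_pos) auto
    then show ?thesis using m by (simp add: b_def divide_inverse mult_ac)
  qed
  have b0: "b n \<ge> 0" for n using B0 by (simp add: b_def)
  have bs: "summable (\<lambda>n. b (n + m))"
    by (rule summable_comparison_test'[OF summable_mult[OF inv2, of "2 * B / real m ^ (2*N)"], of 0]) (use bt b0 in auto)
  then have bsum: "summable b" by (simp only: summable_iff_shift)
  have cC: "\<bar>c n * Cn n al\<bar> \<le> b n" for n al
  proof -
    have "\<bar>c n\<bar> * \<bar>Cn n al\<bar> \<le> \<bar>c n\<bar> * 1" by (intro mult_left_mono abs_Cn_le_1) simp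
    also have "\<bar>c n\<bar> * 1 \<le> b n" using cb[of n] by (cases "n = 0") (auto simp: b_def)
    finally show ?thesis by (simp add: abs_mult)
  qed
  define g where "g al = (\<Sum>n. c n * Cn n al)" for al
  have ul: "uniform_limit Icl (\<lambda>J al. \<Sum>n<J. c n * Cn n al) g sequentially"
    unfolding g_def by (rule Weierstrass_m_test[OF _ bsum]) (use cC in simp)
  have gc: "continuous_on Icl g"
    by (rule uniform_limit_theorem[OF _ ul]) (auto intro!: always_eventually continuous_intros)
  have "integral Icl (\<lambda>al. (S 0 al - g al) * Cn k al) = 0" for k
  proof -
    have "uniform_limit Icl (\<lambda>J al. (\<Sum>n<J. c n * Cn n al) * Cn k al) (\<lambda>al. g al * Cn k al) sequentially"
    proof (rule uniform_limitI)
      fix e :: real assume "e > 0"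
      from uniform_limitD[OF ul this] show "\<forall>\<^sub>F J in sequentially. \<forall>al\<in>Icl. dist ((\<Sum>n<J. c n * Cn n al) * Cn k al) (g al * Cn k al) < e"
      proof (rule eventually_mono, intro ballI)
        fix J al assume "\<forall>al\<in>Icl. dist (\<Sum>n<J. c n * Cn n al) (g al) < e" "al \<in> Icl"
        then have l: "\<bar>(\<Sum>n<J. c n * Cn n al) - g al\<bar> < e" by (simp add: dist_real_def)
        have "dist ((\<Sum>n<J. c n * Cn n al) * Cn k al) (g al * Cn k al) = \<bar>(\<Sum>n<J. c n * Cn n al) - g al\<bar> * \<bar>Cn k al\<bar>"
          by (simp only: dist_real_def left_diff_distrib[symmetric] abs_mult)
        also have "... \<le> \<bar>(\<Sum>n<J. c n * Cn n al) - g al\<bar> * 1" by (intro mult_left_mono abs_Cn_le_1) simp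
        finally show "dist ((\<Sum>n<J. c n * Cn n al) * Cn k al) (g al * Cn k al) < e" using l by simp
      qed
    qed
    note u = this
    have cont: "continuous_on Icl (\<lambda>al. (\<Sum>i<n. c i * Cn i al) * Cn k al)" for n by (intro continuous_intros)
    obtain I J where IJ: "\<And>n. ((\<lambda>al. (\<Sum>i<n. c i * Cn i al) * Cn k al) has_integral I n) Icl"
      "((\<lambda>al. g al * Cn k al) has_integral J) Icl" "I \<longlonglongrightarrow> J"
      by (rule uniform_limit_integral[OF u cont sequentially_bot]) blast
    \<comment> \<open>By orthogonality a partial sum containing index \<open>k\<close> already has
      the same \<open>k\<close>-th coefficient as \<open>S 0\<close>, so the sequence is eventually
      constant.\<close>
    have "I n = integral Icl (\<lambda>al. S 0 al * Cn k al)" if "n > k" for n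
    proof -
      have "I n = integral Icl (\<lambda>al. \<Sum>i<n. c i * (Cn i al * Cn k al))" using IJ(1)[of n] by (simp add: has_integral_iff sum_distrib_right mult.assoc)
      also have "... = (\<Sum>i<n. c i * integral Icl (\<lambda>al. Cn i al * Cn k al))"
        by (subst integral_sum) (auto intro!: integrable_continuous_real continuous_intros)
      also have "... = c k * (if k = 0 then pi else pi/2)" unfolding integral_Cn_Cn using that by (simp add: if_distrib cong: if_cong)
      finally show ?thesis by (simp add: c_def)
    qed
    then have "I \<longlonglongrightarrow> integral Icl (\<lambda>al. S 0 al * Cn k al)"
      by (intro tendsto_eventually) (auto simp: eventually_at_top_dense)
    then have "integral Icl (\<lambda>al. S 0 al * Cn k al) = integral Icl (\<lambda>al. g al * Cn k al)" using IJ LIMSEQ_unique by (metis integral_unique)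
    moreover have "(\<lambda>al. S 0 al * Cn k al) integrable_on Icl" "(\<lambda>al. g al * Cn k al) integrable_on Icl"
      by (intro integrable_continuous_real continuous_intros Sc gc)+
    ultimately show ?thesis by (simp add: left_diff_distrib integral_diff)
  qed
  then have Sg: "S 0 al = g al" if "al \<in> Icl" for al
    using Cn_complete[of "\<lambda>al. S 0 al - g al" al] that by (auto intro!: continuous_intros Sc gc)
  define q where "q = (\<Sum>n<m. smult (c n) (pcompose (Ch n) [:0, -1:]))"
  have "degree q \<le> m - 1" unfolding q_def
  proof (rule degree_sum_le)
    fix n assume "n \<in> {..<m}"
    then show "degree (smult (c n) (pcompose (Ch n) [:0, -1:])) \<le> m - 1" using degree_Ch_le[of n] degree_smult_le[of "c n" "pcompose (Ch n) [:0, -1:]"]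
      by (simp add: degree_pcompose)
  qed simp
  then have "degree q < m" using m by simp
  moreover have "\<bar>S 0 al - poly q (sin al)\<bar> \<le> 2 * B * (\<Sum>n. inverse (real (Suc n) ^ 2)) / real m ^ (2 * N)" if a: "al \<in> Icl" for al
  proof -
    have s: "summable (\<lambda>n. c n * Cn n al)" by (rule summable_comparison_test'[OF bsum, of 0]) (use cC in simp)
    have "poly q (sin al) = (\<Sum>n<m. c n * Cn n al)" by (simp add: q_def poly_sum Cn_poly)
    then have "S 0 al - poly q (sin al) = (\<Sum>n. c (n + m) * Cn (n + m) al)" unfolding Sg[OF a] g_def suminf_split_initial_segment[OF s, of m] by simp
    also have "\<bar>...\<bar> \<le> (\<Sum>n. b (n + m))"
    proof -
      have sn: "summable (\<lambda>n. norm (c (n + m) * Cn (n + m) al))" by (rule summable_comparison_test'[OF bs, of 0]) (use cC in simp)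
      have "norm (\<Sum>n. c (n + m) * Cn (n + m) al) \<le> (\<Sum>n. b (n + m))"
        by (rule order_trans[OF summable_norm[OF sn] suminf_le[OF _ sn bs]]) (use cC in simp)
      then show ?thesis by simp
    qed
    also have "... \<le> (\<Sum>n. 2 * B / real m ^ (2*N) * inverse (real (Suc n) ^ 2))"
      by (intro suminf_le bs summable_mult inv2 bt)
    also have "... = 2 * B / real m ^ (2*N) * (\<Sum>n. inverse (real (Suc n) ^ 2))" by (rule suminf_mult[OF inv2])
    finally show ?thesis by (simp add: field_simps)
  qed
  ultimately show ?thesis by blast
qed

context disk_weight
begin

text \<open>\<open>pg m\<close> annihilates the approximating polynomial of degree below
  \<open>m\<close>, so only the uniform error is integrated. The bound \<open>p <= 1 + p^2\<close>
  and the known norm of \<open>pg m\<close> control the remaining integral.\<close>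

lemma pg_cosine_decay:
  fixes S :: "nat \<Rightarrow> real \<Rightarrow> real"
  assumes d: "\<And>n al. al \<in> Icl \<Longrightarrow> (S n has_real_derivative S (Suc n) al) (at al within Icl)"
    and odd: "\<And>n. odd n \<Longrightarrow> S n (pi/2) = 0" "\<And>n. odd n \<Longrightarrow> S n (-(pi/2)) = 0"
    and B: "\<And>al. al \<in> Icl \<Longrightarrow> \<bar>S (2 * N + 2) al\<bar> \<le> B" and m: "m \<ge> 1"
    and [measurable]: "h \<in> borel_measurable borel" and h: "\<And>al. al \<in> Iang \<Longrightarrow> h al = S 0 al"
  shows "\<bar>LINT al|mA \<gamma>. poly (pg m) (sin al) * h al\<bar> \<le> (measure (mA \<gamma>) UNIV + 1) * (2 * B * (\<Sum>n. inverse (real (Suc n) ^ 2)) / real m ^ (2 * N))"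
proof -
  let ?E = "2 * B * (\<Sum>n. inverse (real (Suc n) ^ 2)) / real m ^ (2 * N)"
  obtain q where q: "degree q < m" "\<And>al. al \<in> Icl \<Longrightarrow> \<bar>S 0 al - poly q (sin al)\<bar> \<le> ?E" using cosine_approx[OF d odd B m] by blast
  then have E0: "?E \<ge> 0" using q(2)[of 0] by (auto intro: order_trans[OF abs_ge_zero])
  have i1: "integrable (mA \<gamma>) (\<lambda>al. ?E * (1 + (poly (pg m) (sin al))^2))"
    using integrable_poly_sin[of "[:?E:] * (1 + (pg m)^2)"] by simp
  have i2: "integrable (mA \<gamma>) (\<lambda>al. poly (pg m) (sin al) * poly q (sin al))" using integrable_poly_sin[of "pg m * q"] by simp
  have le: "AE al in mA \<gamma>. norm (poly (pg m) (sin al) * (h al - poly q (sin al))) \<le> ?E * (1 + (poly (pg m) (sin al))^2)"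
    using AE_mA_Iang
  proof (rule eventually_mono)
    fix al assume a: "al \<in> Iang"
    let ?p = "\<bar>poly (pg m) (sin al)\<bar>"
    have "?p \<le> 1 + ?p^2" using zero_le_power2[of "?p - 1/2"] unfolding power2_diff by (simp add: power_divide)
    moreover have "\<bar>h al - poly q (sin al)\<bar> \<le> ?E" using q(2)[of al] h[OF a] a by auto
    ultimately have "?p * \<bar>h al - poly q (sin al)\<bar> \<le> (1 + ?p^2) * ?E" by (intro mult_mono) auto
    then show "norm (poly (pg m) (sin al) * (h al - poly q (sin al))) \<le> ?E * (1 + (poly (pg m) (sin al))^2)"
      unfolding real_norm_def abs_mult power2_abs by (simp only: mult.commute)
  qed
  have i3: "integrable (mA \<gamma>) (\<lambda>al. poly (pg m) (sin al) * (h al - poly q (sin al)))"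
    by (rule Bochner_Integration.integrable_bound[OF i1]) (measurable, rule eventually_mono[OF le], unfold real_norm_def, erule order_trans[OF _ abs_ge_self])
  have "(LINT al|mA \<gamma>. poly (pg m) (sin al) * h al) = (LINT al|mA \<gamma>. poly (pg m) (sin al) * (h al - poly q (sin al)) + poly (pg m) (sin al) * poly q (sin al))"
    by (simp add: right_diff_distrib)
  also have "... = (LINT al|mA \<gamma>. poly (pg m) (sin al) * (h al - poly q (sin al)))"
    using i2 i3 pg_orth[OF q(1)] by (subst Bochner_Integration.integral_add) auto
  also have "norm ... \<le> (LINT al|mA \<gamma>. ?E * (1 + (poly (pg m) (sin al))^2))"
    by (rule order_trans[OF integral_norm_bound integral_mono_AE[OF integrable_norm[OF i3] i1 le]])
  also have "... = ?E * (measure (mA \<gamma>) UNIV + 1 / (2*pi))"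
    unfolding pg_norm[of m, symmetric] using integrable_poly_sin[of "(pg m)^2"] A.integrable_const[of 1] by (simp add: Bochner_Integration.integral_add)
  also have "... \<le> ?E * (measure (mA \<gamma>) UNIV + 1)" using E0 pi_ge_two by (intro mult_left_mono add_left_mono) (auto simp: divide_le_eq)
  finally show ?thesis by (simp add: mult.commute)
qed

end

section \<open>Decay of the moments of smooth even functions\<close>

lemma flat_bound:
  fixes E :: "nat \<Rightarrow> real \<Rightarrow> complex"
  assumes d: "\<And>n y. \<bar>y\<bar> \<le> r \<Longrightarrow> (E n has_vector_derivative E (Suc n) y) (at y)"
    and z: "\<And>n. n < N \<Longrightarrow> E n 0 = 0" and B: "\<And>y. \<bar>y\<bar> \<le> r \<Longrightarrow> cmod (E N y) \<le> B" and y: "\<bar>y\<bar> \<le> r"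
  shows "cmod (E 0 y) \<le> B * \<bar>y\<bar> ^ N"
proof -
  have B0: "B \<ge> 0" using B[OF y] norm_ge_zero order_trans by blast
  have "cmod (E n y) \<le> B * \<bar>y\<bar> ^ (N - n)" if "n \<le> N" "\<bar>y\<bar> \<le> r" for n y
    using that
  proof (induction "N - n" arbitrary: n y)
    case 0
    then show ?case using B[of y] by simp
  next
    case (Suc k)
    have n: "n < N" "k = N - Suc n" using Suc.hyps(2) by auto
    have "norm (E n y - E n 0) \<le> (B * \<bar>y\<bar> ^ k) * norm (y - 0)"
    proof (rule differentiable_bound[of "{-\<bar>y\<bar>..\<bar>y\<bar>}" "E n" "\<lambda>x h. h *\<^sub>R E (Suc n) x"])
      fix x assume x: "x \<in> {-\<bar>y\<bar>..\<bar>y\<bar>}"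
      then have xr: "\<bar>x\<bar> \<le> \<bar>y\<bar>" "\<bar>x\<bar> \<le> r" using Suc.prems by auto
      show "(E n has_derivative (\<lambda>h. h *\<^sub>R E (Suc n) x)) (at x within {-\<bar>y\<bar>..\<bar>y\<bar>})"
        using d[OF xr(2)] unfolding has_vector_derivative_def by (rule has_derivative_at_withinI)
      have "cmod (E (Suc n) x) \<le> B * \<bar>x\<bar> ^ k" using Suc.hyps(1)[of "Suc n" x] n xr by simp
      also have "... \<le> B * \<bar>y\<bar> ^ k" using xr B0 by (intro mult_left_mono power_mono) auto
      finally show "onorm (\<lambda>h. h *\<^sub>R E (Suc n) x) \<le> B * \<bar>y\<bar> ^ k"
        using onorm_scaleR_left[OF bounded_linear_ident, of "E (Suc n) x"] onorm_id[where 'a=real] by (simp add: id_def)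
    qed (auto simp: abs_if)
    then show ?case using z[OF n(1)] Suc.hyps(2)[symmetric] by (simp add: mult_ac)
  qed
  from this[of 0 y] show ?thesis using y by simp
qed

text \<open>By strong induction the first derivative that could survive has order \<open>n\<close>;
  then \<open>D 0 y\<close> would be close to a nonzero multiple of \<open>y^n\<close>,
  contradicting a bound of order \<open>n + 1\<close> near 0.\<close>

lemma flat_chain_zero:
  fixes D :: "nat \<Rightarrow> real \<Rightarrow> complex"
  assumes r: "r > 0" and d: "\<And>n y. \<bar>y\<bar> \<le> r \<Longrightarrow> (D n has_vector_derivative D (Suc n) y) (at y)"
    and f: "\<And>N. \<exists>C. \<forall>y. \<bar>y\<bar> \<le> r \<longrightarrow> cmod (D 0 y) \<le> C * \<bar>y\<bar> ^ N"
  shows "D n 0 = 0"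
proof (induction n rule: less_induct)
  case (less n)
  define v where "v = D n 0"
  \<comment> \<open>\<open>P k\<close> is the \<open>k\<close>-th derivative of the monomial
    \<open>v * y^n / n!\<close>, continued by 0 for \<open>k > n\<close>; subtracting it makes
    \<open>D\<close> vanish at 0 up to order \<open>n\<close>.\<close>
  define P where "P k y = (if k \<le> n then complex_of_real (y ^ (n - k) / fact (n - k)) * v else 0)" for k y
  have Pd: "(P k has_vector_derivative P (Suc k) y) (at y)" for k y
  proof (cases "k < n")
    case True
    define j where "j = n - Suc k"
    have nk: "n - k = Suc j" using True by (simp add: j_def)
    have "((\<lambda>y. y ^ Suc j / fact (Suc j)) has_real_derivative y ^ j / fact j) (at y)"
    proof -
      have "((\<lambda>y. y ^ Suc j / fact (Suc j)) has_real_derivative (real (Suc j) * y ^ j) / fact (Suc j)) (at y)"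
        by (rule DERIV_cdivide) (use DERIV_pow[of "Suc j" y] in simp)
      then show ?thesis by (simp add: fact_Suc del: of_nat_Suc)
    qed
    then have "((\<lambda>y. complex_of_real (y ^ Suc j / fact (Suc j))) has_vector_derivative complex_of_real (y ^ j / fact j)) (at y)"
      by (rule has_vector_derivative_complex_of_real)
    then have "((\<lambda>y. complex_of_real (y ^ Suc j / fact (Suc j)) * v) has_vector_derivative complex_of_real (y ^ j / fact j) * v) (at y)"
      by (rule has_vector_derivative_mult_left)
    then show ?thesis using True unfolding P_def[abs_def] nk j_def[symmetric] by simp
  next
    case False
    then have "P k = (\<lambda>y. P k 0)" "P (Suc k) y = 0" by (auto simp: P_def)
    then show ?thesis by (metis has_vector_derivative_const)
  qed
  define E where "E k y = D k y - P k y" for k y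
  have Ed: "(E k has_vector_derivative E (Suc k) y) (at y)" if "\<bar>y\<bar> \<le> r" for k y
    unfolding E_def[abs_def] by (intro has_vector_derivative_diff d[OF that] Pd)
  have Ez: "E k 0 = 0" if "k < Suc n" for k
    using that less.IH[of k] by (cases "k = n") (auto simp: E_def P_def v_def)
  have "continuous_on {-r..r} (D (Suc n))"
  proof (intro continuous_at_imp_continuous_on ballI)
    fix x assume "x \<in> {-r..r}"
    then show "isCont (D (Suc n)) x" using d[of x "Suc n"] by (intro has_vector_derivative_continuous) (auto simp: abs_le_iff)
  qed
  then have "bounded (D (Suc n) ` {-r..r})" by (intro compact_imp_bounded compact_continuous_image) auto
  then obtain B where "\<forall>x\<in>{-r..r}. cmod (D (Suc n) x) \<le> B" unfolding bounded_iff by auto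
  then have B: "\<And>y. \<bar>y\<bar> \<le> r \<Longrightarrow> cmod (D (Suc n) y) \<le> B" by (auto simp: abs_le_iff)
  have Eb: "cmod (E 0 y) \<le> B * \<bar>y\<bar> ^ Suc n" if "\<bar>y\<bar> \<le> r" for y
    by (rule flat_bound[where E=E, OF Ed Ez _ that]) (use B in \<open>auto simp: E_def P_def\<close>)
  obtain C where C: "\<And>y. \<bar>y\<bar> \<le> r \<Longrightarrow> cmod (D 0 y) \<le> C * \<bar>y\<bar> ^ Suc n" using f[of "Suc n"] by blast
  have small: "cmod v / fact n \<le> (B + C) * y" if y: "0 < y" "y \<le> r" for y
  proof -
    have "cmod (P 0 y) \<le> cmod (D 0 y) + cmod (E 0 y)" unfolding E_def using norm_triangle_ineq4[of "D 0 y" "D 0 y - P 0 y"] by simp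
    also have "... \<le> (B + C) * y ^ Suc n" using Eb[of y] C[of y] y by (simp add: distrib_right)
    also have "cmod (P 0 y) = cmod v / fact n * y ^ n" using y by (simp add: P_def norm_mult norm_divide norm_power)
    finally have "cmod v / fact n * y ^ n \<le> ((B + C) * y) * y ^ n" by (simp add: mult_ac)
    then show ?thesis by (rule mult_right_le_imp_le) (use y in simp)
  qed
  have "cmod v / fact n \<le> 0"
  proof (rule field_le_epsilon)
    fix e :: real assume e: "e > 0"
    define y where "y = min r (e / (\<bar>B + C\<bar> + 1))"
    have y: "0 < y" "y \<le> r" "y \<le> e / (\<bar>B + C\<bar> + 1)" using r e by (auto simp: y_def)
    have "cmod v / fact n \<le> (B + C) * y" by (rule small[OF y(1,2)])
    also have "... \<le> (\<bar>B + C\<bar> + 1) * y" using y by (intro mult_right_mono) auto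
    also have "... \<le> e" using y(3) by (simp add: pos_le_divide_eq add_nonneg_pos mult.commute)
    finally show "cmod v / fact n \<le> 0 + e" by simp
  qed
  then have "cmod v \<le> 0" by (simp add: pos_divide_le_eq)
  then show ?case by (simp add: v_def)
qed

text \<open>The substitution \<open>sin \<phi> = tanh T\<close> makes the geodesic \<open>zc om al\<close> smooth up to and across \<open>al = \<plusminus>\<pi>/2\<close>.\<close>

definition zs :: "real \<Rightarrow> real \<Rightarrow> real \<Rightarrow> complex" where
  "zs om \<phi> al = cis om * Complex (- sin al * (1 / (1 + cos al * cos \<phi>))) (sin \<phi> * cos al * (1 / (1 + cos al * cos \<phi>)))"

section \<open>Reflection of chords across the ends of the angle interval\<close>

lemma zc_zs:
  assumes a: "cos al > 0"
  shows "zc om al T = zs om (arcsin (tanh T)) al" "zc om al (- T) = zs om (- arcsin (tanh T)) al"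
proof -
  have t: "-1 \<le> tanh T" "tanh T \<le> 1" using tanh_real_bounds[of T] by auto
  have C: "cosh T > 0" by (rule cosh_real_pos)
  have s: "sin (arcsin (tanh T)) = sinh T / cosh T" using t by (simp add: tanh_def)
  have "1 - (tanh T)^2 = (1 / cosh T)^2"
  proof -
    have "1 - (tanh T)^2 = ((cosh T)^2 - (sinh T)^2) / (cosh T)^2" unfolding tanh_def power_divide using C by (simp add: diff_divide_distrib)
    then show ?thesis unfolding hyperbolic_pythagoras power_divide by simp
  qed
  then have c: "cos (arcsin (tanh T)) = 1 / cosh T" using cos_arcsin[OF t] C by (simp add: real_sqrt_divide)
  have i: "1 / (1 + cos al * (1 / cosh T)) = cosh T / (cosh T + cos al)" using C cosh_plus_cos_pos[OF a, of T] by (simp add: divide_simps)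
  show "zc om al T = zs om (arcsin (tanh T)) al" unfolding zc_def zs_def s c i using C by simp
  show "zc om al (- T) = zs om (- arcsin (tanh T)) al" unfolding zc_def zs_def sin_minus cos_minus s c i using C by simp
qed

text \<open>Reflecting \<open>al\<close> about \<open>\<sigma>/2\<close> and changing the sign of
  \<open>\<phi>\<close> preserves the numerator \<open>w\<close> of \<open>zs\<close> and flips the
  sign of \<open>cos al * cos \<phi>\<close> in the denominator. So the point stays on its ray while
  its boundary coordinate \<open>y\<close> becomes \<open>- y\<close>.\<close>

lemma zs_polar:
  assumes x: "\<bar>cos al * cos \<phi>\<bar> < 1" and s: "\<sigma> = pi \<or> \<sigma> = - pi"
  shows "\<exists>\<theta>\<in>{-pi..pi}. zs om \<phi> al = complex_of_real (rx (cos al * cos \<phi>)) * cis \<theta> \<and>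
     zs om (- \<phi>) (\<sigma> - al) = complex_of_real (rx (- (cos al * cos \<phi>))) * cis \<theta>"
proof -
  define x where "x = cos al * cos \<phi>"
  have x1: "1 + x > 0" "1 - x > 0" using x unfolding x_def by auto
  define w where "w = cis om * Complex (- sin al) (sin \<phi> * cos al)"
  have "(cmod w)^2 = (sin al)^2 + (sin \<phi>)^2 * (cos al)^2" by (simp add: w_def norm_mult cmod_power2 power_mult_distrib)
  also have "... = (1 - x) * (1 + x)" unfolding x_def sin_squared_eq by (simp add: power2_eq_square algebra_simps)
  finally have w: "cmod w = sqrt (1 - x) * sqrt (1 + x)" by (metis norm_ge_zero real_sqrt_mult real_sqrt_unique)
  have q: "sqrt a * sqrt b / b = sqrt a / sqrt b" if "b > 0" for a b :: real
  proof -
    have "sqrt a * sqrt b / (sqrt b * sqrt b) = sqrt a / sqrt b" using that by (intro nonzero_mult_divide_mult_cancel_right) simp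
    then show ?thesis using that by simp
  qed
  have r1: "cmod w / (1 + x) = rx x" and r2: "cmod w / (1 - x) = rx (- x)"
    unfolding w rx_def real_sqrt_divide using q[OF x1(1), of "1 - x"] q[OF x1(2), of "1 + x"] by (simp_all add: mult.commute)
  have ww: "w = complex_of_real (cmod w) * cis (Arg w)" using rcis_cmod_Arg[of w] by (simp add: rcis_def)
  have "zs om \<phi> al = w / complex_of_real (1 + x)" unfolding zs_def w_def x_def by (simp add: complex_eq_iff add_divide_distrib diff_divide_distrib)
  also have "... = complex_of_real (cmod w / (1 + x)) * cis (Arg w)" by (subst ww) (simp add: of_real_divide)
  finally have 1: "zs om \<phi> al = complex_of_real (rx x) * cis (Arg w)" unfolding r1 .
  have sc: "sin (\<sigma> - al) = sin al" "cos (\<sigma> - al) = - cos al" using s by (auto simp: sin_diff cos_diff)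
  have "zs om (- \<phi>) (\<sigma> - al) = w / complex_of_real (1 - x)" unfolding zs_def sc w_def x_def by (simp add: complex_eq_iff add_divide_distrib diff_divide_distrib)
  also have "... = complex_of_real (cmod w / (1 - x)) * cis (Arg w)" by (subst ww) (simp add: of_real_divide)
  finally have 2: "zs om (- \<phi>) (\<sigma> - al) = complex_of_real (rx (- x)) * cis (Arg w)" unfolding r2 .
  show ?thesis using 1 2 Arg_bounded[of w] unfolding x_def by (intro bexI[of _ "Arg w"]) auto
qed

definition zs_gen :: "(real \<times> real \<Rightarrow> real \<Rightarrow> complex) set" where
  "zs_gen = {\<lambda>p al. c p |c. continuous_on UNIV c} \<union> {\<lambda>p al. complex_of_real (sin al), \<lambda>p al. complex_of_real (cos al),
     \<lambda>p al. complex_of_real (1 / (1 + cos al * cos (snd p)))}"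

lemma zs_gen_closed:
  assumes D: "\<And>p al. (p, al) \<in> D \<Longrightarrow> 1 + cos al * cos (snd p) > 0" shows "alg_closed D {1} zs_gen"
  unfolding alg_closed_def
proof (intro ballI conjI)
  fix a assume "a \<in> zs_gen"
  then consider c where "continuous_on UNIV c" "a = (\<lambda>p al. c p)" | "a = (\<lambda>p al. complex_of_real (sin al))" | "a = (\<lambda>p al. complex_of_real (cos al))"
    | "a = (\<lambda>p al. complex_of_real (1 / (1 + cos al * cos (snd p))))" unfolding zs_gen_def by blast
  note cs = this
  have const: "continuous_on UNIV c \<Longrightarrow> (\<lambda>p al. c p) \<in> alg zs_gen" for c by (rule alg.gen) (auto simp: zs_gen_def)
  have m: "(\<lambda>p al. complex_of_real (sin al)) \<in> alg zs_gen" "(\<lambda>p al. complex_of_real (cos al)) \<in> alg zs_gen"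
    "(\<lambda>p al. complex_of_real (1 / (1 + cos al * cos (snd p)))) \<in> alg zs_gen" by (auto intro!: alg.gen simp: zs_gen_def)
  have der: "dir_deriv D 1 (\<lambda>p al. complex_of_real (f p al)) (\<lambda>p al. complex_of_real (f' p al))"
    if "\<And>p al. (p, al) \<in> D \<Longrightarrow> (f p has_real_derivative f' p al) (at al)" for f f' :: "real \<times> real \<Rightarrow> real \<Rightarrow> real"
    unfolding dir_deriv_def
  proof (intro allI impI)
    fix p y assume "(p, y) \<in> D"
    then have "(f p has_real_derivative f' p y) (at (0 + y))" using that by simp
    then have "((\<lambda>t. f p (t + y)) has_real_derivative f' p y) (at 0)" by (simp only: DERIV_shift)
    then have "((\<lambda>t. f p (y + t)) has_real_derivative f' p y) (at 0)" by (simp add: add.commute)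
    from has_vector_derivative_complex_of_real[OF this]
    show "((\<lambda>t. complex_of_real (f p (y + t *\<^sub>R 1))) has_vector_derivative complex_of_real (f' p y)) (at 0)" by simp
  qed
  show "continuous_on D (\<lambda>q. a (fst q) (snd q))"
    using cs
  proof cases
    case 1 then show ?thesis by (auto intro!: continuous_on_compose2[OF 1(1)] continuous_intros)
  next
    case 4
    have "1 + cos (snd q) * cos (snd (fst q)) \<noteq> 0" if "q \<in> D" for q using D[of "fst q" "snd q"] that by simp
    then have "continuous_on D (\<lambda>q. 1 / (1 + cos (snd q) * cos (snd (fst q))))" by (intro continuous_intros) auto
    then show ?thesis unfolding 4 by (rule continuous_on_of_real)
  qed (auto intro!: continuous_intros)
  have "\<exists>a'\<in>alg zs_gen. dir_deriv D 1 a a'"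
    using cs
  proof cases
    case 1 then show ?thesis by (intro bexI[of _ "\<lambda>p al. 0"] const) (auto simp: dir_deriv_def)
  next
    case 2
    then show ?thesis by (intro bexI[OF _ m(2)]) (simp only:, rule der, rule DERIV_sin)
  next
    case 3
    have "(\<lambda>p al. (\<lambda>p. -1) p * complex_of_real (sin al)) \<in> alg zs_gen" by (intro alg.mult m const continuous_intros)
    moreover have "dir_deriv D 1 (\<lambda>p al. complex_of_real (cos al)) (\<lambda>p al. complex_of_real (- sin al))" by (rule der, rule DERIV_cos)
    ultimately show ?thesis unfolding 3 by (intro bexI[rotated]) (assumption, simp)
  next
    case 4
    let ?r = "\<lambda>p al. 1 / (1 + cos al * cos (snd p))"
    have "(\<lambda>p al. (\<lambda>p. complex_of_real (cos (snd p))) p * (complex_of_real (sin al) * (complex_of_real (?r p al) * complex_of_real (?r p al)))) \<in> alg zs_gen"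
      by (intro alg.mult m const continuous_intros)
    moreover have "dir_deriv D 1 (\<lambda>p al. complex_of_real (?r p al)) (\<lambda>p al. complex_of_real (cos (snd p) * (sin al * (?r p al * ?r p al))))"
    proof (rule der)
      fix p :: "real \<times> real" and al assume "(p, al) \<in> D"
      then have "1 + cos al * cos (snd p) \<noteq> 0" using D by fastforce
      then show "(?r p has_real_derivative cos (snd p) * (sin al * (?r p al * ?r p al))) (at al)"
        by (auto intro!: derivative_eq_intros)
    qed
    ultimately show ?thesis unfolding 4 by (intro bexI[rotated]) (assumption, simp)
  qed
  then show "\<exists>a'\<in>alg zs_gen. dir_deriv D v a a'" if "v \<in> {1}" for v using that by simp
qed

text \<open>Allows the angle to run slightly past the ends while the denominator
  \<open>1 + cos al * cos \<phi>\<close> of \<open>zs\<close> stays away from 0.\<close>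

lemma cos_ge_past_half_pi:
  assumes "\<bar>al\<bar> < pi/2 + e" "0 < e" "e \<le> 1/2" "\<phi> \<in> Icl" shows "cos al * cos \<phi> > - e"
proof -
  have c: "cos al > - e"
  proof (cases "\<bar>al\<bar> \<le> pi/2")
    case True
    then have "cos al \<ge> 0" by (intro cos_ge_zero) auto
    then show ?thesis using assms by simp
  next
    case False
    have "cos al = cos \<bar>al\<bar>" by simp
    also have "... = - sin (\<bar>al\<bar> - pi/2)" by (simp add: sin_diff)
    also have "... \<ge> - (\<bar>al\<bar> - pi/2)" using sin_x_le_x[of "\<bar>al\<bar> - pi/2"] False by simp
    finally show ?thesis using assms by linarith
  qed
  have p: "0 \<le> cos \<phi>" "cos \<phi> \<le> 1" using assms(4) by (auto intro!: cos_ge_zero)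
  show ?thesis
  proof (cases "cos al \<ge> 0")
    case True
    then have "cos al * cos \<phi> \<ge> 0" using p by simp
    then show ?thesis using assms by linarith
  next
    case False
    then have "cos al * 1 \<le> cos al * cos \<phi>" using p by (intro mult_left_mono_neg) auto
    then show ?thesis using c by linarith
  qed
qed

lemma cmod_zs: assumes "1 + cos al * cos \<phi> > 0" shows "(cmod (zs om \<phi> al))^2 = (1 - cos al * cos \<phi>) / (1 + cos al * cos \<phi>)"
proof -
  let ?x = "cos al * cos \<phi>"
  have "(cmod (zs om \<phi> al))^2 = ((sin al)^2 + (sin \<phi>)^2 * (cos al)^2) / (1 + ?x)^2"
    by (simp add: zs_def norm_mult cmod_power2 power_mult_distrib power_divide add_divide_distrib)
  also have "(sin al)^2 + (sin \<phi>)^2 * (cos al)^2 = (1 - ?x) * (1 + ?x)" unfolding sin_squared_eq by (simp add: power2_eq_square algebra_simps)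
  finally show ?thesis using assms by (simp add: power2_eq_square)
qed

lemma zs_curve_chain:
  assumes g: "smooth_open U g" and U: "cball 0 1 \<subseteq> U"
  shows "\<exists>e K. 0 < e \<and> e < 1 \<and> K 0 = (\<lambda>p al. g (zs (fst p) (snd p) al)) \<and>
    (\<forall>n. continuous_on ((UNIV \<times> Icl) \<times> {-(pi/2)-e<..<pi/2+e}) (\<lambda>q. K n (fst q) (snd q))) \<and>
    (\<forall>n om \<phi> al. \<phi> \<in> Icl \<longrightarrow> \<bar>al\<bar> < pi/2 + e \<longrightarrow> (K n (om, \<phi>) has_vector_derivative K (Suc n) (om, \<phi>) al) (at al))"
proof -
  have oU: "open U" using g unfolding smooth_open_def by blast
  obtain d where d: "d > 0" "cball (0::complex) (1 + d) \<subseteq> U" using cball_thicken[OF oU U] .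
  \<comment> \<open>With \<open>e \<le> 1/2\<close> the quotient in \<open>cmod_zs\<close> is at
    most \<open>1 + 4*e\<close>, and \<open>4*e \<le> d\<close> keeps the curve inside the disk of
    radius \<open>1 + d\<close>.\<close>
  define e where "e = min (1/2) (d/4)"
  have e: "0 < e" "e \<le> 1/2" "4 * e \<le> d" "e < 1" using d by (auto simp: e_def)
  let ?D = "(UNIV \<times> Icl) \<times> {-(pi/2)-e<..<pi/2+e} :: ((real \<times> real) \<times> real) set"
  have x: "cos al * cos (snd p) > - e" if "(p, al) \<in> ?D" for p al
    by (rule cos_ge_past_half_pi) (use that e in \<open>auto simp: abs_if\<close>)
  have x1: "1 + cos al * cos (snd p) > 0" if "(p, al) \<in> ?D" for p al using x[OF that] e by linarith
  let ?c = "\<lambda>p al. zs (fst p) (snd p) al"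
  let ?r = "\<lambda>p al. 1 / (1 + cos al * cos (snd p))"
  have const: "continuous_on UNIV c \<Longrightarrow> (\<lambda>p al. c p) \<in> alg zs_gen" for c by (rule alg.gen) (auto simp: zs_gen_def)
  have m: "(\<lambda>p al. complex_of_real (sin al)) \<in> alg zs_gen" "(\<lambda>p al. complex_of_real (cos al)) \<in> alg zs_gen"
    "(\<lambda>p al. complex_of_real (?r p al)) \<in> alg zs_gen" by (auto intro!: alg.gen simp: zs_gen_def)
  have cr: "(\<lambda>p al. complex_of_real (Re (?c p al))) \<in> alg zs_gen"
  proof -
    have "(\<lambda>p al. (\<lambda>p. - complex_of_real (cos (fst p))) p * (complex_of_real (sin al) * complex_of_real (?r p al)) +
       (\<lambda>p. - complex_of_real (sin (fst p) * sin (snd p))) p * (complex_of_real (cos al) * complex_of_real (?r p al))) \<in> alg zs_gen"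
      by (intro alg.mult alg.add m const continuous_intros)
    then show ?thesis by (simp add: zs_def algebra_simps)
  qed
  have ci: "(\<lambda>p al. complex_of_real (Im (?c p al))) \<in> alg zs_gen"
  proof -
    have "(\<lambda>p al. (\<lambda>p. complex_of_real (cos (fst p) * sin (snd p))) p * (complex_of_real (cos al) * complex_of_real (?r p al)) +
       (\<lambda>p. - complex_of_real (sin (fst p))) p * (complex_of_real (sin al) * complex_of_real (?r p al))) \<in> alg zs_gen"
      by (intro alg.mult alg.add m const continuous_intros)
    then show ?thesis by (simp add: zs_def algebra_simps)
  qed
  have cU: "?c p al \<in> U" if "(p, al) \<in> ?D" for p al
  proof -
    let ?x = "cos al * cos (snd p)"
    have xx: "?x > - e" "1 + ?x > 0" using x[OF that] x1[OF that] by auto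
    have "1 - ?x \<le> (1 + 4 * e) * (1 + ?x)"
    proof -
      have "(1 + 4 * e) * (1 - e) \<le> (1 + 4 * e) * (1 + ?x)" using xx e by (intro mult_left_mono) auto
      moreover have "e * e \<le> e * (1/2)" using e by (intro mult_left_mono) auto
      then have "1 + e \<le> (1 + 4 * e) * (1 - e)" by (simp add: algebra_simps)
      ultimately show ?thesis using xx by linarith
    qed
    then have "(cmod (?c p al))^2 \<le> 1 + 4 * e" unfolding cmod_zs[OF xx(2)] using xx by (simp add: pos_divide_le_eq)
    also have "... \<le> (1 + d)^2"
    proof -
      have "(1 + d)^2 = 1 + 2 * d + d * d" by (simp add: power2_eq_square algebra_simps)
      then show ?thesis using e mult_pos_pos[OF d(1) d(1)] d(1) by linarith
    qed
    finally have "cmod (?c p al) \<le> 1 + d" using d power2_le_imp_le by fastforce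
    then show ?thesis using d by auto
  qed
  note cl = curve_alg_closed[OF g zs_gen_closed[OF x1] cr ci cU]
  have "(\<lambda>p al. g (?c p al)) \<in> alg (zs_gen \<union> {\<lambda>p t. ipartial vs g (?c p t) |vs. set vs \<subseteq> {1, \<i>}})"
    by (rule alg.gen, rule UnI2, rule CollectI, rule exI[of _ "[]"]) simp
  from alg_chain[OF cl this] obtain K where KK: "K 0 = (\<lambda>p al. g (?c p al)) \<and> (\<forall>n. continuous_on ?D (\<lambda>q. K n (fst q) (snd q)) \<and>
     (\<forall>p x. (p, x) \<in> ?D \<longrightarrow> (K n p has_vector_derivative K (Suc n) p x) (at x)))" by (rule exE)
  note K = conjunct1[OF KK] conjunct1[OF spec[OF conjunct2[OF KK]]] conjunct2[OF spec[OF conjunct2[OF KK]], rule_format]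
  show ?thesis
  proof (intro exI[of _ e] exI[of _ K] conjI allI impI e(1,4) K(1,2))
    fix n om \<phi> al assume "\<phi> \<in> Icl" "\<bar>al\<bar> < pi/2 + e"
    then have "((om, \<phi>), al) \<in> ?D" by (auto simp: abs_if split: if_splits)
    then show "(K n (om, \<phi>) has_vector_derivative K (Suc n) (om, \<phi>) al) (at al)" by (rule K(3))
  qed
qed

text \<open>Even Taylor coefficients cancel in the difference of the values at \<open>y\<close> and
  \<open>- y\<close>, odd ones vanish by hypothesis. The constant can be taken uniform in
  \<open>\<theta>\<close> because the derivatives are jointly continuous on a compact set.\<close>

lemma rx_flat:
  assumes g: "smooth_open U g" and U: "cball 0 1 \<subseteq> U"
    and odd: "\<And>\<theta> j. odd j \<Longrightarrow> (deriv ^^ j) (\<lambda>y. Re (g (complex_of_real (rx y) * cis \<theta>))) 0 = 0 \<and>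
         (deriv ^^ j) (\<lambda>y. Im (g (complex_of_real (rx y) * cis \<theta>))) 0 = 0"
  shows "\<exists>r>0. r < 1 \<and> (\<forall>N. \<exists>C. \<forall>\<theta>\<in>{-pi..pi}. \<forall>y. \<bar>y\<bar> \<le> r \<longrightarrow>
     cmod (g (complex_of_real (rx y) * cis \<theta>) - g (complex_of_real (rx (- y)) * cis \<theta>)) \<le> C * \<bar>y\<bar> ^ N)"
proof -
  obtain e K where e: "0 < e" "e < 1" and K0: "K 0 = (\<lambda>\<theta> y. g (complex_of_real (rx y) * cis \<theta>))"
    and Kc: "\<And>n. continuous_on (UNIV \<times> {-e<..<e}) (\<lambda>q. K n (fst q) (snd q))"
    and Kd: "\<And>n \<theta> y. \<bar>y\<bar> < e \<Longrightarrow> (K n \<theta> has_vector_derivative K (Suc n) \<theta> y) (at y)"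
    using rx_curve_chain[OF g U] by blast
  have Ko: "K n \<theta> 0 = 0" if n: "odd n" for n \<theta>
  proof -
    have "(deriv ^^ n) (\<lambda>y. Re (K 0 \<theta> y)) 0 = Re (K n \<theta> 0)"
      by (rule deriv_chain[where K="\<lambda>n y. Re (K n \<theta> y)" and e=e])
        (use e bounded_linear.has_vector_derivative[OF bounded_linear_Re Kd] in \<open>auto simp: has_real_derivative_iff_has_vector_derivative\<close>)
    moreover have "(deriv ^^ n) (\<lambda>y. Im (K 0 \<theta> y)) 0 = Im (K n \<theta> 0)"
      by (rule deriv_chain[where K="\<lambda>n y. Im (K n \<theta> y)" and e=e])
        (use e bounded_linear.has_vector_derivative[OF bounded_linear_Im Kd] in \<open>auto simp: has_real_derivative_iff_has_vector_derivative\<close>)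
    ultimately show ?thesis using odd[OF n, of \<theta>] unfolding K0 by (simp add: complex_eq_iff)
  qed
  \<comment> \<open>The \<open>n\<close>-th derivative of the difference of values at
    \<open>y\<close> and \<open>- y\<close>; at 0 it vanishes for even \<open>n\<close> by
    cancellation and for odd \<open>n\<close> by \<open>Ko\<close>.\<close>
  define E where "E n \<theta> y = K n \<theta> y - (-1) ^ n * K n \<theta> (- y)" for n \<theta> y
  have Ed: "(E n \<theta> has_vector_derivative E (Suc n) \<theta> y) (at y)" if "\<bar>y\<bar> \<le> e/2" for n \<theta> y
  proof -
    have y: "\<bar>y\<bar> < e" "\<bar>- y\<bar> < e" using that e by auto
    have 2: "(uminus has_vector_derivative (-1)) (at y)" by (auto intro!: derivative_eq_intros)
    have "((\<lambda>y. K n \<theta> (- y)) has_vector_derivative - K (Suc n) \<theta> (- y)) (at y)"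
      using vector_diff_chain_at[OF 2 Kd[OF y(2)]] by (simp add: o_def)
    from has_vector_derivative_diff[OF Kd[OF y(1)] has_vector_derivative_mult_right[OF this, of "(-1) ^ n"]]
    show ?thesis unfolding E_def[abs_def] by simp
  qed
  have Ez: "E n \<theta> 0 = 0" for n \<theta> using Ko[of n \<theta>] by (cases "even n") (auto simp: E_def)
  have "\<exists>C. \<forall>\<theta>\<in>{-pi..pi}. \<forall>y. \<bar>y\<bar> \<le> e/2 \<longrightarrow> cmod (K 0 \<theta> y - K 0 \<theta> (- y)) \<le> C * \<bar>y\<bar> ^ N" for N
  proof -
    have "bounded ((\<lambda>q. K N (fst q) (snd q)) ` ({-pi..pi} \<times> {-(e/2)..e/2}))"
      by (intro compact_imp_bounded compact_continuous_image continuous_on_subset[OF Kc] compact_Times) (use e in auto)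
    then obtain B where B: "\<And>\<theta> y. \<theta> \<in> {-pi..pi} \<Longrightarrow> \<bar>y\<bar> \<le> e/2 \<Longrightarrow> cmod (K N \<theta> y) \<le> B"
      unfolding bounded_iff by (fastforce simp: abs_le_iff)
    have "cmod (E 0 \<theta> y) \<le> (2 * B) * \<bar>y\<bar> ^ N" if "\<theta> \<in> {-pi..pi}" "\<bar>y\<bar> \<le> e/2" for \<theta> y
    proof (rule flat_bound[where E="\<lambda>n. E n \<theta>", OF Ed Ez _ that(2)])
      fix y assume y: "\<bar>y\<bar> \<le> e/2"
      have "cmod (E N \<theta> y) \<le> cmod (K N \<theta> y) + cmod ((-1) ^ N * K N \<theta> (- y))" unfolding E_def by (rule norm_triangle_ineq4)
      also have "cmod ((-1) ^ N * K N \<theta> (- y)) = cmod (K N \<theta> (- y))" by (simp add: norm_mult norm_power)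
      also have "cmod (K N \<theta> y) + cmod (K N \<theta> (- y)) \<le> B + B" using y by (intro add_mono B that(1)) auto
      finally show "cmod (E N \<theta> y) \<le> 2 * B" by simp
    qed
    then show ?thesis unfolding E_def by (intro exI[of _ "2 * B"]) auto
  qed
  then show ?thesis unfolding K0 using e by (intro exI[of _ "e/2"]) auto
qed

text \<open>By \<open>zs_polar\<close>, reflecting about the endpoint \<open>\<sigma>/2\<close> and
  replacing \<open>\<phi>\<close> by \<open>- \<phi>\<close> compares values of \<open>g\<close> at
  \<open>y\<close> and \<open>- y\<close> on one ray. The difference is flat by
  \<open>rx_flat\<close>, so all its derivatives vanish at the endpoint; for odd order this is the
  claim.\<close>

lemma zs_sym_odd:
  assumes g: "smooth_open U g" and U: "cball 0 1 \<subseteq> U"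
    and odd: "\<And>\<theta> j. odd j \<Longrightarrow> (deriv ^^ j) (\<lambda>y. Re (g (complex_of_real (rx y) * cis \<theta>))) 0 = 0 \<and>
         (deriv ^^ j) (\<lambda>y. Im (g (complex_of_real (rx y) * cis \<theta>))) 0 = 0"
    and e: "0 < e" and K0: "K 0 = (\<lambda>p al. g (zs (fst p) (snd p) al))"
    and Kd: "\<And>n om \<phi> al. \<phi> \<in> Icl \<Longrightarrow> \<bar>al\<bar> < pi/2 + e \<Longrightarrow> (K n (om, \<phi>) has_vector_derivative K (Suc n) (om, \<phi>) al) (at al)"
    and n: "odd n" and ph: "\<phi> \<in> Icl" and s: "\<sigma> = pi \<or> \<sigma> = - pi"
  shows "K n (om, \<phi>) (\<sigma>/2) + K n (om, - \<phi>) (\<sigma>/2) = 0"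
proof -
  obtain r0 where r0: "r0 > 0" "r0 < 1" and fl: "\<And>N. \<exists>C. \<forall>\<theta>\<in>{-pi..pi}. \<forall>y. \<bar>y\<bar> \<le> r0 \<longrightarrow>
     cmod (g (complex_of_real (rx y) * cis \<theta>) - g (complex_of_real (rx (- y)) * cis \<theta>)) \<le> C * \<bar>y\<bar> ^ N"
    using rx_flat[OF g U odd] by blast
  define r where "r = min (e/2) r0"
  have r: "r > 0" "r < e" "r \<le> r0" using e r0 by (auto simp: r_def)
  define D where "D n t = K n (om, \<phi>) (\<sigma>/2 + t) - (-1) ^ n * K n (om, - \<phi>) (\<sigma>/2 - t)" for n t
  have Dd: "(D n has_vector_derivative D (Suc n) t) (at t)" if "\<bar>t\<bar> \<le> r" for n t
  proof -
    have a: "\<bar>\<sigma>/2 + t\<bar> < pi/2 + e" "\<bar>\<sigma>/2 - t\<bar> < pi/2 + e" "- \<phi> \<in> Icl" using that r s ph by auto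
    have 1: "((\<lambda>t. \<sigma>/2 + t) has_vector_derivative 1) (at t)" and 2: "((\<lambda>t. \<sigma>/2 - t) has_vector_derivative (-1)) (at t)"
      by (auto intro!: derivative_eq_intros)
    have "((\<lambda>t. K n (om, \<phi>) (\<sigma>/2 + t)) has_vector_derivative K (Suc n) (om, \<phi>) (\<sigma>/2 + t)) (at t)"
      using vector_diff_chain_at[OF 1 Kd[OF ph a(1)]] by (simp add: o_def)
    moreover have "((\<lambda>t. K n (om, - \<phi>) (\<sigma>/2 - t)) has_vector_derivative - K (Suc n) (om, - \<phi>) (\<sigma>/2 - t)) (at t)"
      using vector_diff_chain_at[OF 2 Kd[OF a(3,2)]] by (simp add: o_def)
    ultimately show ?thesis
      unfolding D_def[abs_def] using has_vector_derivative_diff[OF _ has_vector_derivative_mult_right[of _ _ _ "(-1) ^ n"]] by fastforce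
  qed
  have "\<exists>C. \<forall>t. \<bar>t\<bar> \<le> r \<longrightarrow> cmod (D 0 t) \<le> C * \<bar>t\<bar> ^ N" for N
  proof -
    obtain C where C: "\<And>\<theta> y. \<theta> \<in> {-pi..pi} \<Longrightarrow> \<bar>y\<bar> \<le> r0 \<Longrightarrow>
      cmod (g (complex_of_real (rx y) * cis \<theta>) - g (complex_of_real (rx (- y)) * cis \<theta>)) \<le> C * \<bar>y\<bar> ^ N" using fl[of N] by blast
    have "cmod (D 0 t) \<le> \<bar>C\<bar> * \<bar>t\<bar> ^ N" if t: "\<bar>t\<bar> \<le> r" for t
    proof -
      let ?a = "\<sigma>/2 + t" and ?x = "cos (\<sigma>/2 + t) * cos \<phi>"
      have "\<bar>cos ?a\<bar> = \<bar>sin t\<bar>" using s by (auto simp: cos_add)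
      then have "\<bar>?x\<bar> \<le> \<bar>t\<bar> * 1" unfolding abs_mult using abs_sin_x_le_abs_x[of t] by (intro mult_mono) auto
      then have x: "\<bar>?x\<bar> \<le> \<bar>t\<bar>" by simp
      then have x1: "\<bar>?x\<bar> < 1" "\<bar>?x\<bar> \<le> r0" using t r r0 by linarith+
      obtain \<theta> where th: "\<theta> \<in> {-pi..pi}" "zs om \<phi> ?a = complex_of_real (rx ?x) * cis \<theta>"
        "zs om (- \<phi>) (\<sigma> - ?a) = complex_of_real (rx (- ?x)) * cis \<theta>" using zs_polar[OF x1(1) s] by blast
      have sa: "\<sigma> - ?a = \<sigma>/2 - t" by simp
      have "D 0 t = g (complex_of_real (rx ?x) * cis \<theta>) - g (complex_of_real (rx (- ?x)) * cis \<theta>)"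
        unfolding D_def K0 th(2,3)[symmetric] sa by simp
      then have "cmod (D 0 t) \<le> C * \<bar>?x\<bar> ^ N" using C[OF th(1) x1(2)] by simp
      also have "... \<le> \<bar>C\<bar> * \<bar>t\<bar> ^ N" using x by (intro mult_mono power_mono) auto
      finally show ?thesis .
    qed
    then show ?thesis by blast
  qed
  from flat_chain_zero[OF r(1) Dd this] have "D n 0 = 0" .
  then show ?thesis using n by (simp add: D_def)
qed

text \<open>Members of \<open>Cinf_ev\<close> are arbitrary off the closed disk. Cutting off makes
  them measurable and bounded everywhere, and neither the transform nor \<open>coefH\<close> sees
  the difference.\<close>

definition on_disk :: "(complex \<Rightarrow> complex) \<Rightarrow> complex \<Rightarrow> complex" where
  "on_disk f z = (if z \<in> ball 0 1 then f z else 0)"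

lemma on_disk_Cinf_ev:
  assumes "f \<in> Cinf_ev"
  shows "on_disk f \<in> borel_measurable borel" "\<exists>B. \<forall>z. cmod (on_disk f z) \<le> B"
proof -
  obtain U g where U: "cball 0 1 \<subseteq> U" "smooth_open U g" "\<And>z. z \<in> cball 0 1 \<Longrightarrow> g z = f z" using assms unfolding Cinf_ev_def by blast
  have "set ([] :: complex list) \<subseteq> {1, \<i>}" by simp
  then have "continuous_on U (ipartial [] g)" using U(2) unfolding smooth_open_def by blast
  then have gc: "continuous_on (cball 0 1) g" using U(1) continuous_on_subset by auto
  have "on_disk f = (\<lambda>z. indicator (ball 0 1) z *\<^sub>R g z)" using U(3) by (auto simp: on_disk_def fun_eq_iff)
  moreover have "continuous_on (ball 0 1) g" using gc continuous_on_subset ball_subset_cball by blast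
  ultimately show "on_disk f \<in> borel_measurable borel" using borel_measurable_continuous_on_indicator[of "ball 0 1" g] by simp
  have "bounded (g ` cball 0 1)" by (intro compact_imp_bounded compact_continuous_image gc) simp
  then obtain B where B: "\<And>z. z \<in> cball 0 1 \<Longrightarrow> cmod (g z) \<le> B" unfolding bounded_iff by blast
  have "cmod (on_disk f z) \<le> \<bar>B\<bar>" for z using B[of z] U(3)[of z] by (auto simp: on_disk_def)
  then show "\<exists>B. \<forall>z. cmod (on_disk f z) \<le> B" by blast
qed

lemma IHw_on_disk: "IHw \<gamma> (on_disk f) = IHw \<gamma> f"
  by (rule IHw_cong) (simp add: on_disk_def)

context disk_weight
begin

text \<open>The symmetry of \<open>mT\<close> allows averaging over \<open>T\<close> and
  \<open>- T\<close>, and Fubini puts the angle integral inside, where the symmetrised function is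
  even at both ends.\<close>

lemma moment_fold:
  assumes [measurable]: "f \<in> borel_measurable borel" and B: "\<And>z. cmod (f z) \<le> B"
  shows "moment_int (IHw \<gamma> f) (poly q) om = (LINT T|mT \<gamma>. LINT al|mA \<gamma>. complex_of_real (poly q (sin al)) * ((f (zc om al T) + f (zc om al (- T))) / 2))"
proof -
  obtain Q where Q: "Q \<ge> 0" "\<And>y. \<bar>y\<bar> \<le> 1 \<Longrightarrow> \<bar>poly q y\<bar> \<le> Q" using poly_bounded[of q] by blast
  let ?E = "\<lambda>al T. complex_of_real (poly q (sin al)) * ((f (zc om al T) + f (zc om al (- T))) / 2)"
  have "moment_int (IHw \<gamma> f) (poly q) om = (LINT al|mA \<gamma>. complex_of_real (poly q (sin al)) * UU \<gamma> (IHw \<gamma> f) om al)"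
    by (rule moment_int_eq) measurable
  also have "... = (LINT al|mA \<gamma>. LINT T|mT \<gamma>. ?E al T)"
  proof (rule integral_mA_cong)
    fix al assume a: "al \<in> Iang"
    have i: "integrable (mT \<gamma>) (\<lambda>T. f (zc om al T))" "integrable (mT \<gamma>) (\<lambda>T. f (zc om al (- T)))"
      by (rule integrable_mT_bounded[where B=B], measurable, rule B)+
    have "(LINT T|mT \<gamma>. f (zc om al (- T))) = (LINT T|mT \<gamma>. f (zc om al T))"
      using integral_mT_reflect[of "\<lambda>T. f (zc om al T)" \<gamma>] by simp
    then have "(LINT T|mT \<gamma>. (f (zc om al T) + f (zc om al (- T))) / 2) = (LINT T|mT \<gamma>. f (zc om al T))" using i by simp
    then show "complex_of_real (poly q (sin al)) * UU \<gamma> (IHw \<gamma> f) om al = (LINT T|mT \<gamma>. ?E al T)" by (subst UU_IHw[OF a]) simp_all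
  qed measurable
  also have "... = (LINT T|mT \<gamma>. LINT al|mA \<gamma>. ?E al T)"
  proof (rule Fubini_bounded(1)[where B="Q * B", symmetric])
    fix al T
    have "cmod ((f (zc om al T) + f (zc om al (- T))) / 2) \<le> B"
      using norm_triangle_ineq[of "f (zc om al T)" "f (zc om al (- T))"] B[of "zc om al T"] B[of "zc om al (- T)"] by (simp add: norm_divide)
    then show "cmod (?E al T) \<le> Q * B" unfolding norm_mult norm_of_real using Q by (intro mult_mono) auto
  qed (unfold_locales, measurable)
  finally show ?thesis .
qed

text \<open>For each \<open>T\<close> the folded integrand satisfies the endpoint conditions of
  \<open>pg_cosine_decay\<close> by \<open>zs_sym_odd\<close>. The bound is uniform in
  \<open>T\<close> because \<open>\<phi> = arcsin (tanh T)\<close> stays in a compact interval on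
  which the derivative of order \<open>2*N + 2\<close> is bounded.\<close>

lemma moment_decay:
  assumes f: "f \<in> Cinf_ev"
  shows "\<exists>C. \<forall>m\<ge>1. \<forall>om\<in>{0..2*pi}. cmod (moment_int (IHw \<gamma> f) (poly (pg m)) om) \<le> C / real m ^ (2 * N)"
proof -
  obtain U g where U: "cball 0 1 \<subseteq> U" and g: "smooth_open U g" and fg: "\<And>z. z \<in> cball 0 1 \<Longrightarrow> g z = f z"
    and odd: "\<And>\<theta> j. odd j \<Longrightarrow> (deriv ^^ j) (\<lambda>y. Re (g (complex_of_real (rx y) * cis \<theta>))) 0 = 0 \<and>
         (deriv ^^ j) (\<lambda>y. Im (g (complex_of_real (rx y) * cis \<theta>))) 0 = 0" using f unfolding Cinf_ev_def by blast
  obtain e K where e: "0 < e" "e < 1" and K0: "K 0 = (\<lambda>p al. g (zs (fst p) (snd p) al))"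
    and Kc: "\<And>n. continuous_on ((UNIV \<times> Icl) \<times> {-(pi/2)-e<..<pi/2+e}) (\<lambda>q. K n (fst q) (snd q))"
    and Kd: "\<And>n om \<phi> al. \<phi> \<in> Icl \<Longrightarrow> \<bar>al\<bar> < pi/2 + e \<Longrightarrow> (K n (om, \<phi>) has_vector_derivative K (Suc n) (om, \<phi>) al) (at al)"
    using zs_curve_chain[OF g U] by blast
  note f0 [measurable] = on_disk_Cinf_ev(1)[OF f]
  obtain B0 where B0: "\<And>z. cmod (on_disk f z) \<le> B0" using on_disk_Cinf_ev(2)[OF f] by blast
  have "bounded ((\<lambda>q. K (2 * N + 2) (fst q) (snd q)) ` (({0..2*pi} \<times> Icl) \<times> Icl))"
    by (intro compact_imp_bounded compact_continuous_image continuous_on_subset[OF Kc] compact_Times) (use e in auto)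
  then obtain B where B: "\<And>om \<phi> al. om \<in> {0..2*pi} \<Longrightarrow> \<phi> \<in> Icl \<Longrightarrow> al \<in> Icl \<Longrightarrow> cmod (K (2 * N + 2) (om, \<phi>) al) \<le> B"
    unfolding bounded_iff by fastforce
  define Z where "Z = (\<Sum>n. inverse (real (Suc n) ^ 2))"
  define A where "A = (measure (mA \<gamma>) UNIV + 1) * (2 * (2 * B) * Z)"
  \<comment> \<open>\<open>R\<close> stands for \<open>Re\<close> or \<open>Im\<close>, since the
    cosine estimate is for real functions; the two values of \<open>K\<close> added together account
    for the bound \<open>2 * B\<close>.\<close>
  have part: "\<bar>LINT al|mA \<gamma>. poly (pg m) (sin al) * R (on_disk f (zc om al T) + on_disk f (zc om al (- T)))\<bar> \<le> A / real m ^ (2 * N)"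
    if m: "m \<ge> 1" and w: "om \<in> {0..2*pi}" and R: "bounded_linear R" "\<And>z. \<bar>R z\<bar> \<le> cmod z" for R :: "complex \<Rightarrow> real" and m om T
  proof -
    define \<phi> where "\<phi> = arcsin (tanh T)"
    have ph: "\<phi> \<in> Icl" "- \<phi> \<in> Icl" using arcsin_bounded[of "tanh T"] tanh_real_bounds[of T] by (auto simp: \<phi>_def)
    have [measurable]: "R \<in> borel_measurable borel" using R(1) by (intro borel_measurable_continuous_onI linear_continuous_on)
    let ?S = "\<lambda>n al. R (K n (om, \<phi>) al + K n (om, - \<phi>) al)"
    have "\<bar>LINT al|mA \<gamma>. poly (pg m) (sin al) * R (on_disk f (zc om al T) + on_disk f (zc om al (- T)))\<bar>
      \<le> (measure (mA \<gamma>) UNIV + 1) * (2 * (2 * B) * (\<Sum>n. inverse (real (Suc n) ^ 2)) / real m ^ (2 * N))"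
    proof (rule pg_cosine_decay[where S="?S", OF _ _ _ _ m])
      fix n al assume a: "al \<in> Icl"
      then have a': "\<bar>al\<bar> < pi/2 + e" using e by auto
      have "((\<lambda>al. K n (om, \<phi>) al + K n (om, - \<phi>) al) has_vector_derivative K (Suc n) (om, \<phi>) al + K (Suc n) (om, - \<phi>) al) (at al)"
        by (intro has_vector_derivative_add Kd a' ph)
      from bounded_linear.has_vector_derivative[OF R(1) this]
      show "(?S n has_real_derivative ?S (Suc n) al) (at al within Icl)"
        unfolding has_real_derivative_iff_has_vector_derivative by (rule has_vector_derivative_at_within)
    next
      fix n :: nat assume n: "odd n"
      have "K n (om, \<phi>) (pi/2) + K n (om, - \<phi>) (pi/2) = 0" "K n (om, \<phi>) (- pi/2) + K n (om, - \<phi>) (- pi/2) = 0"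
        using zs_sym_odd[OF g U odd e(1) K0 Kd n ph(1), of pi] zs_sym_odd[OF g U odd e(1) K0 Kd n ph(1), of "- pi"] by blast+
      then show "?S n (pi/2) = 0" "?S n (-(pi/2)) = 0" using linear_0[OF bounded_linear.linear[OF R(1)]] by simp_all
    next
      fix al assume a: "al \<in> Icl"
      show "\<bar>?S (2 * N + 2) al\<bar> \<le> 2 * B"
        using R(2)[of "K (2 * N + 2) (om, \<phi>) al + K (2 * N + 2) (om, - \<phi>) al"] norm_triangle_ineq[of "K (2 * N + 2) (om, \<phi>) al" "K (2 * N + 2) (om, - \<phi>) al"]
          B[OF w ph(1) a] B[OF w ph(2) a] by linarith
    next
      fix al assume a: "al \<in> Iang"
      have c: "on_disk f (zc om al T') = g (zc om al T')" for T'
        using zc_in_ball[OF cos_Iang[OF a], of om T'] fg[of "zc om al T'"] by (simp add: on_disk_def)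
      show "R (on_disk f (zc om al T) + on_disk f (zc om al (- T))) = ?S 0 al"
        unfolding c unfolding zc_zs(2)[OF cos_Iang[OF a], of om T] unfolding zc_zs(1)[OF cos_Iang[OF a], of om T] K0 \<phi>_def by simp
    next
      show "(\<lambda>al. R (on_disk f (zc om al T) + on_disk f (zc om al (- T)))) \<in> borel_measurable borel" by measurable
    qed
    then show ?thesis by (simp add: A_def Z_def)
  qed
  have "cmod (moment_int (IHw \<gamma> f) (poly (pg m)) om) \<le> (A * measure (mT \<gamma>) UNIV) / real m ^ (2 * N)" if m: "m \<ge> 1" and w: "om \<in> {0..2*pi}" for m om
  proof -
    obtain Q where Q: "Q \<ge> 0" "\<And>y. \<bar>y\<bar> \<le> 1 \<Longrightarrow> \<bar>poly (pg m) y\<bar> \<le> Q" using poly_bounded[of "pg m"] by blast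
    let ?h = "\<lambda>al T. complex_of_real (poly (pg m) (sin al)) * ((on_disk f (zc om al T) + on_disk f (zc om al (- T))) / 2)"
    have hb: "cmod (?h al T) \<le> Q * B0" for al T
    proof -
      have "cmod ((on_disk f (zc om al T) + on_disk f (zc om al (- T))) / 2) \<le> B0"
        using norm_triangle_ineq[of "on_disk f (zc om al T)" "on_disk f (zc om al (- T))"] B0[of "zc om al T"] B0[of "zc om al (- T)"] by (simp add: norm_divide)
      then show ?thesis unfolding norm_mult norm_of_real using Q by (intro mult_mono) auto
    qed
    have hi: "integrable (mA \<gamma>) (\<lambda>al. ?h al T)" for T by (rule A.integrable_const_bound[where B="Q * B0"]) (use hb in auto)
    have inner: "cmod (LINT al|mA \<gamma>. ?h al T) \<le> A / real m ^ (2 * N)" for T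
    proof -
      have "Re (LINT al|mA \<gamma>. ?h al T) = (LINT al|mA \<gamma>. poly (pg m) (sin al) * Re (on_disk f (zc om al T) + on_disk f (zc om al (- T)))) / 2"
        unfolding integral_Re[OF hi, symmetric] by (simp add: Re_divide_of_real distrib_left)
      moreover have "Im (LINT al|mA \<gamma>. ?h al T) = (LINT al|mA \<gamma>. poly (pg m) (sin al) * Im (on_disk f (zc om al T) + on_disk f (zc om al (- T)))) / 2"
        unfolding integral_Im[OF hi, symmetric] by (simp add: Im_divide_of_real distrib_left)
      ultimately show ?thesis
        using cmod_le[of "LINT al|mA \<gamma>. ?h al T"] part[OF m w bounded_linear_Re abs_Re_le_cmod, of T] part[OF m w bounded_linear_Im abs_Im_le_cmod, of T] by simp
    qed
    have "moment_int (IHw \<gamma> f) (poly (pg m)) om = (LINT T|mT \<gamma>. LINT al|mA \<gamma>. ?h al T)"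
      unfolding IHw_on_disk[of \<gamma> f, symmetric] by (rule moment_fold[OF f0 B0])
    also have "cmod ... \<le> (LINT T|mT \<gamma>. A / real m ^ (2 * N))"
      by (rule Bochner_Integration.integral_norm_bound_integral) (use inner in \<open>auto intro!: integrable_mT_bounded[where B="A / real m ^ (2 * N)"]\<close>)
    finally show ?thesis by (simp add: mult_ac)
  qed
  then show ?thesis by blast
qed

lemma AE_mO_Icc: "AE om in mO. om \<in> {0..2*pi}"
  unfolding mO_def by (subst AE_density) (auto intro!: AE_I2 simp: indicator_def)

lemma cmod_Mc_le:
  assumes [measurable]: "u \<in> borel_measurable borel" and b: "\<And>om. om \<in> {0..2*pi} \<Longrightarrow> cmod (moment_int u (poly (pg m)) om) \<le> b"
  shows "cmod (Mc u m k) \<le> b"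
proof -
  let ?h = "\<lambda>om. cis (- ((real m - 2 * real k) * om)) * moment_int u (poly (pg m)) om"
  have ae: "AE om in mO. cmod (?h om) \<le> b" by (rule eventually_mono[OF AE_mO_Icc]) (simp add: norm_mult b)
  have "cmod (LINT om|mO. ?h om) \<le> (LINT om|mO. cmod (?h om))" by (rule integral_norm_bound)
  also have "... \<le> (LINT om|mO. b)"
    by (rule integral_mono_AE[OF integrable_norm[OF O.integrable_const_bound[OF ae]] _ ae]) auto
  also have "... = 2 * pi * b" using integral_mO[of "\<lambda>_. b"] by simp
  finally show ?thesis unfolding Mc_def p_gamma_eq by (simp add: norm_divide field_simps)
qed

lemma rapid_Mc:
  assumes f: "f \<in> Cinf_ev" shows "rapid (Mc (IHw \<gamma> f))"
  unfolding rapid_def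
proof
  fix N :: nat
  obtain C where C: "\<And>m om. m \<ge> 1 \<Longrightarrow> om \<in> {0..2*pi} \<Longrightarrow> cmod (moment_int (IHw \<gamma> f) (poly (pg m)) om) \<le> C / real m ^ (2 * N)" using moment_decay[OF f, of N] by blast
  have [measurable]: "IHw \<gamma> f \<in> borel_measurable borel" using borel_measurable_IHw[OF on_disk_Cinf_ev(1)[OF f]] unfolding IHw_on_disk .
  \<comment> \<open>The second summand covers \<open>m = 0\<close>. For \<open>m \<ge> 1\<close> one
    has \<open>m \<ge> (1 + m) / 2\<close>, which produces the factor
    \<open>2 ^ (2 * N)\<close>.\<close>
  have "cmod (Mc (IHw \<gamma> f) m k) \<le> (\<bar>C\<bar> * 2 ^ (2 * N) + cmod (Mc (IHw \<gamma> f) 0 0)) * (1 + real m) powr (- real N)" (is "_ \<le> (?C1 + ?C2) * ?w") if k: "k \<le> m" for m k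
  proof (cases "m = 0")
    case True
    then show ?thesis using k by (simp add: mult_nonneg_nonneg)
  next
    case False
    then have m: "m \<ge> 1" by simp
    have "cmod (Mc (IHw \<gamma> f) m k) \<le> C / real m ^ (2 * N)" by (rule cmod_Mc_le) (use C[OF m] in auto)
    also have "... \<le> \<bar>C\<bar> / real m ^ (2 * N)" by (intro divide_right_mono) auto
    also have "... \<le> \<bar>C\<bar> / ((1 + real m) / 2) ^ (2 * N)" using m by (intro divide_left_mono power_mono mult_pos_pos) auto
    also have "... = ?C1 * inverse ((1 + real m) ^ (2 * N))" by (simp only: power_divide divide_divide_eq_right divide_inverse[of _ "(1 + real m) ^ (2 * N)"])
    also have "... \<le> ?C1 * inverse ((1 + real m) ^ N)" by (intro mult_left_mono le_imp_inverse_le power_increasing) auto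
    also have "inverse ((1 + real m) ^ N) = ?w" by (simp add: powr_minus powr_realpow)
    also have "?C1 * ?w \<le> (?C1 + ?C2) * ?w" by (intro mult_right_mono) auto
    finally show ?thesis .
  qed
  then show "\<exists>C. \<forall>m. \<forall>k\<le>m. cmod (Mc (IHw \<gamma> f) m k) \<le> C * (1 + real m) powr (- real N)" by blast
qed

end

section \<open>Range characterization\<close>

lemma coefH_on_disk: "coefH \<gamma> n k (on_disk f) = coefH \<gamma> n k f"
proof -
  have "L2D_inner \<gamma> (on_disk f) g = L2D_inner \<gamma> f g" for g by (rule L2D_inner_cong) (auto simp: on_disk_def)
  then show ?thesis unfolding coefH_def by simp
qed

context disk_weight
begin

text \<open>The summand of \<open>cond_sobolev\<close>; for \<open>M = Mc (IHw \<gamma> f)\<close>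
  it is \<open>Hw_terms\<close> up to the factor \<open>(2*pi)^2\<close> (see
  \<open>Hw_terms_Sob\<close>).\<close>

definition Sob :: "real \<Rightarrow> (nat \<Rightarrow> nat \<Rightarrow> complex) \<Rightarrow> nat \<Rightarrow> real" where
  "Sob s M m = (\<Sum>k\<le>m. (real m + 1 + \<gamma>) powr (2 * s) / sigma2 \<gamma> m k * (cmod (M m k))^2)"

lemma Sob_cong: "(\<And>m k. k \<le> m \<Longrightarrow> M m k = M' m k) \<Longrightarrow> Sob s M = Sob s M'"
  unfolding Sob_def[abs_def] by (auto intro!: sum.cong)

lemma Sob_weight_nonneg: "k \<le> m \<Longrightarrow> 0 \<le> (real m + 1 + \<gamma>) powr (2 * s) / sigma2 \<gamma> m k"
  using sigma2_pos[of k m] by simp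

lemma Sob_nonneg: "0 \<le> Sob s M m"
  unfolding Sob_def by (intro sum_nonneg mult_nonneg_nonneg Sob_weight_nonneg) auto

lemma Sob_add_le: "Sob s (\<lambda>m k. M m k + M' m k) m \<le> 2 * Sob s M m + 2 * Sob s M' m"
  unfolding Sob_def sum_distrib_left sum.distrib[symmetric]
proof (rule sum_mono)
  fix k assume "k \<in> {..m}"
  then have k: "k \<le> m" by simp
  let ?w = "(real m + 1 + \<gamma>) powr (2 * s) / sigma2 \<gamma> m k" and ?a = "cmod (M m k)" and ?b = "cmod (M' m k)"
  have "(cmod (M m k + M' m k))^2 \<le> (?a + ?b)^2" by (intro power_mono norm_triangle_ineq) simp
  also have "... \<le> 2 * ?a^2 + 2 * ?b^2" using zero_le_power2[of "?a - ?b"] by (simp add: power2_eq_square algebra_simps)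
  finally have "?w * (cmod (M m k + M' m k))^2 \<le> ?w * (2 * ?a^2 + 2 * ?b^2)" by (rule mult_left_mono[OF _ Sob_weight_nonneg[OF k]])
  then show "?w * (cmod (M m k + M' m k))^2 \<le> 2 * (?w * ?a^2) + 2 * (?w * ?b^2)" by (simp only: distrib_left mult.left_commute)
qed

lemma summable_Sob_rapid:
  assumes M: "rapid M" shows "summable (Sob s M)"
proof -
  obtain c L where c: "c > 0" "\<And>m k. k \<le> m \<Longrightarrow> 1 / sigma2 \<gamma> m k \<le> c * (1 + real m) ^ L" using sigma2_lower by blast
  obtain J :: nat where J: "\<bar>2 * s\<bar> \<le> real J" using real_arch_simple by blast
  obtain G where G: "G > 0" "\<And>m. (real m + 1 + \<gamma>) powr (2 * s) \<le> G * (1 + real m) ^ J"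
  proof -
    \<comment> \<open>A positive lower bound for the base \<open>real m + 1 + \<gamma>\<close>. That
      base is below 1 only for \<open>m = 0\<close> and negative \<open>\<gamma>\<close>, where
      raising the exponent would not give an upper bound.\<close>
    define h where "h = min 1 (1 + \<gamma>)"
    have h: "h > 0" "h \<le> 1" using gam by (auto simp: h_def)
    define G where "G = (1 + \<bar>\<gamma>\<bar>) powr real J + h powr (- real J)"
    have "G > 0" unfolding G_def using h by (intro add_pos_pos) auto
    moreover have "(real m + 1 + \<gamma>) powr (2 * s) \<le> G * (1 + real m) ^ J" for m
    proof (cases "real m + 1 + \<gamma> \<ge> 1")
      case True
      have "(real m + 1 + \<gamma>) powr (2 * s) \<le> (real m + 1 + \<gamma>) powr real J" using True J by (intro powr_mono) auto
      also have "... \<le> ((1 + \<bar>\<gamma>\<bar>) * (1 + real m)) powr real J"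
      proof (rule powr_mono2)
        have "0 \<le> \<bar>\<gamma>\<bar> * real m" by simp
        then show "real m + 1 + \<gamma> \<le> (1 + \<bar>\<gamma>\<bar>) * (1 + real m)" using abs_ge_self[of \<gamma>] unfolding distrib_left distrib_right by linarith
      qed (use True in auto)
      also have "... = (1 + \<bar>\<gamma>\<bar>) powr real J * (1 + real m) ^ J" by (simp add: powr_mult powr_realpow)
      also have "... \<le> G * (1 + real m) ^ J" unfolding G_def by (intro mult_right_mono) auto
      finally show ?thesis .
    next
      case False
      have hm: "h \<le> real m + 1 + \<gamma>" by (simp add: h_def)
      have "(real m + 1 + \<gamma>) powr (2 * s) \<le> (real m + 1 + \<gamma>) powr (- real J)" using False hm h J by (intro powr_mono') auto
      also have "... \<le> h powr (- real J)" using hm h by (intro powr_mono2') auto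
      also have "... \<le> G" by (simp add: G_def)
      also have "... \<le> G * (1 + real m) ^ J" using \<open>G > 0\<close> by (simp add: one_le_power)
      finally show ?thesis .
    qed
    ultimately show ?thesis by (rule that)
  qed
  \<comment> \<open>One power for the sum over \<open>k\<close>, \<open>L\<close> and
    \<open>J\<close> for the two polynomial factors, and 2 for summability.\<close>
  define N where "N = 1 + L + J + 2"
  obtain C where C: "\<And>m k. k \<le> m \<Longrightarrow> cmod (M m k) \<le> C * (1 + real m) powr (- real N)" using M unfolding rapid_def by blast
  have inv2: "summable (\<lambda>n. inverse (real (Suc n) ^ 2))"
    using inverse_power_summable[of 2, where 'a=real] by (simp only: summable_Suc_iff[of "\<lambda>m. inverse (real m ^ 2)"] le_refl)
  have "Sob s M m \<le> (G * c * C^2) * inverse (real (Suc m) ^ 2)" for m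
  proof -
    let ?x = "1 + real m"
    have x: "?x \<ge> 1" "?x > 0" by auto
    have "(real m + 1 + \<gamma>) powr (2 * s) / sigma2 \<gamma> m k * (cmod (M m k))^2 \<le> (G * ?x ^ J) * (c * ?x ^ L) * (C^2 * inverse (?x ^ N))" if k: "k \<le> m" for k
    proof -
      have "(cmod (M m k))^2 \<le> (C * ?x powr (- real N))^2" by (intro power_mono C k) simp
      also have "... = C^2 * (inverse (?x ^ N) * inverse (?x ^ N))" by (simp add: powr_minus powr_realpow power_mult_distrib power2_eq_square)
      also have "... \<le> C^2 * (inverse (?x ^ N) * 1)" using x by (intro mult_left_mono) (auto simp: inverse_le_1_iff one_le_power)
      finally have 1: "(cmod (M m k))^2 \<le> C^2 * inverse (?x ^ N)" by simp
      have "(real m + 1 + \<gamma>) powr (2 * s) * (1 / sigma2 \<gamma> m k) \<le> (G * ?x ^ J) * (c * ?x ^ L)"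
        using G(2)[of m] c(2)[OF k] sigma2_pos[OF k] G(1) by (intro mult_mono) auto
      from mult_mono[OF this 1] show ?thesis using G(1) c(1) by simp
    qed
    then have "Sob s M m \<le> (\<Sum>k\<le>m. (G * ?x ^ J) * (c * ?x ^ L) * (C^2 * inverse (?x ^ N)))" unfolding Sob_def by (intro sum_mono) simp
    also have "... = (G * c * C^2) * (?x ^ (1 + L + J) * inverse (?x ^ N))" by (simp add: power_add)
    also have "?x ^ (1 + L + J) * inverse (?x ^ N) = inverse (?x ^ 2)"
    proof -
      have i: "?x ^ n * inverse (?x ^ n) = 1" for n using x by (intro right_inverse) simp
      show ?thesis unfolding N_def power_add[of ?x "1 + L + J" 2] inverse_mult_distrib mult.assoc[symmetric] i by simp
    qed
    finally show ?thesis by (simp add: add.commute)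
  qed
  then show ?thesis by (intro summable_comparison_test'[OF summable_mult[OF inv2, of "G * c * C^2"], of 0]) (simp add: Sob_nonneg)
qed

lemma integrable_mW_bounded:
  assumes "f \<in> borel_measurable borel" "\<exists>B. \<forall>z. cmod (f z) \<le> B" shows "integrable (mW \<gamma>) (\<lambda>z. f z * cnj (Zk n k z))"
proof -
  obtain B B' where B: "\<And>z. cmod (f z) \<le> B" "\<And>z. cmod (Zk n k z) \<le> B'" using assms(2) Zk_bounded[of n k] by blast
  then have "cmod (f z * cnj (Zk n k z)) \<le> B * B'" for z
    unfolding norm_mult complex_mod_cnj by (intro mult_mono) (auto intro: order_trans[OF norm_ge_zero])
  then show ?thesis using assms(1) by (intro W.integrable_const_bound[where B="B * B'"]) auto
qed

lemma Mc_inner: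
  assumes "f \<in> borel_measurable borel" "\<exists>B. \<forall>z. cmod (f z) \<le> B"
  shows "complex_of_real (2*pi) * Mc (IHw \<gamma> f) n k = (LINT z|mW \<gamma>. f z * cnj (Zk n k z))"
proof -
  obtain B where B: "\<And>z. cmod (f z) \<le> B" using assms(2) by blast
  have "L2D_inner \<gamma> f (Zk n k) = complex_of_real (2*pi) * Mc (IHw \<gamma> f) n k" using inner_Zk[OF assms(1) B] by simp
  moreover have "L2D_inner \<gamma> f (Zk n k) = (LINT z|mW \<gamma>. f z * cnj (Zk n k z))" by (rule L2D_inner_eq) (use assms(1) in auto)
  ultimately show ?thesis by simp
qed

lemma Mc_diff:
  assumes f: "f \<in> borel_measurable borel" "\<exists>B. \<forall>z. cmod (f z) \<le> B" and g: "g \<in> borel_measurable borel" "\<exists>B. \<forall>z. cmod (g z) \<le> B"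
  shows "Mc (IHw \<gamma> (\<lambda>z. f z - g z)) n k = Mc (IHw \<gamma> f) n k - Mc (IHw \<gamma> g) n k"
proof -
  obtain B B' where B: "\<And>z. cmod (f z) \<le> B" "\<And>z. cmod (g z) \<le> B'" using f g by blast
  have "cmod (f z - g z) \<le> B + B'" for z using norm_triangle_ineq4[of "f z" "g z"] B[of z] by linarith
  then have "complex_of_real (2*pi) * Mc (IHw \<gamma> (\<lambda>z. f z - g z)) n k = (LINT z|mW \<gamma>. (f z - g z) * cnj (Zk n k z))"
    using f g by (intro Mc_inner) auto
  also have "... = (LINT z|mW \<gamma>. f z * cnj (Zk n k z)) - (LINT z|mW \<gamma>. g z * cnj (Zk n k z))"
    unfolding left_diff_distrib by (rule Bochner_Integration.integral_diff) (rule integrable_mW_bounded[OF f] integrable_mW_bounded[OF g])+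
  also have "... = complex_of_real (2*pi) * (Mc (IHw \<gamma> f) n k - Mc (IHw \<gamma> g) n k)"
    unfolding Mc_inner[OF f, symmetric] Mc_inner[OF g, symmetric] by (simp only: right_diff_distrib)
  finally show ?thesis by simp
qed

lemma Mc_FJ:
  assumes k: "k \<le> n" shows "Mc (IHw \<gamma> (FJ M J)) n k = (if n \<le> J then M n k else 0)"
proof -
  let ?c = "\<lambda>m k. complex_of_real (2*pi) * M m k / complex_of_real (sigma2 \<gamma> m k)"
  have Zi: "integrable (mW \<gamma>) (\<lambda>z. Zk m j z * cnj (Zk n k z))" for m j by (rule integrable_mW_bounded) (use Zk_bounded in auto)
  have Zz: "(LINT z|mW \<gamma>. Zk m j z * cnj (Zk n k z)) = (if m = n \<and> j = k then complex_of_real (sigma2 \<gamma> m j) else 0)" if "j \<le> m" for m j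
    using inner_Zk_Zk[OF that k] L2D_inner_eq[of "Zk m j" "Zk n k" \<gamma>] by simp
  have "complex_of_real (2*pi) * Mc (IHw \<gamma> (FJ M J)) n k = (LINT z|mW \<gamma>. FJ M J z * cnj (Zk n k z))" using FJ_bounded by (intro Mc_inner) auto
  also have "... = (LINT z|mW \<gamma>. (\<Sum>m\<le>J. \<Sum>j\<le>m. ?c m j * (Zk m j z * cnj (Zk n k z))))" unfolding FJ_def by (simp only: sum_distrib_right mult.assoc)
  also have "... = (\<Sum>m\<le>J. \<Sum>j\<le>m. ?c m j * (LINT z|mW \<gamma>. Zk m j z * cnj (Zk n k z)))"
    using Zi by (simp add: Bochner_Integration.integral_sum Bochner_Integration.integrable_sum del: times_divide_eq_left)
  also have "... = (\<Sum>m\<le>J. \<Sum>j\<le>m. if j = k then (if m = n then complex_of_real (2*pi) * M m j else 0) else 0)"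
    using sigma2_pos[OF k] by (intro sum.cong refl) (auto simp: Zz)
  also have "... = (\<Sum>m\<le>J. if m = n then complex_of_real (2*pi) * M n k else 0)"
    using k by (intro sum.cong refl) (auto simp: sum.delta)
  also have "... = complex_of_real (2*pi) * (if n \<le> J then M n k else 0)" by (simp add: sum.delta)
  finally show ?thesis by simp
qed

lemma Hw_terms_Sob:
  assumes f: "on_disk f \<in> borel_measurable borel" "\<exists>B. \<forall>z. cmod (on_disk f z) \<le> B"
  shows "Hw_terms \<gamma> s f n = (2*pi)^2 * Sob s (Mc (IHw \<gamma> f)) n"
proof -
  obtain B where B: "\<And>z. cmod (on_disk f z) \<le> B" using f(2) by blast
  have "(cmod (coefH \<gamma> n k f))^2 = (2*pi)^2 * ((cmod (Mc (IHw \<gamma> f) n k))^2 / sigma2 \<gamma> n k)" if k: "k \<le> n" for k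
  proof -
    have "coefH \<gamma> n k f = 2 * pi * Mc (IHw \<gamma> f) n k / complex_of_real (sqrt (sigma2 \<gamma> n k))"
      using coefH_eq[OF f(1) B k] unfolding coefH_on_disk IHw_on_disk .
    then have "cmod (coefH \<gamma> n k f) = 2 * pi * cmod (Mc (IHw \<gamma> f) n k) / sqrt (sigma2 \<gamma> n k)" using sigma2_pos[OF k] by (simp add: norm_mult norm_divide)
    then show ?thesis using sigma2_pos[OF k] by (simp add: power_mult_distrib power_divide)
  qed
  then show ?thesis unfolding Hw_terms_def Sob_def sum_distrib_left by (intro sum.cong) auto
qed

lemma Hw_terms_diff:
  assumes f: "f \<in> Cinf_ev" and g: "g \<in> Cinf_ev"
  shows "Hw_terms \<gamma> s (\<lambda>z. f z - g z) n = (2*pi)^2 * Sob s (\<lambda>m k. Mc (IHw \<gamma> f) m k - Mc (IHw \<gamma> g) m k) n"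
proof -
  note f' = on_disk_Cinf_ev[OF f] and g' = on_disk_Cinf_ev[OF g]
  have e: "on_disk (\<lambda>z. f z - g z) = (\<lambda>z. on_disk f z - on_disk g z)" by (auto simp: on_disk_def fun_eq_iff)
  obtain B B' where B: "\<And>z. cmod (on_disk f z) \<le> B" "\<And>z. cmod (on_disk g z) \<le> B'" using f' g' by blast
  have b: "cmod (on_disk f z - on_disk g z) \<le> B + B'" for z using norm_triangle_ineq4[of "on_disk f z" "on_disk g z"] B[of z] by linarith
  have "Mc (IHw \<gamma> (\<lambda>z. f z - g z)) = (\<lambda>m k. Mc (IHw \<gamma> f) m k - Mc (IHw \<gamma> g) m k)"
    unfolding IHw_on_disk[of \<gamma> "\<lambda>z. f z - g z", symmetric] e using Mc_diff[OF f' g'] unfolding IHw_on_disk by blast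
  then show ?thesis using Hw_terms_Sob[of "\<lambda>z. f z - g z" s n] f'(1) g'(1) b unfolding e by auto
qed

lemma moments_of_Cinf_limit:
  assumes u: "goodG u" and F: "\<And>j. F j \<in> Cinf_ev" and lim: "(\<lambda>j. L2G_dist2 \<gamma> (IHw \<gamma> (F j)) u) \<longlonglongrightarrow> 0"
  shows "hyp_moment_conds u" "(\<lambda>j. Mc (IHw \<gamma> (F j)) m k) \<longlonglongrightarrow> Mc u m k"
proof -
  have lim': "(\<lambda>j. L2G_dist2 \<gamma> (IHw \<gamma> (on_disk (F j))) u) \<longlonglongrightarrow> 0" using lim unfolding IHw_on_disk .
  note ml = moments_of_limit[OF u on_disk_Cinf_ev[OF F] lim']
  show "hyp_moment_conds u" unfolding hyp_moment_conds_def
  proof (intro allI impI)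
    fix m and p :: "real poly" assume "degree p = m \<and> (\<forall>j. odd (j + m) \<longrightarrow> coeff p j = 0)"
    then have ae: "AE om in lborel. moment_int u (poly p) om = trig m (fcoef m (moment_int u (poly p))) om" by (intro ml(1)) auto
    obtain c where "\<forall>om. trig m (fcoef m (moment_int u (poly p))) om = hom_poly m c (cos om) (sin om)" using TR_hom_poly[OF TR_I] by blast
    then show "\<exists>c. AE om in lborel. moment_int u (poly p) om = hom_poly m c (cos om) (sin om)" using ae by auto
  qed
  show "(\<lambda>j. Mc (IHw \<gamma> (F j)) m k) \<longlonglongrightarrow> Mc u m k"
    using ml(2)[OF degree_pg coeff_pg_parity] unfolding Mc_fcoef p_gamma_eq IHw_on_disk .
qed

lemma moment_data_ex:
  assumes "hyp_moment_conds u" shows "\<exists>c M. moment_data \<gamma> u c M"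
proof -
  have "\<exists>c. AE om in lborel. moment_int u (poly (pg m)) om = hom_poly m c (cos om) (sin om)" for m
    using assms degree_pg[of m] coeff_pg_parity[of _ m] unfolding hyp_moment_conds_def by blast
  then obtain c where c: "\<And>m. AE om in lborel. moment_int u (poly (pg m)) om = hom_poly m (c m) (cos om) (sin om)" by metis
  have "\<exists>M. \<forall>om. hom_poly m (c m) (cos om) (sin om) = trig m M om" for m using hom_poly_TR[of m "c m"] unfolding TR_def by blast
  then obtain M where "\<And>m om. hom_poly m (c m) (cos om) (sin om) = trig m (M m) om" by metis
  then show ?thesis using c unfolding moment_data_def p_gamma_eq trig_def by blast
qed

lemma moment_data_trig:
  assumes "moment_data \<gamma> u c M" shows "AE om in lborel. moment_int u (poly (pg m)) om = trig m (M m) om"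
proof -
  have "AE om in lborel. moment_int u (poly (pg m)) om = hom_poly m (c m) (cos om) (sin om)" "\<And>om. hom_poly m (c m) (cos om) (sin om) = trig m (M m) om"
    using assms unfolding moment_data_def p_gamma_eq trig_def by auto
  then show ?thesis by simp
qed

lemma goodG_measurable: "goodG u \<Longrightarrow> u \<in> borel_measurable borel" unfolding goodG_def by simp

text \<open>A Fatou argument on coefficients: finite sums for \<open>F j - F N\<close> are below 1
  for all large \<open>j\<close>, and coefficients converge, so the bound holds for
  \<open>Mc u\<close> minus those of \<open>F N\<close>. The latter are rapid, hence
  summable.\<close>

lemma sobolev_necessary:
  assumes u: "goodG u" and F: "Hw_Cauchy \<gamma> s F" and lim: "(\<lambda>j. L2G_dist2 \<gamma> (IHw \<gamma> (F j)) u) \<longlonglongrightarrow> 0"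
  shows "summable (Sob s (Mc u))"
proof -
  have Fc: "F j \<in> Cinf_ev" for j using F unfolding Hw_Cauchy_def by blast
  obtain N where N: "\<And>j l. j \<ge> N \<Longrightarrow> l \<ge> N \<Longrightarrow> summable (Hw_terms \<gamma> s (\<lambda>z. F j z - F l z)) \<and> suminf (Hw_terms \<gamma> s (\<lambda>z. F j z - F l z)) < 1"
    using F unfolding Hw_Cauchy_def by (meson zero_less_one)
  let ?M = "\<lambda>j. Mc (IHw \<gamma> (F j))"
  let ?d = "\<lambda>M m k. M m k - ?M N m k"
  have le: "(\<Sum>n<n0. (2*pi)^2 * Sob s (?d (?M j)) n) \<le> 1" if "j \<ge> N" for j n0
  proof -
    have "(\<Sum>n<n0. Hw_terms \<gamma> s (\<lambda>z. F j z - F N z) n) \<le> suminf (Hw_terms \<gamma> s (\<lambda>z. F j z - F N z))"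
    proof (rule sum_le_suminf)
      show "0 \<le> Hw_terms \<gamma> s (\<lambda>z. F j z - F N z) n" for n by (simp add: Hw_terms_diff[OF Fc Fc] Sob_nonneg)
    qed (use N[OF that, of N] in auto)
    then show ?thesis using N[OF that, of N] unfolding Hw_terms_diff[OF Fc Fc] by simp
  qed
  have "(\<Sum>n<n0. (2*pi)^2 * Sob s (?d (Mc u)) n) \<le> 1" for n0
  proof (rule LIMSEQ_le_const2)
    show "(\<lambda>j. \<Sum>n<n0. (2*pi)^2 * Sob s (?d (?M j)) n) \<longlonglongrightarrow> (\<Sum>n<n0. (2*pi)^2 * Sob s (?d (Mc u)) n)"
      unfolding Sob_def by (intro tendsto_intros moments_of_Cinf_limit(2)[OF u Fc lim])
  qed (use le in blast)
  then have "summable (\<lambda>n. (2*pi)^2 * Sob s (?d (Mc u)) n)" by (intro summableI_nonneg_bounded[where x=1]) (simp_all add: Sob_nonneg)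
  then have d: "summable (Sob s (?d (Mc u)))" by (simp add: summable_cmult_iff)
  have "Sob s (Mc u) n \<le> 2 * Sob s (?d (Mc u)) n + 2 * Sob s (?M N) n" for n using Sob_add_le[of s "?d (Mc u)" "?M N" n] by simp
  then show ?thesis
    by (intro summable_comparison_test'[OF summable_add[OF summable_mult[OF d, of 2] summable_mult[OF summable_Sob_rapid[OF rapid_Mc[OF Fc[of N]], of s], of 2]], of 0])
       (simp add: Sob_nonneg)
qed

text \<open>By \<open>Mc_FJ\<close> the coefficients of \<open>FJ M j - FJ M l\<close> vanish below
  \<open>N\<close> and never exceed those of \<open>M\<close>, so the norm is bounded by a tail of a
  convergent series.\<close>

lemma FJ_Cauchy:
  assumes "summable (Sob s M)" shows "Hw_Cauchy \<gamma> s (FJ M)"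
  unfolding Hw_Cauchy_def
proof (intro conjI allI impI FJ_Cinf_ev)
  fix e :: real assume e: "e > 0"
  let ?T = "\<lambda>n. (2*pi)^2 * Sob s M n"
  have sT: "summable ?T" by (rule summable_mult[OF assms])
  obtain N where N: "norm (\<Sum>i. ?T (i + N)) < e" using suminf_exist_split[OF e sT] by blast
  have "summable (Hw_terms \<gamma> s (\<lambda>z. FJ M j z - FJ M l z)) \<and> suminf (Hw_terms \<gamma> s (\<lambda>z. FJ M j z - FJ M l z)) < e" if "j \<ge> N" "l \<ge> N" for j l
  proof -
    let ?h = "Hw_terms \<gamma> s (\<lambda>z. FJ M j z - FJ M l z)"
    let ?d = "\<lambda>m k. (if m \<le> j then M m k else 0) - (if m \<le> l then M m k else 0)"
    have hd: "?h n = (2*pi)^2 * Sob s ?d n" for n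
      unfolding Hw_terms_diff[OF FJ_Cinf_ev FJ_Cinf_ev] by (subst Sob_cong[where M'="?d"]) (auto simp: Mc_FJ)
    have h0: "?h n = 0" if "n < N" for n using that \<open>j \<ge> N\<close> \<open>l \<ge> N\<close> unfolding hd by (simp add: Sob_def)
    have hT: "?h n \<le> ?T n" "0 \<le> ?h n" for n
    proof -
      show "0 \<le> ?h n" unfolding hd by (simp add: Sob_nonneg)
      show "?h n \<le> ?T n" unfolding hd Sob_def by (intro mult_left_mono sum_mono Sob_weight_nonneg power_mono) auto
    qed
    have s: "summable ?h" by (rule summable_comparison_test'[OF sT, of 0]) (use hT in auto)
    have "suminf ?h = (\<Sum>n. ?h (n + N))" unfolding suminf_split_initial_segment[OF s, of N] using h0 by simp
    also have "... \<le> (\<Sum>n. ?T (n + N))" by (rule suminf_le[OF hT(1) summable_iff_shift[THEN iffD2, OF s] summable_iff_shift[of ?T, THEN iffD2, OF sT]])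
    also have "... < e" using N by simp
    finally show ?thesis using s by simp
  qed
  then show "\<exists>N. \<forall>j\<ge>N. \<forall>l\<ge>N. summable (Hw_terms \<gamma> s (\<lambda>z. FJ M j z - FJ M l z)) \<and> suminf (Hw_terms \<gamma> s (\<lambda>z. FJ M j z - FJ M l z)) < e" by blast
qed

lemma L2G_dist2_zero:
  assumes [measurable]: "v \<in> borel_measurable borel" "w \<in> borel_measurable borel"
  shows "L2G_dist2 \<gamma> v w = 0 \<longleftrightarrow> (AE p in lborel. p \<in> {0..2*pi} \<times> UNIV \<longrightarrow> v p = w p)"
proof -
  have "(1 + (snd p)^2) powr \<gamma> > 0" for p :: "real \<times> real" using add_pos_nonneg[OF zero_less_one zero_le_power2[of "snd p"]] by simp
  then have "indicator ({0..2*pi} \<times> UNIV) p * ennreal ((cmod (v p - w p))^2 * (1 + (snd p)^2) powr \<gamma>) = 0 \<longleftrightarrow> (p \<in> {0..2*pi} \<times> UNIV \<longrightarrow> v p = w p)" for p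
    by (simp add: indicator_def ennreal_eq_0_iff mult_le_0_iff not_le less_imp_le)
  note iff = this
  have [measurable]: "{0..2*pi} \<times> (UNIV :: real set) \<in> sets borel" by (intro borel_closed closed_Times) auto
  have m: "(\<lambda>p. indicator ({0..2*pi} \<times> UNIV) p * ennreal ((cmod (v p - w p))^2 * (1 + (snd p)^2) powr \<gamma>)) \<in> borel_measurable lborel" by measurable
  show ?thesis unfolding L2G_dist2_def nn_integral_0_iff_AE[OF m] iff ..
qed

text \<open>Fubini turns the statement into one about almost every \<open>\<beta>\<close>, to which
  the one-dimensional periodic extension applies.\<close>

lemma AE_periodic_extend:
  fixes v w :: "real \<times> real \<Rightarrow> complex"
  assumes [measurable]: "v \<in> borel_measurable borel" "w \<in> borel_measurable borel"
    and p: "\<And>\<beta> a. v (\<beta> + 2*pi, a) = v (\<beta>, a)" "\<And>\<beta> a. w (\<beta> + 2*pi, a) = w (\<beta>, a)"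
    and ae: "AE q in lborel. q \<in> {0..2*pi} \<times> UNIV \<longrightarrow> v q = w q"
  shows "AE q in lborel. v q = w q"
proof -
  have "AE q in lborel \<Otimes>\<^sub>M lborel. q \<in> {0..2*pi} \<times> (UNIV :: real set) \<longrightarrow> v q = w q" using ae by (subst lborel_prod)
  then have "AE \<beta> in lborel. AE a in lborel. (\<beta>, a) \<in> {0..2*pi} \<times> (UNIV :: real set) \<longrightarrow> v (\<beta>, a) = w (\<beta>, a)" by (rule lborel_pair.AE_pair)
  then have "AE \<beta> in lborel. \<beta> \<in> {0..2*pi} \<longrightarrow> (AE a in lborel. v (\<beta>, a) = w (\<beta>, a))" by (rule eventually_mono) auto
  then have "AE \<beta> in mO. AE a in lborel. v (\<beta>, a) = w (\<beta>, a)" unfolding mO_def by (subst AE_density) (auto simp: indicator_def elim: eventually_mono)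
  then have "AE \<beta> in lborel. AE a in lborel. v (\<beta>, a) = w (\<beta>, a)" by (rule AE_mO_periodic) (simp add: p)
  moreover have "{q \<in> space (lborel \<Otimes>\<^sub>M lborel). v q = w q} \<in> sets (lborel \<Otimes>\<^sub>M lborel)"
  proof -
    have m: "(\<lambda>q. v q - w q) \<in> borel_measurable borel" by measurable
    have "(\<lambda>q. v q - w q) -` {0} \<in> sets borel" by (rule measurable_sets_borel[OF m]) simp
    then show ?thesis unfolding lborel_prod by (simp add: vimage_def)
  qed
  ultimately have "AE q in lborel \<Otimes>\<^sub>M lborel. v q = w q"
    by (intro lborel_pair.AE_pair_measure)
  then show ?thesis by (subst (asm) lborel_prod)
qed

text \<open>\<open>FJ M J\<close> converges to \<open>Fsum M\<close> pointwise and its image to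
  \<open>u\<close> in the weighted norm. Two applications of Fatou bound the distance of the image
  of \<open>Fsum M\<close> from \<open>u\<close> by the limit of the distances, which is 0.\<close>

lemma smooth_sufficient:
  assumes u: "goodG u" and M: "rapid M" and tr: "\<And>m. AE om in lborel. moment_int u (poly (pg m)) om = trig m (M m) om"
  shows "AE p in lborel. u p = IHw \<gamma> (Fsum M) p"
proof -
  let ?f = "on_disk (Fsum M)"
  note fm = on_disk_Cinf_ev[OF Fsum_Cinf_ev[OF M]]
  have [measurable]: "?f \<in> borel_measurable borel" "u \<in> borel_measurable borel" using fm(1) goodG_measurable[OF u] by auto
  have pu: "u (\<beta> + 2*pi, a) = u (\<beta>, a)" for \<beta> a using u unfolding goodG_def by blast
  obtain B where B: "\<And>J z. cmod (FJ M J z) \<le> B" using FJ_tendsto_Fsum(2)[OF M] by blast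
  have UUlim: "(\<lambda>J. UU \<gamma> (IHw \<gamma> (FJ M J)) om al) \<longlonglongrightarrow> UU \<gamma> (IHw \<gamma> ?f) om al" if a: "al \<in> Iang" for om al
  proof -
    have "(\<lambda>J. LINT T|mT \<gamma>. FJ M J (zc om al T)) \<longlonglongrightarrow> (LINT T|mT \<gamma>. ?f (zc om al T))"
    proof (rule integral_dominated_convergence[where w="\<lambda>_. B"])
      show "AE T in mT \<gamma>. (\<lambda>J. FJ M J (zc om al T)) \<longlonglongrightarrow> ?f (zc om al T)"
        using FJ_tendsto_Fsum(1)[OF M] zc_in_ball[OF cos_Iang[OF a]] by (intro AE_I2) (simp add: on_disk_def)
    qed (use B in auto)
    then show ?thesis using UU_IHw[OF a] by simp
  qed
  have "L2G_dist2 \<gamma> (IHw \<gamma> ?f) u = (\<integral>\<^sup>+om. \<integral>\<^sup>+al. ennreal ((cmod (UU \<gamma> (IHw \<gamma> ?f) om al - UU \<gamma> u om al))^2) \<partial>mA \<gamma> \<partial>mO)"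
    by (rule L2G_dist2_eq[OF gam]) (use IHw_periodic pu in auto)
  also have "... = (\<integral>\<^sup>+om. \<integral>\<^sup>+al. liminf (\<lambda>J. ennreal ((cmod (UU \<gamma> (IHw \<gamma> (FJ M J)) om al - UU \<gamma> u om al))^2)) \<partial>mA \<gamma> \<partial>mO)"
  proof (rule nn_integral_cong, rule nn_integral_cong_AE, rule eventually_mono[OF AE_mA_Iang])
    fix om al assume a: "al \<in> Iang"
    have "(\<lambda>J. ennreal ((cmod (UU \<gamma> (IHw \<gamma> (FJ M J)) om al - UU \<gamma> u om al))^2)) \<longlonglongrightarrow> ennreal ((cmod (UU \<gamma> (IHw \<gamma> ?f) om al - UU \<gamma> u om al))^2)"
      by (intro tendsto_ennrealI tendsto_intros UUlim[OF a])
    then show "ennreal ((cmod (UU \<gamma> (IHw \<gamma> ?f) om al - UU \<gamma> u om al))^2) = liminf (\<lambda>J. ennreal ((cmod (UU \<gamma> (IHw \<gamma> (FJ M J)) om al - UU \<gamma> u om al))^2))"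
      by (intro lim_imp_Liminf[symmetric]) auto
  qed
  also have "... \<le> (\<integral>\<^sup>+om. liminf (\<lambda>J. \<integral>\<^sup>+al. ennreal ((cmod (UU \<gamma> (IHw \<gamma> (FJ M J)) om al - UU \<gamma> u om al))^2) \<partial>mA \<gamma>) \<partial>mO)"
    by (intro nn_integral_mono nn_integral_liminf) measurable
  also have "... \<le> liminf (\<lambda>J. \<integral>\<^sup>+om. \<integral>\<^sup>+al. ennreal ((cmod (UU \<gamma> (IHw \<gamma> (FJ M J)) om al - UU \<gamma> u om al))^2) \<partial>mA \<gamma> \<partial>mO)"
    by (intro nn_integral_liminf A.borel_measurable_nn_integral) measurable
  also have "... = liminf (\<lambda>J. L2G_dist2 \<gamma> (IHw \<gamma> (FJ M J)) u)"
    by (intro arg_cong[where f=liminf] ext L2G_dist2_eq[OF gam, symmetric]) (use IHw_periodic pu in auto)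
  also have "... = 0" using partial_sums_converge[OF u tr] by (intro lim_imp_Liminf) auto
  finally have "L2G_dist2 \<gamma> (IHw \<gamma> ?f) u = 0" by simp
  then have "AE p in lborel. p \<in> {0..2*pi} \<times> UNIV \<longrightarrow> IHw \<gamma> ?f p = u p" by (subst (asm) L2G_dist2_zero) auto
  then have "AE p in lborel. IHw \<gamma> ?f p = u p" by (intro AE_periodic_extend) (use IHw_periodic pu in auto)
  then show ?thesis unfolding IHw_on_disk by (rule eventually_mono) simp
qed

end

theorem theorem2p19:
  fixes \<gamma> s :: real and u :: "real \<times> real \<Rightarrow> complex"
  assumes "\<gamma> > -1" and "s \<ge> 0" and "u \<in> L2plus \<gamma>"
  shows "((\<exists>F. Hw_Cauchy \<gamma> s F \<and> (\<lambda>j. L2G_dist2 \<gamma> (IHw \<gamma> (F j)) u) \<longlonglongrightarrow> 0)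
            \<longleftrightarrow> (hyp_moment_conds u \<and> cond_sobolev \<gamma> s u))
       \<and> ((\<exists>f. f \<in> Cinf_ev \<and> (AE p in lborel. u p = IHw \<gamma> f p))
            \<longleftrightarrow> (hyp_moment_conds u \<and> cond_smooth \<gamma> u))"
proof -
  interpret disk_weight \<gamma> by unfold_locales (rule assms(1))
  have u: "goodG u" by (rule goodG_L2plus[OF assms(3)])
  note um [measurable] = goodG_measurable[OF u]
  \<comment> \<open>By uniqueness of moment data it suffices to check the summability for
    \<open>Mc u\<close>.\<close>
  have sob: "cond_sobolev \<gamma> s u" if "summable (Sob s (Mc u))"
    unfolding cond_sobolev_def
  proof (intro allI impI)
    fix c M assume "moment_data \<gamma> u c M"
    then have "Sob s M = Sob s (Mc u)" using moment_data_unique um by (intro Sob_cong) blast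
    then show "summable (\<lambda>m. \<Sum>k\<le>m. (real m + 1 + \<gamma>) powr (2 * s) / sigma2 \<gamma> m k * (cmod (M m k))^2)"
      using that unfolding Sob_def[abs_def] by simp
  qed
  show ?thesis
  proof (intro conjI iffI)
    assume "\<exists>F. Hw_Cauchy \<gamma> s F \<and> (\<lambda>j. L2G_dist2 \<gamma> (IHw \<gamma> (F j)) u) \<longlonglongrightarrow> 0"
    then obtain F where F: "Hw_Cauchy \<gamma> s F" "(\<lambda>j. L2G_dist2 \<gamma> (IHw \<gamma> (F j)) u) \<longlonglongrightarrow> 0" by blast
    then have "F j \<in> Cinf_ev" for j unfolding Hw_Cauchy_def by blast
    then show "hyp_moment_conds u" by (rule moments_of_Cinf_limit(1)[OF u _ F(2)])
    show "cond_sobolev \<gamma> s u" by (rule sob[OF sobolev_necessary[OF u F]])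
  next
    assume a: "hyp_moment_conds u \<and> cond_sobolev \<gamma> s u"
    then obtain c M where cM: "moment_data \<gamma> u c M" using moment_data_ex by blast
    then have "summable (Sob s M)" using a unfolding cond_sobolev_def Sob_def[abs_def] by blast
    then have "Hw_Cauchy \<gamma> s (FJ M)" by (rule FJ_Cauchy)
    moreover have "(\<lambda>J. L2G_dist2 \<gamma> (IHw \<gamma> (FJ M J)) u) \<longlonglongrightarrow> 0" by (rule partial_sums_converge[OF u moment_data_trig[OF cM]])
    ultimately show "\<exists>F. Hw_Cauchy \<gamma> s F \<and> (\<lambda>j. L2G_dist2 \<gamma> (IHw \<gamma> (F j)) u) \<longlonglongrightarrow> 0" by blast
  next
    assume "\<exists>f. f \<in> Cinf_ev \<and> (AE p in lborel. u p = IHw \<gamma> f p)"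
    then obtain f where f: "f \<in> Cinf_ev" "AE p in lborel. u p = IHw \<gamma> f p" by blast
    have "IHw \<gamma> f \<in> borel_measurable borel" using borel_measurable_IHw[OF on_disk_Cinf_ev(1)[OF f(1)]] unfolding IHw_on_disk .
    then have "L2G_dist2 \<gamma> (IHw \<gamma> f) u = 0" using f(2) by (subst L2G_dist2_zero) (auto elim: eventually_mono)
    \<comment> \<open>A constant sequence, so that the lemma on limits of transforms also serves for
      an exact preimage.\<close>
    then have lim: "(\<lambda>j::nat. L2G_dist2 \<gamma> (IHw \<gamma> f) u) \<longlonglongrightarrow> 0" by simp
    show "hyp_moment_conds u" by (rule moments_of_Cinf_limit(1)[OF u f(1) lim])
    have "Mc u m k = Mc (IHw \<gamma> f) m k" for m k using moments_of_Cinf_limit(2)[OF u f(1) lim, of m k] by (simp add: LIMSEQ_const_iff)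
    then have "rapid (Mc u)" using rapid_Mc[OF f(1)] unfolding rapid_def by simp
    then show "cond_smooth \<gamma> u" unfolding cond_smooth_def rapid_def using moment_data_unique[OF _ _ um] by metis
  next
    assume a: "hyp_moment_conds u \<and> cond_smooth \<gamma> u"
    then obtain c M where cM: "moment_data \<gamma> u c M" using moment_data_ex by blast
    then have M: "rapid M" using a unfolding cond_smooth_def rapid_def by blast
    show "\<exists>f. f \<in> Cinf_ev \<and> (AE p in lborel. u p = IHw \<gamma> f p)"
      using Fsum_Cinf_ev[OF M] smooth_sufficient[OF u M moment_data_trig[OF cM]] by blast
  qed
qed

end
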